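(* Let $f:[0,1]\to[0,1]$ be a continuous map. Then there exist an at most countable family of pairs of basic and $\Omega$-basic sets $\{B_i\subset B'_i\}$ and a family of collections of solenoidal sets $\{S^{(\alpha)}\subset S^{(\alpha)}_p\subset S^{(\alpha)}_\omega\subset S^{(\alpha)}_\Omega\subset Q^{(\alpha)}\}_{\alpha\in A}$ with the following properties: 1) $\Omega(f)=X_f\cup\left(\bigcup_\alpha S^{(\alpha)}_\Omega\right)\cup\left(\bigcup_iB'_i\right)$; 2) $\omega(f)=X_f\cup\left(\bigcup_\alpha S^{(\alpha)}_\omega\right)\cup\left(\bigcup_iB_i\right)$; 3) $\overline{\mathrm{Per}\,f}=X_f\cup\left(\bigcup_\alpha S^{(\alpha)}_p\right)\cup\left(\bigcup_iB_i\right)$; 4) for each $\alpha$ the set $S^{(\alpha)}_\Omega\setminus S^{(\alpha)}$ is an at most countable set of isolated points, the set $\{\alpha:\mathrm{int}\,Q^{(\alpha)}\ne\emptyset\}$ is at most countable, and $S^{(\alpha)}=Q^{(\alpha)}$ for all other $\alpha\in A$; 5) intersections in this decomposition are possible only between different basic or $\Omega$-basic sets; each three of them have an empty intersection, and the intersection of two basic or two $\Omega$-basic sets is finite. (Here intersections between a basic set and an $\Omega$-basic set with the same subscript, and between solenoidal sets with the same superscript, are not taken into account.)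
   Context: $\omega(x)$ is the set of limit points of the forward orbit of $x$; $\omega(f)=\bigcup_x\omega(x)$; $\mathrm{Per}\,f$ is the set of periodic points; $\Omega(f)$ is the set of non-wandering points. A cycle is the orbit of a periodic point. $X_f$ is the union of all limit sets of genus $0$, i.e. of all cycles that are maximal by inclusion among the limit sets $\omega(x)$, $x\in[0,1]$. A closed interval $I$ is periodic of period $k$ if $I,fI,\dots,f^{k-1}I$ are pairwise disjoint and $f^kI=I$; $\mathrm{orb}\,I=\bigcup_{i=0}^{k-1}f^iI$. For a set $U$, $\mathrm{orb}\,U=\bigcup_{i\ge0}f^iU$. Solenoidal sets: generating intervals are periodic intervals $I_0\supset I_1\supset\cdots$ whose periods tend to infinity; put $Q=\bigcap_j\mathrm{orb}\,I_j$. Any closed invariant subset of such a $Q$ is a solenoidal set. Put $S_p=Q\cap\overline{\mathrm{Per}\,f}$, $S_\omega=Q\cap\omega(f)$, $S_\Omega=Q\cap\Omega(f)$; there is a unique set $S\subset S_p$ with $\omega(x)=S$ for all $x\in Q$. The collection attached to index $\alpha$ consists of these sets $S,S_p,S_\omega,S_\Omega,Q$ for one $Q=Q^{(\alpha)}$. Basic sets: for a periodic interval $I$ with $M=\mathrm{orb}\,I$, consider $\{x\in M:\overline{\mathrm{orb}\,U}=M$ for every relative neighborhood $U$ of $x$ in $M\}$; if infinite, it is called a basic set and denoted $B(\mathrm{orb}\,I,f)$. $\Omega$-basic sets: for a basic set $B=B(\mathrm{orb}\,I,f)$ let $A_B$ be the set of all endpoints $x$ of the intervals of $\mathrm{orb}\,I$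 such that $x\in\Omega(f)$, and there is an integer $n\ge0$ with $f^nx\in B$, and if $m$ is the least such integer then $x,fx,\dots,f^{m-1}x\notin\mathrm{int}(\mathrm{orb}\,I)$. The corresponding $\Omega$-basic set is $B'=B'(\mathrm{orb}\,I,f)=B\cup A_B$; $B'_i$ denotes the $\Omega$-basic set corresponding to $B_i$. *)

theory Defs
  imports "HOL-Analysis.Analysis"
begin

text \<open>
  The dynamical system is a map of the unit interval, given as a function on the reals that maps
  the unit interval to itself; all points range over the unit interval, and neighbourhoods and
  interiors are taken relative to it.
\<close>

abbreviation unit_top :: "real topology" where
  "unit_top \<equiv> top_of_set {0..1}"

definition orb :: "(real \<Rightarrow> real) \<Rightarrow> real set \<Rightarrow> real set" where
  "orb f U = (\<Union>i. (f ^^ i) ` U)"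

definition Per :: "(real \<Rightarrow> real) \<Rightarrow> real set" where
  "Per f = {x \<in> {0..1}. \<exists>n\<ge>1. (f ^^ n) x = x}"

definition cycle :: "(real \<Rightarrow> real) \<Rightarrow> real set \<Rightarrow> bool" where
  "cycle f Z \<longleftrightarrow> (\<exists>x \<in> Per f. Z = orb f {x})"

text \<open>
  Limit points of the orbit are limit points of the sequence of iterates (so that the limit set of
  a periodic point is its cycle), not accumulation points of the orbit as a set.
\<close>

definition omega_limit :: "(real \<Rightarrow> real) \<Rightarrow> real \<Rightarrow> real set" where
  "omega_limit f x = {y. \<exists>r::nat \<Rightarrow> nat. strict_mono r \<and> (\<lambda>n. (f ^^ r n) x) \<longlonglongrightarrow> y}"

definition omega_set :: "(real \<Rightarrow> real) \<Rightarrow> real set" where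
  "omega_set f = (\<Union>x\<in>{0..1}. omega_limit f x)"

definition nonwandering :: "(real \<Rightarrow> real) \<Rightarrow> real set" where
  "nonwandering f =
     {x \<in> {0..1}. \<forall>U. openin unit_top U \<and> x \<in> U \<longrightarrow> (\<exists>n\<ge>1. (f ^^ n) ` U \<inter> U \<noteq> {})}"

definition genus0_union :: "(real \<Rightarrow> real) \<Rightarrow> real set" where
  "genus0_union f =
     \<Union>{Z. cycle f Z \<and> (\<exists>x\<in>{0..1}. omega_limit f x = Z) \<and>
           (\<forall>x\<in>{0..1}. Z \<subseteq> omega_limit f x \<longrightarrow> omega_limit f x = Z)}"

text \<open>
  Intervals are nondegenerate.  Since the \<open>k\<close>-th iterate maps \<open>I\<close> onto itself, \<open>orb f I\<close> is the
  union of the first \<open>k\<close> images of \<open>I\<close>.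
\<close>

definition periodic_interval :: "(real \<Rightarrow> real) \<Rightarrow> nat \<Rightarrow> real set \<Rightarrow> bool" where
  "periodic_interval f k I \<longleftrightarrow>
     k \<ge> 1 \<and> (\<exists>a b. 0 \<le> a \<and> a < b \<and> b \<le> 1 \<and> I = {a..b}) \<and>
     disjoint_family_on (\<lambda>i. (f ^^ i) ` I) {..<k} \<and> (f ^^ k) ` I = I"

definition generating_intervals ::
    "(real \<Rightarrow> real) \<Rightarrow> (nat \<Rightarrow> nat) \<Rightarrow> (nat \<Rightarrow> real set) \<Rightarrow> bool" where
  "generating_intervals f m I \<longleftrightarrow>
     (\<forall>j. periodic_interval f (m j) (I j)) \<and> decseq I \<and> filterlim m at_top sequentially"

definition generated_set :: "(real \<Rightarrow> real) \<Rightarrow> real set \<Rightarrow> bool" where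
  "generated_set f Q \<longleftrightarrow> (\<exists>m I. generating_intervals f m I \<and> Q = (\<Inter>j. orb f (I j)))"

definition solenoidal :: "(real \<Rightarrow> real) \<Rightarrow> real set \<Rightarrow> bool" where
  "solenoidal f T \<longleftrightarrow> closed T \<and> f ` T \<subseteq> T \<and> (\<exists>Q. generated_set f Q \<and> T \<subseteq> Q)"

text \<open>
  The last two conjuncts determine \<open>S\<close>, because \<open>Q\<close> is nonempty.
\<close>

definition solenoidal_collection ::
    "(real \<Rightarrow> real) \<Rightarrow> real set \<Rightarrow> real set \<Rightarrow> real set \<Rightarrow> real set \<Rightarrow> real set \<Rightarrow> bool" where
  "solenoidal_collection f S Sp Sw SO Q \<longleftrightarrow>
     generated_set f Q \<and>
     Sp = Q \<inter> closure (Per f) \<and> Sw = Q \<inter> omega_set f \<and> SO = Q \<inter> nonwandering f \<and>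
     S \<subseteq> Sp \<and> (\<forall>x\<in>Q. omega_limit f x = S)"

text \<open>
  \<open>B_set f I\<close> and \<open>B'_set f I\<close> stand for \<open>B(orb I, f)\<close> and \<open>B'(orb I, f)\<close>, where \<open>I\<close> is a periodic
  interval; \<open>B_set f I\<close> is a basic set only when it is infinite.
\<close>

definition B_set :: "(real \<Rightarrow> real) \<Rightarrow> real set \<Rightarrow> real set" where
  "B_set f I =
     {x \<in> orb f I. \<forall>U. openin (top_of_set (orb f I)) U \<and> x \<in> U \<longrightarrow> closure (orb f U) = orb f I}"

definition orb_endpoints :: "(real \<Rightarrow> real) \<Rightarrow> real set \<Rightarrow> real set" where
  "orb_endpoints f I = {x. \<exists>i a b. (f ^^ i) ` I = {a..b} \<and> a \<le> b \<and> (x = a \<or> x = b)}"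

definition A_set :: "(real \<Rightarrow> real) \<Rightarrow> real set \<Rightarrow> real set" where
  "A_set f I =
     {x \<in> orb_endpoints f I. x \<in> nonwandering f \<and> (\<exists>n. (f ^^ n) x \<in> B_set f I) \<and>
        (\<forall>j < (LEAST n. (f ^^ n) x \<in> B_set f I). (f ^^ j) x \<notin> unit_top interior_of (orb f I))}"

definition B'_set :: "(real \<Rightarrow> real) \<Rightarrow> real set \<Rightarrow> real set" where
  "B'_set f I = B_set f I \<union> A_set f I"

definition basic_pair :: "(real \<Rightarrow> real) \<Rightarrow> real set \<Rightarrow> real set \<Rightarrow> bool" where
  "basic_pair f B B' \<longleftrightarrow>
     (\<exists>k I. periodic_interval f k I \<and> infinite (B_set f I) \<and> B = B_set f I \<and> B' = B'_set f I)"

end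

theory Submission
  imports Defs
begin

text \<open>
  If a small connected set \<open>J\<close> near \<open>x\<close> meets one of its later images, then the closure of its orbit
  is the orbit of an interval \<open>D\<close> that is weakly periodic: a power of the map sends \<open>D\<close> into \<open>D\<close>.
  Shrinking \<open>J\<close> to \<open>x\<close> gives a decreasing tower of such intervals.  If the periods are unbounded,
  then \<open>x\<close> lies in a solenoidal set.  Otherwise the tower has a core, a periodic interval in whose
  orbit every neighbourhood of \<open>x\<close>, on one fixed side of \<open>x\<close>, has a dense orbit, so that \<open>x\<close> belongs to
  the corresponding set \<open>B\<close>.  The set \<open>B\<close> is infinite because the preimages of \<open>x\<close> in the periodic
  interval inherit that density.
  Applied to the sides on which an orbit accumulates, on which periodic points accumulate, and on
  which a neighbourhood returns, this decomposes the three sets in question.  A non-wandering point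
  outside the closure of the periodic points is exceptional when it is left on one side and returned to only
  on the other side; it is then an endpoint of the orbit of the core.

  A point in the intersection of basic sets has a full side in each of their orbits, and a
  common full side makes two orbits equal; as there are only two sides, no point lies in three
  basic sets.
\<close>

section \<open>Iterates and orbits\<close>

text \<open>Everything is done with one-sided neighbourhoods, because a point may be an endpoint of
  the core or be active on one side only; a two-sided argument would lose exactly these points. The
  towers start from mere inclusions of images, and equality is recovered only in the limit, so a
  core may shrink to a point or end at \<open>x\<close>; excluding this is the recurring obstacle.
  The argument that \<open>B\<close> is infinite through preimages needs \<open>x\<close> to be
  non-periodic. For a point of an infinite limit set, which may be periodic, the whole limit set is
  shown to lie in \<open>B\<close> instead. For a non-wandering point that falls into a cycle,
  density is available only at a point of the cycle, and a homoclinic argument is needed. Maximal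
  cycles are kept out of \<open>B\<close> by an orbit that accumulates at any two prescribed points
  of \<open>B\<close>. In a solenoidal set the decisive fact is that the components along an orbit
  are pairwise disjoint, hence eventually short: this gives one common limit set and isolates the
  non-wandering points outside of it.\<close>

locale interval_map =
  fixes f :: "real \<Rightarrow> real"
  assumes cont: "continuous_on {0..1} f" and maps: "f ` {0..1} \<subseteq> {0..1}"
begin

lemma funpow_in: "x \<in> {0..1} \<Longrightarrow> (f ^^ n) x \<in> {0..1}"
proof (induction n)
  case (Suc n)
  then have "f ((f ^^ n) x) \<in> f ` {0..1}" by blast
  then show ?case using maps by auto
qed simp

lemma funpow_image_in: "A \<subseteq> {0..1} \<Longrightarrow> (f ^^ n) ` A \<subseteq> {0..1}"
  using funpow_in by blast

lemma cont_funpow: "continuous_on {0..1} (f ^^ n)"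
proof (induction n)
  case (Suc n)
  have "(f ^^ n) ` {0..1} \<subseteq> {0..1}" by (rule funpow_image_in) auto
  then have "continuous_on {0..1} (f \<circ> (f ^^ n))"
    using Suc continuous_on_compose continuous_on_subset[OF cont] by blast
  then show ?case by simp
qed (simp add: id_def)

lemma cont_funpow_on: "A \<subseteq> {0..1} \<Longrightarrow> continuous_on A (f ^^ n)"
  using cont_funpow continuous_on_subset by blast

lemma funpow_image_add: "(f ^^ (m + n)) ` A = (f ^^ m) ` ((f ^^ n) ` A)"
  by (auto simp: funpow_add)

lemma funpow_add_app: "(f ^^ (m + n)) x = (f ^^ m) ((f ^^ n) x)"
  by (simp add: funpow_add)

lemma compact_image: "compact A \<Longrightarrow> A \<subseteq> {0..1} \<Longrightarrow> compact ((f ^^ n) ` A)"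
  using compact_continuous_image cont_funpow_on by blast

lemma connected_image: "connected A \<Longrightarrow> A \<subseteq> {0..1} \<Longrightarrow> connected ((f ^^ n) ` A)"
  using connected_continuous_image cont_funpow_on by blast

lemma funpow_near:
  assumes "x \<in> {0..1}" "e > 0"
  shows "\<exists>d>0. \<forall>y\<in>{0..1}. \<bar>y - x\<bar> \<le> d \<longrightarrow> \<bar>(f ^^ n) y - (f ^^ n) x\<bar> < e"
proof -
  obtain d where "d > 0" "\<forall>y\<in>{0..1}. dist y x < d \<longrightarrow> dist ((f ^^ n) y) ((f ^^ n) x) < e"
    using bspec[OF cont_funpow[of n, unfolded continuous_on_iff] assms(1)] assms(2) by blast
  then have "d/2 > 0" "\<forall>y\<in>{0..1}. \<bar>y - x\<bar> \<le> d/2 \<longrightarrow> \<bar>(f ^^ n) y - (f ^^ n) x\<bar> < e"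
    by (auto simp: dist_real_def)
  then show ?thesis by blast
qed

lemma funpow_near_le:
  assumes "x \<in> {0..1}" "e > 0"
  shows "\<exists>d>0. \<forall>n<N. \<forall>y\<in>{0..1}. \<bar>y - x\<bar> \<le> d \<longrightarrow> \<bar>(f ^^ n) y - (f ^^ n) x\<bar> < e"
proof (induction N)
  case (Suc N)
  then obtain d where d: "d > 0" "\<forall>n<N. \<forall>y\<in>{0..1}. \<bar>y - x\<bar> \<le> d \<longrightarrow> \<bar>(f ^^ n) y - (f ^^ n) x\<bar> < e"
    by blast
  obtain d' where d': "d' > 0" "\<forall>y\<in>{0..1}. \<bar>y - x\<bar> \<le> d' \<longrightarrow> \<bar>(f ^^ N) y - (f ^^ N) x\<bar> < e"
    using funpow_near[OF assms] by blast
  show ?case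
    by (rule exI[of _ "min d d'"]) (use d d' in \<open>auto simp: less_Suc_eq\<close>)
qed (auto intro: exI[of _ 1])

lemma funpow_limit:
  assumes "\<forall>n. u n \<in> {0..1}" "u \<longlonglongrightarrow> x"
  shows "(\<lambda>n. (f ^^ k) (u n)) \<longlonglongrightarrow> (f ^^ k) x"
proof -
  have "x \<in> {0..1}" using assms closed_sequentially[of "{0..1::real}" u x] by auto
  then show ?thesis
    using continuous_on_tendsto_compose[OF cont_funpow assms(2)] assms(1) by auto
qed

lemma orb_superset: "A \<subseteq> orb f A"
  unfolding orb_def by (rule subsetI, rule UN_I[of 0]) auto

lemma orb_iter: "x \<in> orb f A \<Longrightarrow> (f ^^ n) x \<in> orb f A"
proof -
  assume "x \<in> orb f A"
  then obtain i y where "y \<in> A" "x = (f ^^ i) y" by (auto simp: orb_def)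
  then have "(f ^^ n) x = (f ^^ (n + i)) y" by (simp add: funpow_add)
  then show ?thesis using \<open>y \<in> A\<close> unfolding orb_def by blast
qed

lemma image_subset_orb: "(f ^^ n) ` A \<subseteq> orb f A"
  unfolding orb_def by blast

lemma orb_mono: "A \<subseteq> B \<Longrightarrow> orb f A \<subseteq> orb f B"
  unfolding orb_def by blast

lemma orb_subset:
  assumes "A \<subseteq> M" "f ` M \<subseteq> M"
  shows "orb f A \<subseteq> M"
proof -
  have "(f ^^ n) x \<in> M" if "x \<in> A" for n x
    using that assms by (induction n) auto
  then show ?thesis by (auto simp: orb_def)
qed

lemma orb_in: "A \<subseteq> {0..1} \<Longrightarrow> orb f A \<subseteq> {0..1}"
  using orb_subset maps by blast

lemma orb_image_subset: "f ` orb f A \<subseteq> orb f A"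
  using orb_iter[of _ A 1] by auto

lemma orb_orb_subset: "A \<subseteq> orb f B \<Longrightarrow> orb f A \<subseteq> orb f B"
  by (rule orb_subset[OF _ orb_image_subset])

lemma funpow_commute: "(f ^^ i) ((f ^^ n) x) = (f ^^ n) ((f ^^ i) x)"
  unfolding funpow_add_app[symmetric] by (simp add: add.commute)

lemma orb_funpow_image: "orb f ((f ^^ n) ` A) = (f ^^ n) ` orb f A"
  unfolding orb_def image_UN image_image funpow_commute[of _ n] ..

lemma closure_orb_in: "A \<subseteq> {0..1} \<Longrightarrow> closure (orb f A) \<subseteq> {0..1}"
  using orb_in by (simp add: closure_minimal)

text \<open>Compactness turns the inclusion given by continuity into an equality. This is how
  density is transported along iterates: every power maps the orbit of a periodic interval onto
  itself, so a set with dense orbit may be replaced by any of its images.\<close>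

lemma image_closure_orb:
  assumes "A \<subseteq> {0..1}"
  shows "(f ^^ n) ` closure (orb f A) = closure (orb f ((f ^^ n) ` A))"
proof
  have "compact (closure (orb f A))"
    using bounded_subset[OF bounded_closed_interval orb_in[OF assms]] by simp
  then have "compact ((f ^^ n) ` closure (orb f A))"
    using compact_image closure_orb_in[OF assms] by blast
  then show "closure (orb f ((f ^^ n) ` A)) \<subseteq> (f ^^ n) ` closure (orb f A)"
    unfolding orb_funpow_image
    by (intro closure_minimal image_mono closure_subset compact_imp_closed)
  show "(f ^^ n) ` closure (orb f A) \<subseteq> closure (orb f ((f ^^ n) ` A))"
    unfolding orb_funpow_image
    by (rule continuous_image_closure_subset[OF cont_funpow closure_orb_in[OF assms], simplified])
qed

lemma closure_orb_mono: "A \<subseteq> orb f B \<Longrightarrow> closure (orb f A) \<subseteq> closure (orb f B)"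
  by (intro closure_mono orb_orb_subset)

lemma closed_image_subset:
  assumes "f ` M \<subseteq> M"
  shows "(f ^^ n) ` M \<subseteq> M"
  using orb_subset[OF order_refl assms] image_subset_orb[of n M] by (rule subset_trans[rotated])

section \<open>Weakly periodic intervals\<close>

definition cinterval :: "real set \<Rightarrow> bool" where
  "cinterval D \<longleftrightarrow> compact D \<and> connected D \<and> D \<noteq> {} \<and> D \<subseteq> {0..1}"

lemma cintervalD:
  assumes "cinterval D"
  shows "compact D" "connected D" "D \<noteq> {}" "D \<subseteq> {0..1}" "closed D"
  using assms compact_imp_closed by (auto simp: cinterval_def)

lemma cinterval_image: "cinterval D \<Longrightarrow> cinterval ((f ^^ n) ` D)"
  unfolding cinterval_def using compact_image connected_image funpow_image_in by simp

lemma cinterval_Icc: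
  assumes "cinterval D" obtains a b where "D = {a..b}" "a \<le> b" "0 \<le> a" "b \<le> 1"
proof -
  obtain a b where ab: "D = {a..b}"
    using assms connected_compact_interval_1 unfolding cinterval_def by blast
  then have "a \<le> b" using assms by (simp add: cinterval_def)
  then show thesis using that[OF ab] assms ab by (auto simp: cinterval_def)
qed

lemma cinterval_Icc_iff: "a \<le> b \<Longrightarrow> cinterval {a..b} \<longleftrightarrow> 0 \<le> a \<and> b \<le> 1"
  by (auto simp: cinterval_def)

text \<open>Only an inclusion is required of the \<open>k\<close>-th image, because the closed orbit
  of an arbitrary interval gives no more; a set mapped onto itself is extracted in
  \<open>wp_core\<close> and \<open>const_tower\<close> as an intersection.\<close>

definition weakly_periodic :: "nat \<Rightarrow> real set \<Rightarrow> bool" where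
  "weakly_periodic k D \<longleftrightarrow> k \<ge> 1 \<and> cinterval D \<and> (f ^^ k) ` D \<subseteq> D \<and>
     disjoint_family_on (\<lambda>i. (f ^^ i) ` D) {..<k}"

lemma weakly_periodicD:
  assumes "weakly_periodic k D"
  shows "k \<ge> 1" "cinterval D" "(f ^^ k) ` D \<subseteq> D" "disjoint_family_on (\<lambda>i. (f ^^ i) ` D) {..<k}"
  using assms by (auto simp: weakly_periodic_def)

lemma wp_power: "weakly_periodic k D \<Longrightarrow> (f ^^ (k * q)) ` D \<subseteq> D"
proof (induction q)
  case (Suc q)
  have "(f ^^ (k * Suc q)) ` D = (f ^^ k) ` ((f ^^ (k * q)) ` D)"
    by (simp add: funpow_image_add)
  also have "\<dots> \<subseteq> (f ^^ k) ` D" using Suc by (intro image_mono) auto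
  finally show ?case using weakly_periodicD(3)[OF Suc.prems] by (rule order_trans)
qed simp

lemma wp_power_decr:
  assumes "weakly_periodic k D" "m \<le> n"
  shows "(f ^^ (k * n)) ` D \<subseteq> (f ^^ (k * m)) ` D"
proof -
  have "(f ^^ (k * n)) ` D = (f ^^ (k * m)) ` ((f ^^ (k * (n - m))) ` D)"
    unfolding funpow_image_add[symmetric] using assms(2) by (simp add: algebra_simps)
  then show ?thesis using wp_power[OF assms(1)] by (simp add: image_mono)
qed

lemma wp_image_mod:
  assumes "weakly_periodic k D"
  shows "(f ^^ n) ` D \<subseteq> (f ^^ (n mod k)) ` D"
proof -
  have "(f ^^ n) ` D = (f ^^ (n mod k)) ` ((f ^^ (k * (n div k))) ` D)"
    unfolding funpow_image_add[symmetric] by simp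
  then show ?thesis using wp_power[OF assms] by (simp add: image_mono)
qed

lemma wp_meet:
  assumes "weakly_periodic k D" "z \<in> (f ^^ i) ` D" "z \<in> (f ^^ j) ` D"
  shows "i mod k = j mod k"
proof (rule ccontr)
  assume "i mod k \<noteq> j mod k"
  moreover have "i mod k < k" "j mod k < k" using weakly_periodicD(1)[OF assms(1)] by auto
  ultimately have "(f ^^ (i mod k)) ` D \<inter> (f ^^ (j mod k)) ` D = {}"
    using weakly_periodicD(4)[OF assms(1)] unfolding disjoint_family_on_def by simp
  moreover have "z \<in> (f ^^ (i mod k)) ` D" "z \<in> (f ^^ (j mod k)) ` D"
    using subsetD[OF wp_image_mod[OF assms(1)]] assms(2,3) by auto
  ultimately show False by blast
qed

lemma wp_return: "weakly_periodic k D \<Longrightarrow> z \<in> D \<Longrightarrow> z \<in> (f ^^ n) ` D \<Longrightarrow> k dvd n"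
  using wp_meet[of k D z 0 n] by (simp add: mod_0_imp_dvd)

lemma wp_orb:
  assumes "weakly_periodic k D"
  shows "orb f D = (\<Union>i<k. (f ^^ i) ` D)"
proof
  show "orb f D \<subseteq> (\<Union>i<k. (f ^^ i) ` D)"
  proof
    fix z assume "z \<in> orb f D"
    then obtain n where "z \<in> (f ^^ n) ` D" unfolding orb_def by blast
    then have "z \<in> (f ^^ (n mod k)) ` D" using wp_image_mod[OF assms, of n] by blast
    moreover have "n mod k < k" using weakly_periodicD(1)[OF assms] by simp
    ultimately show "z \<in> (\<Union>i<k. (f ^^ i) ` D)" by blast
  qed
qed (auto simp: orb_def)

lemma wp_orb_in: "weakly_periodic k D \<Longrightarrow> orb f D \<subseteq> {0..1}"
  by (intro orb_in cintervalD(4)) (rule weakly_periodicD(2))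

lemma wp_compact_orb:
  assumes "weakly_periodic k D" shows "compact (orb f D)"
  unfolding wp_orb[OF assms]
  using cintervalD(1)[OF cinterval_image[OF weakly_periodicD(2)[OF assms]]]
  by (intro compact_UN) auto

lemma wp_closure_orb: "weakly_periodic k D \<Longrightarrow> closure (orb f D) = orb f D"
  by (intro closure_closed compact_imp_closed) (rule wp_compact_orb)

text \<open>The first \<open>k\<close> images are finitely many disjoint closed sets, so a connected
  set cannot split among them.\<close>

lemma wp_connected_subset:
  assumes D: "weakly_periodic k D" and C: "connected C" "C \<subseteq> orb f D" "C \<inter> (f ^^ i) ` D \<noteq> {}" "i < k"
  shows "C \<subseteq> (f ^^ i) ` D"
proof -
  define A R where "A = (f ^^ i) ` D" and "R = (\<Union>j\<in>{..<k}-{i}. (f ^^ j) ` D)"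
  have cl: "closed ((f ^^ j) ` D)" for j
    using cintervalD(5)[OF cinterval_image[OF weakly_periodicD(2)[OF D]]] .
  have "closed R" unfolding R_def using cl by (intro closed_UN) auto
  have "A \<inter> R = {}"
    using weakly_periodicD(4)[OF D] C(4) unfolding disjoint_family_on_def A_def R_def by auto
  have "orb f D = A \<union> R" unfolding wp_orb[OF D] A_def R_def using C(4) by auto
  then have "C \<subseteq> A \<union> R" using C(2) by simp
  then have "A \<inter> C = {} \<or> R \<inter> C = {}"
    using connected_closedD[OF C(1), of A R] \<open>closed R\<close> cl[of i] \<open>A \<inter> R = {}\<close>
    unfolding A_def by auto
  then have "C \<subseteq> A" using \<open>C \<subseteq> A \<union> R\<close> C(3) unfolding A_def[symmetric] by auto
  then show ?thesis unfolding A_def .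
qed

lemma wp_connected_subset0:
  assumes "weakly_periodic k D" "connected C" "C \<subseteq> orb f D" "z \<in> C" "z \<in> D"
  shows "C \<subseteq> D"
  using wp_connected_subset[OF assms(1-3), of 0] assms weakly_periodicD(1)[OF assms(1)] by auto

text \<open>The smaller interval is connected and touches the larger one, so it stays in that
  component, and its return time is a return time of the larger one. The divisibility is what makes
  the periods of a tower either stabilise or grow without bound.\<close>

lemma wp_refine:
  assumes "weakly_periodic k D" "weakly_periodic k' D'" "orb f D' \<subseteq> orb f D" "z \<in> D" "z \<in> D'"
  shows "D' \<subseteq> D" "k dvd k'"
proof -
  show *: "D' \<subseteq> D"
    using wp_connected_subset0[OF assms(1) _ _ assms(5,4)] orb_superset[of D'] assms(3)
      cintervalD(2)[OF weakly_periodicD(2)[OF assms(2)]] by blast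
  have "(f ^^ k') z \<in> D'" using weakly_periodicD(3)[OF assms(2)] assms(5) by blast
  then show "k dvd k'" using wp_return[OF assms(1), of "(f ^^ k') z" k'] * assms(4) by blast
qed

text \<open>The interval is the component \<open>D\<close> of the closed orbit that contains
  \<open>J\<close>. Images of \<open>D\<close> are connected parts of the closed orbit, so an image
  meeting \<open>D\<close> lies in \<open>D\<close>; the period is the least time at which this
  happens.\<close>

lemma wp_exists:
  assumes J: "cinterval J" and n: "n \<ge> 1" "(f ^^ n) ` J \<inter> J \<noteq> {}"
  obtains k D where "weakly_periodic k D" "J \<subseteq> D" "closure (orb f J) = orb f D"
proof -
  define M where "M = closure (orb f J)"
  obtain z where z: "z \<in> J" using cintervalD(3)[OF J] by blast
  define D where "D = connected_component_set M z"
  have M01: "M \<subseteq> {0..1}" unfolding M_def using closure_orb_in cintervalD(4)[OF J] .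
  have JM: "J \<subseteq> M" using orb_superset closure_subset unfolding M_def by (rule order_trans)
  have fM: "(f ^^ i) ` M \<subseteq> M" for i
    unfolding M_def image_closure_orb[OF cintervalD(4)[OF J]]
    by (intro closure_orb_mono image_subset_orb)
  have JD: "J \<subseteq> D" unfolding D_def
    by (rule connected_component_maximal[OF z cintervalD(2)[OF J] JM])
  have DM: "D \<subseteq> M" unfolding D_def by (rule connected_component_subset)
  have conD: "connected D" unfolding D_def by simp
  have "closed M" unfolding M_def by simp
  then have "closed D" unfolding D_def by (rule closed_connected_component)
  then have "compact D" using DM M01
    by (meson bounded_closed_interval bounded_subset compact_eq_bounded_closed order_trans)
  then have cD: "cinterval D" using conD JD z DM M01 unfolding cinterval_def by blast
  have max: "C \<subseteq> D" if "connected C" "C \<subseteq> M" "C \<inter> D \<noteq> {}" for C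
  proof -
    from that obtain w where w: "w \<in> C" "w \<in> D" by blast
    have "C \<subseteq> connected_component_set M w" by (rule connected_component_maximal[OF w(1) that(1,2)])
    moreover have "connected_component_set M w = D"
      using w(2) unfolding D_def by (metis connected_component_eq)
    ultimately show ?thesis by simp
  qed
  define P where "P m \<longleftrightarrow> m \<ge> 1 \<and> (f ^^ m) ` D \<inter> D \<noteq> {}" for m
  have Pn: "P n" unfolding P_def using n JD by blast
  define k where "k = (LEAST m. P m)"
  have Pk: "P k" unfolding k_def by (rule LeastI[of P, OF Pn])
  have least: "k \<le> m" if "P m" for m unfolding k_def by (rule Least_le[of P, OF that])
  have kD: "(f ^^ k) ` D \<subseteq> D"
  proof (rule max)
    show "connected ((f ^^ k) ` D)" using cintervalD(2)[OF cinterval_image[OF cD]] .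
    show "(f ^^ k) ` D \<subseteq> M" using image_mono[OF DM, of "f ^^ k"] fM[of k] by (rule order_trans)
    show "(f ^^ k) ` D \<inter> D \<noteq> {}" using Pk P_def by blast
  qed
  have disj: "(f ^^ i) ` D \<inter> (f ^^ j) ` D = {}" if "i < j" "j < k" for i j
  proof (rule ccontr)
    assume "(f ^^ i) ` D \<inter> (f ^^ j) ` D \<noteq> {}"
    then obtain u v where uv: "u \<in> D" "v \<in> D" "(f ^^ i) u = (f ^^ j) v" by blast
    \<comment> \<open>A collision of two earlier images, pushed forward to time \<open>k\<close>,
      becomes a return to \<open>D\<close> after \<open>j - i < k\<close> steps, against
      minimality.\<close>
    have "(f ^^ (k - i)) ((f ^^ i) u) = (f ^^ k) u" "(f ^^ (k - i)) ((f ^^ j) v) = (f ^^ (j - i)) ((f ^^ k) v)"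
      unfolding funpow_add_app[symmetric] using that by (simp_all add: add.commute)
    then have "(f ^^ k) u = (f ^^ (j - i)) ((f ^^ k) v)" using uv(3) by metis
    moreover have "(f ^^ k) u \<in> D" "(f ^^ k) v \<in> D" using kD uv by auto
    ultimately have "P (j - i)" unfolding P_def using that(1) by fastforce
    then show False using least[of "j - i"] that P_def by auto
  qed
  have wp: "weakly_periodic k D"
    unfolding weakly_periodic_def disjoint_family_on_def
  proof (intro conjI ballI impI)
    show "k \<ge> 1" using Pk P_def by auto
    fix i j assume "i \<in> {..<k}" "j \<in> {..<k}" "i \<noteq> j"
    then show "(f ^^ i) ` D \<inter> (f ^^ j) ` D = {}" using disj[of i j] disj[of j i]
      by (cases "i < j") (auto simp: Int_commute)
  qed (use cD kD in auto)
  have "orb f D \<subseteq> M" by (rule orb_subset[OF DM]) (use fM[of 1] in simp)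
  moreover have "M \<subseteq> orb f D"
    unfolding M_def using closure_mono[OF orb_mono[OF JD]] wp_closure_orb[OF wp] by simp
  ultimately show thesis using that[OF wp JD] unfolding M_def by blast
qed

lemma compact_INT_image:
  assumes "\<And>j::nat. compact (E j)" "\<And>j. E j \<subseteq> {0..1}" "decseq E"
  shows "(f ^^ n) ` (\<Inter>j. E j) = (\<Inter>j. (f ^^ n) ` E j)"
proof
  show "(\<Inter>j. (f ^^ n) ` E j) \<subseteq> (f ^^ n) ` (\<Inter>j. E j)"
  proof
    fix z assume z: "z \<in> (\<Inter>j. (f ^^ n) ` E j)"
    define C where "C j = {w \<in> E j. (f ^^ n) w = z}" for j
    have "C j \<noteq> {}" for j using z unfolding C_def by blast
    moreover have "compact (C j)" for j
    proof -
      have "closed {w \<in> E j. (f ^^ n) w = z}"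
        by (rule continuous_closed_preimage_constant[OF cont_funpow_on[OF assms(2)] compact_imp_closed[OF assms(1)]])
      then have "compact (E j \<inter> {w \<in> E j. (f ^^ n) w = z})" using assms(1) by (rule compact_Int_closed[rotated])
      moreover have "E j \<inter> {w \<in> E j. (f ^^ n) w = z} = C j" unfolding C_def by blast
      ultimately show ?thesis by simp
    qed
    moreover have "C k \<subseteq> C j" if "j \<le> k" for j k
      using decseqD[OF assms(3) that] unfolding C_def by blast
    ultimately have "(\<Inter>j. C j) \<noteq> {}" by (intro compact_nest)
    then show "z \<in> (f ^^ n) ` (\<Inter>j. E j)" unfolding C_def by blast
  qed
qed blast

lemma cinterval_INT:
  assumes "\<And>j::nat. cinterval (E j)" "decseq E"
  shows "cinterval (\<Inter>j. E j)"
proof -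
  have E: "compact (E j)" "connected (E j)" "E j \<noteq> {}" "E j \<subseteq> {0..1}" "closed (E j)" for j
    using cintervalD[OF assms(1)[of j]] by simp_all
  have ne: "(\<Inter>j. E j) \<noteq> {}"
    by (rule compact_nest[of E]) (use E decseqD[OF assms(2)] in auto)
  have sub: "(\<Inter>j. E j) \<subseteq> {0..1}" using E(4)[of 0] by auto
  have "bounded (\<Inter>j. E j)" by (rule bounded_subset[OF bounded_closed_interval sub])
  moreover have "closed (\<Inter>j. E j)" using E(5) by auto
  ultimately have com: "compact (\<Inter>j. E j)" by (simp add: compact_eq_bounded_closed)
  have "is_interval (E j)" for j
    using E(2) by (simp add: is_interval_connected_1)
  then have "is_interval (\<Inter>j. E j)" unfolding is_interval_1 by (metis INT_iff UNIV_I)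
  then have "connected (\<Inter>j. E j)" by (rule is_interval_connected)
  then show ?thesis unfolding cinterval_def using com ne sub by simp
qed

section \<open>Towers of weakly periodic intervals\<close>

definition in_solenoid :: "real \<Rightarrow> bool" where
  "in_solenoid x \<longleftrightarrow> (\<exists>Q. generated_set f Q \<and> x \<in> Q)"

lemma funpow_image_INT:
  assumes "\<And>j::nat. cinterval (E j)" "decseq E"
  shows "(f ^^ n) ` (\<Inter>j. E j) = (\<Inter>j. (f ^^ n) ` E j)"
  by (rule compact_INT_image[of E]) (use assms cintervalD in auto)

lemma decseq_INT_Suc: "decseq E \<Longrightarrow> (\<Inter>j. E (Suc j)) = (\<Inter>j. (E j :: real set))"
  by (auto simp: decseq_Suc_iff)

lemma wp_core:
  assumes D: "weakly_periodic k D"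
  defines "H \<equiv> \<Inter>i. (f ^^ (k * i)) ` D"
  shows "cinterval H" "(f ^^ k) ` H = H" "H \<subseteq> D"
proof -
  let ?E = "\<lambda>i. (f ^^ (k * i)) ` D"
  have E: "cinterval (?E i)" for i by (rule cinterval_image[OF weakly_periodicD(2)[OF D]])
  have dec: "decseq ?E" by (rule antimonoI) (rule wp_power_decr[OF D])
  show "cinterval H" unfolding H_def by (rule cinterval_INT[of ?E, OF E dec])
  have "(f ^^ k) ` ?E i = ?E (Suc i)" for i by (simp add: funpow_image_add)
  then have "(f ^^ k) ` H = (\<Inter>i. ?E (Suc i))"
    unfolding H_def using funpow_image_INT[of ?E k, OF E dec] by simp
  then show "(f ^^ k) ` H = H" unfolding H_def using decseq_INT_Suc[OF dec] by simp
  show "H \<subseteq> D" unfolding H_def by (rule INT_lower[of 0, THEN order_trans]) auto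
qed

lemma periodic_intervalI:
  assumes "weakly_periodic k D" "cinterval H" "(f ^^ k) ` H = H" "H \<subseteq> D" "u \<in> H" "v \<in> H" "u \<noteq> v"
  shows "periodic_interval f k H"
  unfolding periodic_interval_def
proof (intro conjI)
  show "k \<ge> 1" using weakly_periodicD(1)[OF assms(1)] .
  obtain a b where "H = {a..b}" "a \<le> b" "0 \<le> a" "b \<le> 1" using cinterval_Icc[OF assms(2)] .
  moreover have "a < b" using calculation assms(5-7) by auto
  ultimately show "\<exists>a b. 0 \<le> a \<and> a < b \<and> b \<le> 1 \<and> H = {a..b}" by blast
  have "(f ^^ i) ` H \<subseteq> (f ^^ i) ` D" for i using assms(4) by (rule image_mono)
  then show "disjoint_family_on (\<lambda>i. (f ^^ i) ` H) {..<k}"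
    using weakly_periodicD(4)[OF assms(1)] unfolding disjoint_family_on_def by (metis Int_mono subset_empty)
qed (rule assms(3))

lemma periodic_interval_wp:
  assumes "periodic_interval f k I" shows "weakly_periodic k I"
proof -
  obtain a b where "0 \<le> a" "a < b" "b \<le> 1" "I = {a..b}"
    using assms unfolding periodic_interval_def by blast
  then show ?thesis using assms cinterval_Icc_iff[of a b]
    unfolding weakly_periodic_def periodic_interval_def by simp
qed

lemma wp_tower_dvd:
  assumes "\<And>j. weakly_periodic (k j) (D j)" "decseq D" "\<And>j. x \<in> D j" "i \<le> j"
  shows "k i dvd k j"
  using wp_refine(2)[OF assms(1) assms(1) orb_mono assms(3,3)] decseqD[OF assms(2,4)] by blast

text \<open>By divisibility the periods are eventually constant or unbounded; in the second case the
  cores of the intervals generate a solenoidal set. A core cannot be the single point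
  \<open>x\<close>, since then \<open>x\<close> would return after \<open>k j\<close> steps and
  \<open>k j\<close> would be a multiple of all later periods.\<close>

lemma tower_dichotomy:
  assumes wp: "\<And>j. weakly_periodic (k j) (D j)" and dec: "decseq D"
    and x: "\<And>i j. x \<in> (f ^^ (k j * i)) ` D j"
  shows "in_solenoid x \<or> (\<exists>j0. \<forall>j\<ge>j0. k j = k j0)"
proof (rule disjCI)
  assume nconst: "\<not> (\<exists>j0. \<forall>j\<ge>j0. k j = k j0)"
  have xD: "x \<in> D j" for j using x[of j 0] by simp
  have dvd: "k i dvd k j" if "i \<le> j" for i j
    by (rule wp_tower_dvd[of k D, OF wp dec xD that])
  have pos: "k j \<ge> 1" for j using weakly_periodicD(1)[OF wp] .
  have mono: "k i \<le> k j" if "i \<le> j" for i j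
    using dvd_imp_le[OF dvd[OF that]] pos[of j] by simp
  have unb: "\<exists>j. n \<le> k j" for n
  proof (induction n)
    case (Suc n)
    then obtain j where j: "n \<le> k j" by blast
    obtain j' where "j' \<ge> j" "k j' \<noteq> k j" using nconst by blast
    then have "Suc n \<le> k j'" using mono[of j j'] j by simp
    then show ?case by blast
  qed simp
  have lim: "filterlim k at_top sequentially"
    unfolding filterlim_at_top eventually_sequentially using unb mono by (meson order_trans)
  define I where "I j = (\<Inter>i. (f ^^ (k j * i)) ` D j)" for j
  have core: "cinterval (I j)" "(f ^^ k j) ` I j = I j" "I j \<subseteq> D j" for j
    unfolding I_def using wp_core[OF wp] by auto
  have xI: "x \<in> I j" for j unfolding I_def using x by blast
  have "\<exists>u\<in>I j. u \<noteq> x" for j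
  proof (rule ccontr)
    assume "\<not> (\<exists>u\<in>I j. u \<noteq> x)"
    then have "I j = {x}" using xI by blast
    then have fx: "(f ^^ k j) x = x" using core(2)[of j] by auto
    obtain j' where "Suc (k j) \<le> k j'" using unb by blast
    moreover have "k j' dvd k j"
      using wp_return[OF wp, of x j' "k j"] xD[of j'] fx by (metis image_eqI)
    ultimately show False using dvd_imp_le[of "k j'" "k j"] pos[of j] by simp
  qed
  then have per: "periodic_interval f (k j) (I j)" for j
    using periodic_intervalI[OF wp core(1,2,3) xI] by metis
  have "decseq I"
  proof (rule antimonoI)
    fix i j :: nat assume ij: "i \<le> j"
    \<comment> \<open>Since \<open>k j\<close> is a multiple of \<open>k i\<close>, iterating
      \<open>n\<close> times with the longer period goes at least as deep as \<open>n\<close> times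
      with the shorter one.\<close>
    obtain q where q: "k j = k i * q" using dvd[OF ij] by (elim dvdE)
    then have "q \<ge> 1" using pos[of j] by (cases q) auto
    have "I j \<subseteq> (f ^^ (k i * n)) ` D i" for n
    proof -
      have "I j \<subseteq> (f ^^ (k i * (q * n))) ` D j" unfolding I_def q by (auto simp: mult.assoc)
      also have "\<dots> \<subseteq> (f ^^ (k i * (q * n))) ` D i" using decseqD[OF dec ij] by (rule image_mono)
      also have "\<dots> \<subseteq> (f ^^ (k i * n)) ` D i" using \<open>q \<ge> 1\<close> by (intro wp_power_decr[OF wp]) simp
      finally show ?thesis .
    qed
    then show "I j \<subseteq> I i" unfolding I_def[of i] by blast
  qed
  then have "generating_intervals f k I" unfolding generating_intervals_def using per lim by blast
  then have "generated_set f (\<Inter>j. orb f (I j))" unfolding generated_set_def by blast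
  moreover have "x \<in> (\<Inter>j. orb f (I j))" using xI orb_superset by blast
  ultimately show "in_solenoid x" unfolding in_solenoid_def by blast
qed

text \<open>The diagonal family \<open>E\<close> shrinks the interval and passes to a later image at
  the same time. The image of \<open>E j\<close> under \<open>f ^^ k\<close> lies between
  \<open>E (Suc j)\<close> and \<open>E j\<close>, and this sandwich forces the intersection
  \<open>H\<close> to be mapped onto itself, although no single \<open>D j\<close> need be.\<close>

lemma const_tower:
  assumes wp: "\<And>j. weakly_periodic k (D j)" and dec: "decseq D"
  defines "E \<equiv> \<lambda>j. (f ^^ (k * j)) ` D j" and "H \<equiv> \<Inter>j. (f ^^ (k * j)) ` D j"
  shows "cinterval (E j)" "decseq E" "E (Suc j) \<subseteq> (f ^^ k) ` E j" "cinterval H" "(f ^^ k) ` H = H"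
    "H \<subseteq> D j"
    "(\<And>j. z \<in> (\<Union>i<k. (f ^^ i) ` E j)) \<Longrightarrow> z \<in> orb f H"
proof -
  show E: "cinterval (E j)" for j
    unfolding E_def by (rule cinterval_image[OF weakly_periodicD(2)[OF wp]])
  have step: "E (Suc j) \<subseteq> (f ^^ k) ` E j" "(f ^^ k) ` E j \<subseteq> E j" for j
  proof -
    have fE: "(f ^^ k) ` E j = (f ^^ (k * Suc j)) ` D j" unfolding E_def by (simp add: funpow_image_add)
    then show "E (Suc j) \<subseteq> (f ^^ k) ` E j" using decseqD[OF dec, of j "Suc j"] unfolding E_def by auto
    show "(f ^^ k) ` E j \<subseteq> E j" unfolding fE unfolding E_def by (rule wp_power_decr[OF wp]) simp
  qed
  show dE: "decseq E" unfolding decseq_Suc_iff using step by (meson order_trans)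
  show "E (Suc j) \<subseteq> (f ^^ k) ` E j" by (rule step)
  have H: "H = (\<Inter>j. E j)" unfolding H_def E_def ..
  show "cinterval H" unfolding H by (rule cinterval_INT[of E, OF E dE])
  have "(f ^^ k) ` H = (\<Inter>j. (f ^^ k) ` E j)" unfolding H by (rule funpow_image_INT[of E, OF E dE])
  moreover have "\<dots> \<subseteq> H" unfolding H using step(2) by blast
  moreover have "(\<Inter>j. E (Suc j)) \<subseteq> (\<Inter>j. (f ^^ k) ` E j)" using step(1) by blast
  ultimately show "(f ^^ k) ` H = H" using decseq_INT_Suc[OF dE] H by auto
  have "H \<subseteq> E j" unfolding H by blast
  also have "\<dots> \<subseteq> D j" unfolding E_def by (rule wp_power[OF wp])
  finally show "H \<subseteq> D j" .
  assume z: "\<And>j. z \<in> (\<Union>i<k. (f ^^ i) ` E j)"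
  show "z \<in> orb f H"
  proof (rule ccontr)
    assume "z \<notin> orb f H"
    then have "z \<notin> (f ^^ i) ` H" for i using image_subset_orb by blast
    then have "\<exists>j. z \<notin> (f ^^ i) ` E j" for i unfolding H funpow_image_INT[of E, OF E dE] by blast
    then obtain J where J: "z \<notin> (f ^^ i) ` E (J i)" for i by metis
    \<comment> \<open>Only finitely many indices \<open>i < k\<close> matter, so one stage excludes
      \<open>z\<close> from all the images at once.\<close>
    define m where "m = Max (J ` {..<k})"
    obtain i where i: "i < k" "z \<in> (f ^^ i) ` E m" using z by blast
    then have "J i \<le> m" unfolding m_def by simp
    then show False using J[of i] i(2) decseqD[OF dE] by blast
  qed
qed

text \<open>If a decreasing sequence of intervals, each mapped over the next one, overlaps the endpoint
  \<open>x\<close> of its intersection \<open>H\<close> at all stages, then the overlapping parts must come from overlapping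
  parts at an endpoint of \<open>H\<close> again; as there are two endpoints only, \<open>x\<close> is periodic.\<close>

lemma overlapping_endpoint_periodic:
  assumes E: "\<And>j::nat. cinterval (E j)" "decseq E" "\<And>j. E (Suc j) \<subseteq> (f ^^ k) ` E j"
    and H: "H = (\<Inter>j. E j)" "(f ^^ k) ` H \<subseteq> H"
    and out: "\<And>d j. d > 0 \<Longrightarrow> \<exists>w \<in> E j - H. \<bar>w - x\<bar> < d"
  shows "(f ^^ k) x = x \<or> (f ^^ k) ((f ^^ k) x) = x"
proof -
  define ov where "ov e \<longleftrightarrow> (\<forall>d>0. \<forall>j. \<exists>w \<in> E j - H. \<bar>w - e\<bar> < d)" for e
  have cE: "closed (E j)" "E j \<subseteq> {0..1}" for j using cintervalD[OF E(1)] by auto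
  have cH: "cinterval H" unfolding H by (rule cinterval_INT[of E, OF E(1,2)])
  obtain a b where ab: "H = {a..b}" "a \<le> b" using cinterval_Icc[OF cH] .
  have Oab: "e = a \<or> e = b" if ove: "ov e" "e \<in> H" for e
  proof (rule ccontr)
    assume "\<not> (e = a \<or> e = b)"
    then have "min (e - a) (b - e) > 0" using that(2) ab by auto
    then obtain w where "w \<in> E 0 - H" "\<bar>w - e\<bar> < min (e - a) (b - e)" using ove(1) unfolding ov_def by blast
    then show False using ab by auto
  qed
  have pre: "\<exists>e'\<in>H. ov e' \<and> (f ^^ k) e' = e" if "ov e" for e
  proof -
    have "\<exists>w \<in> E (Suc j) - H. \<bar>w - e\<bar> < 1 / real (Suc j)" for j
      using that unfolding ov_def by simp
    then obtain w where w: "w j \<in> E (Suc j) - H" "\<bar>w j - e\<bar> < 1 / real (Suc j)" for j by metis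
    have "w j \<in> (f ^^ k) ` E j" for j using E(3)[of j] w(1)[of j] by blast
    then have "\<exists>v\<in>E j. (f ^^ k) v = w j" for j by (metis imageE)
    then obtain v where v: "v j \<in> E j" "(f ^^ k) (v j) = w j" for j by metis
    \<comment> \<open>\<open>f ^^ k\<close> keeps \<open>H\<close> inside itself, so preimages of
      points outside \<open>H\<close> lie outside \<open>H\<close>; therefore their limit is
      overlapped again.\<close>
    have vH: "v j \<notin> H" for j using v(2) w(1) H(2) by (metis DiffE image_subset_iff)
    have v01: "v j \<in> {0..1}" for j using v(1) cE(2) by blast
    obtain r l where r: "strict_mono r" "(v \<circ> r) \<longlonglongrightarrow> l"
      using compact_Icc[of 0 "1::real", unfolded compact_def] v01 by metis
    have ev: "v (r n) \<in> E j" if "n \<ge> j" for n j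
      using v(1)[of "r n"] decseqD[OF E(2), of j "r n"] that seq_suble[OF r(1), of n] by auto
    have "l \<in> E j" for j
    proof (rule closed_sequentially[OF cE(1)[of j], of "\<lambda>n. v (r (n + j))"])
      show "\<And>n. v (r (n + j)) \<in> E j" using ev by simp
      show "(\<lambda>n. v (r (n + j))) \<longlonglongrightarrow> l" using LIMSEQ_ignore_initial_segment[OF r(2), of j] by simp
    qed
    then have "l \<in> H" unfolding H by blast
    moreover have "ov l" unfolding ov_def
    proof (intro allI impI)
      fix d :: real and j assume "d > 0"
      then obtain N where N: "\<bar>v (r n) - l\<bar> < d" if "n \<ge> N" for n
        using r(2) unfolding LIMSEQ_def dist_real_def by auto
      show "\<exists>w\<in>E j - H. \<bar>w - l\<bar> < d"
        using N[of "max N j"] ev[of j "max N j"] vH by (intro bexI[of _ "v (r (max N j))"]) auto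
    qed
    moreover have "(f ^^ k) l = e"
    proof (rule LIMSEQ_unique)
      have "(\<lambda>n. (f ^^ k) ((v \<circ> r) n)) \<longlonglongrightarrow> (f ^^ k) l"
        by (rule funpow_limit[OF _ r(2)]) (use v01 in simp)
      then show "(w \<circ> r) \<longlonglongrightarrow> (f ^^ k) l" by (simp add: v(2) comp_def)
      have "w \<longlonglongrightarrow> e" 
      proof (rule LIMSEQ_I)
        fix d :: real assume "d > 0"
        then obtain N where "1 / real (Suc N) < d" using nat_approx_posE by metis
        moreover have "1 / real (Suc n) \<le> 1 / real (Suc N)" if "n \<ge> N" for n
          using that by (simp add: frac_le)
        ultimately show "\<exists>N. \<forall>n\<ge>N. norm (w n - e) < d"
          using w(2) by (intro exI[of _ N]) (smt (verit) real_norm_def)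
      qed
      then show "(w \<circ> r) \<longlonglongrightarrow> e" using r(1) by (rule LIMSEQ_subseq_LIMSEQ)
    qed
    ultimately show ?thesis by blast
  qed
  have "ov x" unfolding ov_def using out by blast
  then obtain x1 where x1: "x1 \<in> H" "ov x1" "(f ^^ k) x1 = x" using pre by blast
  obtain x2 where x2: "x2 \<in> H" "ov x2" "(f ^^ k) x2 = x1" using pre[OF x1(2)] by blast
  have "x \<in> H" using x1 H(2) by blast
  \<comment> \<open>All of \<open>x\<close>, \<open>x1\<close>, \<open>x2\<close> are endpoints of
    \<open>H\<close>, so two of them coincide.\<close>
  then show ?thesis using Oab[OF \<open>ov x\<close>] Oab[OF x1(2,1)] Oab[OF x2(2,1)] x1(3) x2(3) by metis
qed

section \<open>One-sided neighbourhoods with dense orbits\<close>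

definition in_basic :: "real \<Rightarrow> bool" where
  "in_basic x \<longleftrightarrow> (\<exists>k I. periodic_interval f k I \<and> infinite (B_set f I) \<and> x \<in> B_set f I)"

text \<open>The side \<open>s\<close> is \<open>1\<close> or \<open>- 1\<close>.\<close>

definition germ :: "real \<Rightarrow> real \<Rightarrow> real \<Rightarrow> real set" where
  "germ x s d = {y \<in> {0..1}. 0 \<le> s * (y - x) \<and> s * (y - x) \<le> d}"

lemma side_cases: "\<bar>s::real\<bar> = 1 \<Longrightarrow> s = 1 \<or> s = -1" by linarith

lemma germ_in: "germ x s d \<subseteq> {0..1}" by (auto simp: germ_def)

lemma germ_base: "x \<in> {0..1} \<Longrightarrow> d \<ge> 0 \<Longrightarrow> x \<in> germ x s d" by (simp add: germ_def)

lemma germ_mono: "d \<le> d' \<Longrightarrow> germ x s d \<subseteq> germ x s d'" by (auto simp: germ_def)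

lemma germ_dist: "\<bar>s\<bar> = 1 \<Longrightarrow> y \<in> germ x s d \<Longrightarrow> \<bar>y - x\<bar> \<le> d"
  using side_cases[of s] by (auto simp: germ_def)

lemma germ_pos: "\<bar>s\<bar> = 1 \<Longrightarrow> y \<in> germ x s d \<Longrightarrow> y \<noteq> x \<Longrightarrow> s * (y - x) > 0"
  using side_cases[of s] by (auto simp: germ_def)

lemma germ_Icc:
  assumes "\<bar>s\<bar> = 1"
  shows "germ x s d = (if s = 1 then {max 0 x..min 1 (x + d)} else {max 0 (x - d)..min 1 x})"
  using side_cases[OF assms] by (auto simp: germ_def)

lemma germ_cinterval:
  assumes "\<bar>s\<bar> = 1" "x \<in> {0..1}" "d \<ge> 0" shows "cinterval (germ x s d)"
  using germ_base[OF assms(2,3), of s] germ_in[of x s d] unfolding cinterval_def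
  by (auto simp: germ_Icc[OF assms(1)])

lemma germ_subset_connected:
  assumes "\<bar>s\<bar> = 1" "connected C" "x \<in> C" "t \<in> C"
  shows "germ x s (s * (t - x)) \<subseteq> C"
proof
  fix y assume y: "y \<in> germ x s (s * (t - x))"
  show "y \<in> C" using side_cases[OF assms(1)]
  proof
    assume "s = 1"
    then have "x \<le> y" "y \<le> t" using y by (auto simp: germ_def)
    then show ?thesis using connectedD_interval[OF assms(2,3,4)] by blast
  next
    assume "s = -1"
    then have "t \<le> y" "y \<le> x" using y by (auto simp: germ_def)
    then show ?thesis using connectedD_interval[OF assms(2,4,3)] by blast
  qed
qed

text \<open>The existence clause says that \<open>M\<close> really extends to the side
  \<open>s\<close> of \<open>x\<close>; density alone could come from points outside
  \<open>M\<close>. Density is stated as one inclusion: for the orbit of a periodic interval the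
  reverse one holds for small germs.\<close>

definition full_germ :: "real set \<Rightarrow> real \<Rightarrow> real \<Rightarrow> bool" where
  "full_germ M x s \<longleftrightarrow> \<bar>s\<bar> = 1 \<and> x \<in> M \<and> (\<exists>t\<in>M. s * (t - x) > 0 \<and> germ x s (s * (t - x)) \<subseteq> M) \<and>
     (\<forall>d>0. M \<subseteq> closure (orb f (germ x s d)))"

lemma periodic_orb_facts:
  assumes "periodic_interval f k I"
  shows "weakly_periodic k I" "orb f I \<subseteq> {0..1}" "closed (orb f I)" "compact (orb f I)"
    "f ` orb f I = orb f I" "(f ^^ n) ` orb f I = orb f I" "I \<subseteq> orb f I" "I \<subseteq> {0..1}"
    "closure (orb f I) = orb f I" "(f ^^ k) ` I = I" "k \<ge> 1"
proof -
  show wp: "weakly_periodic k I" by (rule periodic_interval_wp[OF assms])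
  show "orb f I \<subseteq> {0..1}" by (rule wp_orb_in[OF wp])
  show "compact (orb f I)" by (rule wp_compact_orb[OF wp])
  then show cl: "closed (orb f I)" by (rule compact_imp_closed)
  show "closure (orb f I) = orb f I" using cl by simp
  show fI: "(f ^^ k) ` I = I" "k \<ge> 1" using assms by (auto simp: periodic_interval_def)
  have "(f ^^ i) ` I \<subseteq> f ` orb f I" for i
  proof -
    have "(f ^^ i) ` I = (f ^^ (i + k)) ` I" unfolding funpow_image_add fI ..
    also have "\<dots> = (f ^^ (1 + (i + k - 1))) ` I" using fI(2) by simp
    also have "\<dots> = f ` ((f ^^ (i + k - 1)) ` I)" unfolding funpow_image_add by simp
    also have "\<dots> \<subseteq> f ` orb f I" by (intro image_mono image_subset_orb)
    finally show ?thesis .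
  qed
  then have "orb f I \<subseteq> f ` orb f I" by (auto simp: orb_def)
  then show f1: "f ` orb f I = orb f I" using orb_image_subset[of I] by blast
  show "(f ^^ n) ` orb f I = orb f I"
  proof (induction n)
    case (Suc n)
    have "(f ^^ Suc n) ` orb f I = f ` ((f ^^ n) ` orb f I)" by (simp add: image_comp)
    then show ?case using Suc f1 by simp
  qed simp
  show "I \<subseteq> orb f I" by (rule orb_superset)
  then show "I \<subseteq> {0..1}" using \<open>orb f I \<subseteq> {0..1}\<close> by (rule order_trans)
qed

lemma B_set_iff:
  assumes "periodic_interval f k I"
  shows "w \<in> B_set f I \<longleftrightarrow> w \<in> orb f I \<and> (\<forall>e>0. orb f I \<subseteq> closure (orb f (ball w e \<inter> orb f I)))"
proof (intro iffI conjI allI impI)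
  assume "w \<in> B_set f I"
  then show "w \<in> orb f I" by (simp add: B_set_def)
  fix e :: real assume "e > 0"
  have "openin (top_of_set (orb f I)) (ball w e \<inter> orb f I)"
    by (metis open_ball openin_open Int_commute)
  then show "orb f I \<subseteq> closure (orb f (ball w e \<inter> orb f I))"
    using \<open>w \<in> B_set f I\<close> \<open>e > 0\<close> by (simp add: B_set_def)
next
  assume w: "w \<in> orb f I \<and> (\<forall>e>0. orb f I \<subseteq> closure (orb f (ball w e \<inter> orb f I)))"
  have "closure (orb f U) = orb f I" if U: "openin (top_of_set (orb f I)) U" "w \<in> U" for U
  proof
    have UM: "U \<subseteq> orb f I" using openin_imp_subset[OF U(1)] .
    show "closure (orb f U) \<subseteq> orb f I"
      using closure_orb_mono[OF UM] periodic_orb_facts(9)[OF assms] by simp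
    obtain T where T: "open T" "U = orb f I \<inter> T" using U(1) openin_open by blast
    then obtain e where e: "e > 0" "ball w e \<subseteq> T" using U(2) open_contains_ball by blast
    then have "ball w e \<inter> orb f I \<subseteq> U" using T by blast
    then have "closure (orb f (ball w e \<inter> orb f I)) \<subseteq> closure (orb f U)"
      by (intro closure_mono orb_mono)
    then show "orb f I \<subseteq> closure (orb f U)" using w e(1) by blast
  qed
  then show "w \<in> B_set f I" using w by (simp add: B_set_def)
qed

lemma B_set_subset: "B_set f I \<subseteq> orb f I" by (auto simp: B_set_def)

lemma B_setI_germ:
  assumes I: "periodic_interval f k I" and x: "x \<in> orb f I"
    and sub: "\<And>e. e > 0 \<Longrightarrow> \<exists>A n. A \<subseteq> (f ^^ n) ` (ball x e \<inter> orb f I) \<and> orb f I \<subseteq> closure (orb f A)"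
  shows "x \<in> B_set f I"
  unfolding B_set_iff[OF I]
proof (intro conjI allI impI x)
  fix e :: real assume "e > 0"
  then obtain A n where A: "A \<subseteq> (f ^^ n) ` (ball x e \<inter> orb f I)" "orb f I \<subseteq> closure (orb f A)"
    using sub by blast
  have "A \<subseteq> orb f (ball x e \<inter> orb f I)" using A(1) image_subset_orb by (rule order_trans)
  then show "orb f I \<subseteq> closure (orb f (ball x e \<inter> orb f I))"
    using A(2) closure_orb_mono by (meson order_trans)
qed

lemma full_germ_small:
  assumes "full_germ M x s" "e > 0"
  obtains d where "d > 0" "germ x s d \<subseteq> ball x e \<inter> M"
proof -
  obtain t where t: "s * (t - x) > 0" "germ x s (s * (t - x)) \<subseteq> M" and s: "\<bar>s\<bar> = 1"
    using assms(1) unfolding full_germ_def by blast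
  define d where "d = min (s * (t - x)) (e / 2)"
  have "d > 0" using t assms(2) by (simp add: d_def)
  moreover have "germ x s d \<subseteq> M" using germ_mono[of d "s * (t - x)" x s] t(2) unfolding d_def by auto
  moreover have "germ x s d \<subseteq> ball x e"
  proof
    fix y assume "y \<in> germ x s d"
    then have "\<bar>y - x\<bar> \<le> d" by (rule germ_dist[OF s])
    also have "d < e" using assms(2) by (simp add: d_def)
    finally show "y \<in> ball x e" by (simp add: dist_real_def)
  qed
  ultimately show thesis using that by blast
qed

lemma full_germ_B:
  assumes "periodic_interval f k I" "full_germ (orb f I) x s"
  shows "x \<in> B_set f I"
proof (rule B_setI_germ[OF assms(1)])
  show "x \<in> orb f I" using assms(2) by (simp add: full_germ_def)
  fix e :: real assume "e > 0"
  then obtain d where "d > 0" "germ x s d \<subseteq> ball x e \<inter> orb f I" by (rule full_germ_small[OF assms(2)])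
  then have "germ x s d \<subseteq> (f ^^ 0) ` (ball x e \<inter> orb f I)" "orb f I \<subseteq> closure (orb f (germ x s d))"
    using assms(2) by (simp_all add: full_germ_def)
  then show "\<exists>A n. A \<subseteq> (f ^^ n) ` (ball x e \<inter> orb f I) \<and> orb f I \<subseteq> closure (orb f A)" by blast
qed

text \<open>Small neighbourhoods of \<open>x\<close> are mapped into a given neighbourhood of its
  image, and density survives because every power maps \<open>orb f I\<close> onto itself.\<close>

lemma B_set_forward:
  assumes I: "periodic_interval f k I" and x: "x \<in> B_set f I"
  shows "(f ^^ n) x \<in> B_set f I"
  unfolding B_set_iff[OF I]
proof (intro conjI allI impI)
  let ?M = "orb f I"
  note M = periodic_orb_facts[OF I]
  have xM: "x \<in> ?M" using x B_set_subset by blast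
  then show "(f ^^ n) x \<in> ?M" by (rule orb_iter)
  fix e :: real assume "e > 0"
  then obtain d where d: "d > 0" "\<forall>y\<in>{0..1}. \<bar>y - x\<bar> \<le> d \<longrightarrow> \<bar>(f ^^ n) y - (f ^^ n) x\<bar> < e"
    using funpow_near[of x e n] xM M(2) by blast
  have sub: "(f ^^ n) ` (ball x d \<inter> ?M) \<subseteq> ball ((f ^^ n) x) e \<inter> ?M"
  proof
    fix z assume "z \<in> (f ^^ n) ` (ball x d \<inter> ?M)"
    then obtain y where y: "z = (f ^^ n) y" "\<bar>y - x\<bar> < d" "y \<in> ?M" by (auto simp: dist_real_def)
    then have "y \<in> {0..1}" using M(2) by blast
    then have "\<bar>(f ^^ n) y - (f ^^ n) x\<bar> < e" using d(2) y(2) by simp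
    then show "z \<in> ball ((f ^^ n) x) e \<inter> ?M"
      using y orb_iter[of y I n] by (auto simp: dist_real_def)
  qed
  have "?M \<subseteq> closure (orb f (ball x d \<inter> ?M))" using x d(1) unfolding B_set_iff[OF I] by blast
  then have "(f ^^ n) ` ?M \<subseteq> (f ^^ n) ` closure (orb f (ball x d \<inter> ?M))" by (rule image_mono)
  also have "\<dots> = closure (orb f ((f ^^ n) ` (ball x d \<inter> ?M)))"
    using M(2) by (intro image_closure_orb) blast
  also have "\<dots> \<subseteq> closure (orb f (ball ((f ^^ n) x) e \<inter> ?M))"
    by (intro closure_mono orb_mono sub)
  finally show "?M \<subseteq> closure (orb f (ball ((f ^^ n) x) e \<inter> ?M))" using M(6) by simp
qed

text \<open>The orbit of \<open>D\<close> consists of finitely many closed intervals, so points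
  accumulating at \<open>x\<close> from the side \<open>s\<close> do so within one of them, which
  then contains \<open>x\<close> and a whole germ.\<close>

lemma germ_in_orb:
  assumes D: "weakly_periodic k D" and s: "\<bar>s\<bar> = 1"
    and near: "\<And>d. d > 0 \<Longrightarrow> \<exists>t \<in> orb f D \<inter> germ x s d. t \<noteq> x"
  obtains i t where "i < k" "x \<in> (f ^^ i) ` D" "t \<in> (f ^^ i) ` D" "s * (t - x) > 0"
    "germ x s (s * (t - x)) \<subseteq> (f ^^ i) ` D"
proof -
  have "\<exists>i<k. \<forall>d>0. \<exists>t \<in> (f ^^ i) ` D \<inter> germ x s d. t \<noteq> x"
  proof (rule ccontr)
    assume "\<not> ?thesis"
    then have "\<forall>i<k. \<exists>d>0. \<forall>t \<in> (f ^^ i) ` D \<inter> germ x s d. t = x" by blast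
    then obtain d where d: "\<And>i. i < k \<Longrightarrow> d i > 0"
      "\<And>i t. i < k \<Longrightarrow> t \<in> (f ^^ i) ` D \<Longrightarrow> t \<in> germ x s (d i) \<Longrightarrow> t = x" by (metis IntI)
    define m where "m = Min (d ` {..<k})"
    have k: "k \<ge> 1" using weakly_periodicD(1)[OF D] .
    then have "m > 0" unfolding m_def using d(1) by (subst Min_gr_iff) (auto simp: lessThan_empty_iff)
    then obtain t where t: "t \<in> orb f D" "t \<in> germ x s m" "t \<noteq> x" using near by blast
    then obtain i where i: "i < k" "t \<in> (f ^^ i) ` D" unfolding wp_orb[OF D] by blast
    have "m \<le> d i" unfolding m_def using i(1) by simp
    then have "t \<in> germ x s (d i)" using t(2) germ_mono by blast
    then show False using d(2)[OF i] t(3) by simp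
  qed
  then obtain i where i: "i < k" "\<And>d. d > 0 \<Longrightarrow> \<exists>t \<in> (f ^^ i) ` D \<inter> germ x s d. t \<noteq> x" by blast
  have cD: "cinterval ((f ^^ i) ` D)" by (rule cinterval_image[OF weakly_periodicD(2)[OF D]])
  have "x \<in> closure ((f ^^ i) ` D)"
    unfolding closure_approachable
  proof (intro allI impI)
    fix e :: real assume "e > 0"
    then obtain t where "t \<in> (f ^^ i) ` D" "t \<in> germ x s (e/2)" using i(2)[of "e/2"] by auto
    then show "\<exists>y\<in>(f ^^ i) ` D. dist y x < e"
      using germ_dist[OF s, of t x "e/2"] \<open>e > 0\<close> by (intro bexI[of _ t]) (auto simp: dist_real_def)
  qed
  then have x: "x \<in> (f ^^ i) ` D" using cintervalD(5)[OF cD] by simp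
  obtain t where t: "t \<in> (f ^^ i) ` D" "t \<in> germ x s 1" "t \<noteq> x" using i(2)[of 1] by auto
  show thesis
    by (rule that[OF i(1) x t(1) germ_pos[OF s t(2,3)] germ_subset_connected[OF s cintervalD(2)[OF cD] x t(1)]])
qed

text \<open>The last preimage of \<open>x\<close> before \<open>v\<close> has a side that is mapped over the side \<open>s\<close> of \<open>x\<close>.\<close>

lemma germ_lift:
  assumes C: "connected C" "C \<subseteq> {0..1}" and s: "\<bar>s\<bar> = 1" and uv: "u \<in> C" "v \<in> C"
    and sg: "s * ((f ^^ n) u - x) \<le> 0" "s * ((f ^^ n) v - x) > 0"
  obtains w r where "w \<in> closed_segment u v" "w \<in> C" "\<bar>r\<bar> = 1" "(f ^^ n) w = x" "r * (v - w) > 0"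
    "\<And>e. e > 0 \<Longrightarrow> \<exists>d>0. germ x s d \<subseteq> (f ^^ n) ` (germ w r e \<inter> C)"
proof -
  let ?g = "f ^^ n"
  have seg: "closed_segment u v \<subseteq> C"
    using C(1) uv by (metis closed_segment_subset convex_connected is_interval_connected_1 is_interval_convex_1)
  have cg: "continuous_on C ?g" by (rule cont_funpow_on[OF C(2)])
  \<comment> \<open>\<open>K\<close> collects the points whose image is not strictly on the side
    \<open>s\<close> of \<open>x\<close>; the point of \<open>K\<close> nearest to \<open>v\<close>
    is the last crossing.\<close>
  define K where "K = {w \<in> closed_segment u v. s * (?g w - x) \<le> 0}"
  have "closed K" unfolding K_def
    by (intro continuous_closed_preimage_constant continuous_on_closed_Collect_le closed_segment continuous_intros
      continuous_on_subset[OF cg seg])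
  moreover have "K \<subseteq> closed_segment u v" unfolding K_def by blast
  ultimately have "compact K" using compact_segment[of u v] by (metis compact_Int_closed inf.absorb2)
  moreover have "K \<noteq> {}" unfolding K_def using sg(1) by auto
  moreover have "continuous_on K (\<lambda>w. \<bar>v - w\<bar>)" by (intro continuous_intros)
  ultimately obtain w where w: "w \<in> K" "\<And>w'. w' \<in> K \<Longrightarrow> \<bar>v - w\<bar> \<le> \<bar>v - w'\<bar>"
    using continuous_attains_inf by metis
  have wseg: "w \<in> closed_segment u v" and gw: "s * (?g w - x) \<le> 0" using w(1) by (auto simp: K_def)
  have wv: "w \<noteq> v" using gw sg(2) by auto
  have pos: "s * (?g z - x) > 0" if "z \<in> closed_segment w v" "z \<noteq> w" for z
  proof (rule ccontr)
    assume "\<not> s * (?g z - x) > 0"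
    moreover have "closed_segment w v \<subseteq> closed_segment u v" using wseg by (simp add: subset_closed_segment)
    ultimately have "z \<in> K" using that unfolding K_def by auto
    then have "\<bar>v - w\<bar> \<le> \<bar>v - z\<bar>" by (rule w(2))
    then show False using that wv by (auto simp: closed_segment_eq_real_ivl split: if_splits)
  qed
  have wC: "w \<in> C" using wseg seg by blast
  define r where "r = sgn (v - w)"
  have r: "\<bar>r\<bar> = 1" "r * (v - w) > 0" "r * (v - w) = \<bar>v - w\<bar>" unfolding r_def using wv by (auto simp: sgn_if)
  have segC: "closed_segment w z \<subseteq> C" if "z \<in> closed_segment w v" for z
    using that wseg seg by (meson ends_in_segment(2) order_trans subset_closed_segment subsetD)
  have cov: "germ x s (s * (?g z - x)) \<subseteq> ?g ` closed_segment w z" if "z \<in> closed_segment w v" "?g w = x" for z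
  proof (rule germ_subset_connected[OF s])
    show "connected (?g ` closed_segment w z)"
      using connected_continuous_image[OF continuous_on_subset[OF cg segC[OF that(1)]]] by simp
  qed (use that in auto)
  have gwx: "?g w = x"
  proof (rule ccontr)
    assume "?g w \<noteq> x"
    then have neg: "s * (?g w - x) < 0" using gw side_cases[OF s] by auto
    have "connected (?g ` closed_segment w v)"
      using connected_continuous_image[OF continuous_on_subset[OF cg segC[of v]]] by simp
    then have "x \<in> ?g ` closed_segment w v"
      using connectedD_interval[of "?g ` closed_segment w v" "?g w" "?g v" x]
        connectedD_interval[of "?g ` closed_segment w v" "?g v" "?g w" x] neg sg(2) side_cases[OF s] by auto
    then obtain z where "z \<in> closed_segment w v" "?g z = x" by blast
    then show False using pos[of z] \<open>?g w \<noteq> x\<close> by auto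
  qed
  have "\<exists>d>0. germ x s d \<subseteq> ?g ` (germ w r e \<inter> C)" if "e > 0" for e
  proof -
    define z where "z = w + r * min e \<bar>v - w\<bar>"
    have z: "z \<in> closed_segment w v" "z \<noteq> w" using that wv side_cases[OF r(1)] r(2)
      unfolding z_def by (auto simp: closed_segment_eq_real_ivl)
    have "closed_segment w z \<subseteq> germ w r e"
    proof
      fix y assume y: "y \<in> closed_segment w z"
      then have "y \<in> {0..1}" using segC[OF z(1)] C(2) by blast
      then show "y \<in> germ w r e" using y that side_cases[OF r(1)]
        unfolding germ_def z_def by (auto simp: closed_segment_eq_real_ivl split: if_splits)
    qed
    then have "germ x s (s * (?g z - x)) \<subseteq> ?g ` (germ w r e \<inter> C)"
      using cov[OF z(1) gwx] segC[OF z(1)] by blast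
    then show ?thesis using pos[OF z] by blast
  qed
  then show thesis by (rule that[OF wseg wC r(1) gwx r(2)])
qed

text \<open>The orbit of each small germ at \<open>w\<close> contains a germ at \<open>x\<close> on
  the dense side, so density is inherited. The sign hypotheses ensure that the dense side of
  \<open>x\<close>, and not merely \<open>x\<close>, is reached from inside
  \<open>C\<close>.\<close>

lemma full_germ_lift:
  assumes I: "periodic_interval f k I" and x: "full_germ (orb f I) x s"
    and C: "connected C" "C \<subseteq> orb f I" "u \<in> C" "v \<in> C"
    and sg: "s * ((f ^^ n) u - x) \<le> 0" "s * ((f ^^ n) v - x) > 0"
  obtains w r where "w \<in> closed_segment u v" "w \<in> C" "(f ^^ n) w = x" "full_germ (orb f I) w r"
proof -
  have s: "\<bar>s\<bar> = 1" and full: "\<And>d. d > 0 \<Longrightarrow> orb f I \<subseteq> closure (orb f (germ x s d))"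
    using x by (auto simp: full_germ_def)
  have "C \<subseteq> {0..1}" using C(2) periodic_orb_facts(2)[OF I] by (rule order_trans)
  from germ_lift[OF C(1) this s C(3,4) sg] obtain w r where w: "w \<in> closed_segment u v" "w \<in> C" "\<bar>r\<bar> = 1" "(f ^^ n) w = x" "r * (v - w) > 0"
    and cov: "\<And>e. e > 0 \<Longrightarrow> \<exists>d>0. germ x s d \<subseteq> (f ^^ n) ` (germ w r e \<inter> C)" by blast
  have "orb f I \<subseteq> closure (orb f (germ w r e))" if e: "e > 0" for e
  proof -
    obtain d where d: "d > 0" "germ x s d \<subseteq> (f ^^ n) ` (germ w r e \<inter> C)" using cov[OF e] by blast
    have "germ x s d \<subseteq> orb f (germ w r e)" using d(2) image_subset_orb[of n "germ w r e"] by blast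
    from closure_orb_mono[OF this] show ?thesis using full[OF d(1)] by (rule order_trans[rotated])
  qed
  moreover have "germ w r (r * (v - w)) \<subseteq> orb f I"
    using germ_subset_connected[OF w(3) C(1) w(2) C(4)] C(2) by (rule order_trans)
  ultimately have "full_germ (orb f I) w r" unfolding full_germ_def using w C by blast
  then show thesis using that w by blast
qed

text \<open>The return map \<open>f ^^ k\<close> is onto \<open>I\<close>, so \<open>x\<close> and a
  point of \<open>I\<close> on its dense side have preimages in \<open>I\<close> under all powers of
  it. If the lifted preimages for two different powers coincided, \<open>x\<close> would be
  periodic.\<close>

lemma full_germ_preimages:
  assumes I: "periodic_interval f k I" and x: "full_germ (orb f I) x s" "x \<in> I" "x \<notin> Per f"
  shows "infinite {w \<in> I. \<exists>r n. full_germ (orb f I) w r \<and> (f ^^ n) w = x}"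
proof -
  note M = periodic_orb_facts[OF I]
  obtain t where t: "t \<in> orb f I" "s * (t - x) > 0" "germ x s (s * (t - x)) \<subseteq> orb f I" and s: "\<bar>s\<bar> = 1"
    using x(1) unfolding full_germ_def by blast
  have x01: "x \<in> {0..1}" "t \<in> {0..1}" using x t(1) M by auto
  have cI: "cinterval I" using weakly_periodicD(2)[OF M(1)] .
  have "germ x s (s * (t - x)) \<subseteq> I"
    using t x01 by (intro wp_connected_subset0[OF M(1) _ t(3) germ_base x(2)] cintervalD(2)[OF germ_cinterval[OF s]]) auto
  moreover have "t \<in> germ x s (s * (t - x))" using x01 t(2) by (simp add: germ_def)
  ultimately have tI: "t \<in> I" by blast
  have per: "(f ^^ (k * n)) ` I = I" for n
  proof (induction n)
    case (Suc n)
    have "(f ^^ (k * Suc n)) ` I = (f ^^ k) ` ((f ^^ (k * n)) ` I)" by (simp add: funpow_image_add)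
    then show ?case using Suc M(10) by simp
  qed simp
  have "\<exists>w\<in>I. \<exists>r. full_germ (orb f I) w r \<and> (f ^^ (k * n)) w = x" for n
  proof -
    have "x \<in> (f ^^ (k * n)) ` I" "t \<in> (f ^^ (k * n)) ` I" using per x(2) tI by auto
    then obtain u v where uv: "u \<in> I" "(f ^^ (k * n)) u = x" "v \<in> I" "(f ^^ (k * n)) v = t" by blast
    show ?thesis
      by (rule full_germ_lift[OF I x(1) cintervalD(2)[OF cI] M(7) uv(1,3), of "k * n"]) (use uv t in auto)
  qed
  then obtain w where w: "\<And>n. w n \<in> I \<and> (\<exists>r. full_germ (orb f I) (w n) r) \<and> (f ^^ (k * n)) (w n) = x"
    by metis
  have lt: "w n \<noteq> w m" if "n < m" for n m
  proof
    assume eq: "w n = w m"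
    have "(f ^^ (k * (m - n))) x = (f ^^ (k * (m - n))) ((f ^^ (k * n)) (w n))" using w by simp
    also have "\<dots> = (f ^^ (k * m)) (w m)" unfolding funpow_add_app[symmetric] eq
      using that by (simp add: algebra_simps)
    finally have "(f ^^ (k * (m - n))) x = x" using w by simp
    moreover have "k * (m - n) \<ge> 1" using that M(11) by simp
    ultimately show False using x(3) x01 unfolding Per_def by blast
  qed
  then have "inj w" by (metis injI linorder_neqE_nat)
  then have "infinite (range w)" using finite_imageD by blast
  moreover have "range w \<subseteq> {w \<in> I. \<exists>r n. full_germ (orb f I) w r \<and> (f ^^ n) w = x}" using w by blast
  ultimately show ?thesis using finite_subset by blast
qed

lemma infinite_B_set:
  assumes "periodic_interval f k I" "full_germ (orb f I) x s" "x \<in> I" "x \<notin> Per f"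
  shows "infinite (B_set f I)"
proof
  assume "finite (B_set f I)"
  moreover have "{w \<in> I. \<exists>r n. full_germ (orb f I) w r \<and> (f ^^ n) w = x} \<subseteq> B_set f I"
    using full_germ_B[OF assms(1)] by blast
  ultimately show False using full_germ_preimages[OF assms] finite_subset by blast
qed

section \<open>Recurrence on one side\<close>

lemma const_tower_mem:
  assumes "weakly_periodic k D" "t \<in> D" "t \<in> (f ^^ n) ` D" "n \<ge> k * j"
  shows "t \<in> (f ^^ (k * j)) ` D"
proof -
  obtain q where q: "n = k * q" using wp_return[OF assms(1-3)] by (elim dvdE)
  then have "j \<le> q" using assms(4) weakly_periodicD(1)[OF assms(1)] by simp
  then show ?thesis using wp_power_decr[OF assms(1)] assms(3) q by blast
qed

text \<open>Late returns matter: a point that returns after many steps lies in a deep image of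
  \<open>D j\<close>. Such points converge to \<open>x\<close>, and closedness puts \<open>x\<close>
  itself into all the images, which is what \<open>tower_dichotomy\<close> asks for.\<close>

lemma germ_tower:
  assumes x: "x \<in> {0..1}" and s: "\<bar>s\<bar> = 1"
    and ret: "\<And>d N. d > 0 \<Longrightarrow> \<exists>n\<ge>N. \<exists>y \<in> germ x s d. (f ^^ n) y \<in> germ x s d"
  shows "in_solenoid x \<or> (\<exists>k D d. (\<forall>j. d j > 0) \<and> d \<longlonglongrightarrow> 0 \<and> (\<forall>j. weakly_periodic k (D j)) \<and> decseq D \<and>
     (\<forall>j. germ x s (d j) \<subseteq> D j \<and> closure (orb f (germ x s (d j))) = orb f (D j)) \<and>
     (\<forall>j. x \<in> (f ^^ (k * j)) ` D j))"
proof -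
  define d where "d j = 1 / real (Suc j)" for j
  have d: "d j > 0" for j by (simp add: d_def)
  have ddec: "d j \<le> d i" if "i \<le> j" for i j using that by (simp add: d_def frac_le)
  have dlim: "d \<longlonglongrightarrow> 0" unfolding d_def by (rule LIMSEQ_Suc[OF lim_1_over_n])
  have "\<exists>k D. weakly_periodic k D \<and> germ x s (d j) \<subseteq> D \<and> closure (orb f (germ x s (d j))) = orb f D" for j
  proof -
    obtain n y where n: "n \<ge> 1" "y \<in> germ x s (d j)" "(f ^^ n) y \<in> germ x s (d j)" using ret[OF d] by blast
    then have "(f ^^ n) ` germ x s (d j) \<inter> germ x s (d j) \<noteq> {}" by blast
    from wp_exists[OF germ_cinterval[OF s x] n(1) this] d[of j] show ?thesis by (metis less_imp_le)
  qed
  then obtain k D where kD: "\<And>j. weakly_periodic (k j) (D j)" "\<And>j. germ x s (d j) \<subseteq> D j"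
    "\<And>j. closure (orb f (germ x s (d j))) = orb f (D j)" by metis
  have xD: "x \<in> D j" for j using kD(2) germ_base[OF x] d[of j] by (meson less_imp_le subsetD)
  have dec: "decseq D"
  proof (rule antimonoI)
    fix i j :: nat assume ij: "i \<le> j"
    have "orb f (D j) \<subseteq> orb f (D i)" unfolding kD(3)[symmetric]
      by (intro closure_mono orb_mono germ_mono ddec ij)
    then show "D j \<subseteq> D i" by (rule wp_refine(1)[OF kD(1) kD(1) _ xD xD])
  qed
  have xH: "x \<in> (f ^^ (k j * i)) ` D j" for i j
  proof -
    have "x \<in> closure ((f ^^ (k j * i)) ` D j)"
      unfolding closure_approachable
    proof (intro allI impI)
      fix e :: real assume "e > 0"
      define e' where "e' = min (e / 2) (d j)"
      have e': "e' > 0" "e' < e" "e' \<le> d j" using \<open>e > 0\<close> d[of j] by (auto simp: e'_def)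
      obtain n y where n: "n \<ge> k j * i" "y \<in> germ x s e'" "(f ^^ n) y \<in> germ x s e'" using ret[OF e'(1)] by blast
      have "germ x s e' \<subseteq> D j" using germ_mono[OF e'(3)] kD(2) by (rule order_trans)
      then have "(f ^^ n) y \<in> (f ^^ (k j * i)) ` D j"
        using n by (intro const_tower_mem[OF kD(1), of _ j n i]) auto
      moreover have "dist ((f ^^ n) y) x < e" using germ_dist[OF s n(3)] e'(2) by (simp add: dist_real_def)
      ultimately show "\<exists>y\<in>(f ^^ (k j * i)) ` D j. dist y x < e" by blast
    qed
    then show ?thesis using cintervalD(5)[OF cinterval_image[OF weakly_periodicD(2)[OF kD(1)]]] by simp
  qed
  from tower_dichotomy[of k D, OF kD(1) dec xH] show ?thesis
  proof
    assume "\<exists>j0. \<forall>j\<ge>j0. k j = k j0"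
    then obtain j0 where j0: "\<And>j. j \<ge> j0 \<Longrightarrow> k j = k j0" by blast
    let ?D = "\<lambda>j. D (j + j0)" and ?d = "\<lambda>j. d (j + j0)"
    have "weakly_periodic (k j0) (?D j)" for j using kD(1)[of "j + j0"] j0[of "j + j0"] by simp
    moreover have "decseq ?D" by (intro antimonoI decseqD[OF dec]) simp
    moreover have "x \<in> (f ^^ (k j0 * j)) ` ?D j" for j using xH[of "j + j0" j] j0[of "j + j0"] by simp
    moreover have "?d \<longlonglongrightarrow> 0" by (rule LIMSEQ_ignore_initial_segment[OF dlim])
    ultimately show ?thesis using kD(2,3) d
      by (intro disjI2 exI[of _ "k j0"] exI[of _ ?D] exI[of _ ?d]) auto
  qed blast
qed

lemma full_germ_of_tower:
  assumes H: "periodic_interval f k H" and s: "\<bar>s\<bar> = 1" and x: "x \<in> orb f H"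
    and t: "t \<in> orb f H" "s * (t - x) > 0" "germ x s (s * (t - x)) \<subseteq> orb f H"
    and d: "d \<longlonglongrightarrow> (0::real)" "\<And>j. orb f H \<subseteq> closure (orb f (germ x s (d j)))"
  shows "full_germ (orb f H) x s"
  unfolding full_germ_def
proof (intro conjI allI impI)
  fix e :: real assume "e > 0"
  then obtain j where "\<bar>d j\<bar> < e" using d(1) unfolding LIMSEQ_def dist_real_def by force
  then have "germ x s (d j) \<subseteq> germ x s e" by (intro germ_mono) simp
  then have "closure (orb f (germ x s (d j))) \<subseteq> closure (orb f (germ x s e))" by (intro closure_mono orb_mono)
  then show "orb f H \<subseteq> closure (orb f (germ x s e))" using d(2)[of j] by (rule order_trans[rotated])
qed (use assms in blast)+

text \<open>Because the returning points differ from \<open>x\<close>, all the sets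
  \<open>E j\<close> extend to the side \<open>s\<close>. If \<open>H\<close> did not,
  \<open>x\<close> would be an endpoint of \<open>H\<close> overlapped at every stage, hence
  periodic.\<close>

lemma recurrent_germ:
  assumes x: "x \<in> {0..1}" "x \<notin> Per f" and s: "\<bar>s\<bar> = 1"
    and ret: "\<And>d N. d > 0 \<Longrightarrow> \<exists>n\<ge>N. \<exists>y \<in> germ x s d. (f ^^ n) y \<in> germ x s d \<and> (f ^^ n) y \<noteq> x"
  shows "in_solenoid x \<or> in_basic x"
proof (cases "in_solenoid x")
  case False
  have ret': "\<exists>n\<ge>N. \<exists>y \<in> germ x s d. (f ^^ n) y \<in> germ x s d" if "d > 0" for d N using ret[OF that] by blast
  obtain k D d where d: "\<And>j::nat. d j > 0" "d \<longlonglongrightarrow> 0" and wp: "\<And>j. weakly_periodic k (D j)" and dec: "decseq D"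
    and gD: "\<And>j. germ x s (d j) \<subseteq> D j" "\<And>j. closure (orb f (germ x s (d j))) = orb f (D j)"
    and xE: "\<And>j. x \<in> (f ^^ (k * j)) ` D j"
    using germ_tower[OF x(1) s ret'] False by blast
  define E where "E = (\<lambda>j. (f ^^ (k * j)) ` D j)"
  define H where "H = (\<Inter>j. E j)"
  note T = const_tower[of k D, OF wp dec, folded E_def]
  have E: "\<And>j. cinterval (E j)" "decseq E" "\<And>j. E (Suc j) \<subseteq> (f ^^ k) ` E j" unfolding E_def using const_tower(1-3)[of k D, OF wp dec] by auto
  have H: "cinterval H" "(f ^^ k) ` H = H" "\<And>j. H \<subseteq> D j" unfolding H_def E_def using const_tower(4-6)[of k D, OF wp dec] by auto
  have xH: "x \<in> H" unfolding H_def E_def using xE by blast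
  have tE: "\<exists>t \<in> E j. t \<in> germ x s e \<and> t \<noteq> x" if "e > 0" for e j
  proof -
    define e' where "e' = min e (d j)"
    have e': "e' > 0" "e' \<le> e" "e' \<le> d j" using that d(1)[of j] by (auto simp: e'_def)
    obtain n y where n: "n \<ge> k * j" "y \<in> germ x s e'" "(f ^^ n) y \<in> germ x s e'" "(f ^^ n) y \<noteq> x" using ret[OF e'(1)] by blast
    have "germ x s e' \<subseteq> D j" using germ_mono[OF e'(3)] gD(1) by (rule order_trans)
    then have "(f ^^ n) y \<in> E j" unfolding E_def
      using n by (intro const_tower_mem[OF wp, of _ j n j]) auto
    then show ?thesis using n germ_mono[OF e'(2)] by blast
  qed
  have "\<exists>t\<in>H. s * (t - x) > 0"
  proof (rule ccontr)
    assume no: "\<not> (\<exists>t\<in>H. s * (t - x) > 0)"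
    have "(f ^^ k) x = x \<or> (f ^^ k) ((f ^^ k) x) = x"
    proof (rule overlapping_endpoint_periodic[of E, OF E H_def])
      show "(f ^^ k) ` H \<subseteq> H" using H(2) by simp
      fix e :: real and j assume "e > 0"
      then obtain t where t: "t \<in> E j" "t \<in> germ x s (e / 2)" "t \<noteq> x" using tE[of "e/2" j] by auto
      have "t \<notin> H" using no germ_pos[OF s t(2,3)] by blast
      then show "\<exists>w\<in>E j - H. \<bar>w - x\<bar> < e" using t germ_dist[OF s t(2)] \<open>e > 0\<close> by (intro bexI[of _ t]) auto
    qed
    then have "(f ^^ k) x = x \<or> (f ^^ (k + k)) x = x" unfolding funpow_add_app .
    moreover have "k \<ge> 1" using weakly_periodicD(1)[OF wp] .
    ultimately have "\<exists>n\<ge>1. (f ^^ n) x = x" by (metis trans_le_add1)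
    then show False using x unfolding Per_def by blast
  qed
  then obtain t where t: "t \<in> H" "s * (t - x) > 0" by blast
  have per: "periodic_interval f k H" using t(2) by (intro periodic_intervalI[OF wp H xH t(1)]) auto
  have HO: "H \<subseteq> orb f H" by (rule orb_superset)
  have "orb f H \<subseteq> orb f (D j)" for j by (rule orb_mono[OF H(3)])
  then have full: "full_germ (orb f H) x s"
    using xH t HO germ_subset_connected[OF s cintervalD(2)[OF H(1)] xH t(1)]
    by (intro full_germ_of_tower[OF per s _ _ t(2) _ d(2)]) (auto simp: gD(2))
  have "in_basic x" unfolding in_basic_def
    using per infinite_B_set[OF per full xH x(2)] full_germ_B[OF per full] by blast
  then show ?thesis ..
qed blast

section \<open>Limit sets of single orbits\<close>

lemma omega_limit_iff:
  "z \<in> omega_limit f y \<longleftrightarrow> (\<forall>d>0. \<forall>N. \<exists>n\<ge>N. \<bar>(f ^^ n) y - z\<bar> < d)"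
proof
  assume "z \<in> omega_limit f y"
  then obtain r where r: "strict_mono r" "(\<lambda>n. (f ^^ r n) y) \<longlonglongrightarrow> z" unfolding omega_limit_def by blast
  show "\<forall>d>0. \<forall>N. \<exists>n\<ge>N. \<bar>(f ^^ n) y - z\<bar> < d"
  proof (intro allI impI)
    fix d :: real and N assume "d > 0"
    then obtain M where M: "\<And>n. n \<ge> M \<Longrightarrow> \<bar>(f ^^ r n) y - z\<bar> < d"
      using r(2) unfolding LIMSEQ_def dist_real_def by blast
    have "r (max M N) \<ge> N" using seq_suble[OF r(1), of "max M N"] by simp
    then show "\<exists>n\<ge>N. \<bar>(f ^^ n) y - z\<bar> < d" using M[of "max M N"] by auto
  qed
next
  assume near: "\<forall>d>0. \<forall>N. \<exists>n\<ge>N. \<bar>(f ^^ n) y - z\<bar> < d"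
  have "\<exists>r. \<forall>n. \<bar>(f ^^ r n) y - z\<bar> < 1 / real (Suc n) \<and> r n < r (Suc n)"
  proof (rule dependent_nat_choice)
    show "\<exists>m. \<bar>(f ^^ m) y - z\<bar> < 1 / real (Suc 0)" using near by (metis zero_less_divide_1_iff of_nat_0_less_iff zero_less_Suc)
    fix m n :: nat
    have "1 / real (Suc (Suc n)) > 0" by simp
    then obtain m' where "m' \<ge> Suc m" "\<bar>(f ^^ m') y - z\<bar> < 1 / real (Suc (Suc n))" using near by blast
    then show "\<exists>m'. \<bar>(f ^^ m') y - z\<bar> < 1 / real (Suc (Suc n)) \<and> m < m'" by auto
  qed
  then obtain r where r: "\<And>n. \<bar>(f ^^ r n) y - z\<bar> < 1 / real (Suc n)" "\<And>n. r n < r (Suc n)" by blast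
  have "(\<lambda>n. (f ^^ r n) y) \<longlonglongrightarrow> z"
  proof (rule LIMSEQ_I)
    fix e :: real assume "e > 0"
    then obtain N where N: "1 / real (Suc N) < e" using nat_approx_posE by metis
    have "\<bar>(f ^^ r n) y - z\<bar> < e" if "n \<ge> N" for n
    proof -
      have "1 / real (Suc n) \<le> 1 / real (Suc N)" using that by (simp add: frac_le)
      then show ?thesis using r(1)[of n] N by linarith
    qed
    then show "\<exists>N. \<forall>n\<ge>N. norm ((f ^^ r n) y - z) < e" by auto
  qed
  then show "z \<in> omega_limit f y" unfolding omega_limit_def using r(2) strict_mono_Suc_iff by blast
qed

lemma closed_omega_limit: "closed (omega_limit f y)"
proof -
  have "x \<in> omega_limit f y" if xc: "x \<in> closure (omega_limit f y)" for x
    unfolding omega_limit_iff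
  proof (intro allI impI)
    fix d :: real and N :: nat assume d: "d > 0"
    then obtain z where z: "z \<in> omega_limit f y" "\<bar>z - x\<bar> < d / 2"
      using xc unfolding closure_approachable dist_real_def by (metis half_gt_zero)
    then obtain n where "n \<ge> N" "\<bar>(f ^^ n) y - z\<bar> < d / 2" unfolding omega_limit_iff using half_gt_zero[OF d] by blast
    then show "\<exists>n\<ge>N. \<bar>(f ^^ n) y - x\<bar> < d" using z(2) by (intro exI[of _ n]) linarith
  qed
  then show ?thesis using closure_subset_eq by blast
qed

lemma omega_limit_subset:
  assumes "closed C" "\<And>n. n \<ge> N \<Longrightarrow> (f ^^ n) y \<in> C"
  shows "omega_limit f y \<subseteq> C"
proof
  fix z assume z: "z \<in> omega_limit f y"
  have "z \<in> closure C" unfolding closure_approachable dist_real_def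
    using z assms(2) unfolding omega_limit_iff by blast
  then show "z \<in> C" using assms(1) by simp
qed

lemma omega_limit_in: "y \<in> {0..1} \<Longrightarrow> omega_limit f y \<subseteq> {0..1}"
  by (rule omega_limit_subset[of _ 0]) (use funpow_in in auto)

lemma omega_limit_forward:
  assumes "y \<in> {0..1}" "z \<in> omega_limit f y" shows "(f ^^ m) z \<in> omega_limit f y"
  unfolding omega_limit_iff
proof (intro allI impI)
  fix d :: real and N assume d: "d > 0"
  have z01: "z \<in> {0..1}" using omega_limit_in assms by blast
  obtain e where e: "e > 0" "\<forall>u\<in>{0..1}. \<bar>u - z\<bar> \<le> e \<longrightarrow> \<bar>(f ^^ m) u - (f ^^ m) z\<bar> < d"
    using funpow_near[OF z01 d] by blast
  obtain n where n: "n \<ge> N" "\<bar>(f ^^ n) y - z\<bar> < e" using assms(2) e(1) unfolding omega_limit_iff by blast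
  have "\<bar>(f ^^ (m + n)) y - (f ^^ m) z\<bar> < d"
    unfolding funpow_add_app using e(2) n(2) funpow_in[OF assms(1)] by simp
  then show "\<exists>n\<ge>N. \<bar>(f ^^ n) y - (f ^^ m) z\<bar> < d" using n(1) by (intro exI[of _ "m + n"]) simp
qed

lemma funpow_mod_period:
  assumes "(f ^^ p) x = x" shows "(f ^^ n) x = (f ^^ (n mod p)) x"
proof -
  have "(f ^^ (p * q)) x = x" for q
    by (induction q) (simp_all add: assms funpow_add_app)
  then have "(f ^^ (n mod p)) ((f ^^ (p * (n div p))) x) = (f ^^ (n mod p)) x" by simp
  then show ?thesis unfolding funpow_add_app[symmetric] by simp
qed

lemma orb_periodic_point:
  assumes "(f ^^ p) x = x" "p \<ge> 1" shows "orb f {x} = (\<lambda>i. (f ^^ i) x) ` {..<p}" "finite (orb f {x})"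
proof -
  have "(f ^^ n) x \<in> (\<lambda>i. (f ^^ i) x) ` {..<p}" for n
    using funpow_mod_period[OF assms(1), of n] assms(2) by simp
  then show "orb f {x} = (\<lambda>i. (f ^^ i) x) ` {..<p}" unfolding orb_def by auto
  then show "finite (orb f {x})" by simp
qed

lemma omega_limit_preperiodic:
  assumes "(f ^^ p) ((f ^^ n) y) = (f ^^ n) y" "p \<ge> 1"
  shows "omega_limit f y = orb f {(f ^^ n) y}"
proof
  let ?Z = "orb f {(f ^^ n) y}"
  show "omega_limit f y \<subseteq> ?Z"
  proof (rule omega_limit_subset)
    show "closed ?Z" using orb_periodic_point(2)[OF assms] finite_imp_closed by blast
    fix m assume "n \<le> m"
    then have "(f ^^ m) y = (f ^^ (m - n)) ((f ^^ n) y)" unfolding funpow_add_app[symmetric] by simp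
    then show "(f ^^ m) y \<in> ?Z" unfolding orb_def by blast
  qed
  have "(f ^^ i) ((f ^^ n) y) \<in> omega_limit f y" for i
    unfolding omega_limit_iff
  proof (intro allI impI)
    fix d :: real and N assume "d > 0"
    have "(f ^^ (p * N + i)) ((f ^^ n) y) = (f ^^ i) ((f ^^ n) y)"
      using funpow_mod_period[OF assms(1), of "p * N + i"] funpow_mod_period[OF assms(1), of i] by simp
    then have "(f ^^ (p * N + i + n)) y = (f ^^ i) ((f ^^ n) y)" unfolding funpow_add_app by simp
    moreover have "p * N + i + n \<ge> N" using assms(2) by (simp add: trans_le_add1)
    ultimately show "\<exists>m\<ge>N. \<bar>(f ^^ m) y - (f ^^ i) ((f ^^ n) y)\<bar> < d"
      using \<open>d > 0\<close> by (intro exI[of _ "p * N + i + n"]) simp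
  qed
  then show "?Z \<subseteq> omega_limit f y" unfolding orb_def by blast
qed

text \<open>An orbit meeting \<open>x\<close> twice is eventually periodic and has a finite limit
  set. So the late part of the orbit avoids \<open>x\<close> and accumulates at it from one of the
  two sides.\<close>

lemma omega_limit_side:
  assumes y: "y \<in> {0..1}" and inf: "infinite (omega_limit f y)" and x: "x \<in> omega_limit f y"
  obtains s where "\<bar>s\<bar> = 1" "\<And>d N. d > 0 \<Longrightarrow> \<exists>n\<ge>N. (f ^^ n) y \<in> germ x s d \<and> (f ^^ n) y \<noteq> x"
proof -
  have once: "m = n" if eq: "(f ^^ n) y = x" "(f ^^ m) y = x" for m n
  proof -
    have False if "n < m" "(f ^^ n) y = x" "(f ^^ m) y = x" for m n
    proof -
      have "(f ^^ (m - n)) ((f ^^ n) y) = (f ^^ n) y" unfolding funpow_add_app[symmetric] using that by simp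
      moreover have "m - n \<ge> 1" using that(1) by simp
      ultimately have "omega_limit f y = orb f {(f ^^ n) y}" "finite (orb f {(f ^^ n) y})"
        by (rule omega_limit_preperiodic, rule orb_periodic_point(2))
      then show False using inf by simp
    qed
    then show ?thesis using eq by (metis linorder_neqE_nat)
  qed
  obtain N0 where N0: "\<And>n. n \<ge> N0 \<Longrightarrow> (f ^^ n) y \<noteq> x"
  proof (cases "\<exists>n. (f ^^ n) y = x")
    case True
    then obtain n where "(f ^^ n) y = x" by blast
    then show thesis using once that[of "Suc n"] by (metis Suc_n_not_le_n)
  qed (use that in blast)
  define P where "P s \<longleftrightarrow> (\<forall>d>0. \<forall>N. \<exists>n\<ge>N. (f ^^ n) y \<in> germ x s d \<and> (f ^^ n) y \<noteq> x)" for s :: real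
  have "P 1 \<or> P (-1)"
  proof (rule ccontr)
    assume "\<not> (P 1 \<or> P (-1))"
    then obtain d1 N1 d2 N2 where d1: "d1 > 0" "\<And>n. n \<ge> N1 \<Longrightarrow> (f ^^ n) y \<in> germ x 1 d1 \<Longrightarrow> (f ^^ n) y = x"
      and d2: "d2 > 0" "\<And>n. n \<ge> N2 \<Longrightarrow> (f ^^ n) y \<in> germ x (-1) d2 \<Longrightarrow> (f ^^ n) y = x"
      unfolding P_def by blast
    obtain n where n: "n \<ge> max N0 (max N1 N2)" "\<bar>(f ^^ n) y - x\<bar> < min d1 d2"
      using x d1(1) d2(1) unfolding omega_limit_iff by (metis min_less_iff_conj)
    have "(f ^^ n) y \<in> germ x 1 d1 \<or> (f ^^ n) y \<in> germ x (-1) d2"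
      using n(2) funpow_in[OF y, of n] unfolding germ_def by auto
    then show False using d1(2) d2(2) N0 n(1) by auto
  qed
  then show thesis
  proof
    assume "P 1" then show thesis by (intro that[of 1]) (auto simp: P_def)
  next
    assume "P (-1)" then show thesis by (intro that[of "-1"]) (auto simp: P_def)
  qed
qed

text \<open>Only finitely many points of the orbit are endpoints of its intervals, and all the
  others are interior.\<close>

lemma finite_complement_interior:
  assumes "weakly_periodic k D" "infinite X" "X \<subseteq> orb f D"
  obtains z e where "z \<in> X" "e > 0" "ball z e \<subseteq> orb f D"
proof -
  have "\<forall>i. \<exists>F. finite F \<and> (\<forall>z \<in> (f ^^ i) ` D - F. \<exists>e>0. ball z e \<subseteq> (f ^^ i) ` D)"
  proof
    fix i
    obtain a b where ab: "(f ^^ i) ` D = {a..b}"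
      by (rule cinterval_Icc[OF cinterval_image[OF weakly_periodicD(2)[OF assms(1)]], of i])
    have *: "\<exists>e>0. ball z e \<subseteq> {a..b}" if "z \<in> {a..b} - {a, b}" for z
      using that by (intro exI[of _ "min (z - a) (b - z)"]) (auto simp: dist_real_def)
    show "\<exists>F. finite F \<and> (\<forall>z \<in> (f ^^ i) ` D - F. \<exists>e>0. ball z e \<subseteq> (f ^^ i) ` D)" unfolding ab
    proof (intro exI[of _ "{a, b}"] conjI ballI)
      show "finite {a, b}" by simp
    qed (rule *)
  qed
  from choice[OF this] obtain F where FF: "\<forall>i. finite (F i) \<and> (\<forall>z \<in> (f ^^ i) ` D - F i. \<exists>e>0. ball z e \<subseteq> (f ^^ i) ` D)" ..
  have F: "finite (F i)" "z \<in> (f ^^ i) ` D - F i \<Longrightarrow> \<exists>e>0. ball z e \<subseteq> (f ^^ i) ` D" for i z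
    using spec[OF FF, of i] by simp_all
  have "finite (\<Union>i<k. F i)" using F(1) by simp
  then have "\<not> X \<subseteq> (\<Union>i<k. F i)" using assms(2) by (metis finite_subset)
  then obtain z where z: "z \<in> X" "z \<notin> (\<Union>i<k. F i)" by blast
  then obtain i where i: "i < k" "z \<in> (f ^^ i) ` D" using assms(3) unfolding wp_orb[OF assms(1)] by blast
  then have "z \<in> (f ^^ i) ` D - F i" using z(2) by simp
  from F(2)[OF this] obtain e where e: "e > 0" "ball z e \<subseteq> (f ^^ i) ` D" by (elim exE conjE)
  show thesis by (rule that[OF z(1) e(1) order_trans[OF e(2) image_subset_orb]])
qed

section \<open>Limit sets and the closure of the periodic points\<close>

lemma wp_subset:
  assumes "weakly_periodic k D" "cinterval E" "E \<subseteq> D" "(f ^^ k) ` E \<subseteq> E"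
  shows "weakly_periodic k E"
proof -
  have "(f ^^ i) ` E \<subseteq> (f ^^ i) ` D" for i using assms(3) by (rule image_mono)
  then have "disjoint_family_on (\<lambda>i. (f ^^ i) ` E) {..<k}"
    using weakly_periodicD(4)[OF assms(1)] unfolding disjoint_family_on_def by (metis Int_mono subset_empty)
  then show ?thesis using assms weakly_periodicD(1)[OF assms(1)] by (simp add: weakly_periodic_def)
qed

lemma wp_image:
  assumes "weakly_periodic k D" shows "weakly_periodic k ((f ^^ (k * j)) ` D)"
proof (rule wp_subset[OF assms cinterval_image[OF weakly_periodicD(2)[OF assms]] wp_power[OF assms]])
  have "(f ^^ k) ` (f ^^ (k * j)) ` D = (f ^^ (k * Suc j)) ` D" by (simp add: funpow_image_add)
  then show "(f ^^ k) ` (f ^^ (k * j)) ` D \<subseteq> (f ^^ (k * j)) ` D" using wp_power_decr[OF assms, of j "Suc j"] by simp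
qed

lemma closure_orb_wp:
  assumes "weakly_periodic k D" "A \<subseteq> orb f D" shows "closure (orb f A) \<subseteq> orb f D"
  using closure_orb_mono[OF assms(2)] wp_closure_orb[OF assms(1)] by simp

lemma orb_tail:
  assumes "weakly_periodic k D" "(f ^^ m) y \<in> D" "n \<ge> m + k * j"
  shows "(f ^^ n) y \<in> orb f ((f ^^ (k * j)) ` D)"
proof -
  have "n = (n - (m + k * j)) + (k * j + m)" using assms(3) by simp
  then have "(f ^^ n) y = (f ^^ (n - (m + k * j))) ((f ^^ (k * j)) ((f ^^ m) y))"
    by (metis funpow_add_app)
  moreover have "(f ^^ (k * j)) ((f ^^ m) y) \<in> (f ^^ (k * j)) ` D" using assms(2) by (rule imageI)
  ultimately show ?thesis using image_subset_orb[of "n - (m + k * j)" "(f ^^ (k * j)) ` D"] by auto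
qed

text \<open>Here \<open>x\<close> may be periodic, so its preimages do not show that the basic set
  is infinite; instead the whole limit set is placed in \<open>B_set f H\<close>. The orbit of
  \<open>y\<close> really enters \<open>orb f H\<close>, because an infinite limit set contains
  interior points of it. From then on every germ at which the orbit accumulates can be compared with
  the dense germ at \<open>x\<close>.\<close>

lemma infinite_omega_limit:
  assumes y: "y \<in> {0..1}" and inf: "infinite (omega_limit f y)" and x: "x \<in> omega_limit f y"
  shows "in_solenoid x \<or> in_basic x"
proof (cases "in_solenoid x")
  case nsol: False
  have ret: "\<exists>n\<ge>N. \<exists>y' \<in> germ z s d. (f ^^ n) y' \<in> germ z s d"
    if io: "\<And>d N. d > 0 \<Longrightarrow> \<exists>n\<ge>N. (f ^^ n) y \<in> germ z s d \<and> (f ^^ n) y \<noteq> z" "d > 0" for z s d N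
  proof -
    obtain m where m: "(f ^^ m) y \<in> germ z s d" using io by blast
    obtain m' where m': "m' \<ge> m + N" "(f ^^ m') y \<in> germ z s d" using io by blast
    then have "(f ^^ (m' - m)) ((f ^^ m) y) \<in> germ z s d" unfolding funpow_add_app[symmetric] by simp
    then show ?thesis using m m'(1) by (intro exI[of _ "m' - m"] conjI bexI[of _ "(f ^^ m) y"]) auto
  qed
  have om01: "omega_limit f y \<subseteq> {0..1}" by (rule omega_limit_in[OF y])
  obtain s where s: "\<bar>s\<bar> = 1" "\<And>d N. d > 0 \<Longrightarrow> \<exists>n\<ge>N. (f ^^ n) y \<in> germ x s d \<and> (f ^^ n) y \<noteq> x"
    by (rule omega_limit_side[OF y inf x]) blast
  have x01: "x \<in> {0..1}" using om01 x by blast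
  obtain k D d where d: "\<And>j::nat. d j > 0" "d \<longlonglongrightarrow> 0" and wp: "\<And>j. weakly_periodic k (D j)" and dec: "decseq D"
    and gD: "\<And>j. germ x s (d j) \<subseteq> D j" "\<And>j. closure (orb f (germ x s (d j))) = orb f (D j)"
    and xE: "\<And>j. x \<in> (f ^^ (k * j)) ` D j"
    using germ_tower[OF x01 s(1) ret[OF s(2)]] nsol by blast
  define H where "H = (\<Inter>j. (f ^^ (k * j)) ` D j)"
  have H: "cinterval H" "(f ^^ k) ` H = H" "\<And>j. H \<subseteq> D j" unfolding H_def using const_tower(4-6)[of k D, OF wp dec] by auto
  have xH: "x \<in> H" unfolding H_def using xE by blast
  have omH: "omega_limit f y \<subseteq> orb f H"
  proof
    fix z assume z: "z \<in> omega_limit f y"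
    show "z \<in> orb f H" unfolding H_def
    proof (rule const_tower(7)[of k D, OF wp dec])
      fix j
      let ?E = "(f ^^ (k * j)) ` D j"
      have wE: "weakly_periodic k ?E" by (rule wp_image[OF wp])
      obtain m where "(f ^^ m) y \<in> D j" using s(2)[OF d(1)[of j], of 0] gD(1)[of j] by blast
      then have "omega_limit f y \<subseteq> orb f ?E"
        using orb_tail[OF wp] by (intro omega_limit_subset[of _ "m + k * j"] compact_imp_closed wp_compact_orb[OF wE])
      then show "z \<in> (\<Union>i<k. (f ^^ i) ` ?E)" using z wp_orb[OF wE] by blast
    qed
  qed
  have wH: "weakly_periodic k H" using wp_subset[OF wp H(1,3)] H(2) by simp
  have "\<exists>t\<in>H. t \<noteq> x"
  proof (rule ccontr)
    assume "\<not> (\<exists>t\<in>H. t \<noteq> x)"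
    \<comment> \<open>A one-point core has a finite orbit, too small to contain the limit
      set.\<close>
    then have "H \<subseteq> {x}" by blast
    then have "finite H" by (rule finite_subset) simp
    then have "finite (orb f H)" unfolding wp_orb[OF wH] by simp
    then show False using omH inf finite_subset by blast
  qed
  then have per: "periodic_interval f k H" using periodic_intervalI[OF wH H(1,2) order_refl xH] by blast
  obtain n0 where n0: "(f ^^ n0) y \<in> orb f H"
  proof -
    obtain z e where z: "z \<in> omega_limit f y" "e > 0" "ball z e \<subseteq> orb f H"
      by (rule finite_complement_interior[OF wH inf omH])
    obtain n where "n \<ge> 0" "\<bar>(f ^^ n) y - z\<bar> < e" using z(1,2) unfolding omega_limit_iff by blast
    then have "(f ^^ n) y \<in> ball z e" by (simp add: dist_real_def)
    then show thesis using z(3) that by blast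
  qed
  have tail: "(f ^^ n) y \<in> A" if "n \<ge> m" "(f ^^ m) y \<in> A" "f ` A \<subseteq> A" for n m A
  proof -
    have "(f ^^ (n - m)) ((f ^^ m) y) \<in> A" using closed_image_subset[OF that(3), of "n - m"] that(2) by blast
    then show ?thesis unfolding funpow_add_app[symmetric] using that(1) by simp
  qed
  have into: "\<exists>i<k'. \<exists>t. s' * (t - z) > 0 \<and> t \<in> (f ^^ i) ` D' \<and> germ z s' (s' * (t - z)) \<subseteq> (f ^^ i) ` D'"
    if D': "weakly_periodic k' D'" "(f ^^ m) y \<in> orb f D'" and s': "\<bar>s'\<bar> = 1"
      "\<And>d N. d > 0 \<Longrightarrow> \<exists>n\<ge>N. (f ^^ n) y \<in> germ z s' d \<and> (f ^^ n) y \<noteq> z" for k' D' z s' m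
  proof (rule germ_in_orb[OF D'(1) s'(1)])
    fix e :: real assume "e > 0"
    then obtain n where n: "n \<ge> m" "(f ^^ n) y \<in> germ z s' e" "(f ^^ n) y \<noteq> z" using s'(2) by blast
    then show "\<exists>t\<in>orb f D' \<inter> germ z s' e. t \<noteq> z"
      using tail[OF n(1) D'(2) orb_image_subset] by blast
  qed blast
  have M: "orb f H \<subseteq> closure (orb f (germ x s (d j)))" for j
    unfolding gD(2) by (rule orb_mono[OF H(3)])
  have fullx: "full_germ (orb f H) x s"
  proof -
    obtain i t where "s * (t - x) > 0" "t \<in> (f ^^ i) ` H" "germ x s (s * (t - x)) \<subseteq> (f ^^ i) ` H"
      using into[OF wH n0 s] by blast
    then show ?thesis using omH x image_subset_orb[of i H]
      by (intro full_germ_of_tower[OF per s(1) _ _ _ _ d(2) M]) auto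
  qed
  have "omega_limit f y \<subseteq> B_set f H"
  proof
    fix z assume z: "z \<in> omega_limit f y"
    then obtain s' where s': "\<bar>s'\<bar> = 1" "\<And>d N. d > 0 \<Longrightarrow> \<exists>n\<ge>N. (f ^^ n) y \<in> germ z s' d \<and> (f ^^ n) y \<noteq> z"
      by (rule omega_limit_side[OF y inf]) blast
    have z01: "z \<in> {0..1}" using om01 z by blast
    have "orb f H \<subseteq> closure (orb f (germ z s' e))" if e: "e > 0" for e
    proof -
      \<comment> \<open>The germ at \<open>z\<close> generates an interval \<open>D'\<close> whose
        orbit captures the orbit of \<open>y\<close>. As the latter accumulates at \<open>x\<close>
        from the side \<open>s\<close>, the orbit of \<open>D'\<close> contains a germ at
        \<open>x\<close>, whose orbit is already dense.\<close>
      obtain n u where n: "n \<ge> 1" "u \<in> germ z s' e" "(f ^^ n) u \<in> germ z s' e" using ret[OF s'(2) e] by blast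
      then have "(f ^^ n) ` germ z s' e \<inter> germ z s' e \<noteq> {}" by blast
      from wp_exists[OF germ_cinterval[OF s'(1) z01 less_imp_le[OF e]] n(1) this]
      obtain k' D' where D': "weakly_periodic k' D'" "germ z s' e \<subseteq> D'" "closure (orb f (germ z s' e)) = orb f D'" .
      obtain m where "(f ^^ m) y \<in> germ z s' e" using s'(2)[OF e] by blast
      then have "(f ^^ m) y \<in> orb f D'" using D'(2) orb_superset by blast
      then obtain i t where i: "s * (t - x) > 0" "germ x s (s * (t - x)) \<subseteq> (f ^^ i) ` D'"
        using into[OF D'(1) _ s] by blast
      then have "orb f H \<subseteq> closure (orb f (germ x s (s * (t - x))))" using fullx unfolding full_germ_def by blast
      also have "\<dots> \<subseteq> orb f D'" using i(2) image_subset_orb by (intro closure_orb_wp[OF D'(1)]) (rule order_trans)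
      finally show ?thesis unfolding D'(3) .
    qed
    moreover obtain i t where t: "s' * (t - z) > 0" "t \<in> (f ^^ i) ` H" "germ z s' (s' * (t - z)) \<subseteq> (f ^^ i) ` H"
      using into[OF wH n0 s'] by blast
    moreover have "germ z s' (s' * (t - z)) \<subseteq> orb f H" "t \<in> orb f H" using t(2,3) image_subset_orb[of i H] by auto
    ultimately have "full_germ (orb f H) z s'" unfolding full_germ_def using s'(1) z omH by blast
    then show "z \<in> B_set f H" by (rule full_germ_B[OF per])
  qed
  then have "in_basic x" unfolding in_basic_def using per inf x finite_subset by blast
  then show ?thesis ..
qed blast

section \<open>Finite limit sets and periodic points\<close>

lemma omega_limit_meets:
  assumes C: "compact C" and inf: "\<And>N. \<exists>n\<ge>N. (f ^^ n) y \<in> C"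
  shows "C \<inter> omega_limit f y \<noteq> {}"
proof -
  have "infinite {n. (f ^^ n) y \<in> C}" using inf by (simp add: infinite_nat_iff_unbounded_le)
  from infinite_enumerate[OF this] obtain r :: "nat \<Rightarrow> nat" where r: "strict_mono r" "\<And>n. (f ^^ r n) y \<in> C" by auto
  obtain l q where l: "l \<in> C" "strict_mono q" "((\<lambda>n. (f ^^ r n) y) \<circ> q) \<longlonglongrightarrow> l"
    using C[unfolded compact_def, rule_format, of "\<lambda>n. (f ^^ r n) y"] r(2) by blast
  have "strict_mono (r \<circ> q)" "(\<lambda>n. (f ^^ (r \<circ> q) n) y) \<longlonglongrightarrow> l"
    using r(1) l(2,3) strict_mono_o by (auto simp: comp_def)
  then have "l \<in> omega_limit f y" unfolding omega_limit_def by blast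
  then show ?thesis using l(1) by blast
qed

text \<open>Let \<open>c\<close> separate the points of the limit set. An orbit that stays within
  \<open>b \<le> c / 2\<close> of this set has no choice: once near \<open>x\<close> it follows the
  orbit of \<open>x\<close> for ever, and when it comes near \<open>x\<close> again,
  \<open>x\<close> turns out to be periodic.\<close>

lemma finite_omega_limit:
  assumes y: "y \<in> {0..1}" and fin: "finite (omega_limit f y)" and x: "x \<in> omega_limit f y"
  shows "x \<in> Per f" "omega_limit f y = orb f {x}"
proof -
  let ?F = "omega_limit f y"
  have F01: "?F \<subseteq> {0..1}" by (rule omega_limit_in[OF y])
  obtain c where c: "c > 0" "\<And>u v. u \<in> ?F \<Longrightarrow> v \<in> ?F \<Longrightarrow> \<bar>u - v\<bar> < c \<Longrightarrow> u = v"
  proof -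
    define P where "P = (\<lambda>(u, v). \<bar>u - v\<bar>) ` {p \<in> ?F \<times> ?F. fst p \<noteq> snd p}"
    have "finite P" unfolding P_def using fin by simp
    then have "Min (insert 1 P) > 0" unfolding P_def by (subst Min_gr_iff) auto
    moreover have "\<bar>u - v\<bar> \<ge> Min (insert 1 P)" if "u \<in> ?F" "v \<in> ?F" "u \<noteq> v" for u v
      using that \<open>finite P\<close> by (intro Min_le) (auto simp: P_def image_iff)
    ultimately show thesis by (intro that[of "Min (insert 1 P)"]) (auto simp: not_less[symmetric])
  qed
  have "\<forall>u\<in>?F. \<exists>e>0. \<forall>v\<in>{0..1}. \<bar>v - u\<bar> \<le> e \<longrightarrow> \<bar>(f ^^ 1) v - (f ^^ 1) u\<bar> < c / 2"
    using funpow_near[OF subsetD[OF F01] half_gt_zero[OF c(1)]] by blast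
  from bchoice[OF this] obtain e where ee: "\<forall>u\<in>?F. e u > 0 \<and> (\<forall>v\<in>{0..1}. \<bar>v - u\<bar> \<le> e u \<longrightarrow> \<bar>(f ^^ 1) v - (f ^^ 1) u\<bar> < c / 2)" ..
  have e: "e u > 0" "v \<in> {0..1} \<Longrightarrow> \<bar>v - u\<bar> \<le> e u \<Longrightarrow> \<bar>f v - f u\<bar> < c / 2" if "u \<in> ?F" for u v
    using bspec[OF ee that] by simp_all
  define b where "b = Min (insert (c / 2) (e ` ?F))"
  have finb: "finite (insert (c / 2) (e ` ?F))" using fin by simp
  have b: "b > 0" "b \<le> c / 2" "\<And>u. u \<in> ?F \<Longrightarrow> b \<le> e u"
  proof -
    show "b > 0" unfolding b_def using finb c(1) e(1) by (subst Min_gr_iff) auto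
    show "b \<le> c / 2" unfolding b_def by (rule Min_le[OF finb]) simp
    show "b \<le> e u" if "u \<in> ?F" for u unfolding b_def by (rule Min_le[OF finb]) (use that in simp)
  qed
  define C where "C = {0..1} - (\<Union>u\<in>?F. ball u b)"
  have "compact C" unfolding C_def by (intro compact_diff open_UN) auto
  have "C \<inter> ?F = {}" unfolding C_def using b(1) by auto
  then have "\<not> (\<forall>N. \<exists>n\<ge>N. (f ^^ n) y \<in> C)" using omega_limit_meets[OF \<open>compact C\<close>, of y] by blast
  then obtain N where N: "\<And>n. n \<ge> N \<Longrightarrow> (f ^^ n) y \<notin> C" by blast
  have near: "\<exists>u\<in>?F. \<bar>(f ^^ n) y - u\<bar> < b" if "n \<ge> N" for n
    using N[OF that] funpow_in[OF y, of n] unfolding C_def by (auto simp: dist_real_def abs_minus_commute)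
  obtain n where n: "n \<ge> N" "\<bar>(f ^^ n) y - x\<bar> < b" using x b(1) unfolding omega_limit_iff by blast
  have fwd: "(f ^^ i) x \<in> ?F" for i by (rule omega_limit_forward[OF y x])
  have follow: "\<bar>(f ^^ (i + n)) y - (f ^^ i) x\<bar> < b" for i
  proof (induction i)
    case (Suc i)
    let ?v = "(f ^^ (i + n)) y" and ?u = "(f ^^ i) x"
    have "\<bar>f ?v - f ?u\<bar> < c / 2"
      using e(2)[OF fwd funpow_in[OF y], of "i + n" i] Suc b(3)[OF fwd[of i]] by simp
    moreover obtain u' where u': "u' \<in> ?F" "\<bar>f ?v - u'\<bar> < b" using near[of "Suc (i + n)"] n(1) by auto
    ultimately have "\<bar>u' - f ?u\<bar> < c" using b(2) by linarith
    then have "\<bar>u' - (f ^^ Suc i) x\<bar> < c" by simp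
    then have "u' = (f ^^ Suc i) x" using c(2) u'(1) fwd by blast
    then show ?case using u'(2) by simp
  qed (use n in simp)
  obtain m where m: "m \<ge> Suc n" "\<bar>(f ^^ m) y - x\<bar> < b" using x b(1) unfolding omega_limit_iff by blast
  have "\<bar>(f ^^ (m - n)) x - x\<bar> < c" using follow[of "m - n"] m b(2) by simp
  then have p: "(f ^^ (m - n)) x = x" "m - n \<ge> 1" using c(2)[OF fwd x] m(1) by auto
  then show "x \<in> Per f" using F01 x unfolding Per_def by blast
  have "?F \<subseteq> orb f {x}"
  proof
    fix z assume z: "z \<in> ?F"
    then obtain n' where n': "n' \<ge> n" "\<bar>(f ^^ n') y - z\<bar> < b" using b(1) unfolding omega_limit_iff by blast
    have "\<bar>z - (f ^^ (n' - n)) x\<bar> < c" using follow[of "n' - n"] n' b(2) by simp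
    then have "z = (f ^^ (n' - n)) x" using c(2)[OF z fwd] by blast
    then show "z \<in> orb f {x}" unfolding orb_def by blast
  qed
  then show "?F = orb f {x}" using fwd unfolding orb_def by auto
qed

lemma Per_omega_limit:
  assumes "x \<in> Per f" shows "omega_limit f x = orb f {x}" "finite (orb f {x})" "x \<in> omega_limit f x"
proof -
  obtain n where n: "n \<ge> 1" "(f ^^ n) x = x" using assms unfolding Per_def by blast
  show *: "omega_limit f x = orb f {x}" using omega_limit_preperiodic[of n 0 x] n by simp
  show "finite (orb f {x})" using orb_periodic_point(2)[OF n(2,1)] .
  show "x \<in> omega_limit f x" unfolding * using orb_superset by blast
qed

text \<open>A cycle that lies in no infinite limit set is maximal, because a finite limit set
  containing \<open>x\<close> is the cycle of \<open>x\<close>.\<close>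

lemma Per_dichotomy:
  assumes "x \<in> Per f" shows "x \<in> genus0_union f \<or> in_solenoid x \<or> in_basic x"
proof (cases "\<exists>y\<in>{0..1}. infinite (omega_limit f y) \<and> x \<in> omega_limit f y")
  case False
  let ?Z = "orb f {x}"
  have x01: "x \<in> {0..1}" using assms by (simp add: Per_def)
  have xZ: "x \<in> ?Z" using orb_superset by blast
  have "omega_limit f y = ?Z" if "y \<in> {0..1}" "?Z \<subseteq> omega_limit f y" for y
    using False finite_omega_limit(2)[OF that(1)] that xZ by blast
  then have "?Z \<in> {Z. cycle f Z \<and> (\<exists>x\<in>{0..1}. omega_limit f x = Z) \<and>
           (\<forall>x\<in>{0..1}. Z \<subseteq> omega_limit f x \<longrightarrow> omega_limit f x = Z)}"
    using Per_omega_limit(1)[OF assms] x01 assms unfolding cycle_def by blast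
  then show ?thesis unfolding genus0_union_def using xZ by blast
qed (use infinite_omega_limit in blast)

lemma omega_set_trichotomy:
  assumes "x \<in> omega_set f" shows "x \<in> genus0_union f \<or> in_solenoid x \<or> in_basic x"
proof -
  obtain y where y: "y \<in> {0..1}" "x \<in> omega_limit f y" using assms unfolding omega_set_def by blast
  show ?thesis
    using infinite_omega_limit[OF y(1) _ y(2)] finite_omega_limit(1)[OF y(1) _ y(2)] Per_dichotomy by blast
qed

lemma accumulation_side:
  assumes "A \<subseteq> {0..1}" "\<And>d. d > 0 \<Longrightarrow> \<exists>t\<in>A. \<bar>t - x\<bar> < d \<and> t \<noteq> x"
  obtains s where "\<bar>s\<bar> = 1" "\<And>d. d > 0 \<Longrightarrow> \<exists>t \<in> A \<inter> germ x s d. t \<noteq> x"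
proof -
  define P where "P s \<longleftrightarrow> (\<forall>d>0. \<exists>t \<in> A \<inter> germ x s d. t \<noteq> x)" for s :: real
  have "P 1 \<or> P (-1)"
  proof (rule ccontr)
    assume "\<not> (P 1 \<or> P (-1))"
    then obtain d1 d2 where d1: "d1 > 0" "\<And>t. t \<in> A \<Longrightarrow> t \<in> germ x 1 d1 \<Longrightarrow> t = x"
      and d2: "d2 > 0" "\<And>t. t \<in> A \<Longrightarrow> t \<in> germ x (-1) d2 \<Longrightarrow> t = x" unfolding P_def by blast
    obtain t where t: "t \<in> A" "\<bar>t - x\<bar> < min d1 d2" "t \<noteq> x" using assms(2)[of "min d1 d2"] d1(1) d2(1) by auto
    have "t \<in> germ x 1 d1 \<or> t \<in> germ x (-1) d2" using t(1,2) assms(1) unfolding germ_def by auto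
    then show False using d1(2) d2(2) t by blast
  qed
  then show thesis
  proof
    assume "P 1" then show thesis by (intro that[of 1]) (auto simp: P_def)
  next
    assume "P (-1)" then show thesis by (intro that[of "-1"]) (auto simp: P_def)
  qed
qed

text \<open>A periodic point near \<open>x\<close> returns to itself at arbitrarily late times and
  differs from \<open>x\<close>: exactly the recurrence needed, on a side where periodic points
  accumulate.\<close>

lemma closure_Per_trichotomy:
  assumes "x \<in> closure (Per f)" shows "x \<in> genus0_union f \<or> in_solenoid x \<or> in_basic x"
proof (cases "x \<in> Per f")
  case False
  have P01: "Per f \<subseteq> {0..1}" by (auto simp: Per_def)
  then have x01: "x \<in> {0..1}" using assms closure_minimal[of "Per f" "{0..1}"] by auto
  have near: "\<exists>t\<in>Per f. \<bar>t - x\<bar> < d \<and> t \<noteq> x" if "d > 0" for d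
    using assms False that unfolding closure_approachable dist_real_def by metis
  obtain s where s: "\<bar>s\<bar> = 1" "\<And>d. d > 0 \<Longrightarrow> \<exists>t \<in> Per f \<inter> germ x s d. t \<noteq> x"
    by (rule accumulation_side[OF P01 near]) blast+
  have "\<exists>n\<ge>N. \<exists>y \<in> germ x s d. (f ^^ n) y \<in> germ x s d \<and> (f ^^ n) y \<noteq> x" if d: "d > 0" for d N
  proof -
    obtain t where t: "t \<in> Per f" "t \<in> germ x s d" "t \<noteq> x" using s(2)[OF d] by blast
    then obtain p where p: "p \<ge> 1" "(f ^^ p) t = t" unfolding Per_def by blast
    have "(f ^^ (p * N)) t = t" using funpow_mod_period[OF p(2), of "p * N"] by simp
    moreover have "p * N \<ge> N" using p(1) by simp
    ultimately show ?thesis using t by (intro exI[of _ "p * N"] conjI bexI[of _ t]) auto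
  qed
  then show ?thesis using recurrent_germ[OF x01 False s(1)] by blast
qed (use Per_dichotomy in blast)

section \<open>Monotone returns\<close>

text \<open>Without periodic points in \<open>J\<close>, the displacement
  \<open>(f ^^ N) z - z\<close> has constant sign on \<open>J\<close> for each
  \<open>N \<ge> 1\<close>, even where the image leaves \<open>J\<close>. A return in one direction
  can therefore be iterated, and two opposite returns after \<open>m\<close> and \<open>n\<close>
  steps would give opposite displacements for \<open>m * n\<close> steps.\<close>

lemma const_direction:
  assumes J: "connected J" "J \<subseteq> {0..1}" "J \<inter> Per f = {}" and s: "\<bar>s\<bar> = 1"
    and x: "x \<in> J" "(f ^^ m) x \<in> J" "m \<ge> 1" "s * ((f ^^ m) x - x) > 0"
    and y: "y \<in> J" "(f ^^ n) y \<in> J" "n \<ge> 1"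
  shows "s * ((f ^^ n) y - y) > 0"
proof (rule ccontr)
  assume neg: "\<not> s * ((f ^^ n) y - y) > 0"
  have nofix: "(f ^^ N) z \<noteq> z" if "N \<ge> 1" "z \<in> J" for N z
    using J(2,3) that unfolding Per_def by blast
  have const: "r * ((f ^^ N) w - w) > 0"
    if r: "\<bar>r\<bar> = 1" and N: "N \<ge> 1" and z: "z \<in> J" "r * ((f ^^ N) z - z) > 0" and w: "w \<in> J" for r N z w
  proof (rule ccontr)
    assume le: "\<not> r * ((f ^^ N) w - w) > 0"
    have "connected ((\<lambda>z. r * ((f ^^ N) z - z)) ` J)"
      by (intro connected_continuous_image J(1) continuous_intros cont_funpow_on[OF J(2)])
    then have "0 \<in> (\<lambda>z. r * ((f ^^ N) z - z)) ` J"
      using connectedD_interval[of "(\<lambda>z. r * ((f ^^ N) z - z)) ` J" "r * ((f ^^ N) w - w)" "r * ((f ^^ N) z - z)" 0]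
        le z w by auto
    then obtain v where v: "v \<in> J" "r * ((f ^^ N) v - v) = 0" by auto
    then have "(f ^^ N) v = v" using r by auto
    then show False using nofix[OF N v(1)] by simp
  qed
  have iter: "r * ((f ^^ (N * Suc j)) z - z) > 0"
    if r: "\<bar>r\<bar> = 1" and N: "N \<ge> 1" and z: "z \<in> J" "(f ^^ N) z \<in> J" "r * ((f ^^ N) z - z) > 0" for r N z j
  proof (induction j)
    case (Suc j)
    have "N * Suc j \<ge> 1" using N by simp
    from const[OF r this z(1) Suc z(2)]
    have "r * ((f ^^ (N * Suc j)) ((f ^^ N) z) - (f ^^ N) z) > 0" .
    moreover have "(f ^^ (N * Suc j)) ((f ^^ N) z) = (f ^^ (N * Suc (Suc j))) z"
      unfolding funpow_add_app[symmetric] by (simp add: algebra_simps)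
    ultimately have "r * ((f ^^ (N * Suc (Suc j))) z - (f ^^ N) z) + r * ((f ^^ N) z - z) > 0" using z(3) by simp
    then show ?case by (simp add: algebra_simps)
  qed (use z in simp)
  have "(f ^^ n) y \<noteq> y" by (rule nofix[OF y(3,1)])
  then have "(- s) * ((f ^^ n) y - y) > 0" using neg side_cases[OF s] by auto
  from iter[OF _ y(3,1,2) this, of "m - 1"] have 1: "(- s) * ((f ^^ (n * m)) y - y) > 0" using s x(3) by simp
  have mn: "m * n \<ge> 1" using x(3) y(3) by simp
  from iter[OF s x(3,1,2,4), of "n - 1"] have "s * ((f ^^ (m * n)) x - x) > 0" using y(3) by simp
  from const[OF s mn x(1) this y(1)] show False using 1 by (simp add: mult.commute)
qed

section \<open>Orbits of intervals that meet one of their images\<close>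

lemma connected_closure_diff:
  fixes S :: "real set" assumes "connected S" "bounded S"
  shows "closure S - S \<subseteq> {Inf S, Sup S}"
proof
  fix z assume z: "z \<in> closure S - S"
  then have ne: "S \<noteq> {}" by auto
  have near: "\<exists>y\<in>S. \<bar>y - z\<bar> < e" if "e > 0" for e
  proof -
    have "z \<in> closure S" using z by blast
    then show ?thesis using that unfolding closure_approachable dist_real_def by blast
  qed
  have "(\<forall>y\<in>S. z < y) \<or> (\<forall>y\<in>S. y < z)"
  proof (rule ccontr)
    assume "\<not> ?thesis"
    then obtain u v where "u \<in> S" "v \<in> S" "u \<le> z" "z \<le> v" by (meson not_less)
    then have "z \<in> S" using connectedD_interval[OF assms(1)] by blast
    then show False using z by blast
  qed
  then show "z \<in> {Inf S, Sup S}"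
  proof
    assume lt: "\<forall>y\<in>S. z < y"
    have "Inf S = z"
    proof (rule cInf_eq_non_empty[OF ne])
      fix y assume "\<And>x. x \<in> S \<Longrightarrow> y \<le> x"
      then show "y \<le> z" using near[of "y - z"] by (cases "y > z") force+
    qed (use lt in force)
    then show ?thesis by simp
  next
    assume lt: "\<forall>y\<in>S. y < z"
    have "Sup S = z"
    proof (rule cSup_eq_non_empty[OF ne])
      fix y assume "\<And>x. x \<in> S \<Longrightarrow> x \<le> y"
      then show "z \<le> y" using near[of "z - y"] by (cases "y < z") force+
    qed (use lt in force)
    then show ?thesis by simp
  qed
qed

text \<open>Consecutive images along multiples of \<open>m\<close> overlap, so each residue class
  forms one interval, and taking closures adds at most two points to each. Consequently, if the
  orbit of such an interval is dense, it misses only finitely many points.\<close>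

lemma orb_recurrent_decomp:
  assumes J: "connected J" "J \<subseteq> {0..1}" and m: "m \<ge> 1" "(f ^^ m) ` J \<inter> J \<noteq> {}"
  defines "O' \<equiv> \<lambda>i. \<Union>j. (f ^^ (m * j + i)) ` J"
  shows "connected (O' i)" "orb f J = (\<Union>i<m. O' i)" "finite (closure (orb f J) - orb f J)"
proof -
  have con: "connected (\<Union>j\<le>n. (f ^^ (m * j + i)) ` J)" for n i
  proof (induction n)
    case (Suc n)
    obtain u v where uv: "u \<in> J" "v \<in> J" "v = (f ^^ m) u" using m(2) by blast
    have "(f ^^ (m * n + i)) v = (f ^^ (m * Suc n + i)) u"
      unfolding uv(3) funpow_add_app[symmetric] by (simp add: algebra_simps)
    then have "(\<Union>j\<le>n. (f ^^ (m * j + i)) ` J) \<inter> (f ^^ (m * Suc n + i)) ` J \<noteq> {}"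
      using uv(1,2) by (metis (no_types, lifting) IntI UN_I atMost_iff empty_iff imageI order_refl)
    then have "connected ((\<Union>j\<le>n. (f ^^ (m * j + i)) ` J) \<union> (f ^^ (m * Suc n + i)) ` J)"
      by (rule connected_Un[OF Suc connected_image[OF J]])
    moreover have "(\<Union>j\<le>Suc n. (f ^^ (m * j + i)) ` J) = (\<Union>j\<le>n. (f ^^ (m * j + i)) ` J) \<union> (f ^^ (m * Suc n + i)) ` J"
      by (simp add: atMost_Suc Un_commute)
    ultimately show ?case by simp
  qed (use connected_image[OF J] in simp)
  show conO: "connected (O' i)" for i
  proof -
    obtain u where u: "u \<in> J" using m(2) by blast
    have "connected (\<Union>n. \<Union>j\<le>n. (f ^^ (m * j + i)) ` J)"
    proof (rule connected_Union)
      fix S assume "S \<in> range (\<lambda>n. \<Union>j\<le>n. (f ^^ (m * j + i)) ` J)"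
      then show "connected S" using con by auto
    next
      have "(f ^^ (m * 0 + i)) u \<in> (\<Union>j\<le>n. (f ^^ (m * j + i)) ` J)" for n using u by blast
      then show "\<Inter> (range (\<lambda>n. \<Union>j\<le>n. (f ^^ (m * j + i)) ` J)) \<noteq> {}" by blast
    qed
    moreover have "(\<Union>n. \<Union>j\<le>n. (f ^^ (m * j + i)) ` J) = O' i" unfolding O'_def by auto
    ultimately show ?thesis by simp
  qed
  show orb: "orb f J = (\<Union>i<m. O' i)"
  proof
    show "orb f J \<subseteq> (\<Union>i<m. O' i)"
    proof
      fix z assume "z \<in> orb f J"
      then obtain n where "z \<in> (f ^^ n) ` J" unfolding orb_def by blast
      then have "z \<in> (f ^^ (m * (n div m) + n mod m)) ` J" by simp
      then have "z \<in> O' (n mod m)" unfolding O'_def by blast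
      moreover have "n mod m < m" using m(1) by simp
      ultimately show "z \<in> (\<Union>i<m. O' i)" by blast
    qed
  qed (auto simp: O'_def orb_def)
  have "closure (orb f J) \<subseteq> (\<Union>i<m. closure (O' i))"
    unfolding orb using closure_subset by (intro closure_minimal closed_UN) auto
  then have "closure (orb f J) - orb f J \<subseteq> (\<Union>i<m. closure (O' i) - O' i)" unfolding orb by blast
  moreover have "finite (closure (O' i) - O' i)" for i
  proof -
    have "O' i \<subseteq> {0..1}" unfolding O'_def using funpow_image_in[OF J(2)] by blast
    then have "bounded (O' i)" using bounded_closed_interval bounded_subset by blast
    from connected_closure_diff[OF conO this] show ?thesis by (rule finite_subset) simp
  qed
  ultimately show "finite (closure (orb f J) - orb f J)" using finite_subset by blast
qed

text \<open>\<open>B_set\<close> depends on the orbit only, so any interval of the orbit may serve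
  as the base. This is why later lemmas may assume \<open>x \<in> I\<close>.\<close>

lemma periodic_interval_shift:
  assumes I: "periodic_interval f k I" and x: "x \<in> orb f I"
  obtains i where "periodic_interval f k ((f ^^ i) ` I)" "orb f ((f ^^ i) ` I) = orb f I"
    "B_set f ((f ^^ i) ` I) = B_set f I" "x \<in> (f ^^ i) ` I"
proof -
  note M = periodic_orb_facts[OF I]
  obtain i where i: "i < k" "x \<in> (f ^^ i) ` I" using x unfolding wp_orb[OF M(1)] by blast
  let ?C = "(f ^^ i) ` I"
  have orb: "orb f ?C = orb f I" unfolding orb_funpow_image by (rule M(6))
  have kC: "(f ^^ k) ` ?C = ?C"
    by (metis M(10) add.commute funpow_image_add)
  have cI: "cinterval I" using weakly_periodicD(2)[OF M(1)] .
  have cC: "cinterval ?C" by (rule cinterval_image[OF cI])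
  have disj: "disjoint_family_on (\<lambda>j. (f ^^ j) ` ?C) {..<k}"
    unfolding disjoint_family_on_def
  proof (intro ballI impI)
    fix a b assume ab: "a \<in> {..<k}" "b \<in> {..<k}" "a \<noteq> b"
    show "(f ^^ a) ` ?C \<inter> (f ^^ b) ` ?C = {}"
    proof (rule ccontr)
      assume "(f ^^ a) ` ?C \<inter> (f ^^ b) ` ?C \<noteq> {}"
      then obtain z where z: "z \<in> (f ^^ (a + i)) ` I" "z \<in> (f ^^ (b + i)) ` I" unfolding funpow_image_add by blast
      have "(f ^^ (k - i)) z \<in> (f ^^ (c + k)) ` I" if "z \<in> (f ^^ (c + i)) ` I" for c
      proof -
        have "(f ^^ (k - i)) z \<in> (f ^^ ((k - i) + (c + i))) ` I" unfolding funpow_image_add[of "k - i"] using that by (rule imageI)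
        then show ?thesis using i(1) by (simp add: add.commute)
      qed
      then have "(a + k) mod k = (b + k) mod k" using z by (blast intro: wp_meet[OF M(1)])
      then show False using ab by simp
    qed
  qed
  have wpC: "weakly_periodic k ?C" unfolding weakly_periodic_def using M(11) cC kC disj by simp
  obtain a b where ab: "a < b" "I = {a..b}" using I unfolding periodic_interval_def by blast
  have "\<exists>u\<in>?C. \<exists>v\<in>?C. u \<noteq> v"
  proof (rule ccontr)
    assume "\<not> ?thesis"
    then have "\<forall>u\<in>?C. u = x" using i(2) by blast
    moreover have "(f ^^ (k - i)) ` ?C = I" unfolding funpow_image_add[symmetric] using i(1) M(10) by simp
    ultimately have "\<forall>u\<in>I. u = (f ^^ (k - i)) x" by (metis imageE)
    then have "a = b" using ab by (metis atLeastAtMost_iff less_imp_le order_refl)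
    then show False using ab by simp
  qed
  then obtain u v where uv: "u \<in> ?C" "v \<in> ?C" "u \<noteq> v" by blast
  have "periodic_interval f k ?C" by (rule periodic_intervalI[OF wpC cC kC order_refl uv])
  moreover have "B_set f ?C = B_set f I" unfolding B_set_def orb ..
  ultimately show thesis using that orb i(2) by blast
qed

lemma component_nbhd:
  assumes D: "weakly_periodic k D" and x: "x \<in> D"
  obtains e where "e > 0" "ball x e \<inter> orb f D \<subseteq> D"
proof -
  define R where "R = (\<Union>i\<in>{1..<k}. (f ^^ i) ` D)"
  have "closed R" unfolding R_def
    using cintervalD(5)[OF cinterval_image[OF weakly_periodicD(2)[OF D]]] by (intro closed_UN) auto
  then have "open (- R)" by (rule open_Compl)
  moreover have "x \<notin> R"
  proof
    assume "x \<in> R"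
    then obtain i where "1 \<le> i" "i < k" "x \<in> (f ^^ i) ` D" unfolding R_def by auto
    then show False using wp_return[OF D x, of i] by (auto dest: dvd_imp_le)
  qed
  then have "x \<in> - R" by simp
  ultimately obtain e where e: "e > 0" "ball x e \<subseteq> - R" by (rule openE)
  have "orb f D \<subseteq> D \<union> R"
  proof
    fix z assume "z \<in> orb f D"
    then obtain i where "i < k" "z \<in> (f ^^ i) ` D" unfolding wp_orb[OF D] by blast
    then show "z \<in> D \<union> R" unfolding R_def by (cases "i = 0") auto
  qed
  then have "ball x e \<inter> orb f D \<subseteq> D" using e(2) by blast
  then show thesis by (rule that[OF e(1)])
qed

section \<open>Basic sets\<close>

text \<open>A positive time is obtained by dropping the zeroth image, which costs nothing because
  \<open>f\<close> maps \<open>orb f I\<close> onto itself.\<close>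

lemma B_set_meets_open:
  assumes I: "periodic_interval f k I" and x: "x \<in> B_set f I" "e > 0"
    and G: "open G" "G \<inter> orb f I \<noteq> {}"
  shows "\<exists>y \<in> ball x e \<inter> orb f I. \<exists>n\<ge>1. (f ^^ n) y \<in> G"
proof -
  let ?U = "ball x e \<inter> orb f I"
  note M = periodic_orb_facts[OF I]
  have "?U \<subseteq> {0..1}" using M(2) by blast
  have "orb f I \<subseteq> closure (orb f ?U)" using x unfolding B_set_iff[OF I] by blast
  then have "(f ^^ 1) ` orb f I \<subseteq> (f ^^ 1) ` closure (orb f ?U)" by (rule image_mono)
  then have "orb f I \<subseteq> closure (orb f ((f ^^ 1) ` ?U))"
    unfolding image_closure_orb[OF \<open>?U \<subseteq> {0..1}\<close>] M(6) .
  then have "G \<inter> closure (orb f ((f ^^ 1) ` ?U)) \<noteq> {}" using G(2) by blast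
  then have "G \<inter> orb f ((f ^^ 1) ` ?U) \<noteq> {}" using open_Int_closure_eq_empty[OF G(1)] by blast
  then obtain n u where "u \<in> ?U" "(f ^^ n) ((f ^^ 1) u) \<in> G" unfolding orb_def by blast
  then have "u \<in> ?U" "(f ^^ (n + 1)) u \<in> G" unfolding funpow_add_app by auto
  then show ?thesis by (intro bexI[of _ u] exI[of _ "n + 1"]) auto
qed

text \<open>At an interior point of the orbit, density of small neighbourhoods produces returns to
  the right and returns to the left. Without periodic points nearby this contradicts
  \<open>const_direction\<close>.\<close>

lemma B_interior_closure_Per:
  assumes I: "periodic_interval f k I" and x: "x \<in> B_set f I" and g: "g > 0" "ball x g \<subseteq> orb f I" and e: "e > 0"
  shows "\<exists>q \<in> Per f \<inter> orb f I. \<bar>q - x\<bar> < e"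
proof (rule ccontr)
  assume no: "\<not> ?thesis"
  define d where "d = min e g"
  have d: "d > 0" "d \<le> e" "d \<le> g" using e g by (auto simp: d_def)
  have J: "ball x d \<subseteq> orb f I" using g(2) d(3) subset_ball[of d g x] by blast
  have J01: "ball x d \<subseteq> {0..1}" using J periodic_orb_facts(2)[OF I] by blast
  have JP: "ball x d \<inter> Per f = {}" using no J d(2) by (force simp: dist_real_def)
  have inJ: "x + t * d \<in> ball x d" if "\<bar>t\<bar> < 1" for t using that d(1) by (auto simp: dist_real_def abs_mult)
  have move: "\<exists>y n. n \<ge> 1 \<and> y \<in> ball x d \<and> (f ^^ n) y \<in> ball x d \<and> s * ((f ^^ n) y - y) > 0" if s: "\<bar>s\<bar> = 1" for s
  proof -
    \<comment> \<open>Starting within \<open>d / 3\<close> of \<open>x\<close> and landing within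
      \<open>d / 3\<close> of the point at distance \<open>2 / 3 * d\<close> on the side
      \<open>s\<close> forces a move in the direction \<open>s\<close> that does not leave
      \<open>ball x d\<close>.\<close>
    define G where "G = ball (x + s * (2/3) * d) (d / 3)"
    have "x + s * (2/3) * d \<in> G \<inter> orb f I" unfolding G_def using d(1) inJ[of "s * (2/3)"] J s by auto
    moreover have "open G" unfolding G_def by simp
    ultimately have "\<exists>y \<in> ball x (d/3) \<inter> orb f I. \<exists>n\<ge>1. (f ^^ n) y \<in> G"
      using d(1) by (intro B_set_meets_open[OF I x]) auto
    then obtain y n where y: "y \<in> ball x (d/3)" "n \<ge> 1" "(f ^^ n) y \<in> G" by blast
    then have yb: "\<bar>x - y\<bar> < d/3" "\<bar>x + s * (2/3) * d - (f ^^ n) y\<bar> < d/3" by (auto simp: G_def dist_real_def)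
    have "\<bar>x - y\<bar> < d" using yb(1) d(1) by linarith
    moreover have "\<bar>x - (f ^^ n) y\<bar> < d \<and> s * ((f ^^ n) y - y) > 0"
      using side_cases[OF s] yb d(1) unfolding abs_less_iff by auto
    ultimately show ?thesis using y(2) by (intro exI[of _ y] exI[of _ n]) (auto simp: dist_real_def)
  qed
  obtain y n where y: "n \<ge> 1" "y \<in> ball x d" "(f ^^ n) y \<in> ball x d" "1 * ((f ^^ n) y - y) > 0" using move[of 1] by auto
  obtain y' n' where y': "n' \<ge> 1" "y' \<in> ball x d" "(f ^^ n') y' \<in> ball x d" "-1 * ((f ^^ n') y' - y') > 0" using move[of "-1"] by auto
  have "1 * ((f ^^ n') y' - y') > 0"
    by (rule const_direction[OF _ J01 JP _ y(2,3,1,4) y'(2,3,1)]) auto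
  then show False using y'(4) by simp
qed

lemma Per_funpow: "q \<in> Per f \<Longrightarrow> (f ^^ n) q \<in> Per f"
proof -
  assume "q \<in> Per f"
  then obtain p where p: "q \<in> {0..1}" "p \<ge> 1" "(f ^^ p) q = q" unfolding Per_def by blast
  then have "(f ^^ p) ((f ^^ n) q) = (f ^^ n) q" using funpow_commute[of p n q] by simp
  then show ?thesis using p funpow_in[of q n] unfolding Per_def by blast
qed

text \<open>At an endpoint of its component, a small relative neighbourhood of \<open>x\<close> in
  the orbit is itself one-sided.\<close>

lemma endpoint_full_germ:
  assumes I: "periodic_interval f k I" and x: "x \<in> B_set f I" "x \<in> I" and s: "\<bar>s\<bar> = 1"
    and t: "t \<in> I" "s * (t - x) > 0" and side: "\<And>y. y \<in> I \<Longrightarrow> s * (y - x) \<ge> 0"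
  shows "full_germ (orb f I) x s"
  unfolding full_germ_def
proof (intro conjI allI impI)
  note M = periodic_orb_facts[OF I]
  have cI: "connected I" using cintervalD(2)[OF weakly_periodicD(2)[OF M(1)]] .
  show "x \<in> orb f I" using x(2) M(7) by blast
  show "\<exists>t\<in>orb f I. 0 < s * (t - x) \<and> germ x s (s * (t - x)) \<subseteq> orb f I"
    using germ_subset_connected[OF s cI x(2) t(1)] t M(7) by blast
  fix d :: real assume d: "d > 0"
  obtain e where e: "e > 0" "ball x e \<inter> orb f I \<subseteq> I" by (rule component_nbhd[OF M(1) x(2)])
  have "ball x (min d e) \<inter> orb f I \<subseteq> germ x s d"
  proof
    fix y assume y: "y \<in> ball x (min d e) \<inter> orb f I"
    then have "y \<in> I" "\<bar>y - x\<bar> < d" using e(2) by (auto simp: dist_real_def)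
    then show "y \<in> germ x s d" using side[of y] M(8) side_cases[OF s] unfolding germ_def by auto
  qed
  then have "closure (orb f (ball x (min d e) \<inter> orb f I)) \<subseteq> closure (orb f (germ x s d))"
    by (intro closure_mono orb_mono)
  moreover have "orb f I \<subseteq> closure (orb f (ball x (min d e) \<inter> orb f I))"
    using x(1) d e(1) unfolding B_set_iff[OF I] by simp
  ultimately show "orb f I \<subseteq> closure (orb f (germ x s d))" by blast
qed (rule s)

text \<open>The argument with two directions fails at an endpoint of \<open>I\<close>. A
  non-periodic endpoint \<open>x\<close> has a full germ and hence infinitely many preimages in
  \<open>I\<close> with full germs; one of them is not an endpoint, and the periodic points near it
  are mapped to periodic points near \<open>x\<close>.\<close>

lemma B_closure_Per:
  assumes I: "periodic_interval f k I" and x: "x \<in> B_set f I" "x \<in> I" and e: "e > 0"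
  shows "\<exists>q \<in> Per f \<inter> orb f I. \<bar>q - x\<bar> < e"
proof (cases "x \<in> Per f")
  case True
  then show ?thesis using x e periodic_orb_facts(7)[OF I] by (intro bexI[of _ x]) auto
next
  case nper: False
  note M = periodic_orb_facts[OF I]
  obtain a b where ab: "a < b" "I = {a..b}" using I unfolding periodic_interval_def by blast
  have ball: "\<exists>g>0. ball w g \<subseteq> orb f I" if "w \<in> I" "w \<noteq> a" "w \<noteq> b" for w
  proof -
    have "ball w (min (w - a) (b - w)) \<subseteq> I" unfolding ab(2) by (auto simp: dist_real_def)
    then show ?thesis using that M(7) unfolding ab(2) by (intro exI[of _ "min (w - a) (b - w)"]) auto
  qed
  show ?thesis
  proof (cases "x = a \<or> x = b")
    case False
    then obtain g where "g > 0" "ball x g \<subseteq> orb f I" using ball[OF x(2)] by blast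
    then show ?thesis by (rule B_interior_closure_Per[OF I x(1) _ _ e])
  next
    case True
    have "\<exists>s. full_germ (orb f I) x s"
    proof (cases "x = a")
      case True
      have "full_germ (orb f I) x 1"
        by (rule endpoint_full_germ[OF I x, of _ b]) (use True ab in auto)
      then show ?thesis ..
    next
      case False
      then have "x = b" using \<open>x = a \<or> x = b\<close> by simp
      then have "full_germ (orb f I) x (-1)"
        by (intro endpoint_full_germ[OF I x, of _ a]) (use ab in auto)
      then show ?thesis ..
    qed
    then obtain s where s: "full_germ (orb f I) x s" ..
    let ?W = "{w \<in> I. \<exists>r n. full_germ (orb f I) w r \<and> (f ^^ n) w = x}"
    have "infinite ?W" by (rule full_germ_preimages[OF I s x(2) nper])
    moreover have "finite {a, b}" by simp
    ultimately have "\<not> ?W \<subseteq> {a, b}" by (metis (no_types, lifting) finite_subset)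
    then obtain w r n where w: "w \<in> I" "w \<noteq> a" "w \<noteq> b" "full_germ (orb f I) w r" "(f ^^ n) w = x" by blast
    obtain d where d: "d > 0" "\<forall>y\<in>{0..1}. \<bar>y - w\<bar> \<le> d \<longrightarrow> \<bar>(f ^^ n) y - (f ^^ n) w\<bar> < e"
      using funpow_near[of w e n] M(8) w(1) e by blast
    obtain g where "g > 0" "ball w g \<subseteq> orb f I" using ball[OF w(1-3)] by blast
    from B_interior_closure_Per[OF I full_germ_B[OF I w(4)] this d(1)]
    obtain q where q: "q \<in> Per f" "q \<in> orb f I" "\<bar>q - w\<bar> < d" by blast
    have "q \<in> {0..1}" using q(2) M(2) by blast
    then have "\<bar>(f ^^ n) q - x\<bar> < e" using d(2) q(3) w(5) by auto
    then show ?thesis using Per_funpow[OF q(1), of n] orb_iter[OF q(2), of n] by blast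
  qed
qed

lemma B_subset_closure_Per:
  assumes I: "periodic_interval f k I" shows "B_set f I \<subseteq> closure (Per f)"
proof
  fix x assume x: "x \<in> B_set f I"
  then have "x \<in> orb f I" using B_set_subset by blast
  then obtain i where i: "periodic_interval f k ((f ^^ i) ` I)" "B_set f ((f ^^ i) ` I) = B_set f I" "x \<in> (f ^^ i) ` I"
    by (rule periodic_interval_shift[OF I])
  show "x \<in> closure (Per f)" unfolding closure_approachable dist_real_def
    using B_closure_Per[OF i(1) _ i(3)] x i(2) by blast
qed

lemma infinite_one_side:
  fixes q :: real assumes "infinite X"
  obtains s where "\<bar>s\<bar> = 1" "infinite {b \<in> X. s * (b - q) \<ge> 0}"
proof -
  have "X \<subseteq> {b \<in> X. 1 * (b - q) \<ge> 0} \<union> {b \<in> X. (-1) * (b - q) \<ge> 0}" by auto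
  then have "\<not> finite ({b \<in> X. 1 * (b - q) \<ge> 0} \<union> {b \<in> X. (-1) * (b - q) \<ge> 0})"
    using assms by (rule infinite_super)
  then have "infinite {b \<in> X. 1 * (b - q) \<ge> 0} \<or> infinite {b \<in> X. (-1) * (b - q) \<ge> 0}"
    unfolding finite_Un by blast
  then show thesis
  proof
    assume "infinite {b \<in> X. 1 * (b - q) \<ge> 0}" then show thesis by (intro that[of 1]) simp_all
  next
    assume "infinite {b \<in> X. (-1) * (b - q) \<ge> 0}" then show thesis by (intro that[of "-1"]) simp_all
  qed
qed

text \<open>A neighbourhood of a point of \<open>B_set f I\<close> contains a periodic point \<open>q\<close>, so that its images
  under multiples of the period of \<open>q\<close> all contain \<open>q\<close>; this is why one single image
  catches several points of \<open>X\<close>.\<close>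

lemma B_cover:
  assumes I: "periodic_interval f k I" and x: "x \<in> B_set f I" "x \<in> I" and e: "e > 0"
    and X: "X \<subseteq> orb f I" "infinite X"
  shows "\<exists>n\<ge>1. \<exists>F\<subseteq>X. finite F \<and> card F = K \<and> F \<subseteq> (f ^^ n) ` (ball x e \<inter> I)"
proof (cases "K = 0")
  case True
  then show ?thesis by (intro exI[of _ 1] exI[of _ "{}"]) auto
next
  case K: False
  note M = periodic_orb_facts[OF I]
  obtain e1 where e1: "e1 > 0" "ball x e1 \<inter> orb f I \<subseteq> I" by (rule component_nbhd[OF M(1) x(2)])
  define d where "d = min e e1"
  have d: "d > 0" "d \<le> e" "ball x d \<inter> orb f I = ball x d \<inter> I" using e e1 M(7) by (auto simp: d_def)
  define U where "U = ball x d \<inter> I"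
  obtain a b where "I = {a..b}" using I unfolding periodic_interval_def by blast
  then have cU: "connected U" unfolding U_def
    by (intro convex_connected convex_Int) auto
  have U01: "U \<subseteq> {0..1}" unfolding U_def using M(8) by blast
  obtain q where q: "q \<in> Per f" "q \<in> orb f I" "\<bar>q - x\<bar> < d" using B_closure_Per[OF I x d(1)] by blast
  then have "q \<in> ball x d \<inter> orb f I" by (simp add: dist_real_def abs_minus_commute)
  then have qU: "q \<in> U" unfolding U_def d(3) .
  obtain m where m: "m \<ge> 1" "(f ^^ m) q = q" using q(1) unfolding Per_def by blast
  \<comment> \<open>\<open>V\<close> still contains \<open>q\<close>; using it in place of
    \<open>U\<close> makes the final time at least \<open>m \<ge> 1\<close>.\<close>
  define V where "V = (f ^^ m) ` U"
  have qV: "q \<in> V" unfolding V_def using qU m(2) by (metis imageI)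
  have V: "connected V" "V \<subseteq> {0..1}" unfolding V_def using connected_image[OF cU U01] funpow_image_in[OF U01] by auto
  have "(f ^^ m) q \<in> (f ^^ m) ` V" using qV by (rule imageI)
  then have ne: "(f ^^ m) ` V \<inter> V \<noteq> {}" using m(2) qV by auto
  note dec = orb_recurrent_decomp[OF V m(1) ne]
  have "orb f I \<subseteq> closure (orb f (ball x d \<inter> orb f I))" using x(1) d(1) B_set_iff[OF I, of x] by simp
  then have "orb f I \<subseteq> closure (orb f U)" unfolding U_def d(3) .
  then have "(f ^^ m) ` orb f I \<subseteq> (f ^^ m) ` closure (orb f U)" by (rule image_mono)
  then have dense: "orb f I \<subseteq> closure (orb f V)" unfolding V_def image_closure_orb[OF U01] M(6) .
  have "X - orb f V \<subseteq> closure (orb f V) - orb f V" using X(1) dense by blast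
  then have "finite (X - orb f V)" using dec(3) by (rule finite_subset)
  have "X \<subseteq> (X - orb f V) \<union> (X \<inter> orb f V)" by blast
  then have "\<not> finite ((X - orb f V) \<union> (X \<inter> orb f V))" using X(2) by (rule infinite_super)
  then have "infinite (X \<inter> orb f V)" using \<open>finite (X - orb f V)\<close> unfolding finite_Un by blast
  moreover have "X \<inter> orb f V = (\<Union>i<m. X \<inter> (\<Union>j. (f ^^ (m * j + i)) ` V))" unfolding dec(2) by blast
  ultimately have inf: "infinite (\<Union>i<m. X \<inter> (\<Union>j. (f ^^ (m * j + i)) ` V))" by metis
  \<comment> \<open>Pigeonhole over the residues modulo \<open>m\<close>, and below over the two
    sides of \<open>q'\<close>.\<close>
  have "\<exists>i. infinite (X \<inter> (\<Union>j. (f ^^ (m * j + i)) ` V))"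
  proof (rule ccontr)
    assume "\<nexists>i. infinite (X \<inter> (\<Union>j. (f ^^ (m * j + i)) ` V))"
    then have fin: "finite (X \<inter> (\<Union>j. (f ^^ (m * j + i)) ` V))" for i by blast
    have "finite (\<Union>i<m. X \<inter> (\<Union>j. (f ^^ (m * j + i)) ` V))" by (rule finite_UN_I[OF finite_lessThan fin])
    then show False using inf by simp
  qed
  then obtain i where i: "infinite (X \<inter> (\<Union>j. (f ^^ (m * j + i)) ` V))" ..
  define q' where "q' = (f ^^ i) q"
  have q': "q' \<in> (f ^^ (m * j + i)) ` V" for j
  proof -
    have "(f ^^ (m * j + i)) q = q'"
      using funpow_mod_period[OF m(2), of "m * j + i"] funpow_mod_period[OF m(2), of i] by (simp add: q'_def)
    then show ?thesis using qV by (metis imageI)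
  qed
  obtain s where s: "\<bar>s\<bar> = 1" "infinite {b \<in> X \<inter> (\<Union>j. (f ^^ (m * j + i)) ` V). s * (b - q') \<ge> 0}"
    by (rule infinite_one_side[OF i])
  obtain F where F: "finite F" "card F = K" "F \<subseteq> {b \<in> X \<inter> (\<Union>j. (f ^^ (m * j + i)) ` V). s * (b - q') \<ge> 0}"
    using infinite_arbitrarily_large[OF s(2), of K] by auto
  have "F \<noteq> {}" using F(2) K by auto
  then have "Max ((\<lambda>b. s * (b - q')) ` F) \<in> (\<lambda>b. s * (b - q')) ` F" using F(1) by (intro Max_in) auto
  \<comment> \<open>The point of \<open>F\<close> farthest from \<open>q'\<close>: an image
    containing both is an interval and so contains the rest of \<open>F\<close>.\<close>
  then obtain b where b: "b \<in> F" "Max ((\<lambda>b. s * (b - q')) ` F) = s * (b - q')" by blast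
  have bmax: "s * (c - q') \<le> s * (b - q')" if "c \<in> F" for c
    unfolding b(2)[symmetric] using F(1) that by (intro Max_ge) auto
  obtain j where j: "b \<in> (f ^^ (m * j + i)) ` V" using b(1) F(3) by blast
  have "germ q' s (s * (b - q')) \<subseteq> (f ^^ (m * j + i)) ` V"
    by (rule germ_subset_connected[OF s(1) connected_image[OF V] q' j])
  moreover have "F \<subseteq> germ q' s (s * (b - q'))"
  proof
    fix c assume c: "c \<in> F"
    then have "c \<in> {0..1}" using F(3) X(1) M(2) by blast
    then show "c \<in> germ q' s (s * (b - q'))" using bmax[OF c] c F(3) unfolding germ_def by blast
  qed
  ultimately have "F \<subseteq> (f ^^ (m * j + i)) ` V" by blast
  also have "\<dots> = (f ^^ (m * j + i + m)) ` U" unfolding V_def funpow_image_add ..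
  also have "\<dots> \<subseteq> (f ^^ (m * j + i + m)) ` (ball x e \<inter> I)"
    unfolding U_def using d(2) by (intro image_mono) auto
  finally show ?thesis using F m(1) by (intro exI[of _ "m * j + i + m"] conjI exI[of _ F]) auto
qed

text \<open>A point of \<open>B_set f I\<close> in the interior of an image of \<open>G\<close>
  would have a neighbourhood with dense orbit inside that image; only the endpoints of the image are
  left.\<close>

lemma non_dense_image:
  assumes I: "periodic_interval f k I" and G: "cinterval G" "\<not> orb f I \<subseteq> closure (orb f G)"
  shows "\<exists>a b. B_set f I \<inter> (f ^^ n) ` G \<subseteq> {a, b}"
proof -
  obtain a b where ab: "(f ^^ n) ` G = {a..b}"
    by (rule cinterval_Icc[OF cinterval_image[OF G(1)], of n])
  have "B_set f I \<inter> (f ^^ n) ` G \<subseteq> {a, b}"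
  proof
    fix z assume z: "z \<in> B_set f I \<inter> (f ^^ n) ` G"
    show "z \<in> {a, b}"
    proof (rule ccontr)
      assume "z \<notin> {a, b}"
      then have pos: "min (z - a) (b - z) > 0" using z ab by auto
      have "ball z (min (z - a) (b - z)) \<inter> orb f I \<subseteq> (f ^^ n) ` G" unfolding ab by (auto simp: dist_real_def)
      also have "\<dots> \<subseteq> orb f G" by (rule image_subset_orb)
      finally have "closure (orb f (ball z (min (z - a) (b - z)) \<inter> orb f I)) \<subseteq> closure (orb f G)"
        by (rule closure_orb_mono)
      moreover have "orb f I \<subseteq> closure (orb f (ball z (min (z - a) (b - z)) \<inter> orb f I))"
        using z pos B_set_iff[OF I, of z] by blast
      ultimately show False using G(2) by blast
    qed
  qed
  then show ?thesis by blast
qed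

text \<open>If no side is full, each side of \<open>x\<close> within \<open>I\<close> is empty or
  has a germ whose orbit is not dense, so that its images contain at most two points of
  \<open>B_set f I\<close>. A neighbourhood of \<open>x\<close> then never covers many points of
  this set at one time, against \<open>B_cover\<close>.\<close>

lemma B_full_germ:
  assumes I: "periodic_interval f k I" and inf: "infinite (B_set f I)" and x: "x \<in> B_set f I" "x \<in> I"
  shows "\<exists>s. full_germ (orb f I) x s"
proof (rule ccontr)
  assume no: "\<not> ?thesis"
  note M = periodic_orb_facts[OF I]
  have cI: "cinterval I" by (rule weakly_periodicD(2)[OF M(1)])
  have x01: "x \<in> {0..1}" using x(2) M(8) by blast
  have side: "\<exists>d>0. \<forall>n. \<exists>a b. B_set f I \<inter> (f ^^ n) ` ((germ x s d \<inter> I) - {x}) \<subseteq> {a, b}" if s: "\<bar>s\<bar> = 1" for s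
  proof (cases "\<exists>t\<in>I. s * (t - x) > 0")
    case True
    then obtain t where t: "t \<in> I" "s * (t - x) > 0" by blast
    then have "germ x s (s * (t - x)) \<subseteq> orb f I"
      using germ_subset_connected[OF s cintervalD(2)[OF cI] x(2) t(1)] M(7) by blast
    then obtain d where d: "d > 0" "\<not> orb f I \<subseteq> closure (orb f (germ x s d))"
      using no s t x(2) M(7) unfolding full_germ_def by blast
    have gi: "cinterval (germ x s d)" by (rule germ_cinterval[OF s x01]) (use d in simp)
    have "\<exists>a b. B_set f I \<inter> (f ^^ n) ` ((germ x s d \<inter> I) - {x}) \<subseteq> {a, b}" for n
    proof -
      obtain a b where ab: "B_set f I \<inter> (f ^^ n) ` germ x s d \<subseteq> {a, b}" using non_dense_image[OF I gi d(2)] by blast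
      have "B_set f I \<inter> (f ^^ n) ` ((germ x s d \<inter> I) - {x}) \<subseteq> B_set f I \<inter> (f ^^ n) ` germ x s d"
        by (intro Int_mono image_mono) auto
      then show ?thesis using ab by (intro exI[of _ a] exI[of _ b]) (rule order_trans)
    qed
    then show ?thesis using d(1) by blast
  next
    case False
    have "germ x s 1 \<inter> I - {x} = {}"
    proof (rule ccontr)
      assume "germ x s 1 \<inter> I - {x} \<noteq> {}"
      then obtain t where "t \<in> germ x s 1" "t \<in> I" "t \<noteq> x" by blast
      then show False using germ_pos[OF s] False by blast
    qed
    then have "B_set f I \<inter> (f ^^ n) ` (germ x s 1 \<inter> I - {x}) \<subseteq> {x, x}" for n by (simp only: image_empty Int_empty_right empty_subsetI)
    then show ?thesis by (intro exI[of _ 1] conjI allI exI[of _ x]) simp_all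
  qed
  obtain d1 where d1: "d1 > 0" "\<forall>n. \<exists>a b. B_set f I \<inter> (f ^^ n) ` ((germ x 1 d1 \<inter> I) - {x}) \<subseteq> {a, b}"
    using side[of 1] by auto
  obtain d2 where d2: "d2 > 0" "\<forall>n. \<exists>a b. B_set f I \<inter> (f ^^ n) ` ((germ x (-1) d2 \<inter> I) - {x}) \<subseteq> {a, b}"
    using side[of "-1"] by auto
  have "min d1 d2 > 0" using d1(1) d2(1) by simp
  \<comment> \<open>Six exceeds the bound \<open>1 + 2 + 2\<close>: the image of \<open>x\<close>
    and two endpoints for each side.\<close>
  from B_cover[OF I x this B_set_subset inf, of 6]
  obtain n F where F: "F \<subseteq> B_set f I" "finite F" "card F = 6" "F \<subseteq> (f ^^ n) ` (ball x (min d1 d2) \<inter> I)" by blast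
  obtain a1 b1 where 1: "B_set f I \<inter> (f ^^ n) ` ((germ x 1 d1 \<inter> I) - {x}) \<subseteq> {a1, b1}" using d1(2) by blast
  obtain a2 b2 where 2: "B_set f I \<inter> (f ^^ n) ` ((germ x (-1) d2 \<inter> I) - {x}) \<subseteq> {a2, b2}" using d2(2) by blast
  have "ball x (min d1 d2) \<inter> I \<subseteq> {x} \<union> ((germ x 1 d1 \<inter> I) - {x}) \<union> ((germ x (-1) d2 \<inter> I) - {x})"
    using M(8) unfolding germ_def by (auto simp: dist_real_def)
  then have "(f ^^ n) ` (ball x (min d1 d2) \<inter> I) \<subseteq> {(f ^^ n) x} \<union> (f ^^ n) ` ((germ x 1 d1 \<inter> I) - {x}) \<union> (f ^^ n) ` ((germ x (-1) d2 \<inter> I) - {x})"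
    by blast
  with F(4) have split: "F \<subseteq> {(f ^^ n) x} \<union> (f ^^ n) ` ((germ x 1 d1 \<inter> I) - {x}) \<union> (f ^^ n) ` ((germ x (-1) d2 \<inter> I) - {x})"
    by (rule order_trans)
  have "F \<subseteq> {(f ^^ n) x, a1, b1, a2, b2}"
  proof
    fix z assume "z \<in> F"
    then have "z \<in> B_set f I" "z = (f ^^ n) x \<or> z \<in> (f ^^ n) ` ((germ x 1 d1 \<inter> I) - {x}) \<or> z \<in> (f ^^ n) ` ((germ x (-1) d2 \<inter> I) - {x})"
      using F(1) split by auto
    then show "z \<in> {(f ^^ n) x, a1, b1, a2, b2}" using subsetD[OF 1, of z] subsetD[OF 2, of z] by auto
  qed
  then have "card F \<le> card {(f ^^ n) x, a1, b1, a2, b2}" by (intro card_mono) auto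
  also have "\<dots> \<le> 5" by (simp add: card_insert_if)
  finally show False using F(3) by simp
qed

lemma orb_f_B_cong: "orb f I = orb f J \<Longrightarrow> B_set f I = B_set f J"
  unfolding B_set_def by simp

section \<open>Perfectness of basic sets and orbits with prescribed limit points\<close>

lemma middle_points:
  fixes F :: "real set" assumes "finite F" "card F = K + 2"
  shows "card (F - {Min F, Max F}) \<ge> K" "b \<in> F - {Min F, Max F} \<Longrightarrow> Min F < b \<and> b < Max F" "Min F \<in> F" "Max F \<in> F"
proof -
  have "F \<noteq> {}" using assms(2) by auto
  then show "Min F \<in> F" "Max F \<in> F" using assms(1) by auto
  have "card F - card {Min F, Max F} \<le> card (F - {Min F, Max F})" by (rule diff_card_le_card_Diff) simp
  moreover have "card {Min F, Max F} \<le> 2" by (simp add: card_insert_if)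
  ultimately show "card (F - {Min F, Max F}) \<ge> K" using assms(2) by simp
  show "Min F < b \<and> b < Max F" if "b \<in> F - {Min F, Max F}"
    using that assms(1) by (metis DiffE Max_ge Min_le insertCI order_less_le)
qed

text \<open>A covered point of \<open>B_set f I\<close> has a preimage of the same kind in the
  neighbourhood by \<open>full_germ_lift\<close>, provided that its full side is covered too.
  Discarding the smallest and the largest covered point ensures this on either side.\<close>

lemma B_perfect:
  assumes I: "periodic_interval f k I" and inf: "infinite (B_set f I)" and x: "x \<in> B_set f I" "x \<in> I" and e: "e > 0"
  shows "infinite (B_set f I \<inter> (ball x e \<inter> I))"
proof
  assume fin: "finite (B_set f I \<inter> (ball x e \<inter> I))"
  let ?U = "ball x e \<inter> I"
  \<comment> \<open>One more than the supposed number of points; the additional \<open>2\<close>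
    below pays for the two extreme points.\<close>
  define K where "K = card (B_set f I \<inter> ?U) + 1"
  obtain n F where F: "F \<subseteq> B_set f I" "finite F" "card F = K + 2" "F \<subseteq> (f ^^ n) ` ?U"
    using B_cover[OF I x e B_set_subset inf, of "K + 2"] by blast
  note mid = middle_points[OF F(2,3)]
  obtain a b where "I = {a..b}" using I unfolding periodic_interval_def by blast
  then have cU: "connected ?U" by (intro convex_connected convex_Int) auto
  have UM: "?U \<subseteq> orb f I" using periodic_orb_facts(7)[OF I] by blast
  have "F - {Min F, Max F} \<subseteq> (f ^^ n) ` (B_set f I \<inter> ?U)"
  proof
    fix b assume b: "b \<in> F - {Min F, Max F}"
    then have bB: "b \<in> B_set f I" using F(1) by blast
    then obtain i where i: "periodic_interval f k ((f ^^ i) ` I)" "orb f ((f ^^ i) ` I) = orb f I"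
      "B_set f ((f ^^ i) ` I) = B_set f I" "b \<in> (f ^^ i) ` I"
      using periodic_interval_shift[OF I subsetD[OF B_set_subset]] by metis
    obtain s where s: "full_germ (orb f I) b s" using B_full_germ[OF i(1) _ _ i(4)] inf bB i(2,3) by auto
    then have s1: "\<bar>s\<bar> = 1" by (simp add: full_germ_def)
    obtain u where u: "u \<in> ?U" "(f ^^ n) u = b" using b F(4) by blast
    have "\<exists>c\<in>F. s * (c - b) > 0" using side_cases[OF s1] mid(2)[OF b] mid(3,4) by auto
    then obtain v where v: "v \<in> ?U" "s * ((f ^^ n) v - b) > 0" using F(4) by blast
    obtain w r where w: "w \<in> ?U" "(f ^^ n) w = b" "full_germ (orb f I) w r"
      by (rule full_germ_lift[OF I s cU UM u(1) v(1), of n]) (use u(2) v(2) in auto)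
    then show "b \<in> (f ^^ n) ` (B_set f I \<inter> ?U)" using full_germ_B[OF I w(3)] by blast
  qed
  then have "card (F - {Min F, Max F}) \<le> card ((f ^^ n) ` (B_set f I \<inter> ?U))" using fin by (intro card_mono) auto
  also have "\<dots> \<le> card (B_set f I \<inter> ?U)" using fin by (rule card_image_le)
  finally show False using mid(1) unfolding K_def by simp
qed

text \<open>Perfectness supplies infinitely many targets near \<open>x'\<close>. Covering three of
  them covers a neighbourhood of the middle one, which is again a point of \<open>B_set f I\<close>,
  so that the step can be repeated from there.\<close>

lemma B_cover_step:
  assumes I: "periodic_interval f k I" and inf: "infinite (B_set f I)" and x: "x \<in> B_set f I" and x': "x' \<in> B_set f I"
    and e: "e > 0" "e' > 0"
  shows "\<exists>n\<ge>1. \<exists>b \<in> B_set f I. \<exists>d>0. cball b d \<subseteq> (f ^^ n) ` (ball x e \<inter> orb f I) \<and> cball b d \<subseteq> ball x' e'"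
proof -
  obtain i where i: "periodic_interval f k ((f ^^ i) ` I)" "orb f ((f ^^ i) ` I) = orb f I"
    "B_set f ((f ^^ i) ` I) = B_set f I" "x \<in> (f ^^ i) ` I"
    using periodic_interval_shift[OF I subsetD[OF B_set_subset x]] by metis
  obtain j where j: "periodic_interval f k ((f ^^ j) ` I)" "orb f ((f ^^ j) ` I) = orb f I"
    "B_set f ((f ^^ j) ` I) = B_set f I" "x' \<in> (f ^^ j) ` I"
    using periodic_interval_shift[OF I subsetD[OF B_set_subset x']] by metis
  let ?I = "(f ^^ i) ` I" and ?X = "B_set f I \<inter> (ball x' e' \<inter> (f ^^ j) ` I)"
  have "infinite ?X" using B_perfect[OF j(1) _ _ j(4) e(2)] inf x' j(3) by simp
  moreover have "?X \<subseteq> orb f ?I" using B_set_subset i(2) by blast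
  ultimately obtain n F where F: "n \<ge> 1" "F \<subseteq> ?X" "finite F" "card F = 1 + 2" "F \<subseteq> (f ^^ n) ` (ball x e \<inter> ?I)"
    using B_cover[OF i(1) _ i(4) e(1), of ?X "1 + 2"] x i(3) by metis
  note mid = middle_points[OF F(3,4)]
  obtain b where b: "b \<in> F - {Min F, Max F}" using mid(1) by (metis card.empty ex_in_conv not_one_le_zero)
  have bb: "Min F < b" "b < Max F" "b \<in> ball x' e'" using mid(2)[OF b] b F(2) by auto
  define d where "d = min (min (b - Min F) (Max F - b)) (e' - \<bar>b - x'\<bar>) / 2"
  have d: "d > 0" unfolding d_def using bb by (auto simp: dist_real_def)
  have d': "2 * d \<le> b - Min F" "2 * d \<le> Max F - b" "2 * d \<le> e' - \<bar>b - x'\<bar>" unfolding d_def by auto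
  obtain a c where "?I = {a..c}" using i(1) unfolding periodic_interval_def by blast
  then have "connected (ball x e \<inter> ?I)" by (intro convex_connected convex_Int) auto
  moreover have "ball x e \<inter> ?I \<subseteq> {0..1}" using periodic_orb_facts(8)[OF i(1)] by blast
  ultimately have con: "connected ((f ^^ n) ` (ball x e \<inter> ?I))" by (rule connected_image)
  have "{Min F..Max F} \<subseteq> (f ^^ n) ` (ball x e \<inter> ?I)"
    using connected_contains_Icc[OF con, of "Min F" "Max F"] mid(3,4) F(5) by blast
  moreover have "cball b d \<subseteq> {Min F..Max F}" using d d' by (auto simp: dist_real_def)
  moreover have "(f ^^ n) ` (ball x e \<inter> ?I) \<subseteq> (f ^^ n) ` (ball x e \<inter> orb f I)"
    using i(2) periodic_orb_facts(7)[OF i(1)] by (intro image_mono) auto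
  ultimately have "cball b d \<subseteq> (f ^^ n) ` (ball x e \<inter> orb f I)" by blast
  moreover have "cball b d \<subseteq> ball x' e'" using d d'(3) by (auto simp: dist_real_def)
  ultimately show ?thesis using F(1,2) b d by blast
qed

text \<open>The points that follow the first \<open>j\<close> prescribed steps form nested compact
  sets; these are nonempty because a final position can be pulled back one covering at a
  time.\<close>

lemma covering_chain:
  assumes V: "\<And>j::nat. compact (V j)" "\<And>j. V j \<subseteq> {0..1}" "\<And>j. V j \<noteq> {}"
    and cov: "\<And>j. V (Suc j) \<subseteq> (f ^^ n j) ` V j"
  obtains y where "y \<in> V 0" "\<And>j. (f ^^ (\<Sum>i<j. n i)) y \<in> V j"
proof -
  define N where "N j = (\<Sum>i<j. n i)" for j
  define C where "C j = {y \<in> V 0. \<forall>i\<le>j. (f ^^ N i) y \<in> V i}" for j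
  have onto: "V j \<subseteq> (f ^^ N j) ` C j" for j
  proof (induction j)
    case 0
    show ?case by (auto simp: C_def N_def)
  next
    case (Suc j)
    show ?case
    proof
      fix z assume z: "z \<in> V (Suc j)"
      then obtain w where w: "w \<in> V j" "z = (f ^^ n j) w" using cov by blast
      then obtain y where y: "y \<in> C j" "w = (f ^^ N j) y" using Suc by blast
      have "(f ^^ N (Suc j)) y = z"
        unfolding w(2) y(2) funpow_add_app[symmetric] N_def by (simp add: add.commute)
      then show "z \<in> (f ^^ N (Suc j)) ` C (Suc j)" using y(1) z by (force simp: C_def le_Suc_eq)
    qed
  qed
  have "closed (C j)" for j
  proof -
    have "closed {y \<in> V 0. (f ^^ N i) y \<in> V i}" for i
    proof -
      have "{y \<in> V 0. (f ^^ N i) y \<in> V i} = V 0 \<inter> (f ^^ N i) -` V i" by blast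
      then show ?thesis
        using continuous_closed_preimage[OF cont_funpow_on[OF V(2)] compact_imp_closed[OF V(1)] compact_imp_closed[OF V(1)]] by simp
    qed
    then have "closed (\<Inter>i\<in>{..j}. {y \<in> V 0. (f ^^ N i) y \<in> V i})" by (intro closed_INT) auto
    moreover have "(\<Inter>i\<in>{..j}. {y \<in> V 0. (f ^^ N i) y \<in> V i}) = C j" unfolding C_def by auto
    ultimately show ?thesis by simp
  qed
  then have "compact (V 0 \<inter> C j)" for j by (rule compact_Int_closed[OF V(1)])
  moreover have "V 0 \<inter> C j = C j" for j unfolding C_def by blast
  ultimately have comp: "compact (C j)" for j by simp
  have ne: "C j \<noteq> {}" for j using onto[of j] V(3)[of j] by blast
  have "\<Inter> (range C) \<noteq> {}" by (rule compact_nest[of C, OF comp ne]) (auto simp: C_def)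
  then obtain y where "\<And>j. y \<in> C j" by blast
  then show thesis using that[of y] unfolding C_def N_def by blast
qed

text \<open>The chain of coverings is steered towards \<open>x\<close> at even stages and towards
  \<open>x'\<close> at odd ones, with radii tending to 0. Two different targets are what separates
  basic sets from maximal cycles.\<close>

lemma B_common_orbit:
  assumes I: "periodic_interval f k I" and inf: "infinite (B_set f I)" and x: "x \<in> B_set f I" and x': "x' \<in> B_set f I"
  shows "\<exists>y\<in>{0..1}. x \<in> omega_limit f y \<and> x' \<in> omega_limit f y"
proof -
  let ?M = "orb f I"
  note M = periodic_orb_facts[OF I]
  define g where "g j = (if even j then x else x')" for j :: nat
  have gB: "g j \<in> B_set f I" for j using x x' by (simp add: g_def)
  define P where "P j p \<longleftrightarrow> fst p \<in> B_set f I \<and> snd p > 0 \<and> cball (fst p) (snd p) \<subseteq> ?M \<inter> ball (g j) (1 / real (Suc j))" for j p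
  define R where "R (j::nat) p p' \<longleftrightarrow> (\<exists>n\<ge>1. cball (fst p') (snd p') \<subseteq> (f ^^ n) ` cball (fst p) (snd p))" for j p and p' :: "real \<times> real"
  have step: "\<exists>p'. P j p' \<and> (\<exists>n\<ge>1. cball (fst p') (snd p') \<subseteq> (f ^^ n) ` (ball b d \<inter> ?M))" if "b \<in> B_set f I" "d > 0" for b d j
  proof -
    have "1 / real (Suc j) > 0" by simp
    from B_cover_step[OF I inf that(1) gB that(2) this] obtain n b' d' where
      n: "n \<ge> 1" "b' \<in> B_set f I" "d' > 0" "cball b' d' \<subseteq> (f ^^ n) ` (ball b d \<inter> ?M)" "cball b' d' \<subseteq> ball (g j) (1 / real (Suc j))" by blast
    have "(f ^^ n) ` (ball b d \<inter> ?M) \<subseteq> ?M" using orb_iter by blast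
    then have "P j (b', d')" unfolding P_def using n by auto
    then show ?thesis using n by (intro exI[of _ "(b', d')"]) auto
  qed
  have "\<exists>p. \<forall>j. P j (p j) \<and> R j (p j) (p (Suc j))"
  proof (rule dependent_nat_choice)
    show "\<exists>p. P 0 p" using step[OF x, of 1 0] by auto
    fix p j assume "P j p"
    then have "fst p \<in> B_set f I" "snd p > 0" by (auto simp: P_def)
    from step[OF this, of "Suc j"] obtain p' n where p': "P (Suc j) p'" "n \<ge> 1"
      "cball (fst p') (snd p') \<subseteq> (f ^^ n) ` (ball (fst p) (snd p) \<inter> ?M)" by blast
    have "(f ^^ n) ` (ball (fst p) (snd p) \<inter> ?M) \<subseteq> (f ^^ n) ` cball (fst p) (snd p)" by (intro image_mono) auto
    with p'(3) have "cball (fst p') (snd p') \<subseteq> (f ^^ n) ` cball (fst p) (snd p)" by (rule order_trans)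
    then have "R j p p'" unfolding R_def using p'(2) by (intro exI[of _ n] conjI)
    then show "\<exists>p'. P (Suc j) p' \<and> R j p p'" using p'(1) by (intro exI[of _ p'] conjI)
  qed
  then obtain p where p: "\<And>j. P j (p j)" "\<And>j. R j (p j) (p (Suc j))" by blast
  define V where "V j = cball (fst (p j)) (snd (p j))" for j
  have "\<exists>n\<ge>1. V (Suc j) \<subseteq> (f ^^ n) ` V j" for j using p(2)[of j] unfolding R_def V_def .
  then obtain n where n: "\<And>j. n j \<ge> 1" "\<And>j. V (Suc j) \<subseteq> (f ^^ n j) ` V j" by metis
  have VM: "V j \<subseteq> ?M" "V j \<subseteq> ball (g j) (1 / real (Suc j))" for j using p(1)[of j] unfolding P_def V_def by auto
  have V01: "V j \<subseteq> {0..1}" for j using VM(1) M(2) by (rule order_trans)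
  have Vne: "V j \<noteq> {}" for j using p(1)[of j] unfolding P_def V_def by auto
  have Vc: "compact (V j)" for j unfolding V_def by simp
  obtain y where y: "y \<in> V 0" "\<And>j. (f ^^ (\<Sum>i<j. n i)) y \<in> V j"
    by (rule covering_chain[of V n, OF Vc V01 Vne n(2)]) blast+
  have large: "(\<Sum>i<j. n i) \<ge> j" for j
    using sum_mono[of "{..<j}" "\<lambda>_. 1" n] n(1) by simp
  have "z \<in> omega_limit f y" if "\<And>N. \<exists>j\<ge>N. g j = z" for z
    unfolding omega_limit_iff
  proof (intro allI impI)
    fix d :: real and N assume "d > 0"
    then obtain N' where N': "1 / real (Suc N') < d" using nat_approx_posE by metis
    obtain j where j: "j \<ge> max N N'" "g j = z" using \<open>\<And>N. \<exists>j\<ge>N. g j = z\<close> by blast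
    have "(f ^^ (\<Sum>i<j. n i)) y \<in> ball z (1 / real (Suc j))" using y(2)[of j] VM(2)[of j] j(2) by blast
    moreover have "1 / real (Suc j) \<le> 1 / real (Suc N')" using j(1) by (simp add: frac_le)
    ultimately have "\<bar>(f ^^ (\<Sum>i<j. n i)) y - z\<bar> < d" using N' by (simp add: dist_real_def abs_minus_commute)
    then show "\<exists>n\<ge>N. \<bar>(f ^^ n) y - z\<bar> < d" using large[of j] j(1) by (intro exI[of _ "\<Sum>i<j. n i"]) simp
  qed
  moreover have "\<exists>j\<ge>N. g j = x" for N by (rule exI[of _ "2 * N"]) (simp add: g_def)
  moreover have "\<exists>j\<ge>N. g j = x'" for N by (rule exI[of _ "2 * N + 1"]) (simp add: g_def)
  moreover have "y \<in> {0..1}" using y(1) V01 by blast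
  ultimately show ?thesis by blast
qed

lemma B_subset_omega_set:
  assumes "periodic_interval f k I" "infinite (B_set f I)" shows "B_set f I \<subseteq> omega_set f"
  using B_common_orbit[OF assms] unfolding omega_set_def by blast

text \<open>A limit set through a point of a cycle contains the whole cycle. As
  \<open>B_set f I\<close> is infinite, that limit set can be made to contain a further point
  outside the cycle, which is then not maximal.\<close>

lemma B_genus0_disjoint:
  assumes I: "periodic_interval f k I" "infinite (B_set f I)"
  shows "B_set f I \<inter> genus0_union f = {}"
proof (rule ccontr)
  assume "B_set f I \<inter> genus0_union f \<noteq> {}"
  then obtain x Z where x: "x \<in> B_set f I" "x \<in> Z" "cycle f Z"
    and max: "\<And>y. y \<in> {0..1} \<Longrightarrow> Z \<subseteq> omega_limit f y \<Longrightarrow> omega_limit f y = Z" unfolding genus0_union_def by blast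
  obtain z where z: "z \<in> Per f" "Z = orb f {z}" using x(3) unfolding cycle_def by blast
  have "finite Z" using Per_omega_limit(2)[OF z(1)] z(2) by simp
  then obtain x' where x': "x' \<in> B_set f I" "x' \<notin> Z" using I(2) by (meson finite_subset subsetI)
  obtain y where y: "y \<in> {0..1}" "x \<in> omega_limit f y" "x' \<in> omega_limit f y"
    using B_common_orbit[OF I x(1) x'(1)] by blast
  obtain p where p: "p \<ge> 1" "(f ^^ p) z = z" using z(1) unfolding Per_def by blast
  obtain i where i: "i < p" "x = (f ^^ i) z" using x(2) unfolding z(2) orb_periodic_point(1)[OF p(2,1)] by blast
  have "(f ^^ (p - i)) x = z" unfolding i(2) funpow_add_app[symmetric] using i(1) p(2) by simp
  then have "z \<in> omega_limit f y" using omega_limit_forward[OF y(1,2)] by metis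
  then have "(f ^^ j) z \<in> omega_limit f y" for j by (rule omega_limit_forward[OF y(1)])
  then have "Z \<subseteq> omega_limit f y" unfolding z(2) orb_def by blast
  then show False using max[OF y(1)] x'(2) y(3) by blast
qed

section \<open>Homoclinic points\<close>

lemma periodic_orb_point:
  assumes "(f ^^ p) e = e" "p \<ge> 1" "z \<in> orb f {e}"
  shows "orb f {z} = orb f {e}" "(f ^^ p) z = z"
proof -
  obtain i where i: "i < p" "z = (f ^^ i) e" using assms unfolding orb_periodic_point(1)[OF assms(1,2)] by blast
  show "(f ^^ p) z = z" unfolding i(2) using funpow_commute[of p i e] assms(1) by simp
  have "(f ^^ (p - i)) z = e" unfolding i(2) funpow_add_app[symmetric] using i(1) assms(1) by simp
  then have "e \<in> orb f {z}" unfolding orb_def by blast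
  then have "orb f {e} \<subseteq> orb f {z}" by (intro orb_orb_subset) simp
  moreover have "orb f {z} \<subseteq> orb f {e}" using assms(3) by (intro orb_orb_subset) simp
  ultimately show "orb f {z} = orb f {e}" by blast
qed

lemma full_germ_tail:
  assumes I: "periodic_interval f k I" and "full_germ (orb f I) x s" "d > 0" "x \<in> {0..1}"
  shows "orb f I \<subseteq> closure (orb f ((f ^^ n) ` germ x s d))"
proof -
  have "orb f I \<subseteq> closure (orb f (germ x s d))" using assms(2,3) by (simp add: full_germ_def)
  then have "(f ^^ n) ` orb f I \<subseteq> (f ^^ n) ` closure (orb f (germ x s d))" by (rule image_mono)
  then show ?thesis unfolding image_closure_orb[OF germ_in] periodic_orb_facts(6)[OF I] .
qed

text \<open>Backwards along the cycle the full germ is lifted to some preimage \<open>w\<close> of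
  \<open>e\<close>. A non-periodic \<open>w\<close> would make \<open>B_set f I\<close> infinite by
  \<open>infinite_B_set\<close>, and a periodic one reaching \<open>e\<close> after
  \<open>p - i\<close> steps can only be \<open>z\<close>.\<close>

lemma full_germ_periodic_preimage:
  assumes I: "periodic_interval f k I" and fin: "finite (B_set f I)"
    and e: "full_germ (orb f I) e t" "(f ^^ p) e = e" "p \<ge> 1" and z: "z \<in> orb f {e}"
  shows "\<exists>s. full_germ (orb f I) z s"
proof -
  obtain i where i: "i < p" "z = (f ^^ i) e" using z unfolding orb_periodic_point(1)[OF e(2,3)] by blast
  have eM: "e \<in> orb f I" using e(1) by (simp add: full_germ_def)
  obtain b where I': "periodic_interval f k ((f ^^ b) ` I)" "orb f ((f ^^ b) ` I) = orb f I"
    "B_set f ((f ^^ b) ` I) = B_set f I" "e \<in> (f ^^ b) ` I" by (rule periodic_interval_shift[OF I eM])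
  let ?I = "(f ^^ b) ` I"
  note M = periodic_orb_facts[OF I'(1), unfolded I'(2)]
  define n where "n = p - i"
  have per: "(f ^^ (k * j)) ` ?I = ?I" for j
  proof (induction j)
    case (Suc j)
    have "(f ^^ (k * Suc j)) ` ?I = (f ^^ k) ` ((f ^^ (k * j)) ` ?I)" by (simp only: funpow_image_add[symmetric] mult_Suc_right add.assoc)
    then show ?case using Suc M(10) by simp
  qed simp
  \<comment> \<open>The image from which \<open>n\<close> further steps lead onto \<open>?I\<close>,
    because \<open>(k - 1) * n + n\<close> is a multiple of the period.\<close>
  let ?C = "(f ^^ ((k - 1) * n)) ` ?I"
  have "n + (k - 1) * n = k * n" using M(11) by (cases k) auto
  then have fC: "(f ^^ n) ` ?C = ?I" unfolding funpow_image_add[symmetric, of n] using per[of n] by (simp add: funpow_image_add)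
  obtain u0 where u0: "u0 \<in> orb f I" "t * (u0 - e) > 0" "germ e t (t * (u0 - e)) \<subseteq> orb f I" and t: "\<bar>t\<bar> = 1"
    using e(1) unfolding full_germ_def by blast
  have e01: "e \<in> {0..1}" "u0 \<in> {0..1}" using eM u0(1) M(2) by auto
  have sub: "germ e t (t * (u0 - e)) \<subseteq> ?I"
  proof (rule wp_connected_subset0[OF M(1) _ _ _ I'(4)])
    show "connected (germ e t (t * (u0 - e)))"
      using cintervalD(2)[OF germ_cinterval[OF t e01(1)]] u0(2) by simp
    show "germ e t (t * (u0 - e)) \<subseteq> orb f ?I" using u0(3) I'(2) by simp
    show "e \<in> germ e t (t * (u0 - e))" using germ_base[OF e01(1)] u0(2) by simp
  qed
  have "u0 \<in> germ e t (t * (u0 - e))" using e01(2) u0(2) by (simp add: germ_def)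
  then have "e \<in> (f ^^ n) ` ?C" "u0 \<in> (f ^^ n) ` ?C" using sub I'(4) fC by auto
  then obtain u v where uv: "u \<in> ?C" "(f ^^ n) u = e" "v \<in> ?C" "(f ^^ n) v = u0" by blast
  have conC: "connected ?C" using cintervalD(2)[OF cinterval_image[OF weakly_periodicD(2)[OF M(1)]]] .
  have CM: "?C \<subseteq> orb f I" using image_subset_orb[of "(k - 1) * n" ?I] I'(2) by simp
  obtain w r where w: "w \<in> ?C" "(f ^^ n) w = e" "full_germ (orb f I) w r"
    by (rule full_germ_lift[OF I e(1) conC CM uv(1,3), of n]) (use uv u0 in auto)
  have "w \<in> Per f"
  proof (rule ccontr)
    assume nper: "w \<notin> Per f"
    obtain c where c: "periodic_interval f k ((f ^^ c) ` I)" "orb f ((f ^^ c) ` I) = orb f I"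
      "B_set f ((f ^^ c) ` I) = B_set f I" "w \<in> (f ^^ c) ` I"
      by (rule periodic_interval_shift[OF I subsetD[OF CM w(1)]])
    have "infinite (B_set f ((f ^^ c) ` I))"
      by (rule infinite_B_set[OF c(1) _ c(4) nper]) (use w(3) c(2) in simp)
    then show False using fin c(3) by simp
  qed
  then obtain q where q: "q \<ge> 1" "(f ^^ q) w = w" unfolding Per_def by blast
  have "n \<le> q * p" unfolding n_def using q(1) by (metis diff_le_self le_trans mult_le_mono1 nat_mult_1)
  then have "w = (f ^^ (q * p - n)) ((f ^^ n) w)"
    unfolding funpow_add_app[symmetric] using funpow_mod_period[OF q(2), of "q * p"] by simp
  also have "\<dots> = (f ^^ (q * p - n)) e" using w(2) by simp
  also have "\<dots> = (f ^^ ((q * p - n) mod p)) e" by (rule funpow_mod_period[OF e(2)])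
  also have "q * p - n = (q - 1) * p + i"
    using i(1) q(1) unfolding n_def by (cases q) (auto simp: algebra_simps)
  also have "((q - 1) * p + i) mod p = i" using i(1) by simp
  finally have "w = z" using i(2) by simp
  then show ?thesis using w(3) by blast
qed

text \<open>Surjectivity gives \<open>x\<close> infinitely many preimages in \<open>orb f I\<close>,
  while the orbit of a germ at the periodic point \<open>c\<close> omits only finitely many points
  of \<open>orb f I\<close>. So a preimage of \<open>x\<close> is reached from points arbitrarily
  close to \<open>c\<close>.\<close>

lemma full_germ_homoclinic:
  assumes I: "periodic_interval f k I" and c: "full_germ (orb f I) c s" "(f ^^ p) c = c" "p \<ge> 1"
    and x: "x \<in> orb f I" "x \<notin> Per f" "(f ^^ r) x \<in> orb f {c}" and d: "d > 0"
  obtains z N where "z \<in> germ c s d" "z \<noteq> c" "\<And>n. n \<ge> N \<Longrightarrow> (f ^^ n) z \<in> orb f {c}"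
proof -
  note M = periodic_orb_facts[OF I]
  have s: "\<bar>s\<bar> = 1" and c01: "c \<in> {0..1}" using c(1) M(2) unfolding full_germ_def by auto
  let ?G = "germ c s d"
  have cG: "c \<in> ?G" using germ_base[OF c01] d by simp
  have "(f ^^ p) c \<in> (f ^^ p) ` ?G" using cG by (rule imageI)
  then have "(f ^^ p) ` ?G \<inter> ?G \<noteq> {}" using cG c(2) by auto
  from orb_recurrent_decomp(3)[OF cintervalD(2)[OF germ_cinterval[OF s c01 less_imp_le[OF d]]] germ_in c(3) this]
  have fin: "finite (closure (orb f ?G) - orb f ?G)" .
  have "\<exists>w\<in>orb f I. (f ^^ n) w = x" for n using x(1) M(6)[of n] by (metis imageE)
  then obtain w where w: "\<And>n. w n \<in> orb f I" "\<And>n. (f ^^ n) (w n) = x" by metis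
  have x01: "x \<in> {0..1}" using x(1) M(2) by blast
  have lt: "w n \<noteq> w m" if "n < m" for n m
  proof
    assume eq: "w n = w m"
    have "(f ^^ (m - n)) x = (f ^^ (m - n)) ((f ^^ n) (w n))" using w by simp
    also have "\<dots> = (f ^^ m) (w m)" unfolding funpow_add_app[symmetric] eq using that by simp
    finally have "(f ^^ (m - n)) x = x" using w by simp
    moreover have "m - n \<ge> 1" using that by simp
    ultimately show False using x(2) x01 unfolding Per_def by blast
  qed
  then have "inj w" by (metis injI linorder_neqE_nat)
  then have inf: "infinite (range w)" using finite_imageD by blast
  have "orb f I \<subseteq> closure (orb f ?G)" using c(1) d by (simp add: full_germ_def)
  then have "range w - orb f ?G \<subseteq> closure (orb f ?G) - orb f ?G" using w(1) by auto
  then have "finite (range w - orb f ?G)" using fin by (rule finite_subset)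
  then have "\<not> range w \<subseteq> range w - orb f ?G" using inf by (metis finite_subset)
  then obtain n where "w n \<in> orb f ?G" by blast
  then obtain i z where z: "z \<in> ?G" "w n = (f ^^ i) z" unfolding orb_def by blast
  have hit: "(f ^^ (r + (n + i))) z \<in> orb f {c}"
    unfolding funpow_add_app z(2)[symmetric] w(2) by (rule x(3))
  have "z \<noteq> c"
  proof
    assume "z = c"
    then have "x = (f ^^ (n + i)) c" using w(2)[of n] z(2) by (simp add: funpow_add_app)
    then have "x \<in> orb f {c}" unfolding orb_def by blast
    then have "(f ^^ p) x = x" by (rule periodic_orb_point(2)[OF c(2,3)])
    then show False using x(2) x01 c(3) unfolding Per_def by blast
  qed
  moreover have "(f ^^ m) z \<in> orb f {c}" if "m \<ge> r + (n + i)" for m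
  proof -
    have "(f ^^ m) z = (f ^^ (m - (r + (n + i)))) ((f ^^ (r + (n + i))) z)"
      unfolding funpow_add_app[symmetric] using that by simp
    then show ?thesis using orb_iter[OF hit] by simp
  qed
  ultimately show thesis using that z(1) by blast
qed

text \<open>A finite basic set is refuted at the leftmost point \<open>c\<close> of the cycle. A
  small punctured germ on a full side of \<open>c\<close> contains no lifted preimage of
  \<open>c\<close>, so each iterate sends it either entirely strictly to that side or entirely off
  it. A full left germ is impossible: its homoclinic points force all its late images to the right
  of \<open>c\<close>, and these could not be dense to the left. A full right germ has an iterate
  that fixes \<open>c\<close> and folds it onto a left germ, which is then full as well.\<close>

lemma infinite_B_homoclinic:
  assumes I: "periodic_interval f k I" and e: "full_germ (orb f I) e t" "(f ^^ p) e = e" "p \<ge> 1"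
    and x: "x \<in> orb f I" "x \<notin> Per f" "(f ^^ r) x = e"
  shows "infinite (B_set f I)"
proof
  assume fin: "finite (B_set f I)"
  note M = periodic_orb_facts[OF I]
  define Z where "Z = orb f {e}"
  have finZ: "finite Z" unfolding Z_def by (rule orb_periodic_point(2)[OF e(2,3)])
  have eZ: "e \<in> Z" unfolding Z_def using orb_superset by blast
  \<comment> \<open>Minimality turns membership in the cycle into an inequality; both cases below
    rest on it.\<close>
  define c where "c = Min Z"
  have cZ: "c \<in> Z" unfolding c_def using finZ eZ by (intro Min_in) auto
  have cmin: "c \<le> z" if "z \<in> Z" for z unfolding c_def using finZ that by simp
  have Zc: "orb f {c} = Z" and cp: "(f ^^ p) c = c"
    using periodic_orb_point[OF e(2,3) cZ[unfolded Z_def]] Z_def by auto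
  have eM: "e \<in> orb f I" using e(1) by (simp add: full_germ_def)
  then have ZM: "Z \<subseteq> orb f I" unfolding Z_def by (intro orb_orb_subset) simp
  have c01: "c \<in> {0..1}" using cZ ZM M(2) by blast
  have xc: "(f ^^ r) x \<in> orb f {c}" using x(3) eZ Zc by simp
  have sign: "\<exists>g>0. germ c s g \<subseteq> orb f I \<and> (\<forall>n. \<forall>u\<in>germ c s g - {c}. \<forall>v\<in>germ c s g - {c}.
      s * ((f ^^ n) u - c) \<le> 0 \<longrightarrow> s * ((f ^^ n) v - c) \<le> 0)" if full: "full_germ (orb f I) c s" for s
  proof -
    have s: "\<bar>s\<bar> = 1" using full by (simp add: full_germ_def)
    have fB: "finite (B_set f I - {c})" using fin by simp
    \<comment> \<open>\<open>g0\<close> keeps all other points of the supposedly finite set away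
      from the germ.\<close>
    obtain g0 where g0: "g0 > 0" "\<And>b. b \<in> B_set f I - {c} \<Longrightarrow> g0 \<le> \<bar>b - c\<bar>"
    proof (cases "B_set f I - {c} = {}")
      case False
      have "Min ((\<lambda>b. \<bar>b - c\<bar>) ` (B_set f I - {c})) > 0" using fB False by (subst Min_gr_iff) auto
      moreover have "Min ((\<lambda>b. \<bar>b - c\<bar>) ` (B_set f I - {c})) \<le> \<bar>b - c\<bar>" if "b \<in> B_set f I - {c}" for b
        using fB that by (intro Min_le) auto
      ultimately show thesis by (rule that)
    qed (use that[of 1] in auto)
    obtain g1 where g1: "g1 > 0" "germ c s g1 \<subseteq> ball c 1 \<inter> orb f I" by (rule full_germ_small[OF full, of 1]) auto
    define g where "g = min g1 (g0 / 2)"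
    have g: "g > 0" "g \<le> g1" "g < g0" using g0(1) g1(1) by (auto simp: g_def)
    have gM: "germ c s g \<subseteq> orb f I" using germ_mono[OF g(2), of c s] g1(2) by blast
    have con: "connected (germ c s g)" using cintervalD(2)[OF germ_cinterval[OF s c01]] g(1) by simp
    have "s * ((f ^^ n) v - c) \<le> 0"
      if u: "u \<in> germ c s g - {c}" and v: "v \<in> germ c s g - {c}" and un: "s * ((f ^^ n) u - c) \<le> 0" for n u v
    proof (rule ccontr)
      assume "\<not> ?thesis"
      then have vn: "s * ((f ^^ n) v - c) > 0" by simp
      have uv: "u \<in> germ c s g" "v \<in> germ c s g" using u v by auto
      obtain w r' where w: "w \<in> closed_segment u v" "w \<in> germ c s g" "full_germ (orb f I) w r'"
        by (rule full_germ_lift[OF I full con gM uv un vn])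
      have "s * (u - c) > 0" "s * (v - c) > 0" using germ_pos[OF s] u v by auto
      then have "w \<noteq> c" using w(1) side_cases[OF s] by (auto simp: closed_segment_eq_real_ivl split: if_splits)
      then have "g0 \<le> \<bar>w - c\<bar>" using g0(2) full_germ_B[OF I w(3)] by blast
      then show False using germ_dist[OF s w(2)] g(3) by simp
    qed
    then show ?thesis using g(1) gM by blast
  qed
  have left: False if full: "full_germ (orb f I) c (-1)"
  proof -
    obtain g where g: "g > 0" "germ c (-1) g \<subseteq> orb f I" "\<And>n u v. u \<in> germ c (-1) g - {c} \<Longrightarrow> v \<in> germ c (-1) g - {c} \<Longrightarrow>
      (-1) * ((f ^^ n) u - c) \<le> 0 \<Longrightarrow> (-1) * ((f ^^ n) v - c) \<le> 0" using sign[OF full] by blast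
    obtain z N where z: "z \<in> germ c (-1) g" "z \<noteq> c" "\<And>n. n \<ge> N \<Longrightarrow> (f ^^ n) z \<in> orb f {c}"
      by (rule full_germ_homoclinic[OF I full cp e(3) x(1,2) xc g(1)]) blast
    have ge: "(f ^^ n) v \<ge> c" if "n \<ge> N" "v \<in> germ c (-1) g" for n v
    proof (cases "v = c")
      case True
      have "(f ^^ n) c \<in> Z" unfolding Zc[symmetric] by (rule orb_iter) (use orb_superset in blast)
      then show ?thesis using cmin True by blast
    next
      case False
      have "(f ^^ n) z \<ge> c" using z(3)[OF that(1)] cmin Zc by blast
      then show ?thesis using g(3)[of z v n] z(1,2) that(2) False by simp
    qed
    have "orb f ((f ^^ N) ` germ c (-1) g) \<subseteq> {c..}"
    proof
      fix y assume "y \<in> orb f ((f ^^ N) ` germ c (-1) g)"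
      then obtain i v where "v \<in> germ c (-1) g" "y = (f ^^ (i + N)) v" unfolding orb_def funpow_add_app by blast
      then show "y \<in> {c..}" using ge[of "i + N" v] by simp
    qed
    then have "closure (orb f ((f ^^ N) ` germ c (-1) g)) \<subseteq> {c..}" by (intro closure_minimal closed_atLeast)
    then have "orb f I \<subseteq> {c..}" using full_germ_tail[OF I full g(1) c01] by blast
    then have "z \<ge> c" using z(1) g(2) by blast
    then show False using germ_pos[OF _ z(1,2)] by simp
  qed
  obtain s where s: "full_germ (orb f I) c s"
    using full_germ_periodic_preimage[OF I fin e cZ[unfolded Z_def]] by blast
  have "s = 1" using s left side_cases[of s] unfolding full_germ_def by blast
  then have full: "full_germ (orb f I) c 1" using s by simp
  obtain g where g: "g > 0" "germ c 1 g \<subseteq> orb f I" "\<And>n u v. u \<in> germ c 1 g - {c} \<Longrightarrow> v \<in> germ c 1 g - {c} \<Longrightarrow>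
    1 * ((f ^^ n) u - c) \<le> 0 \<Longrightarrow> 1 * ((f ^^ n) v - c) \<le> 0" using sign[OF full] by blast
  obtain z N where z: "z \<in> germ c 1 g" "z \<noteq> c" "\<And>n. n \<ge> N \<Longrightarrow> (f ^^ n) z \<in> orb f {c}"
    by (rule full_germ_homoclinic[OF I full cp e(3) x(1,2) xc g(1)]) blast
  have "(f ^^ N) z \<in> orb f {c}" by (rule z(3)) simp
  then have "orb f {(f ^^ N) z} = orb f {c}" by (rule periodic_orb_point(1)[OF cp e(3)])
  then have "c \<in> orb f {(f ^^ N) z}" using orb_superset by blast
  then obtain j where "(f ^^ j) ((f ^^ N) z) = c" unfolding orb_def by auto
  then have zn: "(f ^^ (j + N)) z = c" by (simp add: funpow_add_app)
  define n where "n = j + N"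
  have le: "(f ^^ n) v \<le> c" if "v \<in> germ c 1 g" "v \<noteq> c" for v
    using g(3)[of z v n] z(1,2) zn that unfolding n_def by simp
  \<comment> \<open>By continuity the image of \<open>c\<close> is at most \<open>c\<close>, and it
    lies in the cycle, whose minimum is \<open>c\<close>.\<close>
  have cn: "(f ^^ n) c = c"
  proof -
    have cnZ: "(f ^^ n) c \<in> Z" unfolding Zc[symmetric] by (rule orb_iter) (use orb_superset in blast)
    have "(f ^^ n) c \<le> c"
    proof (rule ccontr)
      assume "\<not> (f ^^ n) c \<le> c"
      then have "(f ^^ n) c - c > 0" by simp
      then obtain h where h: "h > 0" "\<forall>y\<in>{0..1}. \<bar>y - c\<bar> \<le> h \<longrightarrow> \<bar>(f ^^ n) y - (f ^^ n) c\<bar> < (f ^^ n) c - c"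
        using funpow_near[OF c01] by blast
      define y where "y = c + min h (z - c)"
      have "z > c" using germ_pos[OF _ z(1,2)] by simp
      then have y: "y \<in> germ c 1 g" "y \<noteq> c" "\<bar>y - c\<bar> \<le> h" "y \<in> {0..1}"
        using z(1) h(1) c01 unfolding y_def germ_def by auto
      then have "\<bar>(f ^^ n) y - (f ^^ n) c\<bar> < (f ^^ n) c - c" using h(2) by blast
      then show False using le[OF y(1,2)] by linarith
    qed
    then show ?thesis using cmin[OF cnZ] by simp
  qed
  have le': "(f ^^ n) v \<le> c" if "v \<in> germ c 1 g" for v using le[OF that] cn by (cases "v = c") auto
  have "full_germ (orb f I) c (-1)"
    unfolding full_germ_def
  proof (intro conjI allI impI)
    show "\<bar>-1 :: real\<bar> = 1" by simp
    show "c \<in> orb f I" using cZ ZM by blast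
    have "\<exists>v\<in>germ c 1 g. (f ^^ n) v < c"
    proof (rule ccontr)
      assume "\<not> ?thesis"
      then have "(f ^^ n) ` germ c 1 g \<subseteq> {c}" using le' by force
      then have "orb f ((f ^^ n) ` germ c 1 g) \<subseteq> Z" unfolding Zc[symmetric] by (rule orb_mono)
      then have "closure (orb f ((f ^^ n) ` germ c 1 g)) \<subseteq> Z" by (intro closure_minimal finite_imp_closed finZ)
      then have "orb f I \<subseteq> Z" using full_germ_tail[OF I full g(1) c01, of n] by blast
      then have "x \<in> Z" using x(1) by blast
      then have "(f ^^ p) x = x" using periodic_orb_point(2)[OF e(2,3)] unfolding Z_def by blast
      moreover have "x \<in> {0..1}" using x(1) M(2) by blast
      ultimately show False using x(2) e(3) unfolding Per_def by blast
    qed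
    then obtain v where v: "v \<in> germ c 1 g" "(f ^^ n) v < c" by blast
    have "connected ((f ^^ n) ` germ c 1 g)"
      by (intro connected_image germ_in cintervalD(2)[OF germ_cinterval]) (use c01 g(1) in auto)
    moreover have "c \<in> (f ^^ n) ` germ c 1 g" using cn germ_base[OF c01, of g 1] g(1) by (metis imageI less_imp_le)
    ultimately have "germ c (-1) ((-1) * ((f ^^ n) v - c)) \<subseteq> (f ^^ n) ` germ c 1 g"
      using v(1) by (intro germ_subset_connected) auto
    moreover have "(f ^^ n) ` germ c 1 g \<subseteq> orb f I" using g(2) orb_iter by blast
    ultimately show "\<exists>t\<in>orb f I. 0 < (-1) * (t - c) \<and> germ c (-1) ((-1) * (t - c)) \<subseteq> orb f I"
      using v by (intro bexI[of _ "(f ^^ n) v"]) auto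
    fix h :: real assume "h > 0"
    then obtain h' where h': "h' > 0" "\<forall>y\<in>{0..1}. \<bar>y - c\<bar> \<le> h' \<longrightarrow> \<bar>(f ^^ n) y - (f ^^ n) c\<bar> < h"
      using funpow_near[OF c01] by blast
    have "(f ^^ n) ` germ c 1 (min h' g) \<subseteq> germ c (-1) h"
    proof
      fix y assume "y \<in> (f ^^ n) ` germ c 1 (min h' g)"
      then obtain v where v: "y = (f ^^ n) v" "v \<in> germ c 1 (min h' g)" by blast
      have v01: "v \<in> {0..1}" using v(2) germ_in by blast
      have "\<bar>v - c\<bar> \<le> min h' g" using germ_dist[OF _ v(2)] by simp
      then have "\<bar>y - c\<bar> < h" using h'(2) v01 cn v(1) by auto
      moreover have "y \<le> c" using le'[of v] v germ_mono[of "min h' g" g c 1] by auto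
      ultimately show "y \<in> germ c (-1) h" using funpow_in[OF v01, of n] v(1) unfolding germ_def by auto
    qed
    then have "closure (orb f ((f ^^ n) ` germ c 1 (min h' g))) \<subseteq> closure (orb f (germ c (-1) h))"
      by (intro closure_mono orb_mono)
    moreover have "min h' g > 0" using h'(1) g(1) by simp
    ultimately show "orb f I \<subseteq> closure (orb f (germ c (-1) h))"
      using full_germ_tail[OF I full _ c01, of "min h' g" n] by blast
  qed
  then show False by (rule left)
qed

text \<open>A point of period \<open>p\<close> would return to its interval too early at a level
  whose period exceeds \<open>p\<close>.\<close>

lemma solenoid_not_Per:
  assumes "in_solenoid x" shows "x \<notin> Per f"
proof
  assume "x \<in> Per f"
  then obtain p where p: "p \<ge> 1" "(f ^^ p) x = x" unfolding Per_def by blast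
  obtain m I where g: "generating_intervals f m I" "x \<in> (\<Inter>j. orb f (I j))"
    using assms unfolding in_solenoid_def generated_set_def by blast
  obtain j where j: "m j \<ge> Suc p"
    using g(1) unfolding generating_intervals_def filterlim_at_top eventually_sequentially by blast
  have per: "periodic_interval f (m j) (I j)" using g(1) by (simp add: generating_intervals_def)
  note wp = periodic_interval_wp[OF per]
  have "x \<in> orb f (I j)" using g(2) by blast
  then obtain i where i: "i < m j" "x \<in> (f ^^ i) ` I j" unfolding wp_orb[OF wp] by blast
  have "(f ^^ p) x \<in> (f ^^ p) ` ((f ^^ i) ` I j)" using i(2) by (rule imageI)
  then have "x \<in> (f ^^ (p + i)) ` I j" unfolding funpow_image_add p(2) .
  then have "(p + i) mod m j = i mod m j" using i(2) by (rule wp_meet[OF wp])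
  then have "(p + i) mod m j = i" using i(1) by simp
  moreover have "(p + i) mod m j \<noteq> i"
  proof (cases "p + i < m j")
    case True then show ?thesis using p(1) by simp
  next
    case False
    then have "(p + i) mod m j = p + i - m j" using i(1) j by (subst le_mod_geq) auto
    then show ?thesis using j False by simp
  qed
  ultimately show False by simp
qed

text \<open>If \<open>H\<close> lies on one side of its periodic endpoint \<open>e\<close>, then points on the other side close to
  \<open>e\<close> can move towards a dense part of the orbit of \<open>H\<close> only by crossing \<open>e\<close>.\<close>

lemma opposite_germ_full:
  assumes e: "(f ^^ p) e = e" "p \<ge> 1" and s: "\<bar>s\<bar> = 1"
    and d: "\<And>j::nat. d j > 0" "d \<longlonglongrightarrow> 0" and wp: "\<And>j. weakly_periodic k (D j)" and dec: "decseq D"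
    and gD: "\<And>j. germ e s (d j) \<subseteq> D j" "\<And>j. closure (orb f (germ e s (d j))) = orb f (D j)"
    and H: "H = (\<Inter>j. (f ^^ (k * j)) ` D j)" "e \<in> H" "\<And>t. t \<in> H \<Longrightarrow> s * (t - e) \<le> 0"
    and per: "periodic_interval f k H"
  shows "full_germ (orb f H) e (- s)"
  unfolding full_germ_def
proof (intro conjI allI impI)
  note M = periodic_orb_facts[OF per]
  have e01: "e \<in> {0..1}" using H(2) M(8) by blast
  have conH: "connected H" using cintervalD(2)[OF weakly_periodicD(2)[OF M(1)]] .
  show "\<bar>- s\<bar> = 1" using s by simp
  show "e \<in> orb f H" using H(2) M(7) by blast
  obtain a b where ab: "a < b" "H = {a..b}" using per unfolding periodic_interval_def by blast
  then have "\<exists>t\<in>H. t \<noteq> e" by (metis atLeastAtMost_iff less_imp_le order_less_irrefl order_refl)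
  then obtain t where t: "t \<in> H" "t \<noteq> e" by blast
  have st: "(- s) * (t - e) > 0" using H(3)[OF t(1)] t(2) side_cases[OF s] by auto
  have "germ e (- s) ((- s) * (t - e)) \<subseteq> H"
    by (rule germ_subset_connected[OF _ conH H(2) t(1)]) (use s in simp)
  then show "\<exists>t\<in>orb f H. 0 < (- s) * (t - e) \<and> germ e (- s) ((- s) * (t - e)) \<subseteq> orb f H"
    using t(1) st M(7) by blast
  fix h :: real assume h: "h > 0"
  define U where "U = germ e (- s) h"
  have eU: "e \<in> U" unfolding U_def using germ_base[OF e01] h by simp
  show "orb f H \<subseteq> closure (orb f (germ e (- s) h))"
  proof (rule ccontr)
    assume "\<not> ?thesis"
    then obtain v where v: "v \<in> orb f H" "v \<notin> closure (orb f U)" unfolding U_def by blast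
    then obtain rho where rho: "rho > 0" "\<And>u. u \<in> orb f U \<Longrightarrow> rho \<le> \<bar>u - v\<bar>"
      unfolding closure_approachable dist_real_def by (meson not_less)
    obtain g1 where g1: "g1 > 0" "\<forall>y\<in>{0..1}. \<bar>y - e\<bar> \<le> g1 \<longrightarrow> \<bar>(f ^^ p) y - (f ^^ p) e\<bar> < h"
      using funpow_near[OF e01 h] by blast
    have "rho / 2 > 0" using rho(1) by simp
    from funpow_near_le[OF e01 this, of p] obtain g2 where g2: "g2 > 0"
      "\<forall>i<p. \<forall>y\<in>{0..1}. \<bar>y - e\<bar> \<le> g2 \<longrightarrow> \<bar>(f ^^ i) y - (f ^^ i) e\<bar> < rho / 2" by blast
    define g where "g = min g1 g2"
    have g: "g > 0" using g1(1) g2(1) by (simp add: g_def)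
    define E where "E j = (f ^^ (k * j)) ` D j" for j
    have cE: "cinterval (E j)" for j unfolding E_def by (rule cinterval_image[OF weakly_periodicD(2)[OF wp]])
    have HE: "H = (\<Inter>j. E j)" unfolding H(1) E_def ..
    \<comment> \<open>The intervals \<open>E j\<close> shrink to \<open>H\<close>, which does not
      reach beyond \<open>e\<close> on the side \<open>s\<close>; so some stage overlaps that side
      by less than \<open>g\<close>.\<close>
    have "\<exists>j. \<forall>y\<in>E j. s * (y - e) < g"
    proof (rule ccontr)
      assume "\<not> ?thesis"
      then have far: "\<And>j. \<exists>y\<in>E j. g \<le> s * (y - e)" by (meson not_less)
      have sg: "s * (e + s * g - e) = g" using side_cases[OF s] by auto
      have "e + s * g \<in> E j" for j
      proof -
        obtain y where y: "y \<in> E j" "g \<le> s * (y - e)" using far by blast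
        have eE: "e \<in> E j" using H(2) HE by blast
        have sub: "germ e s (s * (y - e)) \<subseteq> E j" by (rule germ_subset_connected[OF s cintervalD(2)[OF cE] eE y(1)])
        have "y \<in> {0..1}" using y(1) cintervalD(4)[OF cE] by blast
        then have "e + s * g \<in> germ e s (s * (y - e))"
          unfolding germ_def using side_cases[OF s] e01 y(2) g by auto
        then show ?thesis using sub by blast
      qed
      then have "e + s * g \<in> H" using HE by blast
      from H(3)[OF this] show False unfolding sg using g by simp
    qed
    then obtain j where j: "\<And>y. y \<in> E j \<Longrightarrow> s * (y - e) < g" by blast
    obtain d1 where d1: "d1 > 0" "\<forall>n<p * (k * j). \<forall>y\<in>{0..1}. \<bar>y - e\<bar> \<le> d1 \<longrightarrow> \<bar>(f ^^ n) y - (f ^^ n) e\<bar> < g"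
      using funpow_near_le[OF e01 g, of "p * (k * j)"] by blast
    define d' where "d' = min d1 (d j)"
    have d': "d' > 0" "d' \<le> d1" "d' \<le> d j" using d1(1) d(1)[of j] by (auto simp: d'_def)
    have pe: "(f ^^ (p * i)) e = e" for i using funpow_mod_period[OF e(1), of "p * i"] by simp
    have kp: "k dvd p"
    proof (rule wp_return[OF M(1) H(2)])
      have "(f ^^ p) e \<in> (f ^^ p) ` H" using H(2) by (rule imageI)
      then show "e \<in> (f ^^ p) ` H" using e(1) by simp
    qed
    have k1: "k \<ge> 1" by (rule M(11))
    \<comment> \<open>Early iterates are controlled by continuity at \<open>e\<close>, late ones by
      membership in \<open>E j\<close>.\<close>
    have c1: "s * ((f ^^ (p * i)) y - e) < g" if y: "y \<in> germ e s d'" for i y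
    proof (cases "p * i < p * (k * j)")
      case True
      have "y \<in> {0..1}" using y germ_in by blast
      moreover have "\<bar>y - e\<bar> \<le> d1" using germ_dist[OF s y] d'(2) by simp
      ultimately have "\<bar>(f ^^ (p * i)) y - e\<bar> < g" using d1(2) True pe[of i] by metis
      then show ?thesis using side_cases[OF s] by auto
    next
      case False
      then have i: "k * j \<le> i" using e(2) by simp
      have yD: "y \<in> D j" using y germ_mono[OF d'(3)] gD(1) by blast
      obtain q where q: "p = k * q" using kp by (elim dvdE)
      then have "q \<ge> 1" using e(2) by (cases q) auto
      have "j \<le> k * j" using k1 by simp
      also have "\<dots> \<le> i" by (rule i)
      also have "i \<le> q * i" using \<open>q \<ge> 1\<close> by simp
      finally have "j \<le> q * i" .
      then have "(f ^^ (k * (q * i))) ` D j \<subseteq> E j" unfolding E_def by (rule wp_power_decr[OF wp])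
      then have "(f ^^ (p * i)) y \<in> E j" using yD q by (auto simp: mult.assoc)
      then show ?thesis by (rule j)
    qed
    \<comment> \<open>Either the iterates by multiples of \<open>p\<close> leave the side
      \<open>s\<close>, and then their first landing is in \<open>U\<close>; or they stay close to
      \<open>e\<close> and the orbit follows the cycle of \<open>e\<close>, which lies in
      \<open>orb f U\<close>. Either way \<open>v\<close> is missed by
      \<open>rho / 2\<close>.\<close>
    have c2: "rho / 2 \<le> \<bar>(f ^^ n) y - v\<bar>" if y: "y \<in> germ e s d'" for n y
    proof (cases "\<exists>i. p * i \<le> n \<and> s * ((f ^^ (p * i)) y - e) \<le> 0")
      case True
      define Q where "Q i \<longleftrightarrow> p * i \<le> n \<and> s * ((f ^^ (p * i)) y - e) \<le> 0" for i
      define i where "i = (LEAST i. Q i)"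
      have Qi: "Q i" unfolding i_def using True Q_def by (auto intro: LeastI)
      have y01: "y \<in> {0..1}" using y germ_in by blast
      have "(f ^^ (p * i)) y \<in> U"
      proof (cases i)
        case 0
        then have "s * (y - e) \<le> 0" using Qi Q_def by simp
        then have "y = e" using y side_cases[OF s] unfolding germ_def by auto
        then show ?thesis using 0 eU by simp
      next
        case (Suc i')
        have "\<not> Q i'" using not_less_Least[of i' Q] Suc i_def by simp
        then have pos: "s * ((f ^^ (p * i')) y - e) > 0" using Qi Suc unfolding Q_def by auto
        let ?w = "(f ^^ (p * i')) y"
        have "\<bar>?w - e\<bar> \<le> g1" using pos c1[OF y, of i'] side_cases[OF s] unfolding g_def by auto
        then have "\<bar>(f ^^ p) ?w - e\<bar> < h" using g1(2) funpow_in[OF y01] e(1) by auto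
        moreover have "(f ^^ p) ?w = (f ^^ (p * i)) y" unfolding Suc funpow_add_app[symmetric] by simp
        ultimately have "\<bar>(f ^^ (p * i)) y - e\<bar> < h" by simp
        then show ?thesis using Qi funpow_in[OF y01, of "p * i"] side_cases[OF s] unfolding Q_def U_def germ_def by auto
      qed
      then have "(f ^^ (p * i)) y \<in> orb f U" using orb_superset by blast
      then have "(f ^^ (n - p * i)) ((f ^^ (p * i)) y) \<in> orb f U" by (rule orb_iter)
      moreover have "(f ^^ (n - p * i)) ((f ^^ (p * i)) y) = (f ^^ n) y"
        unfolding funpow_add_app[symmetric] using Qi Q_def by simp
      ultimately have "rho \<le> \<bar>(f ^^ n) y - v\<bar>" using rho(2) by simp
      then show ?thesis using rho(1) by simp
    next
      case False
      have y01: "y \<in> {0..1}" using y germ_in by blast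
      define i r where "i = n div p" and "r = n mod p"
      have n: "n = r + p * i" "r < p" unfolding i_def r_def using e(2) by auto
      let ?w = "(f ^^ (p * i)) y"
      have "p * i \<le> n" using n(1) by simp
      then have "s * (?w - e) > 0" using False by force
      then have "\<bar>?w - e\<bar> \<le> g2" using c1[OF y, of i] side_cases[OF s] unfolding g_def by auto
      then have near: "\<bar>(f ^^ r) ?w - (f ^^ r) e\<bar> < rho / 2" using g2(2) n(2) funpow_in[OF y01] by blast
      have "(f ^^ r) e \<in> orb f U" using eU image_subset_orb[of r U] by blast
      then have "rho \<le> \<bar>(f ^^ r) e - v\<bar>" by (rule rho(2))
      then have "rho / 2 \<le> \<bar>(f ^^ r) ?w - v\<bar>" using near by linarith
      then show ?thesis unfolding n(1) funpow_add_app .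
    qed
    obtain l where "\<bar>d l\<bar> < d'" using d(2) d'(1) unfolding LIMSEQ_def dist_real_def by force
    then have "germ e s (d l) \<subseteq> germ e s d'" by (intro germ_mono) simp
    then have "closure (orb f (germ e s (d l))) \<subseteq> closure (orb f (germ e s d'))" by (intro closure_mono orb_mono)
    moreover have "H \<subseteq> D l" unfolding H(1) using const_tower(6)[of k D, OF wp dec] .
    then have "orb f H \<subseteq> closure (orb f (germ e s (d l)))" unfolding gD(2) by (rule orb_mono)
    ultimately have "v \<in> closure (orb f (germ e s d'))" using v(1) by blast
    then obtain u where "u \<in> orb f (germ e s d')" "\<bar>u - v\<bar> < rho / 2"
      unfolding closure_approachable dist_real_def using \<open>rho / 2 > 0\<close> by blast
    then obtain n y where "y \<in> germ e s d'" "\<bar>(f ^^ n) y - v\<bar> < rho / 2" unfolding orb_def by blast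
    then show False using c2[of y n] by simp
  qed
qed

section \<open>Non-wandering points\<close>

text \<open>A point that is left on the side \<open>- s\<close> and returned to only on the side \<open>s\<close>: this is how a
  non-wandering point fails to be a limit point.\<close>

definition crossing :: "real \<Rightarrow> real \<Rightarrow> real \<Rightarrow> bool" where
  "crossing x s c \<longleftrightarrow> x \<in> {0..1} \<and> \<bar>s\<bar> = 1 \<and> x \<notin> Per f \<and> c > 0 \<and>
     (\<forall>n\<ge>1. \<forall>y \<in> germ x (- s) c. (f ^^ n) y \<notin> germ x (- s) c - {x}) \<and>
     (\<forall>n\<ge>1. (f ^^ n) x \<notin> germ x s c) \<and>
     (\<forall>d>0. \<forall>N. \<exists>n\<ge>N. \<exists>y \<in> germ x (- s) d. (f ^^ n) y \<in> germ x s d)"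

lemma crossingD:
  assumes "crossing x s c"
  shows "x \<in> {0..1}" "\<bar>s\<bar> = 1" "\<bar>- s\<bar> = 1" "x \<notin> Per f" "c > 0"
    "\<And>n y. n \<ge> 1 \<Longrightarrow> y \<in> germ x (- s) c \<Longrightarrow> (f ^^ n) y \<notin> germ x (- s) c - {x}"
    "\<And>n. n \<ge> 1 \<Longrightarrow> (f ^^ n) x \<notin> germ x s c"
    "\<And>d N. d > 0 \<Longrightarrow> \<exists>n\<ge>N. \<exists>y \<in> germ x (- s) d. (f ^^ n) y \<in> germ x s d"
  using assms unfolding crossing_def by auto

text \<open>An image of \<open>x\<close> on the side \<open>- s\<close> would be farther away than
  \<open>c\<close>, and the image of the germ would sweep across the germ that must not be
  revisited. So \<open>x\<close> is thrown beyond \<open>c\<close> on the side \<open>s\<close>, and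
  an interval joining its image to the returning point covers that side between \<open>d\<close> and
  \<open>c\<close>.\<close>

lemma crossing_segment:
  assumes X: "crossing x s c" and n: "n \<ge> 1" and d: "d \<le> c"
    and y: "y \<in> germ x (- s) d" "(f ^^ n) y \<in> germ x s d"
  shows "s * ((f ^^ n) x - x) > c" "y \<noteq> x"
    "\<And>C q. connected C \<Longrightarrow> (f ^^ n) y \<in> C \<Longrightarrow> (f ^^ n) x \<in> C \<Longrightarrow> d \<le> s * (q - x) \<Longrightarrow> s * (q - x) \<le> c \<Longrightarrow> q \<in> C"
proof -
  note D = crossingD[OF X]
  have d0: "0 \<le> d" using y(1) unfolding germ_def by auto
  have fx: "(f ^^ n) x \<in> {0..1}" by (rule funpow_in[OF D(1)])
  have "(f ^^ n) y \<in> germ x s c" using y(2) germ_mono[OF d] by blast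
  then show "y \<noteq> x" using D(7)[OF n] by blast
  have sy: "0 \<le> s * ((f ^^ n) y - x)" "s * ((f ^^ n) y - x) \<le> d" using y(2) by (auto simp: germ_def)
  show gt: "s * ((f ^^ n) x - x) > c"
  proof (rule ccontr)
    assume "\<not> s * ((f ^^ n) x - x) > c"
    then have neg: "s * ((f ^^ n) x - x) < 0" using D(7)[OF n] fx unfolding germ_def by auto
    then have ne: "(f ^^ n) x \<noteq> x" by auto
    have xg: "x \<in> germ x (- s) c" by (rule germ_base[OF D(1)]) (use D(5) in simp)
    have "(f ^^ n) x \<notin> germ x (- s) c" using D(6)[OF n xg] ne by blast
    then have far: "s * ((f ^^ n) x - x) < - c" using neg fx D(5) unfolding germ_def by auto
    have con: "connected ((f ^^ n) ` germ x (- s) d)"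
      by (intro connected_image germ_in cintervalD(2)[OF germ_cinterval]) (use D d0 in auto)
    \<comment> \<open>The far end of the germ on the side \<open>- s\<close>, which no iterate may
      hit.\<close>
    define q where "q = x - s * c"
    have qs: "s * (q - x) = - c" using side_cases[OF D(2)] by (auto simp: q_def)
    have "(f ^^ n) y \<in> (f ^^ n) ` germ x (- s) d" "(f ^^ n) x \<in> (f ^^ n) ` germ x (- s) d"
      using y(1) germ_base[OF D(1) d0] by auto
    then have "q \<in> (f ^^ n) ` germ x (- s) d"
      using connectedD_interval[OF con, of "(f ^^ n) y" "(f ^^ n) x" q] connectedD_interval[OF con, of "(f ^^ n) x" "(f ^^ n) y" q]
        sy(1) far qs side_cases[OF D(2)] D(5) by auto
    then obtain w where w: "w \<in> germ x (- s) d" "q = (f ^^ n) w" by blast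
    have wc: "w \<in> germ x (- s) c" using w(1) germ_mono[OF d] by blast
    have "q \<in> {0..1}" using w germ_in funpow_in by blast
    then have "q \<in> germ x (- s) c - {x}" using qs D(5) side_cases[OF D(2)] unfolding germ_def by auto
    then show False using D(6)[OF n wc] w(2) by simp
  qed
  fix C q assume C: "connected C" "(f ^^ n) y \<in> C" "(f ^^ n) x \<in> C" and q: "d \<le> s * (q - x)" "s * (q - x) \<le> c"
  show "q \<in> C"
    using connectedD_interval[OF C(1) C(2,3), of q] connectedD_interval[OF C(1) C(3,2), of q] gt sy q side_cases[OF D(2)] by auto
qed

text \<open>The dense germs at \<open>x\<close> may lie outside \<open>orb f I\<close>. Interiority
  of the later point guarantees that the image of a small germ falls into \<open>orb f I\<close>,
  where it witnesses density.\<close>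

lemma crossing_interior_B:
  assumes I: "periodic_interval f k I" and x: "x \<in> {0..1}" and r: "\<bar>r\<bar> = 1"
    and dense: "\<And>d. d > 0 \<Longrightarrow> orb f I \<subseteq> closure (orb f (germ x r d))"
    and int: "(f ^^ i) x \<in> unit_top interior_of (orb f I)"
  shows "(f ^^ i) x \<in> B_set f I"
proof (rule B_setI_germ[OF I])
  note M = periodic_orb_facts[OF I]
  show "(f ^^ i) x \<in> orb f I" by (rule subsetD[OF interior_of_subset int])
  fix e :: real assume e: "e > 0"
  obtain T where T: "openin unit_top T" "(f ^^ i) x \<in> T" "T \<subseteq> orb f I"
    using int unfolding interior_of_def by blast
  then obtain S where S: "open S" "T = {0..1} \<inter> S" unfolding openin_open by blast
  have "(f ^^ i) x \<in> S \<inter> ball ((f ^^ i) x) e" "open (S \<inter> ball ((f ^^ i) x) e)" using T(2) S e by auto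
  then obtain g where g: "g > 0" "ball ((f ^^ i) x) g \<subseteq> S \<inter> ball ((f ^^ i) x) e" by (meson openE)
  obtain d where d: "d > 0" "\<forall>y\<in>{0..1}. \<bar>y - x\<bar> \<le> d \<longrightarrow> \<bar>(f ^^ i) y - (f ^^ i) x\<bar> < g"
    using funpow_near[OF x g(1)] by blast
  have "(f ^^ i) ` germ x r d \<subseteq> ball ((f ^^ i) x) e \<inter> orb f I"
  proof
    fix z assume "z \<in> (f ^^ i) ` germ x r d"
    then obtain y where y: "z = (f ^^ i) y" "y \<in> germ x r d" by blast
    then have y01: "y \<in> {0..1}" using germ_in by blast
    then have "\<bar>z - (f ^^ i) x\<bar> < g" using d(2) germ_dist[OF r y(2)] y(1) by blast
    then have "z \<in> ball ((f ^^ i) x) g" by (simp add: dist_real_def abs_minus_commute)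
    moreover have "z \<in> {0..1}" using funpow_in[OF y01] y(1) by simp
    ultimately show "z \<in> ball ((f ^^ i) x) e \<inter> orb f I" using g(2) S(2) T(3) by blast
  qed
  moreover have "orb f I \<subseteq> closure (orb f ((f ^^ i) ` germ x r d))"
  proof -
    have "(f ^^ i) ` orb f I \<subseteq> (f ^^ i) ` closure (orb f (germ x r d))" by (rule image_mono[OF dense[OF d(1)]])
    then show ?thesis unfolding image_closure_orb[OF germ_in] M(6) .
  qed
  ultimately show "\<exists>A n. A \<subseteq> (f ^^ n) ` (ball ((f ^^ i) x) e \<inter> orb f I) \<and> orb f I \<subseteq> closure (orb f A)"
    by (intro exI[of _ "(f ^^ i) ` germ x r d"] exI[of _ 0]) simp
qed

text \<open>If the interval of \<open>x\<close> continued to the side \<open>- s\<close>, its points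
  there would be approached by orbits that started on that side, although nothing returns to it
  except possibly to \<open>x\<close> itself.\<close>

lemma crossing_endpoint:
  assumes X: "crossing x s c" and I: "periodic_interval f k I" and xM: "x \<in> orb f I"
    and n: "n \<ge> 1" "orb f I \<subseteq> closure (orb f ((f ^^ n) ` germ x (- s) c))"
  shows "x \<in> orb_endpoints f I"
proof -
  note D = crossingD[OF X]
  note M = periodic_orb_facts[OF I]
  have avoid: "z \<notin> orb f I" if z: "0 < (- s) * (z - x)" "(- s) * (z - x) < c" "z \<in> {0..1}" for z
  proof
    assume "z \<in> orb f I"
    then have zc: "z \<in> closure (orb f ((f ^^ n) ` germ x (- s) c))" using n(2) by blast
    define e where "e = min ((- s) * (z - x)) (c - (- s) * (z - x))"
    have e: "e > 0" using z unfolding e_def by simp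
    then obtain w where w: "w \<in> orb f ((f ^^ n) ` germ x (- s) c)" "\<bar>w - z\<bar> < e"
      using zc unfolding closure_approachable dist_real_def by blast
    then obtain i y where y: "y \<in> germ x (- s) c" "w = (f ^^ (i + n)) y" unfolding orb_def funpow_add_app by blast
    have "w \<in> {0..1}" using y germ_in funpow_in by blast
    moreover have "0 < (- s) * (w - x)" "(- s) * (w - x) < c"
      using w(2) side_cases[OF D(2)] unfolding e_def by auto
    ultimately have "w \<in> germ x (- s) c - {x}" unfolding germ_def by auto
    moreover have "i + n \<ge> 1" using n(1) by simp
    ultimately show False using D(6)[of "i + n" y] y by simp
  qed
  obtain i where i: "i < k" "x \<in> (f ^^ i) ` I" using xM unfolding wp_orb[OF M(1)] by blast
  obtain a b where ab: "(f ^^ i) ` I = {a..b}" "a \<le> b" "0 \<le> a" "b \<le> 1"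
    by (rule cinterval_Icc[OF cinterval_image[OF weakly_periodicD(2)[OF M(1)]], of i])
  have "x = a \<or> x = b"
  proof (rule ccontr)
    assume "\<not> (x = a \<or> x = b)"
    then have lt: "a < x" "x < b" using i(2) ab by auto
    define h where "h = min (min (x - a) (b - x)) (c / 2)"
    have h: "0 < h" "h \<le> x - a" "h \<le> b - x" "h < c" unfolding h_def using lt D(5) by auto
    have "x - s * h \<in> {a..b}" using side_cases[OF D(2)] h by auto
    then have "x - s * h \<in> orb f I" "x - s * h \<in> {0..1}" using ab image_subset_orb[of i I] by auto
    moreover have "(- s) * (x - s * h - x) = h" using side_cases[OF D(2)] by auto
    ultimately show False using avoid[of "x - s * h"] h(1,4) by metis
  qed
  then show ?thesis unfolding orb_endpoints_def using ab by blast
qed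

text \<open>The last conjunct implies the condition in \<open>A_set\<close> without mentioning the least entry time.\<close>

definition nonwandering_end :: "real \<Rightarrow> bool" where
  "nonwandering_end x \<longleftrightarrow> (\<exists>k I. periodic_interval f k I \<and> infinite (B_set f I) \<and> x \<in> orb_endpoints f I \<and>
     (\<exists>n. (f ^^ n) x \<in> B_set f I) \<and>
     (\<forall>i. (f ^^ i) x \<in> unit_top interior_of (orb f I) \<longrightarrow> (f ^^ i) x \<in> B_set f I))"

text \<open>The returning points pass through one side \<open>g\<close> of the cycle point
  \<open>e\<close>, so the tower is built at \<open>e\<close> and not at \<open>x\<close>. By
  \<open>crossing_segment\<close> the orbit of its core covers the side \<open>s\<close> of
  \<open>x\<close> and hence contains \<open>x\<close>. As \<open>e\<close> is periodic,
  \<open>infinite_B_homoclinic\<close> is used with the non-periodic preimage \<open>x\<close> of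
  \<open>e\<close>.\<close>

lemma crossing_preperiodic:
  assumes X: "crossing x s c" and pre: "(f ^^ p) ((f ^^ r) x) = (f ^^ r) x" "p \<ge> 1"
  shows "nonwandering_end x"
proof -
  note C = crossingD[OF X]
  define e where "e = (f ^^ r) x"
  have e01: "e \<in> {0..1}" unfolding e_def by (rule funpow_in[OF C(1)])
  have ep: "(f ^^ p) e = e" unfolding e_def by (rule pre(1))
  have ePer: "e \<in> Per f" unfolding Per_def using e01 ep pre(2) by blast
  have r1: "r \<ge> 1" using C(4) ePer unfolding e_def by (cases r) auto
  define P where "P g \<longleftrightarrow> (\<forall>d>0. \<forall>N. \<exists>n\<ge>N. \<exists>y \<in> germ x (- s) d. (f ^^ r) y \<in> germ e g d \<and> (f ^^ r) y \<noteq> e \<and>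
    (f ^^ n) ((f ^^ r) y) \<in> germ x s d)" for g
  have "P 1 \<or> P (-1)"
  proof (rule ccontr)
    assume "\<not> (P 1 \<or> P (-1))"
    then have n1: "\<not> P 1" and n2: "\<not> P (-1)" by auto
    obtain d1 N1 where d1: "d1 > 0" "\<forall>n\<ge>N1. \<forall>y \<in> germ x (- s) d1. (f ^^ r) y \<in> germ e 1 d1 \<and> (f ^^ r) y \<noteq> e \<longrightarrow> (f ^^ n) ((f ^^ r) y) \<notin> germ x s d1"
      using n1 unfolding P_def by blast
    obtain d2 N2 where d2: "d2 > 0" "\<forall>n\<ge>N2. \<forall>y \<in> germ x (- s) d2. (f ^^ r) y \<in> germ e (-1) d2 \<and> (f ^^ r) y \<noteq> e \<longrightarrow> (f ^^ n) ((f ^^ r) y) \<notin> germ x s d2"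
      using n2 unfolding P_def by blast
    have "min d1 d2 > 0" using d1(1) d2(1) by simp
    then obtain h where h: "h > 0" "\<forall>y\<in>{0..1}. \<bar>y - x\<bar> \<le> h \<longrightarrow> \<bar>(f ^^ r) y - (f ^^ r) x\<bar> < min d1 d2"
      using funpow_near[OF C(1)] by blast
    define d where "d = min (min d1 d2) (min h c)"
    have d: "d > 0" "d \<le> d1" "d \<le> d2" "d \<le> h" "d \<le> c" using d1(1) d2(1) h(1) C(5) by (auto simp: d_def)
    obtain n y where y: "n \<ge> max N1 N2 + r" "y \<in> germ x (- s) d" "(f ^^ n) y \<in> germ x s d" using C(8)[OF d(1)] by blast
    define n' where "n' = n - r"
    have n': "n = n' + r" "n' \<ge> N1" "n' \<ge> N2" using y(1) unfolding n'_def by auto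
    have y01: "y \<in> {0..1}" using y(2) germ_in by blast
    have fny: "(f ^^ n') ((f ^^ r) y) \<in> germ x s d" using y(3) unfolding n'(1) funpow_add_app .
    \<comment> \<open>Otherwise \<open>y\<close> and \<open>x\<close> have the same later orbit, and
      \<open>x\<close> itself would return to its side \<open>s\<close>.\<close>
    have ne: "(f ^^ r) y \<noteq> e"
    proof
      assume "(f ^^ r) y = e"
      then have "(f ^^ n) x = (f ^^ n) y" unfolding n'(1) funpow_add_app e_def by simp
      then have "(f ^^ n) x \<in> germ x s c" using y(3) germ_mono[OF d(5)] by auto
      moreover have "n \<ge> 1" using r1 n'(1) by simp
      ultimately show False using C(7) by blast
    qed
    have "\<bar>y - x\<bar> \<le> h" using germ_dist[OF C(3) y(2)] d(4) by simp
    then have "\<bar>(f ^^ r) y - e\<bar> < min d1 d2" using h(2) y01 unfolding e_def by blast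
    then have "(f ^^ r) y \<in> germ e 1 d1 \<or> (f ^^ r) y \<in> germ e (-1) d2"
      using funpow_in[OF y01, of r] unfolding germ_def by auto
    moreover have "y \<in> germ x (- s) d1" "y \<in> germ x (- s) d2" "(f ^^ n') ((f ^^ r) y) \<in> germ x s d1" "(f ^^ n') ((f ^^ r) y) \<in> germ x s d2"
      using subsetD[OF germ_mono[OF d(2)] y(2)] subsetD[OF germ_mono[OF d(3)] y(2)]
        subsetD[OF germ_mono[OF d(2)] fny] subsetD[OF germ_mono[OF d(3)] fny] by auto
    ultimately show False using d1(2)[rule_format, OF n'(2)] d2(2)[rule_format, OF n'(3)] ne by blast
  qed
  then obtain g where g: "\<bar>g\<bar> = 1" "P g"
  proof
    assume "P 1" then show thesis by (intro that[of 1]) auto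
  next
    assume "P (-1)" then show thesis by (intro that[of "-1"]) auto
  qed
  have pe: "(f ^^ (p * N)) e = e" for N using funpow_mod_period[OF ep, of "p * N"] by simp
  have ret: "\<exists>n\<ge>N. \<exists>y \<in> germ e g d. (f ^^ n) y \<in> germ e g d" if "d > 0" for d N
    using germ_base[OF e01, of d g] that pe[of N] pre(2) by (intro exI[of _ "p * N"] conjI bexI[of _ e]) auto
  have "\<not> in_solenoid e" using solenoid_not_Per ePer by blast
  then obtain k D d where d: "\<And>j::nat. d j > 0" "d \<longlonglongrightarrow> 0" and wp: "\<And>j. weakly_periodic k (D j)" and dec: "decseq D"
    and gD: "\<And>j. germ e g (d j) \<subseteq> D j" "\<And>j. closure (orb f (germ e g (d j))) = orb f (D j)"
    and eE: "\<And>j. e \<in> (f ^^ (k * j)) ` D j"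
    using germ_tower[OF e01 g(1) ret] by blast
  define H where "H = (\<Inter>j. (f ^^ (k * j)) ` D j)"
  have H: "cinterval H" "(f ^^ k) ` H = H" "\<And>j. H \<subseteq> D j" unfolding H_def using const_tower(4-6)[of k D, OF wp dec] by auto
  have eH: "e \<in> H" unfolding H_def using eE by blast
  have wH: "weakly_periodic k H" using wp_subset[OF wp H(1,3)] H(2) by simp
  have right: "q \<in> orb f H" if q: "0 < s * (q - x)" "s * (q - x) \<le> c" for q
    unfolding H_def
  proof (rule const_tower(7)[of k D, OF wp dec])
    fix j
    let ?E = "(f ^^ (k * j)) ` D j"
    define h where "h = min (min (d j) (s * (q - x))) c"
    have h: "h > 0" "h \<le> d j" "h \<le> s * (q - x)" "h \<le> c" using d(1)[of j] q C(5) by (auto simp: h_def)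
    obtain n y where n: "n \<ge> k * j" "y \<in> germ x (- s) h" "(f ^^ r) y \<in> germ e g h" "(f ^^ n) ((f ^^ r) y) \<in> germ x s h"
      using g(2) h(1) unfolding P_def by blast
    have ge: "germ e g h \<subseteq> {0..1}" "connected (germ e g h)" "e \<in> germ e g h"
      using germ_in germ_base[OF e01] cintervalD(2)[OF germ_cinterval[OF g(1) e01]] h(1) by auto
    have n1: "n + r \<ge> 1" using r1 by simp
    have yy: "(f ^^ (n + r)) y \<in> germ x s h" using n(4) unfolding funpow_add_app .
    have "q \<in> (f ^^ n) ` germ e g h"
    proof (rule crossing_segment(3)[OF X n1 h(4) n(2) yy])
      show "connected ((f ^^ n) ` germ e g h)" by (rule connected_image[OF ge(2,1)])
      show "(f ^^ (n + r)) y \<in> (f ^^ n) ` germ e g h" unfolding funpow_add_app by (rule imageI[OF n(3)])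
      show "(f ^^ (n + r)) x \<in> (f ^^ n) ` germ e g h" unfolding funpow_add_app e_def[symmetric] by (rule imageI[OF ge(3)])
    qed (use h q in auto)
    then obtain w where w: "w \<in> germ e g h" "q = (f ^^ n) w" by blast
    have "w \<in> D j" using w(1) germ_mono[OF h(2)] gD(1) by blast
    then have "(f ^^ 0) w \<in> D j" by simp
    then have "(f ^^ n) w \<in> orb f ?E" by (rule orb_tail[OF wp]) (use n(1) in simp)
    then show "q \<in> (\<Union>i<k. (f ^^ i) ` ?E)" using w(2) wp_orb[OF wp_image[OF wp]] by blast
  qed
  have xs: "x + s * (c / Suc m) \<in> orb f H" for m
  proof (rule right)
    have eq: "s * (x + s * (c / Suc m) - x) = c / Suc m" using side_cases[OF C(2)] by auto
    show "0 < s * (x + s * (c / Suc m) - x)" unfolding eq using C(5) by simp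
    show "s * (x + s * (c / Suc m) - x) \<le> c" unfolding eq using C(5) by (simp add: field_simps)
  qed
  have xM: "x \<in> orb f H"
  proof (rule closed_sequentially[OF compact_imp_closed[OF wp_compact_orb[OF wH]] xs])
    have "(\<lambda>m. x + s * (c / Suc m)) \<longlonglongrightarrow> x + s * 0"
      by (intro tendsto_intros LIMSEQ_Suc[OF lim_const_over_n])
    then show "(\<lambda>m. x + s * (c / Suc m)) \<longlonglongrightarrow> x" by simp
  qed
  have "\<exists>t\<in>H. t \<noteq> e"
  proof (rule ccontr)
    assume "\<not> ?thesis"
    then have "H = {e}" using eH by blast
    then have "x \<in> orb f {e}" using xM by simp
    then have "(f ^^ p) x = x" by (rule periodic_orb_point(2)[OF ep pre(2)])
    then show False using C(1,4) pre(2) unfolding Per_def by blast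
  qed
  then have per: "periodic_interval f k H" using periodic_intervalI[OF wH H(1,2) order_refl eH] by blast
  have MD: "orb f H \<subseteq> closure (orb f (germ e g (d j)))" for j unfolding gD(2) by (rule orb_mono[OF H(3)])
  have into: "\<exists>j. germ e g (d j) \<subseteq> (f ^^ r) ` germ x (- s) h" if h: "h > 0" for h
  proof -
    obtain y where y: "y \<in> germ x (- s) h" "(f ^^ r) y \<in> germ e g h" "(f ^^ r) y \<noteq> e"
      using g(2) h unfolding P_def by blast
    have pos: "g * ((f ^^ r) y - e) > 0" by (rule germ_pos[OF g(1) y(2,3)])
    then obtain j where "\<bar>d j\<bar> < g * ((f ^^ r) y - e)" using d(2) unfolding LIMSEQ_def dist_real_def by force
    then have "germ e g (d j) \<subseteq> germ e g (g * ((f ^^ r) y - e))" by (intro germ_mono) simp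
    also have "\<dots> \<subseteq> (f ^^ r) ` germ x (- s) h"
    proof (rule germ_subset_connected[OF g(1)])
      show "connected ((f ^^ r) ` germ x (- s) h)"
        by (intro connected_image germ_in cintervalD(2)[OF germ_cinterval]) (use C h in auto)
      show "e \<in> (f ^^ r) ` germ x (- s) h" unfolding e_def using germ_base[OF C(1)] h by simp
      show "(f ^^ r) y \<in> (f ^^ r) ` germ x (- s) h" using y(1) by (rule imageI)
    qed
    finally show ?thesis by blast
  qed
  have densr: "orb f H \<subseteq> closure (orb f ((f ^^ r) ` germ x (- s) h))" if h: "h > 0" for h
  proof -
    obtain j where "germ e g (d j) \<subseteq> (f ^^ r) ` germ x (- s) h" using into[OF h] by blast
    then have "closure (orb f (germ e g (d j))) \<subseteq> closure (orb f ((f ^^ r) ` germ x (- s) h))"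
      by (intro closure_mono orb_mono)
    with MD show ?thesis by (rule order_trans)
  qed
  have dens: "orb f H \<subseteq> closure (orb f (germ x (- s) h))" if h: "h > 0" for h
    using densr[OF h] closure_orb_mono[OF image_subset_orb[of r "germ x (- s) h"]] by (rule order_trans)
  \<comment> \<open>The core may lie only on the side of \<open>e\<close> opposite to the germs that
    generate the tower; then \<open>opposite_germ_full\<close> applies.\<close>
  have "\<exists>t. full_germ (orb f H) e t"
  proof (cases "\<exists>t\<in>H. g * (t - e) > 0")
    case True
    then obtain t where t: "t \<in> H" "g * (t - e) > 0" by blast
    have "germ e g (g * (t - e)) \<subseteq> H" by (rule germ_subset_connected[OF g(1) cintervalD(2)[OF H(1)] eH t(1)])
    then have "full_germ (orb f H) e g"
      using eH t orb_superset[of H] by (intro full_germ_of_tower[OF per g(1) _ _ t(2) _ d(2) MD]) auto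
    then show ?thesis ..
  next
    case False
    then have "full_germ (orb f H) e (- g)"
      by (intro opposite_germ_full[OF ep pre(2) g(1) d wp dec gD H_def eH _ per]) (auto simp: not_less)
    then show ?thesis ..
  qed
  then obtain t where t: "full_germ (orb f H) e t" ..
  have "infinite (B_set f H)"
    by (rule infinite_B_homoclinic[OF per t ep pre(2) xM C(4)]) (simp add: e_def)
  moreover have "x \<in> orb_endpoints f H" by (rule crossing_endpoint[OF X per xM r1 densr[OF C(5)]])
  moreover have "(f ^^ r) x \<in> B_set f H" using full_germ_B[OF per t] unfolding e_def .
  moreover have "(f ^^ i) x \<in> B_set f H" if "(f ^^ i) x \<in> unit_top interior_of (orb f H)" for i
    by (rule crossing_interior_B[OF per C(1,3) dens that])
  ultimately show ?thesis unfolding nonwandering_end_def using per by blast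
qed

text \<open>The images \<open>J j\<close> of shrinking germs on the side \<open>- s\<close> all
  contain the point \<open>q0\<close> at distance \<open>c\<close> on the side \<open>s\<close>,
  whereas \<open>x\<close> is reached only as a limit. The tower is therefore based at
  \<open>q0\<close>, and closedness puts \<open>x\<close> into its core. The infinite orbit of
  \<open>x\<close> meets the interior of the orbit of the core, and from there on it stays in the
  basic set, which is thus infinite.\<close>

lemma crossing_not_preperiodic:
  assumes X: "crossing x s c" and npre: "\<And>p r. p \<ge> 1 \<Longrightarrow> (f ^^ p) ((f ^^ r) x) \<noteq> (f ^^ r) x"
  shows "in_solenoid x \<or> nonwandering_end x"
proof -
  note C = crossingD[OF X]
  define d where "d j = c / real (j + 2)" for j
  have d: "d j > 0" "d j \<le> c" for j using C(5) unfolding d_def by (auto simp: field_simps)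
  have dlim: "d \<longlonglongrightarrow> 0" unfolding d_def by (rule LIMSEQ_ignore_initial_segment[OF lim_const_over_n])
  have "\<exists>n. \<forall>j. (n j \<ge> 1 \<and> (\<exists>y \<in> germ x (- s) (d j). (f ^^ n j) y \<in> germ x s (d j))) \<and> n j < n (Suc j)"
  proof (rule dependent_nat_choice)
    show "\<exists>n. n \<ge> 1 \<and> (\<exists>y \<in> germ x (- s) (d 0). (f ^^ n) y \<in> germ x s (d 0))"
      using C(8)[OF d(1)[of 0], of 1] by blast
    fix n j
    obtain n' where "n' \<ge> Suc n" "\<exists>y \<in> germ x (- s) (d (Suc j)). (f ^^ n') y \<in> germ x s (d (Suc j))"
      using C(8)[OF d(1)[of "Suc j"], of "Suc n"] by blast
    then show "\<exists>n'. (n' \<ge> 1 \<and> (\<exists>y \<in> germ x (- s) (d (Suc j)). (f ^^ n') y \<in> germ x s (d (Suc j)))) \<and> n < n'"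
      by (intro exI[of _ n']) auto
  qed
  then obtain n where n: "\<And>j. n j \<ge> 1" "\<And>j. \<exists>y \<in> germ x (- s) (d j). (f ^^ n j) y \<in> germ x s (d j)" "\<And>j. n j < n (Suc j)"
    by blast
  have nadd: "n j + i \<le> n (j + i)" for i j
  proof (induction i)
    case (Suc i) then show ?case using n(3)[of "j + i"] by simp
  qed simp
  define L where "L j = germ x (- s) (d j)" for j
  have cL: "cinterval (L j)" for j unfolding L_def using germ_cinterval[OF C(3,1)] d(1)[of j] by simp
  have Lmono: "L j' \<subseteq> L j" if "j \<le> j'" for j j'
  proof -
    have "d j' \<le> d j" unfolding d_def using that C(5) by (intro divide_left_mono) auto
    then show ?thesis unfolding L_def by (rule germ_mono)
  qed
  define J where "J j = (f ^^ n j) ` L j" for j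
  have cJ: "cinterval (J j)" for j unfolding J_def by (rule cinterval_image[OF cL])
  have seg: "q \<in> J j" if "d j \<le> s * (q - x)" "s * (q - x) \<le> c" for q j
  proof -
    obtain y where y: "y \<in> germ x (- s) (d j)" "(f ^^ n j) y \<in> germ x s (d j)" using n(2) by blast
    have "(f ^^ n j) y \<in> J j" "(f ^^ n j) x \<in> J j"
      unfolding J_def L_def using y(1) germ_base[OF C(1)] d(1)[of j] by auto
    then show ?thesis
      by (rule crossing_segment(3)[OF X n(1) d(2) y cintervalD(2)[OF cJ]]) (use that in auto)
  qed
  have Jsub: "J (j + i) \<subseteq> (f ^^ (n (j + i) - n j)) ` J j" for i j
  proof -
    have "n j \<le> n (j + i)" using nadd[of j i] by simp
    then have "(f ^^ (n (j + i) - n j)) ` J j = (f ^^ n (j + i)) ` L j"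
      unfolding J_def funpow_image_add[symmetric] by simp
    then show ?thesis unfolding J_def using Lmono[of j "j + i"] by (simp add: image_mono)
  qed
  define q0 where "q0 = x + s * c"
  have sq0: "s * (q0 - x) = c" using side_cases[OF C(2)] by (auto simp: q0_def)
  have q0J: "q0 \<in> J j" for j by (rule seg) (use sq0 d(2) in auto)
  have "\<exists>k D. weakly_periodic k D \<and> J j \<subseteq> D \<and> closure (orb f (J j)) = orb f D" for j
  proof -
    let ?m = "n (j + 1) - n j"
    have m: "?m \<ge> 1" using n(3)[of j] by simp
    \<comment> \<open>The next image is contained in an image of \<open>J j\<close>, and both
      contain \<open>q0\<close>.\<close>
    have "q0 \<in> (f ^^ ?m) ` J j \<inter> J j" using q0J[of "j + 1"] Jsub[of j 1] q0J[of j] by blast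
    then have "(f ^^ ?m) ` J j \<inter> J j \<noteq> {}" by blast
    from wp_exists[OF cJ m this] show ?thesis by metis
  qed
  then obtain k D where kD: "\<And>j. weakly_periodic (k j) (D j)" "\<And>j. J j \<subseteq> D j" "\<And>j. closure (orb f (J j)) = orb f (D j)"
    by metis
  have q0D: "q0 \<in> D j" for j using q0J kD(2) by blast
  have decD: "decseq D"
    unfolding decseq_Suc_iff
  proof
    fix j
    have "J (j + 1) \<subseteq> orb f (J j)" using Jsub[of j 1] image_subset_orb by (rule order_trans)
    then have "orb f (D (j + 1)) \<subseteq> orb f (D j)" unfolding kD(3)[symmetric] by (rule closure_orb_mono)
    then show "D (Suc j) \<subseteq> D j" using wp_refine(1)[OF kD(1) kD(1) _ q0D q0D] by simp
  qed
  have qD: "q \<in> (f ^^ (k j * i)) ` D j" if q: "0 < s * (q - x)" "s * (q - x) \<le> c" for q i j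
  proof -
    obtain M where M: "\<And>m. m \<ge> M \<Longrightarrow> d m \<le> s * (q - x)"
      using order_tendstoD(2)[OF dlim q(1)] unfolding eventually_sequentially by (meson less_imp_le)
    define l where "l = M + k j * i"
    let ?m = "n (j + l) - n j"
    have m: "?m \<ge> k j * i" using nadd[of j l] unfolding l_def by simp
    have "d (j + l) \<le> s * (q - x)" by (rule M) (simp add: l_def)
    then have "q \<in> J (j + l)" using q(2) by (rule seg)
    moreover have sub: "J (j + l) \<subseteq> (f ^^ ?m) ` D j" using Jsub[of j l] image_mono[OF kD(2)] by (rule order_trans)
    ultimately have q: "q \<in> (f ^^ ?m) ` D j" by blast
    have "q0 \<in> (f ^^ ?m) ` D j" using sub q0J by blast
    then have "k j dvd ?m" by (rule wp_return[OF kD(1) q0D])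
    then obtain a where a: "?m = k j * a" by (elim dvdE)
    have "k j \<ge> 1" using weakly_periodicD(1)[OF kD(1)] .
    then have "i \<le> a" using m unfolding a by simp
    then have "(f ^^ ?m) ` D j \<subseteq> (f ^^ (k j * i)) ` D j" unfolding a by (rule wp_power_decr[OF kD(1)])
    then show ?thesis using q by blast
  qed
  have xs: "0 < s * (x + s * (c / Suc m) - x)" "s * (x + s * (c / Suc m) - x) \<le> c" for m
  proof -
    have eq: "s * (x + s * (c / Suc m) - x) = c / Suc m" using side_cases[OF C(2)] by auto
    show "0 < s * (x + s * (c / Suc m) - x)" unfolding eq using C(5) by simp
    show "s * (x + s * (c / Suc m) - x) \<le> c" unfolding eq using C(5) by (simp add: field_simps)
  qed
  have xD: "x \<in> (f ^^ (k j * i)) ` D j" for i j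
  proof (rule closed_sequentially)
    show "closed ((f ^^ (k j * i)) ` D j)" by (rule cintervalD(5)[OF cinterval_image[OF weakly_periodicD(2)[OF kD(1)]]])
    show "x + s * (c / Suc m) \<in> (f ^^ (k j * i)) ` D j" for m by (rule qD[OF xs])
    have "(\<lambda>m. x + s * (c / Suc m)) \<longlonglongrightarrow> x + s * 0"
      by (intro tendsto_intros LIMSEQ_Suc[OF lim_const_over_n])
    then show "(\<lambda>m. x + s * (c / Suc m)) \<longlonglongrightarrow> x" by simp
  qed
  from tower_dichotomy[of k D, OF kD(1) decD xD] show ?thesis
  proof
    assume "\<exists>j0. \<forall>j\<ge>j0. k j = k j0"
    then obtain j0 where j0: "\<And>j. j \<ge> j0 \<Longrightarrow> k j = k j0" by blast
    define K where "K = k j0"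
    define D' where "D' j = D (j + j0)" for j
    have wp: "weakly_periodic K (D' j)" for j using kD(1)[of "j + j0"] j0[of "j + j0"] by (simp add: K_def D'_def)
    have dec: "decseq D'" unfolding D'_def by (intro antimonoI decseqD[OF decD]) simp
    define H where "H = (\<Inter>j. (f ^^ (K * j)) ` D' j)"
    have H: "cinterval H" "(f ^^ K) ` H = H" "\<And>j. H \<subseteq> D' j" unfolding H_def using const_tower(4-6)[of K D', OF wp dec] by auto
    have inH: "q \<in> H" if "\<And>i j. q \<in> (f ^^ (k j * i)) ` D j" for q
      unfolding H_def D'_def K_def
    proof
      fix j show "q \<in> (f ^^ (k j0 * j)) ` D (j + j0)" using that[of "j + j0" j] j0[of "j + j0"] by simp
    qed
    have xH: "x \<in> H" using inH xD by blast
    have q0H: "q0 \<in> H" using inH qD[of q0] sq0 C(5) by simp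
    have "x \<noteq> q0" using sq0 C(5) by auto
    then have per: "periodic_interval f K H" by (rule periodic_intervalI[OF wp H xH q0H])
    note M = periodic_orb_facts[OF per]
    have xM: "x \<in> orb f H" using xH M(7) by blast
    have MJ: "orb f H \<subseteq> closure (orb f (J (j + j0)))" for j unfolding kD(3) using orb_mono[OF H(3)[of j]] by (simp add: D'_def)
    have dens: "orb f H \<subseteq> closure (orb f (germ x (- s) h))" if h: "h > 0" for h
    proof -
      obtain N where "\<And>m. m \<ge> N \<Longrightarrow> d m < h" using order_tendstoD(2)[OF dlim h] unfolding eventually_sequentially by blast
      then have "d (N + j0) \<le> h" by (simp add: less_imp_le)
      then have "L (N + j0) \<subseteq> germ x (- s) h" unfolding L_def by (rule germ_mono)
      then have "J (N + j0) \<subseteq> (f ^^ n (N + j0)) ` germ x (- s) h" unfolding J_def by (rule image_mono)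
      then have "J (N + j0) \<subseteq> orb f (germ x (- s) h)" using image_subset_orb by (rule order_trans)
      then have "closure (orb f (J (N + j0))) \<subseteq> closure (orb f (germ x (- s) h))" by (rule closure_orb_mono)
      with MJ show ?thesis by (rule order_trans)
    qed
    have int: "(f ^^ i) x \<in> B_set f H" if "(f ^^ i) x \<in> unit_top interior_of (orb f H)" for i
      by (rule crossing_interior_B[OF per C(1,3) dens that])
    have "L j0 \<subseteq> germ x (- s) c" unfolding L_def using d(2) by (rule germ_mono)
    then have "J j0 \<subseteq> (f ^^ n j0) ` germ x (- s) c" unfolding J_def by (rule image_mono)
    then have "closure (orb f (J j0)) \<subseteq> closure (orb f ((f ^^ n j0) ` germ x (- s) c))" by (intro closure_mono orb_mono)
    with MJ[of 0] have "orb f H \<subseteq> closure (orb f ((f ^^ n j0) ` germ x (- s) c))" by auto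
    then have endp: "x \<in> orb_endpoints f H" by (rule crossing_endpoint[OF X per xM n(1)])
    have inj: "inj (\<lambda>i. (f ^^ i) x)"
    proof (rule injI)
      have neq: "(f ^^ a) x \<noteq> (f ^^ b) x" if "a < b" for a b
      proof
        assume "(f ^^ a) x = (f ^^ b) x"
        then have "(f ^^ (b - a)) ((f ^^ a) x) = (f ^^ a) x" unfolding funpow_add_app[symmetric] using that by simp
        then show False using npre[of "b - a" a] that by simp
      qed
      fix a b assume "(f ^^ a) x = (f ^^ b) x"
      then show "a = b" using neq[of a b] neq[of b a] by (metis linorder_neqE_nat)
    qed
    then have "infinite (range (\<lambda>i. (f ^^ i) x))" using finite_imageD by blast
    moreover have "range (\<lambda>i. (f ^^ i) x) \<subseteq> orb f H" using orb_iter[OF xM] by blast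
    ultimately obtain z e where z: "z \<in> range (\<lambda>i. (f ^^ i) x)" "e > 0" "ball z e \<subseteq> orb f H"
      by (rule finite_complement_interior[OF M(1)])
    then obtain l where l: "z = (f ^^ l) x" by blast
    have "openin unit_top (ball z e)"
      using z(3) M(2) by (intro open_subset) auto
    then have "z \<in> unit_top interior_of (orb f H)" unfolding interior_of_def using z(2,3) by auto
    then have lB: "(f ^^ l) x \<in> B_set f H" using int l by blast
    have "infinite (B_set f H)"
    proof
      assume fin: "finite (B_set f H)"
      have "inj (\<lambda>i. (f ^^ i) ((f ^^ l) x))"
        unfolding funpow_add_app[symmetric] using inj unfolding inj_def by (metis add_right_cancel)
      then have "infinite (range (\<lambda>i. (f ^^ i) ((f ^^ l) x)))" using finite_imageD by blast
      moreover have "range (\<lambda>i. (f ^^ i) ((f ^^ l) x)) \<subseteq> B_set f H" using B_set_forward[OF per lB] by blast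
      ultimately show False using fin by (metis finite_subset)
    qed
    then have "nonwandering_end x" unfolding nonwandering_end_def using per endp lB int by blast
    then show ?thesis ..
  qed blast
qed

section \<open>Reduction of non-wandering points to recurrence or crossing\<close>

lemma nonwandering_iff:
  "x \<in> nonwandering f \<longleftrightarrow> x \<in> {0..1} \<and> (\<forall>d>0. \<exists>n\<ge>1. \<exists>y\<in>{0..1}. \<bar>y - x\<bar> < d \<and> \<bar>(f ^^ n) y - x\<bar> < d)"
proof (intro iffI conjI allI impI)
  assume x: "x \<in> nonwandering f"
  then show "x \<in> {0..1}" by (simp add: nonwandering_def)
  fix d :: real assume "d > 0"
  have "openin unit_top ({0..1} \<inter> ball x d)" by (rule openin_open_Int) simp
  moreover have "x \<in> {0..1} \<inter> ball x d" using x \<open>d > 0\<close> by (simp add: nonwandering_def)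
  ultimately obtain n where n: "n \<ge> 1" "(f ^^ n) ` ({0..1} \<inter> ball x d) \<inter> ({0..1} \<inter> ball x d) \<noteq> {}"
    using x unfolding nonwandering_def by blast
  then obtain y where "y \<in> {0..1} \<inter> ball x d" "(f ^^ n) y \<in> ball x d" by blast
  then show "\<exists>n\<ge>1. \<exists>y\<in>{0..1}. \<bar>y - x\<bar> < d \<and> \<bar>(f ^^ n) y - x\<bar> < d"
    using n(1) by (intro exI[of _ n] conjI bexI[of _ y]) (auto simp: dist_real_def)
next
  assume x: "x \<in> {0..1} \<and> (\<forall>d>0. \<exists>n\<ge>1. \<exists>y\<in>{0..1}. \<bar>y - x\<bar> < d \<and> \<bar>(f ^^ n) y - x\<bar> < d)"
  have "\<exists>n\<ge>1. (f ^^ n) ` U \<inter> U \<noteq> {}" if U: "openin unit_top U" "x \<in> U" for U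
  proof -
    obtain S where S: "open S" "U = {0..1} \<inter> S" using U(1) openin_open by blast
    then obtain d where d: "d > 0" "ball x d \<subseteq> S" using U(2) by (meson IntD2 openE)
    obtain n y where n: "n \<ge> 1" "y \<in> {0..1}" "\<bar>y - x\<bar> < d" "\<bar>(f ^^ n) y - x\<bar> < d" using x d(1) by blast
    then have "y \<in> U" "(f ^^ n) y \<in> U" using S(2) d(2) funpow_in[OF n(2), of n] by (auto simp: dist_real_def)
    then show ?thesis using n(1) by blast
  qed
  then show "x \<in> nonwandering f" using x by (simp add: nonwandering_def)
qed

text \<open>Each of the finitely many times below \<open>N\<close> moves the non-periodic
  \<open>x\<close> by a positive distance, and nearby points follow by continuity.\<close>

lemma no_short_return:
  assumes x: "x \<in> {0..1}" "x \<notin> Per f"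
  obtains d where "d > 0" "\<And>n y. 1 \<le> n \<Longrightarrow> n < N \<Longrightarrow> y \<in> {0..1} \<Longrightarrow> \<bar>y - x\<bar> \<le> d \<Longrightarrow> \<bar>(f ^^ n) y - x\<bar> > d"
proof -
  have "\<exists>d>0. \<forall>n y. 1 \<le> n \<longrightarrow> n < N \<longrightarrow> y \<in> {0..1} \<longrightarrow> \<bar>y - x\<bar> \<le> d \<longrightarrow> \<bar>(f ^^ n) y - x\<bar> > d"
  proof (induction N)
    case (Suc N)
    then obtain d where d: "d > 0" "\<forall>n y. 1 \<le> n \<longrightarrow> n < N \<longrightarrow> y \<in> {0..1} \<longrightarrow> \<bar>y - x\<bar> \<le> d \<longrightarrow> \<bar>(f ^^ n) y - x\<bar> > d" by blast
    show ?case
    proof (cases "N = 0")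
      case False
      then have "(f ^^ N) x \<noteq> x" using x unfolding Per_def by auto
      then have g: "\<bar>(f ^^ N) x - x\<bar> / 2 > 0" by simp
      then obtain h where h: "h > 0" "\<forall>y\<in>{0..1}. \<bar>y - x\<bar> \<le> h \<longrightarrow> \<bar>(f ^^ N) y - (f ^^ N) x\<bar> < \<bar>(f ^^ N) x - x\<bar> / 2"
        using funpow_near[OF x(1)] by blast
      define m where "m = min (min d h) (\<bar>(f ^^ N) x - x\<bar> / 2)"
      have m: "m > 0" "m \<le> d" "m \<le> h" using d(1) h(1) g unfolding m_def by auto
      have m4: "m \<le> \<bar>(f ^^ N) x - x\<bar> / 2" unfolding m_def by (rule min.cobounded2)
      have "\<bar>(f ^^ n) y - x\<bar> > m" if "1 \<le> n" "n < Suc N" "y \<in> {0..1}" "\<bar>y - x\<bar> \<le> m" for n y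
      proof (cases "n = N")
        case True
        have "\<bar>y - x\<bar> \<le> h" using that(4) m(3) by simp
        then have "\<bar>(f ^^ N) y - (f ^^ N) x\<bar> < \<bar>(f ^^ N) x - x\<bar> / 2" using h(2) that(3) by blast
        moreover have "\<bar>(f ^^ N) x - x\<bar> \<le> \<bar>(f ^^ N) y - (f ^^ N) x\<bar> + \<bar>(f ^^ N) y - x\<bar>" by linarith
        ultimately show ?thesis using m4 unfolding True by simp
      next
        case False
        then have "\<bar>(f ^^ n) y - x\<bar> > d" using d(2) that m(2) by auto
        then show ?thesis using m(2) by simp
      qed
      then show ?thesis using m(1) by blast
    qed (use d in auto)
  qed (auto intro: exI[of _ 1])
  then show thesis using that by blast
qed

text \<open>Off the closure of the periodic points all returns near \<open>x\<close> move in one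
  direction \<open>s\<close>. If they stay within one side at arbitrarily late times,
  \<open>recurrent_germ\<close> applies; otherwise all returns to a small neighbourhood lead from
  the side \<open>- s\<close> to the side \<open>s\<close>.\<close>

lemma nonwandering_tetrachotomy:
  assumes x: "x \<in> nonwandering f"
  shows "x \<in> genus0_union f \<or> in_solenoid x \<or> in_basic x \<or> nonwandering_end x"
proof (cases "x \<in> closure (Per f)")
  case False
  have x01: "x \<in> {0..1}" using x by (simp add: nonwandering_def)
  have nper: "x \<notin> Per f" using False closure_subset by blast
  have "\<exists>g>0. \<forall>q\<in>Per f. g \<le> \<bar>q - x\<bar>" using False unfolding closure_approachable dist_real_def by (meson not_less)
  then obtain g where g: "g > 0" "\<And>q. q \<in> Per f \<Longrightarrow> g \<le> \<bar>q - x\<bar>" by blast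
  define J where "J = ball x g \<inter> {0..1}"
  have J: "connected J" "J \<subseteq> {0..1}" "J \<inter> Per f = {}"
    unfolding J_def using g(2) by (auto intro!: convex_connected convex_Int simp: dist_real_def abs_minus_commute) (meson not_less)
  have inJ: "y \<in> J" if "y \<in> {0..1}" "\<bar>y - x\<bar> < g" for y using that unfolding J_def by (simp add: dist_real_def abs_minus_commute)
  obtain n0 y0 where y0: "n0 \<ge> 1" "y0 \<in> J" "(f ^^ n0) y0 \<in> J"
  proof -
    obtain n y where "n \<ge> 1" "y \<in> {0..1}" "\<bar>y - x\<bar> < g" "\<bar>(f ^^ n) y - x\<bar> < g"
      using x g(1) unfolding nonwandering_iff by blast
    then show thesis using that inJ funpow_in by blast
  qed
  define s where "s = sgn ((f ^^ n0) y0 - y0)"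
  have "(f ^^ n0) y0 \<noteq> y0" using J(2,3) y0 unfolding Per_def by blast
  then have s: "\<bar>s\<bar> = 1" "s * ((f ^^ n0) y0 - y0) > 0" unfolding s_def by (auto simp: sgn_if)
  have s': "\<bar>- s\<bar> = 1" using s(1) by simp
  have dir: "s * ((f ^^ n) y - y) > 0" if "n \<ge> 1" "y \<in> {0..1}" "\<bar>y - x\<bar> < g" "\<bar>(f ^^ n) y - x\<bar> < g" for n y
    using that by (intro const_direction[OF J s(1) y0(2,3,1) s(2)] inJ funpow_in) auto
  define P1 where "P1 \<longleftrightarrow> (\<forall>d>0. \<forall>N. \<exists>n\<ge>N. \<exists>y \<in> germ x s d. (f ^^ n) y \<in> germ x s d)"
  define P2 where "P2 \<longleftrightarrow> (\<forall>d>0. \<forall>N. \<exists>n\<ge>N. \<exists>y \<in> germ x (- s) d. (f ^^ n) y \<in> germ x (- s) d \<and> (f ^^ n) y \<noteq> x)"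
  consider "P1" | "P2" | "\<not> P1" "\<not> P2" by blast
  then show ?thesis
  proof cases
    case 1
    have "\<exists>n\<ge>N. \<exists>y \<in> germ x s d. (f ^^ n) y \<in> germ x s d \<and> (f ^^ n) y \<noteq> x" if d: "d > 0" for d N
    proof -
      have "min d (g / 2) > 0" using d g(1) by simp
      then obtain n y where n: "n \<ge> max N 1" "y \<in> germ x s (min d (g/2))" "(f ^^ n) y \<in> germ x s (min d (g/2))"
        using 1 unfolding P1_def by blast
      have y01: "y \<in> {0..1}" using n(2) germ_in by blast
      have "\<bar>y - x\<bar> < g" "\<bar>(f ^^ n) y - x\<bar> < g" using germ_dist[OF s(1) n(2)] germ_dist[OF s(1) n(3)] g(1) by auto
      then have "s * ((f ^^ n) y - y) > 0" using n(1) y01 by (intro dir) auto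
      moreover have "s * (y - x) \<ge> 0" using n(2) by (simp add: germ_def)
      \<comment> \<open>A point on the side \<open>s\<close> moves on in the direction
        \<open>s\<close>, so it cannot land on \<open>x\<close>.\<close>
      ultimately have "(f ^^ n) y \<noteq> x" by (auto simp: algebra_simps)
      moreover have "y \<in> germ x s d" "(f ^^ n) y \<in> germ x s d"
        using subsetD[OF germ_mono n(2), of d] subsetD[OF germ_mono n(3), of d] by auto
      ultimately show ?thesis using n(1) by (intro exI[of _ n] conjI bexI[of _ y]) auto
    qed
    from recurrent_germ[OF x01 nper s(1) this] show ?thesis by blast
  next
    case 2
    then have "in_solenoid x \<or> in_basic x"
      unfolding P2_def by (intro recurrent_germ[OF x01 nper s']) blast
    then show ?thesis by blast
  next
    case 3
    obtain d1 N1 where d1: "d1 > 0" "\<forall>n\<ge>N1. \<forall>y \<in> germ x s d1. (f ^^ n) y \<notin> germ x s d1"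
      using 3(1) unfolding P1_def by blast
    obtain d2 N2 where d2: "d2 > 0" "\<forall>n\<ge>N2. \<forall>y \<in> germ x (- s) d2. (f ^^ n) y \<in> germ x (- s) d2 \<longrightarrow> (f ^^ n) y = x"
      using 3(2) unfolding P2_def by blast
    obtain d3 where d3: "d3 > 0" "\<And>n y. 1 \<le> n \<Longrightarrow> n < max N1 N2 \<Longrightarrow> y \<in> {0..1} \<Longrightarrow> \<bar>y - x\<bar> \<le> d3 \<Longrightarrow> \<bar>(f ^^ n) y - x\<bar> > d3"
      by (rule no_short_return[OF x01 nper, of "max N1 N2"]) blast
    define c where "c = min (min d1 d2) d3"
    have c: "c > 0" "c \<le> d1" "c \<le> d2" "c \<le> d3" using d1(1) d2(1) d3(1) by (auto simp: c_def)
    \<comment> \<open>By the choice of \<open>d3\<close>, returns within \<open>c\<close> are late;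
      so the negations of \<open>P1\<close> and \<open>P2\<close>, which concern late times only,
      apply to all \<open>n \<ge> 1\<close>.\<close>
    have long: "n \<ge> max N1 N2" if "n \<ge> 1" "y \<in> {0..1}" "\<bar>y - x\<bar> \<le> c" "\<bar>(f ^^ n) y - x\<bar> \<le> c" for n y
      using d3(2)[of n y] that c(4) by (meson dual_order.trans linorder_not_less)
    have R: "(f ^^ n) y \<notin> germ x s c" if "n \<ge> 1" "y \<in> germ x s c" for n y
    proof
      assume fy: "(f ^^ n) y \<in> germ x s c"
      have "y \<in> {0..1}" using that(2) germ_in by blast
      then have "n \<ge> max N1 N2" by (rule long[OF that(1) _ germ_dist[OF s(1) that(2)] germ_dist[OF s(1) fy]])
      moreover have "y \<in> germ x s d1" "(f ^^ n) y \<in> germ x s d1" using subsetD[OF germ_mono[OF c(2)]] that(2) fy by auto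
      ultimately show False using d1(2) by auto
    qed
    have Lf: "(f ^^ n) y \<notin> germ x (- s) c - {x}" if "n \<ge> 1" "y \<in> germ x (- s) c" for n y
    proof
      assume fy: "(f ^^ n) y \<in> germ x (- s) c - {x}"
      have "y \<in> {0..1}" using that(2) germ_in by blast
      then have "n \<ge> max N1 N2" using fy by (intro long[OF that(1) _ germ_dist[OF s' that(2)] germ_dist[OF s']]) auto
      moreover have "y \<in> germ x (- s) d2" "(f ^^ n) y \<in> germ x (- s) d2" using subsetD[OF germ_mono[OF c(3)]] that(2) fy by auto
      ultimately show False using d2(2) fy by auto
    qed
    have X3: "\<exists>n\<ge>N. \<exists>y \<in> germ x (- s) d. (f ^^ n) y \<in> germ x s d" if d: "d > 0" for d N
    proof -
      obtain e where e: "e > 0" "\<And>n y. 1 \<le> n \<Longrightarrow> n < N \<Longrightarrow> y \<in> {0..1} \<Longrightarrow> \<bar>y - x\<bar> \<le> e \<Longrightarrow> \<bar>(f ^^ n) y - x\<bar> > e"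
        by (rule no_short_return[OF x01 nper, of N]) blast
      define h where "h = min (min d e) (min c g)"
      have h: "h > 0" "h \<le> d" "h \<le> e" "h \<le> c" "h \<le> g" using d e(1) c(1) g(1) by (auto simp: h_def)
      obtain n y where n: "n \<ge> 1" "y \<in> {0..1}" "\<bar>y - x\<bar> < h" "\<bar>(f ^^ n) y - x\<bar> < h"
        using x h(1) unfolding nonwandering_iff by blast
      have nN: "n \<ge> N" using e(2)[of n y] n h(3) by (meson dual_order.trans less_imp_le linorder_not_less)
      have f01: "(f ^^ n) y \<in> {0..1}" by (rule funpow_in[OF n(2)])
      have sd: "s * ((f ^^ n) y - y) > 0" using n h(5) by (intro dir) auto
      have two: "z \<in> germ x s h \<or> z \<in> germ x (- s) h - {x}" if "z \<in> {0..1}" "\<bar>z - x\<bar> < h" for z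
        using that side_cases[OF s(1)] unfolding germ_def by auto
      have hc: "germ x s h \<subseteq> germ x s c" "germ x (- s) h \<subseteq> germ x (- s) c" by (rule germ_mono[OF h(4)])+
      have ynot: "y \<notin> germ x s h"
      proof
        assume y: "y \<in> germ x s h"
        then have "s * (y - x) \<ge> 0" by (simp add: germ_def)
        then have "s * ((f ^^ n) y - x) \<ge> 0" using sd by (simp add: algebra_simps)
        then have "(f ^^ n) y \<in> germ x s h" using f01 n(4) side_cases[OF s(1)] unfolding germ_def by auto
        then show False using R[OF n(1)] y hc(1) by blast
      qed
      then have yL: "y \<in> germ x (- s) h" using two[OF n(2,3)] by blast
      have "(f ^^ n) y \<in> germ x s h" using two[OF f01 n(4)] Lf[OF n(1)] yL hc(2) by blast
      then show ?thesis using nN yL subsetD[OF germ_mono[OF h(2)]] by blast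
    qed
    have xg: "x \<in> germ x s c" by (rule germ_base[OF x01]) (use c in simp)
    have X: "crossing x s c" unfolding crossing_def
      using x01 s(1) nper c(1) Lf R[OF _ xg] X3 by blast
    show ?thesis
    proof (cases "\<exists>p r. p \<ge> 1 \<and> (f ^^ p) ((f ^^ r) x) = (f ^^ r) x")
      case True
      then show ?thesis using crossing_preperiodic[OF X] by blast
    next
      case False
      then show ?thesis using crossing_not_preperiodic[OF X] by blast
    qed
  qed
qed (use closure_Per_trichotomy in blast)

section \<open>Solenoidal sets\<close>

lemma periodic_image_multiple:
  assumes "periodic_interval f k I" shows "(f ^^ (k * q)) ` I = I"
proof (induction q)
  case (Suc q)
  have "(f ^^ (k * Suc q)) ` I = (f ^^ k) ` ((f ^^ (k * q)) ` I)" by (simp add: funpow_image_add)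
  then show ?case using Suc periodic_orb_facts(10)[OF assms] by simp
qed simp

lemma periodic_image_mod:
  assumes "periodic_interval f k I" shows "(f ^^ i) ` I = (f ^^ (i mod k)) ` I"
proof -
  have "(f ^^ i) ` I = (f ^^ (i mod k)) ` ((f ^^ (k * (i div k))) ` I)"
    unfolding funpow_image_add[symmetric] by simp
  then show ?thesis unfolding periodic_image_multiple[OF assms] .
qed

text \<open>Describes the intervals of the orbit without reference to the numbering of the images,
  so that different generating intervals can be compared.\<close>

lemma periodic_component:
  assumes I: "periodic_interval f k I" and x: "x \<in> (f ^^ i) ` I"
  shows "connected_component_set (orb f I) x = (f ^^ i) ` I"
proof
  have wp: "weakly_periodic k I" by (rule periodic_interval_wp[OF I])
  have ci: "cinterval ((f ^^ i) ` I)" by (rule cinterval_image[OF weakly_periodicD(2)[OF wp]])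
  show "(f ^^ i) ` I \<subseteq> connected_component_set (orb f I) x"
    by (rule connected_component_maximal[OF x cintervalD(2)[OF ci] image_subset_orb])
  have "x \<in> orb f I" using x image_subset_orb by blast
  then have "x \<in> connected_component_set (orb f I) x" by simp
  then have "connected_component_set (orb f I) x \<inter> (f ^^ (i mod k)) ` I \<noteq> {}"
    using x unfolding periodic_image_mod[OF I, of i] by blast
  then have "connected_component_set (orb f I) x \<subseteq> (f ^^ (i mod k)) ` I"
    using weakly_periodicD(1)[OF wp] by (intro wp_connected_subset[OF wp]) (auto simp: connected_component_subset)
  then show "connected_component_set (orb f I) x \<subseteq> (f ^^ i) ` I" unfolding periodic_image_mod[OF I, of i] .
qed

end

section \<open>Components of a solenoidal set\<close>

locale solenoid_tower = interval_map +
  fixes m :: "nat \<Rightarrow> nat" and I :: "nat \<Rightarrow> real set"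
  assumes gen: "generating_intervals f m I"
begin

definition Q :: "real set" where "Q = (\<Inter>j. orb f (I j))"

definition K :: "nat \<Rightarrow> real \<Rightarrow> real set" where "K j q = connected_component_set (orb f (I j)) q"

text \<open>For \<open>q \<in> Q\<close> this is the component of \<open>Q\<close> containing
  \<open>q\<close>: an interval or a single point.\<close>

definition C :: "real \<Rightarrow> real set" where "C q = (\<Inter>j. K j q)"

lemma per: "periodic_interval f (m j) (I j)"
  and dec: "decseq I" and unbounded: "\<exists>j. n \<le> m j"
  using gen unfolding generating_intervals_def filterlim_at_top eventually_sequentially by blast+

lemma wp: "weakly_periodic (m j) (I j)" by (rule periodic_interval_wp[OF per])

lemma orb_dec: "i \<le> j \<Longrightarrow> orb f (I j) \<subseteq> orb f (I i)"
  by (rule orb_mono[OF decseqD[OF dec]])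

lemma orb_closed: "closed (orb f (I j))" by (rule periodic_orb_facts(3)[OF per])

lemma Q_subset_orb: "Q \<subseteq> orb f (I j)" unfolding Q_def by blast

lemma Q_in: "Q \<subseteq> {0..1}" using Q_subset_orb periodic_orb_facts(2)[OF per] by (rule order_trans)

lemma Q_closed: "closed Q" unfolding Q_def using orb_closed by (intro closed_INT) auto

lemma Q_forward: "q \<in> Q \<Longrightarrow> (f ^^ n) q \<in> Q" unfolding Q_def using orb_iter by blast

lemma generated: "generated_set f Q" unfolding generated_set_def Q_def using gen by blast

lemma in_solenoidI: "q \<in> Q \<Longrightarrow> in_solenoid q" unfolding in_solenoid_def using generated by blast

lemma Q_not_Per: "q \<in> Q \<Longrightarrow> q \<notin> Per f" by (rule solenoid_not_Per[OF in_solenoidI])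

lemma Q_nonempty: "Q \<noteq> {}"
proof -
  have ne: "orb f (I j) \<noteq> {}" for j
  proof -
    have "I j \<noteq> {}" using cintervalD(3)[OF weakly_periodicD(2)[OF wp]] .
    then show ?thesis using orb_superset[of "I j"] by (metis subset_empty)
  qed
  show ?thesis unfolding Q_def
    by (rule compact_nest[of "\<lambda>j. orb f (I j)", OF periodic_orb_facts(4)[OF per] ne orb_dec])
qed

lemma m_pos: "m j \<ge> 1" by (rule periodic_orb_facts(11)[OF per])

lemma K_eq: "q \<in> (f ^^ i) ` I j \<Longrightarrow> K j q = (f ^^ i) ` I j"
  unfolding K_def by (rule periodic_component[OF per])

lemma K_obtain:
  assumes "q \<in> Q" obtains i where "i < m j" "q \<in> (f ^^ i) ` I j" "K j q = (f ^^ i) ` I j"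
proof -
  have "q \<in> orb f (I j)" using assms Q_subset_orb by blast
  then obtain i where "i < m j" "q \<in> (f ^^ i) ` I j" unfolding wp_orb[OF wp] by blast
  then show thesis using that K_eq by blast
qed

lemma K_cinterval: "q \<in> Q \<Longrightarrow> cinterval (K j q)"
  using K_obtain[of q j] cinterval_image[OF weakly_periodicD(2)[OF wp]] by metis

lemma K_self: "q \<in> Q \<Longrightarrow> q \<in> K j q" using K_obtain[of q j] by metis

lemma K_dec: "decseq (\<lambda>j. K j q)"
proof (rule antimonoI)
  fix i j :: nat assume "i \<le> j"
  then show "K j q \<subseteq> K i q" unfolding K_def by (rule connected_component_mono[OF orb_dec])
qed

lemma K_subset: "K j q \<subseteq> orb f (I j)" unfolding K_def by (rule connected_component_subset)

lemma K_cong: "z \<in> K j q \<Longrightarrow> K j z = K j q" unfolding K_def by (metis connected_component_eq)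

lemma K_image: "q \<in> Q \<Longrightarrow> (f ^^ n) ` K j q = K j ((f ^^ n) q)"
proof -
  assume q: "q \<in> Q"
  obtain i where i: "q \<in> (f ^^ i) ` I j" "K j q = (f ^^ i) ` I j" using K_obtain[OF q, of j] by metis
  have "(f ^^ n) q \<in> (f ^^ (n + i)) ` I j" unfolding funpow_image_add using i(1) by (rule imageI)
  then have "K j ((f ^^ n) q) = (f ^^ (n + i)) ` I j" by (rule K_eq)
  then show ?thesis unfolding i(2) funpow_image_add by simp
qed

lemma K_return:
  assumes q: "q \<in> Q" and z: "z \<in> K j q" "z \<in> K j ((f ^^ n) q)"
  shows "m j dvd n"
proof -
  obtain i where i: "i < m j" "K j q = (f ^^ i) ` I j" using K_obtain[OF q, of j] by metis
  have eq: "K j ((f ^^ n) q) = K j q" using K_cong[OF z(1)] K_cong[OF z(2)] by simp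
  have "K j ((f ^^ n) q) = (f ^^ (n + i)) ` I j" unfolding K_image[OF q, symmetric] i(2) funpow_image_add ..
  then have "z \<in> (f ^^ (n + i)) ` I j" using z(2) by simp
  then have "(f ^^ (m j - i)) z \<in> (f ^^ (m j - i)) ` ((f ^^ (n + i)) ` I j)" by (rule imageI)
  also have "\<dots> = (f ^^ (m j + n)) ` I j" unfolding funpow_image_add[symmetric] using i(1) by simp
  finally have 1: "(f ^^ (m j - i)) z \<in> (f ^^ (m j + n)) ` I j" .
  have "(f ^^ (m j - i)) z \<in> (f ^^ (m j - i)) ` ((f ^^ i) ` I j)" using z(1) i(2) by simp
  also have "\<dots> = (f ^^ (m j)) ` I j" unfolding funpow_image_add[symmetric] using i(1) by simp
  finally have "(m j + n) mod m j = m j mod m j" using wp_meet[OF wp 1] by blast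
  then show ?thesis by (simp add: mod_0_imp_dvd)
qed

lemma K_period: "q \<in> Q \<Longrightarrow> m j dvd n \<Longrightarrow> K j ((f ^^ n) q) = K j q"
proof -
  assume q: "q \<in> Q" and "m j dvd n"
  then obtain a where a: "n = m j * a" by (elim dvdE)
  obtain i where i: "K j q = (f ^^ i) ` I j" using K_obtain[OF q, of j] by metis
  have "(f ^^ n) ` K j q = (f ^^ (n + i)) ` I j" unfolding i funpow_image_add ..
  also have "\<dots> = (f ^^ ((n + i) mod m j)) ` I j" by (rule periodic_image_mod[OF per])
  also have "\<dots> = (f ^^ i) ` I j" unfolding a using periodic_image_mod[OF per, of i] by simp
  finally show ?thesis using K_image[OF q, where n = n and j = j] i by simp
qed

lemma K_visit:
  assumes "q \<in> Q" "z \<in> Q" shows "\<exists>t\<ge>N. K j ((f ^^ t) q) = K j z"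
proof -
  obtain i where i: "i < m j" "q \<in> (f ^^ i) ` I j" "K j q = (f ^^ i) ` I j" using K_obtain[OF assms(1), of j] by metis
  obtain i' where i': "K j z = (f ^^ i') ` I j" using K_obtain[OF assms(2), of j] by metis
  define t where "t = i' + (m j - i) + m j * N"
  have "K j ((f ^^ t) q) = (f ^^ (t + i)) ` I j" unfolding K_image[OF assms(1), symmetric] i(3) funpow_image_add ..
  also have "t + i = i' + m j * Suc N" unfolding t_def using i(1) by simp
  also have "(f ^^ (i' + m j * Suc N)) ` I j = (f ^^ i') ` ((f ^^ (m j * Suc N)) ` I j)" by (rule funpow_image_add)
  also have "\<dots> = K j z" unfolding periodic_image_multiple[OF per] i' ..
  finally have "K j ((f ^^ t) q) = K j z" .
  moreover have "t \<ge> N" unfolding t_def using m_pos[of j] by (simp add: trans_le_add2)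
  ultimately show ?thesis by blast
qed

lemma C_cinterval: "q \<in> Q \<Longrightarrow> cinterval (C q)"
  unfolding C_def using K_cinterval K_dec by (intro cinterval_INT) auto

lemma C_self: "q \<in> Q \<Longrightarrow> q \<in> C q" unfolding C_def using K_self by blast

lemma C_subset: "C q \<subseteq> Q" unfolding C_def Q_def using K_subset by blast

lemma C_cong: "z \<in> C q \<Longrightarrow> C z = C q" unfolding C_def using K_cong by (metis (no_types, lifting) INT_E INF_cong UNIV_I)

lemma C_closed: "closed (C q)"
  unfolding C_def K_def using closed_connected_component[OF orb_closed] by (intro closed_INT) auto

text \<open>If two of these components met, every period \<open>m j\<close> would divide the fixed
  time difference.\<close>

lemma C_wander:
  assumes q: "q \<in> Q" and "a \<noteq> b" shows "C ((f ^^ a) q) \<inter> C ((f ^^ b) q) = {}"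
proof -
  have lt: "C ((f ^^ a) q) \<inter> C ((f ^^ b) q) = {}" if "a < b" for a b
  proof (rule ccontr)
    assume "C ((f ^^ a) q) \<inter> C ((f ^^ b) q) \<noteq> {}"
    then obtain z where z: "z \<in> C ((f ^^ a) q)" "z \<in> C ((f ^^ b) q)" by blast
    obtain j where j: "Suc (b - a) \<le> m j" using unbounded by blast
    have "(f ^^ b) q = (f ^^ (b - a)) ((f ^^ a) q)" unfolding funpow_add_app[symmetric] using that by simp
    then have "m j dvd (b - a)" using z unfolding C_def by (intro K_return[OF Q_forward[OF q]]) auto
    then show False using j that by (auto dest: dvd_imp_le)
  qed
  show ?thesis using lt[of a b] lt[of b a] assms(2) by (cases "a < b") auto
qed

text \<open>Infinitely many disjoint intervals cannot all contain an interval of length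
  \<open>e\<close> inside the unit interval.\<close>

lemma C_small:
  assumes q: "q \<in> Q" and e: "e > 0"
  shows "\<exists>N. \<forall>n\<ge>N. C ((f ^^ n) q) \<subseteq> ball ((f ^^ n) q) e"
proof (rule ccontr)
  assume no: "\<not> ?thesis"
  define A where "A = {n. \<not> C ((f ^^ n) q) \<subseteq> ball ((f ^^ n) q) e}"
  have "infinite A" using no unfolding A_def infinite_nat_iff_unbounded_le by blast
  then obtain r :: "nat \<Rightarrow> nat" where r: "strict_mono r" "\<And>n. r n \<in> A" using infinite_enumerate by blast
  have "\<exists>z. z \<in> C ((f ^^ r n) q) \<and> e \<le> \<bar>z - (f ^^ r n) q\<bar>" for n
    using r(2)[of n] unfolding A_def by (auto simp: dist_real_def not_less abs_minus_commute)
  then obtain z where z: "\<And>n. z n \<in> C ((f ^^ r n) q)" "\<And>n. e \<le> \<bar>z n - (f ^^ r n) q\<bar>" by metis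
  \<comment> \<open>Around its midpoint each long component contains a closed ball of radius
    \<open>e / 2\<close>, so two close midpoints make two components meet.\<close>
  define u where "u n = (z n + (f ^^ r n) q) / 2" for n
  have qn: "(f ^^ r n) q \<in> Q" for n by (rule Q_forward[OF q])
  have con: "connected (C ((f ^^ r n) q))" for n using cintervalD(2)[OF C_cinterval[OF qn]] .
  have near: "w \<in> C ((f ^^ r n) q)" if "\<bar>w - u n\<bar> \<le> e / 2" for w n
  proof -
    have "w \<in> closed_segment ((f ^^ r n) q) (z n)"
    proof (cases "(f ^^ r n) q \<le> z n")
      case True
      then show ?thesis using that z(2)[of n] unfolding u_def abs_le_iff by (auto simp: closed_segment_eq_real_ivl abs_le_iff field_simps)
    next
      case False
      then show ?thesis using that z(2)[of n] unfolding u_def abs_le_iff by (auto simp: closed_segment_eq_real_ivl abs_le_iff field_simps)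
    qed
    moreover have "closed_segment ((f ^^ r n) q) (z n) \<subseteq> C ((f ^^ r n) q)"
      using con[of n] C_self[OF qn[of n]] z(1)[of n] connected_contains_Icc[OF con[of n]]
      by (auto simp: closed_segment_eq_real_ivl split: if_splits)
    ultimately show ?thesis by blast
  qed
  have "u n \<in> {0..1}" for n
    using near[of "u n" n] e C_subset[of "(f ^^ r n) q"] Q_in by auto
  then obtain l p where l: "strict_mono p" "(u \<circ> p) \<longlonglongrightarrow> l"
    using compact_Icc[of 0 "1::real", unfolded compact_def] by metis
  then have "Cauchy (u \<circ> p)" by (intro LIMSEQ_imp_Cauchy)
  then obtain M where M: "\<And>a b. a \<ge> M \<Longrightarrow> b \<ge> M \<Longrightarrow> \<bar>(u \<circ> p) a - (u \<circ> p) b\<bar> < e / 2"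
    using e unfolding Cauchy_def dist_real_def by (meson half_gt_zero)
  have "\<bar>u (p (Suc M)) - u (p M)\<bar> \<le> e / 2" using M[of "Suc M" M] by simp
  then have "u (p (Suc M)) \<in> C ((f ^^ r (p M)) q)" by (rule near)
  moreover have "u (p (Suc M)) \<in> C ((f ^^ r (p (Suc M))) q)" by (rule near) (use e in simp)
  moreover have "r (p M) \<noteq> r (p (Suc M))" using r(1) l(1) by (metis lessI strict_mono_less less_irrefl)
  ultimately show False using C_wander[OF q] by blast
qed

lemma K_small:
  assumes q: "q \<in> Q" and U: "open U" "C q \<subseteq> U"
  shows "\<exists>j. K j q \<subseteq> U"
proof (rule ccontr)
  assume no: "\<not> ?thesis"
  have "(\<Inter>j. K j q - U) \<noteq> {}"
  proof (rule compact_nest)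
    show "compact (K j q - U)" for j using compact_diff[OF cintervalD(1)[OF K_cinterval[OF q]] U(1)] .
    show "K j q - U \<noteq> {}" for j using no by blast
    show "K j q - U \<subseteq> K i q - U" if "i \<le> j" for i j using decseqD[OF K_dec that] by blast
  qed
  then show False using U(2) unfolding C_def by blast
qed

text \<open>A late component near \<open>z\<close> is short by \<open>C_small\<close>, and it is the
  limit of the intervals \<open>K j\<close> around it; so a whole interval of some level fits into
  the ball.\<close>

lemma approx:
  assumes q: "q \<in> Q" and z: "z \<in> omega_limit f q" and e: "e > 0"
  obtains n j where "n \<ge> N" "K j ((f ^^ n) q) \<subseteq> ball z e"
proof -
  obtain N' where N': "\<And>n. n \<ge> N' \<Longrightarrow> C ((f ^^ n) q) \<subseteq> ball ((f ^^ n) q) (e / 2)" using C_small[OF q, of "e/2"] e by auto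
  obtain n where n: "n \<ge> max N N'" "\<bar>(f ^^ n) q - z\<bar> < e / 2" using z half_gt_zero[OF e] unfolding omega_limit_iff by blast
  then have "C ((f ^^ n) q) \<subseteq> ball ((f ^^ n) q) (e / 2)" using N' by simp
  then obtain j where j: "K j ((f ^^ n) q) \<subseteq> ball ((f ^^ n) q) (e / 2)" using K_small[OF Q_forward[OF q] open_ball] by blast
  have "ball ((f ^^ n) q) (e / 2) \<subseteq> ball z e"
  proof
    fix w assume "w \<in> ball ((f ^^ n) q) (e / 2)"
    then have "\<bar>(f ^^ n) q - w\<bar> < e / 2" by (simp add: dist_real_def)
    then have "\<bar>z - w\<bar> < e" using n(2) by linarith
    then show "w \<in> ball z e" by (simp add: dist_real_def)
  qed
  with j have "K j ((f ^^ n) q) \<subseteq> ball z e" by (rule order_trans)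
  then show thesis using n(1) by (intro that[of n j]) auto
qed

text \<open>Every orbit in \<open>Q\<close> visits all the intervals of each level infinitely often,
  in particular the small ones near \<open>z\<close>.\<close>

lemma omega_limit_eq:
  assumes "x \<in> Q" "y \<in> Q" shows "omega_limit f x \<subseteq> omega_limit f y"
proof
  fix z assume z: "z \<in> omega_limit f x"
  show "z \<in> omega_limit f y" unfolding omega_limit_iff
  proof (intro allI impI)
    fix d :: real and N assume "d > 0"
    then obtain n j where n: "K j ((f ^^ n) x) \<subseteq> ball z d" using approx[OF assms(1) z] by metis
    obtain t where t: "t \<ge> N" "K j ((f ^^ t) y) = K j ((f ^^ n) x)" using K_visit[OF assms(2) Q_forward[OF assms(1)]] by metis
    have "(f ^^ t) y \<in> ball z d" using K_self[OF Q_forward[OF assms(2)], of t j] t(2) n by blast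
    then show "\<exists>n\<ge>N. \<bar>(f ^^ n) y - z\<bar> < d" using t(1) by (intro exI[of _ t]) (simp add: dist_real_def abs_minus_commute)
  qed
qed

definition S :: "real set" where "S = omega_limit f (SOME q. q \<in> Q)"

lemma omega_S: "x \<in> Q \<Longrightarrow> omega_limit f x = S"
proof -
  assume x: "x \<in> Q"
  have "(SOME q. q \<in> Q) \<in> Q" using Q_nonempty by (simp add: some_in_eq)
  then show ?thesis unfolding S_def using omega_limit_eq x by blast
qed

lemma S_closed: "closed S" unfolding S_def by (rule closed_omega_limit)

lemma S_forward: "z \<in> S \<Longrightarrow> (f ^^ n) z \<in> S"
  using omega_limit_forward[of "SOME q. q \<in> Q" z n] Q_in Q_nonempty unfolding S_def by (simp add: some_in_eq subset_iff)

lemma S_subset_Q: "S \<subseteq> Q"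
proof -
  obtain q where q: "q \<in> Q" using Q_nonempty by blast
  show ?thesis unfolding omega_S[OF q, symmetric] by (rule omega_limit_subset[OF Q_closed, of 0]) (rule Q_forward[OF q])
qed

lemma C_meets_S: assumes q: "q \<in> Q" shows "C q \<inter> S \<noteq> {}"
proof -
  have ne: "K j q \<inter> S \<noteq> {}" for j
    unfolding omega_S[OF q, symmetric]
  proof (rule omega_limit_meets[OF cintervalD(1)[OF K_cinterval[OF q]]])
    fix N
    obtain t where "t \<ge> N" "K j ((f ^^ t) q) = K j q" using K_visit[OF q q] by blast
    then show "\<exists>n\<ge>N. (f ^^ n) q \<in> K j q" using K_self[OF Q_forward[OF q], of t j] by blast
  qed
  have "(\<Inter>j. K j q \<inter> S) \<noteq> {}"
  proof (rule compact_nest[OF _ ne])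
    show "compact (K j q \<inter> S)" for j by (rule compact_Int_closed[OF cintervalD(1)[OF K_cinterval[OF q]] S_closed])
    show "K j q \<inter> S \<subseteq> K i q \<inter> S" if "i \<le> j" for i j using decseqD[OF K_dec that] by blast
  qed
  then show ?thesis unfolding C_def by blast
qed

text \<open>A small interval of level \<open>j\<close> near \<open>z\<close> is mapped onto itself
  by \<open>f ^^ m j\<close>, which therefore has a fixed point in it.\<close>

lemma S_closure_Per: "S \<subseteq> closure (Per f)"
proof
  fix z assume z: "z \<in> S"
  obtain q where q: "q \<in> Q" using Q_nonempty by blast
  have zq: "z \<in> omega_limit f q" using omega_S[OF q] z by simp
  show "z \<in> closure (Per f)" unfolding closure_approachable
  proof (intro allI impI)
    fix e :: real assume "e > 0"
    then obtain n j where n: "K j ((f ^^ n) q) \<subseteq> ball z e" using approx[OF q zq] by metis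
    let ?K = "K j ((f ^^ n) q)"
    have qn: "(f ^^ n) q \<in> Q" by (rule Q_forward[OF q])
    have fK: "(f ^^ m j) ` ?K = ?K" using K_image[OF qn, of "m j" j] K_period[OF qn, of j "m j"] by simp
    have cK: "cinterval ?K" by (rule K_cinterval[OF qn])
    have "convex ?K" using cintervalD(2)[OF cK] by (metis is_interval_connected_1 is_interval_convex_1)
    then obtain p where p: "p \<in> ?K" "(f ^^ m j) p = p"
      using brouwer[OF cintervalD(1)[OF cK] _ cintervalD(3)[OF cK] cont_funpow_on[OF cintervalD(4)[OF cK]], of "m j"] fK by auto
    have "p \<in> Per f" using p cintervalD(4)[OF cK] m_pos[of j] unfolding Per_def by blast
    moreover have "p \<in> ball z e" using n p(1) by blast
    ultimately show "\<exists>y\<in>Per f. dist y z < e" by (intro bexI[of _ p]) (simp add: dist_commute)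
  qed
qed

text \<open>A component other than \<open>C x\<close> meets \<open>S\<close>, which keeps a distance
  \<open>g0\<close> from \<open>x\<close>; if it comes close to \<open>x\<close>, it passes through
  one of the two points at distance \<open>g0 / 2\<close> from \<open>x\<close>. So only two
  components compete, each at a positive distance from \<open>x\<close>.\<close>

lemma isolation:
  assumes x: "x \<in> Q" "x \<notin> S" obtains g where "g > 0" "Q \<inter> ball x g \<subseteq> C x"
proof -
  obtain g0 where g0: "g0 > 0" "ball x g0 \<inter> S = {}"
    using x(2) S_closed by (metis open_Compl openE ComplI disjoint_eq_subset_Compl)
  have "\<exists>h>0. x \<in> C p \<or> ball x h \<inter> C p = {}" for p
  proof (cases "x \<in> C p")
    case False
    then obtain h where "h > 0" "ball x h \<subseteq> - C p" using C_closed[of p] by (metis open_Compl openE ComplI)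
    then show ?thesis by blast
  qed (auto intro: exI[of _ 1])
  then obtain h where h: "\<And>p. h p > 0" "\<And>p. x \<in> C p \<or> ball x (h p) \<inter> C p = {}" by metis
  define g where "g = min (g0 / 2) (min (h (x + g0 / 2)) (h (x - g0 / 2)))"
  have g: "g > 0" "g \<le> g0 / 2" "g \<le> h (x + g0 / 2)" "g \<le> h (x - g0 / 2)" using g0(1) h(1) by (auto simp: g_def)
  have "Q \<inter> ball x g \<subseteq> C x"
  proof
    fix q assume q: "q \<in> Q \<inter> ball x g"
    show "q \<in> C x"
    proof (rule ccontr)
      assume nq: "q \<notin> C x"
      have qQ: "q \<in> Q" using q by blast
      have xC: "x \<notin> C q" using nq C_cong[of x q] C_self[OF qQ] by blast
      obtain z where z: "z \<in> C q" "z \<in> S" using C_meets_S[OF qQ] by blast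
      have zfar: "\<bar>z - x\<bar> \<ge> g0" using z(2) g0(2) by (force simp: dist_real_def abs_minus_commute)
      have con: "connected (C q)" by (rule cintervalD(2)[OF C_cinterval[OF qQ]])
      have "\<bar>q - x\<bar> < g" using q by (simp add: dist_real_def abs_minus_commute)
      then have qn: "\<bar>q - x\<bar> < g0 / 2" "\<bar>q - x\<bar> < g" using g(2) by linarith+
      have no: "p = x + g0 / 2 \<or> p = x - g0 / 2 \<Longrightarrow> p \<notin> C q" for p
      proof
        assume p: "p = x + g0 / 2 \<or> p = x - g0 / 2" "p \<in> C q"
        then have "C p = C q" by (intro C_cong) auto
        then have "ball x (h p) \<inter> C q = {}" using h(2)[of p] xC by auto
        moreover have "q \<in> ball x (h p)" using qn(2) g(3,4) p(1) by (auto simp: dist_real_def)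
        ultimately show False using C_self[OF qQ] by blast
      qed
      show False
      proof (cases "z \<le> x")
        case True
        then have zl: "z \<le> x - g0" using zfar by auto
        show False
        proof (cases "q \<le> x")
          case True
          then have "z \<le> x - g0 / 2" "x - g0 / 2 \<le> q" using zl qn(1) g0(1) by auto
          then show False using connectedD_interval[OF con z(1) C_self[OF qQ]] no by blast
        next
          case False
          then show False using connectedD_interval[OF con z(1) C_self[OF qQ], of x] \<open>z \<le> x\<close> xC by auto
        qed
      next
        case False
        then have zl: "z \<ge> x + g0" using zfar by auto
        show False
        proof (cases "q \<ge> x")
          case True
          then have "x + g0 / 2 \<le> z" "q \<le> x + g0 / 2" using zl qn(1) g0(1) by auto
          then show False using connectedD_interval[OF con C_self[OF qQ] z(1)] no by blast
        next
          case False
          then show False using connectedD_interval[OF con C_self[OF qQ] z(1), of x] \<open>\<not> z \<le> x\<close> xC by auto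
        qed
      qed
    qed
  qed
  then show thesis by (rule that[OF g(1)])
qed

lemma nonwandering_endpoint:
  assumes x: "x \<in> Q" and C: "C x = {a..b}" and z: "z \<in> C x" "z \<in> nonwandering f"
  shows "z = a \<or> z = b"
proof (rule ccontr)
  assume "\<not> (z = a \<or> z = b)"
  then have lt: "a < z" "z < b" using z(1) C by auto
  define d where "d = min (z - a) (b - z)"
  have d: "d > 0" using lt by (simp add: d_def)
  obtain n y where n: "n \<ge> 1" "\<bar>y - z\<bar> < d" "\<bar>(f ^^ n) y - z\<bar> < d" using z(2) d unfolding nonwandering_iff by blast
  then have y: "y \<in> C x" "(f ^^ n) y \<in> C x" unfolding C d_def by auto
  then have yQ: "y \<in> Q" using C_subset by blast
  have "C y = C x" "C ((f ^^ n) y) = C x" using C_cong y by auto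
  then have "C ((f ^^ 0) y) \<inter> C ((f ^^ n) y) \<noteq> {}" using C_self[OF x] by auto
  then show False using C_wander[OF yQ, of 0 n] n(1) by simp
qed

text \<open>Iterating \<open>m j\<close> steps twice gives three points of \<open>Q\<close> in the
  same interval of level \<open>j\<close>, and the middle one is interior. They are distinct because
  they lie in different intervals of a level whose period exceeds \<open>2 * m j\<close>.\<close>

lemma interior_visit:
  assumes q: "q \<in> Q" obtains t e where "e > 0" "ball ((f ^^ t) q) e \<subseteq> K j q"
proof -
  obtain i where i: "Suc (2 * m j) \<le> m i" using unbounded by blast
  define l where "l = max i j"
  obtain a b where "a < b" "I l = {a..b}" using per[of l] unfolding periodic_interval_def by blast
  then have al: "a \<in> I l" by simp
  have il: "i \<le> l" by (simp add: l_def)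
  have "a \<in> I i" using decseqD[OF dec il] al by blast
  then have "m i dvd m l" using al by (rule wp_refine(2)[OF wp wp orb_dec[OF il]])
  then have big: "m l > 2 * m j" using i m_pos[of l] by (auto dest: dvd_imp_le)
  define p where "p a = (f ^^ (a * m j)) q" for a :: nat
  have pQ: "p a \<in> Q" for a unfolding p_def by (rule Q_forward[OF q])
  have pK: "p a \<in> K j q" for a using K_period[OF q, of j "a * m j"] K_self[OF pQ, of a j] unfolding p_def by simp
  have dis: "K l (p a) \<inter> K l (p b) = {}" if "a < b" "b \<le> 2" for a b
  proof (rule ccontr)
    assume "K l (p a) \<inter> K l (p b) \<noteq> {}"
    then obtain z where z: "z \<in> K l (p a)" "z \<in> K l (p b)" by blast
    have "p b = (f ^^ ((b - a) * m j)) (p a)" unfolding p_def funpow_add_app[symmetric] using that(1)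
      by (simp add: add_mult_distrib[symmetric])
    then have "m l dvd (b - a) * m j" using K_return[OF pQ z(1)] z(2) by simp
    moreover have "(b - a) * m j > 0" using that(1) m_pos[of j] by simp
    ultimately have "m l \<le> (b - a) * m j" by (rule dvd_imp_le)
    also have "\<dots> \<le> 2 * m j" using that(2) by (intro mult_right_mono) auto
    finally show False using big by simp
  qed
  have pne: "p a \<noteq> p b" if "a < b" "b \<le> 2" for a b using dis[OF that] K_self[OF pQ, of a l] K_self[OF pQ, of b l] by auto
  have "\<exists>a b c. p a < p b \<and> p b < p c"
    using pne[of 0 1] pne[of 0 2] pne[of 1 2] by (metis linorder_neqE_linordered_idom one_le_numeral order_refl pos2 zero_less_one one_less_numeral_iff semiring_norm(76))
  then obtain a b c where abc: "p a < p b" "p b < p c" by blast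
  have con: "connected (K j q)" by (rule cintervalD(2)[OF K_cinterval[OF q]])
  have "{p a..p c} \<subseteq> K j q" by (rule connected_contains_Icc[OF con pK pK])
  moreover have "ball (p b) (min (p b - p a) (p c - p b)) \<subseteq> {p a..p c}" by (auto simp: dist_real_def)
  ultimately have "ball (p b) (min (p b - p a) (p c - p b)) \<subseteq> K j q" by blast
  then show thesis using that[of "min (p b - p a) (p c - p b)" "b * m j"] abc unfolding p_def by simp
qed

end

section \<open>Isolated points, and closedness of the sets in a collection\<close>

lemma countable_isolated:
  fixes A :: "real set" assumes "\<And>x. x \<in> A \<Longrightarrow> x isolated_in A"
  shows "countable A"
proof -
  have "\<forall>x\<in>A. \<exists>r :: rat \<times> rat. A \<inter> {of_rat (fst r)<..<of_rat (snd r)} = {x}"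
  proof
    fix x assume x: "x \<in> A"
    obtain e where e: "e > 0" "\<forall>y\<in>A. dist x y < e \<longrightarrow> y = x"
      using assms[OF x] unfolding isolated_in_dist_Ex_iff by blast
    have "x - e < x" "x < x + e" using e(1) by auto
    then obtain p q :: rat
      where p: "x - e < of_rat p" "of_rat p < x" and q: "x < of_rat q" "of_rat q < x + e"
      by (meson of_rat_dense)
    have "y = x" if "y \<in> A" "of_rat p < y" "y < of_rat q" for y
    proof -
      have "dist x y < e" using that(2,3) p q by (simp add: dist_real_def abs_less_iff)
      then show ?thesis using e(2) that(1) by blast
    qed
    then have "A \<inter> {of_rat p<..<of_rat q} \<subseteq> {x}" unfolding Int_iff greaterThanLessThan_iff subset_iff singleton_iff by meson
    then have "A \<inter> {of_rat (fst (p, q))<..<of_rat (snd (p, q))} = {x}" using p(2) q(1) x by (simp add: subset_antisym)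
    then show "\<exists>r :: rat \<times> rat. A \<inter> {of_rat (fst r)<..<of_rat (snd r)} = {x}" by (rule exI)
  qed
  from bchoice[OF this] obtain r :: "real \<Rightarrow> rat \<times> rat" where
    r: "\<forall>x\<in>A. A \<inter> {of_rat (fst (r x))<..<of_rat (snd (r x))} = {x}" ..
  have "inj_on r A"
  proof (rule inj_onI)
    fix x y assume xy: "x \<in> A" "y \<in> A" "r x = r y"
    have "{x} = A \<inter> {of_rat (fst (r y))<..<of_rat (snd (r y))}" using bspec[OF r xy(1)] unfolding xy(3) by (rule sym)
    also have "\<dots> = {y}" by (rule bspec[OF r xy(2)])
    finally show "x = y" by simp
  qed
  then show ?thesis by (rule countable_image_inj_on[OF countableI_type])
qed

context interval_map begin

lemma Per_in: "Per f \<subseteq> {0..1}" by (auto simp: Per_def)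

lemma nonwandering_closed: "closed (nonwandering f)"
proof -
  have "x \<in> nonwandering f" if xc: "x \<in> closure (nonwandering f)" for x
    unfolding nonwandering_iff
  proof (intro conjI allI impI)
    have "nonwandering f \<subseteq> {0..1}" by (auto simp: nonwandering_def)
    from subsetD[OF closure_minimal[OF this] xc] show "x \<in> {0..1}" by simp
    fix d :: real assume d: "d > 0"
    then obtain z where z: "z \<in> nonwandering f" "\<bar>z - x\<bar> < d / 2"
      using xc half_gt_zero[OF d] unfolding closure_approachable dist_real_def by blast
    then obtain n y where "n \<ge> 1" "y \<in> {0..1}" "\<bar>y - z\<bar> < d / 2" "\<bar>(f ^^ n) y - z\<bar> < d / 2"
      using half_gt_zero[OF d] unfolding nonwandering_iff by blast
    then show "\<exists>n\<ge>1. \<exists>y\<in>{0..1}. \<bar>y - x\<bar> < d \<and> \<bar>(f ^^ n) y - x\<bar> < d"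
      using z(2) by (intro exI[of _ n] conjI bexI[of _ y]) linarith+
  qed
  then show ?thesis using closure_subset_eq by blast
qed

lemma nonwandering_forward: "x \<in> nonwandering f \<Longrightarrow> f x \<in> nonwandering f"
  unfolding nonwandering_iff
proof (intro conjI allI impI)
  assume x: "x \<in> {0..1} \<and> (\<forall>d>0. \<exists>n\<ge>1. \<exists>y\<in>{0..1}. \<bar>y - x\<bar> < d \<and> \<bar>(f ^^ n) y - x\<bar> < d)"
  then show "f x \<in> {0..1}" using funpow_in[of x 1] by simp
  fix d :: real assume "d > 0"
  then obtain h where h: "h > 0" "\<forall>y\<in>{0..1}. \<bar>y - x\<bar> \<le> h \<longrightarrow> \<bar>(f ^^ 1) y - (f ^^ 1) x\<bar> < d"
    using funpow_near[of x d 1] x by blast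
  obtain n y where n: "n \<ge> 1" "y \<in> {0..1}" "\<bar>y - x\<bar> < h" "\<bar>(f ^^ n) y - x\<bar> < h" using x h(1) by blast
  have "\<bar>f y - f x\<bar> < d" "\<bar>f ((f ^^ n) y) - f x\<bar> < d" using h(2) n funpow_in[OF n(2)] by auto
  moreover have "f ((f ^^ n) y) = (f ^^ n) (f y)" by (simp add: funpow_swap1)
  ultimately show "\<exists>n\<ge>1. \<exists>y\<in>{0..1}. \<bar>y - f x\<bar> < d \<and> \<bar>(f ^^ n) y - f x\<bar> < d"
    using n(1) funpow_in[OF n(2), of 1] by (intro exI[of _ n] conjI bexI[of _ "f y"]) auto
qed

lemma Per_nonwandering: "Per f \<subseteq> nonwandering f"
proof
  fix x assume "x \<in> Per f"
  then obtain n where n: "x \<in> {0..1}" "n \<ge> 1" "(f ^^ n) x = x" unfolding Per_def by blast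
  show "x \<in> nonwandering f" unfolding nonwandering_iff
    using n by (intro conjI allI impI exI[of _ n] bexI[of _ x]) auto
qed

lemma closure_Per_nonwandering: "closure (Per f) \<subseteq> nonwandering f"
  by (rule closure_minimal[OF Per_nonwandering nonwandering_closed])

lemma omega_set_nonwandering: "omega_set f \<subseteq> nonwandering f"
proof
  fix z assume "z \<in> omega_set f"
  then obtain y where y: "y \<in> {0..1}" "z \<in> omega_limit f y" unfolding omega_set_def by blast
  show "z \<in> nonwandering f" unfolding nonwandering_iff
  proof (intro conjI allI impI)
    show "z \<in> {0..1}" using omega_limit_in[OF y(1)] y(2) by blast
    fix d :: real assume d: "d > 0"
    obtain n where n: "\<bar>(f ^^ n) y - z\<bar> < d" using y(2) d unfolding omega_limit_iff by blast
    obtain n' where n': "n' \<ge> Suc n" "\<bar>(f ^^ n') y - z\<bar> < d" using y(2) d unfolding omega_limit_iff by blast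
    have "(f ^^ (n' - n)) ((f ^^ n) y) = (f ^^ n') y" unfolding funpow_add_app[symmetric] using n'(1) by simp
    then show "\<exists>n\<ge>1. \<exists>y\<in>{0..1}. \<bar>y - z\<bar> < d \<and> \<bar>(f ^^ n) y - z\<bar> < d"
      using n n' funpow_in[OF y(1)] by (intro exI[of _ "n' - n"] conjI bexI[of _ "(f ^^ n) y"]) auto
  qed
qed

lemma omega_set_forward: "z \<in> omega_set f \<Longrightarrow> f z \<in> omega_set f"
proof -
  assume "z \<in> omega_set f"
  then obtain y where y: "y \<in> {0..1}" "z \<in> omega_limit f y" unfolding omega_set_def by (elim UN_E)
  have "f z \<in> omega_limit f y" using omega_limit_forward[OF y, of 1] by simp
  then show ?thesis unfolding omega_set_def by (rule UN_I[OF y(1)])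
qed

lemma closure_Per_forward: "z \<in> closure (Per f) \<Longrightarrow> f z \<in> closure (Per f)"
proof -
  assume z: "z \<in> closure (Per f)"
  have cl: "closure (Per f) \<subseteq> {0..1}" using Per_in by (simp add: closure_minimal)
  have "f ` closure (Per f) \<subseteq> closure (f ` Per f)"
    by (rule continuous_image_closure_subset[OF cont cl])
  also have "\<dots> \<subseteq> closure (Per f)" using Per_funpow[of _ 1] by (intro closure_mono) auto
  finally show ?thesis using z by blast
qed

lemma genus0_subset_Per: "genus0_union f \<subseteq> Per f"
proof
  fix x assume "x \<in> genus0_union f"
  then obtain z where z: "z \<in> Per f" "x \<in> orb f {z}" unfolding genus0_union_def cycle_def by blast
  then obtain i where "x = (f ^^ i) z" unfolding orb_def by blast
  then show "x \<in> Per f" using Per_funpow[OF z(1)] by simp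
qed

lemma genus0_forward: "x \<in> genus0_union f \<Longrightarrow> (f ^^ n) x \<in> genus0_union f"
proof -
  assume "x \<in> genus0_union f"
  then obtain Z where Z: "x \<in> Z" "cycle f Z" "\<exists>x\<in>{0..1}. omega_limit f x = Z"
    "\<forall>x\<in>{0..1}. Z \<subseteq> omega_limit f x \<longrightarrow> omega_limit f x = Z" unfolding genus0_union_def by blast
  obtain z where "Z = orb f {z}" using Z(2) unfolding cycle_def by blast
  then have "(f ^^ n) x \<in> Z" using orb_iter Z(1) by blast
  then show ?thesis unfolding genus0_union_def using Z by blast
qed

lemma Per_omega_set: "Per f \<subseteq> omega_set f"
  using Per_omega_limit(3) Per_in unfolding omega_set_def by blast

end

context solenoid_tower begin

text \<open>Within \<open>C x\<close> only the two endpoints can be non-wandering, and near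
  \<open>x\<close> there is no point of \<open>Q\<close> outside \<open>C x\<close>. The interval is
  nondegenerate since it meets \<open>S\<close>, to which \<open>x\<close> does not belong.\<close>

lemma isolated:
  assumes x: "x \<in> Q" "x \<in> nonwandering f" "x \<notin> S"
  obtains a b e where "C x = {a..b}" "a < b" "x = a \<or> x = b" "e > 0" "Q \<inter> ball x e \<subseteq> C x" "Q \<inter> nonwandering f \<inter> ball x e = {x}"
proof -
  obtain a b where ab: "C x = {a..b}" "a \<le> b" by (rule cinterval_Icc[OF C_cinterval[OF x(1)]])
  have ends: "x = a \<or> x = b" by (rule nonwandering_endpoint[OF x(1) ab(1) C_self[OF x(1)] x(2)])
  have "a \<noteq> b"
  proof
    assume "a = b"
    then have "C x = {x}" using ab C_self[OF x(1)] by auto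
    then show False using C_meets_S[OF x(1)] x(3) by auto
  qed
  then have lt: "a < b" using ab(2) by simp
  obtain g where g: "g > 0" "Q \<inter> ball x g \<subseteq> C x" by (rule isolation[OF x(1,3)])
  define e where "e = min g (b - a)"
  have e: "e > 0" "e \<le> g" "e \<le> b - a" using g(1) lt by (auto simp: e_def)
  have sub: "Q \<inter> ball x e \<subseteq> C x" using g(2) subset_ball[OF e(2), of x] by blast
  have "Q \<inter> nonwandering f \<inter> ball x e = {x}"
  proof
    show "Q \<inter> nonwandering f \<inter> ball x e \<subseteq> {x}"
    proof
      fix z assume z: "z \<in> Q \<inter> nonwandering f \<inter> ball x e"
      then have "z \<in> C x" using sub by blast
      then have "z = a \<or> z = b" using nonwandering_endpoint[OF x(1) ab(1)] z by blast
      then show "z \<in> {x}" using ends z e(3) lt by (auto simp: dist_real_def)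
    qed
    show "{x} \<subseteq> Q \<inter> nonwandering f \<inter> ball x e" using x e(1) by simp
  qed
  then show thesis using that[OF ab(1) lt ends e(1) sub] by blast
qed

lemma isolated_in_nonwandering:
  assumes "x \<in> Q \<inter> nonwandering f - S" shows "x isolated_in (Q \<inter> nonwandering f)"
proof -
  obtain a b e where "e > 0" "Q \<inter> nonwandering f \<inter> ball x e = {x}"
    using isolated[of x] assms by (metis DiffE IntE)
  then show ?thesis using assms by (intro isolated_inI[of x _ "ball x e"]) auto
qed

lemma countable_difference: "countable (Q \<inter> nonwandering f - S)"
proof (rule countable_isolated)
  fix x assume x: "x \<in> Q \<inter> nonwandering f - S"
  obtain T where T: "open T" "T \<inter> (Q \<inter> nonwandering f) = {x}"
    using isolated_in_nonwandering[OF x] by (auto simp: isolated_in_def)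
  then show "x isolated_in (Q \<inter> nonwandering f - S)"
    using x by (intro isolated_inI[of x _ T]) blast+
qed

text \<open>Points outside \<open>S\<close> are isolated, so no limit points are lost. This gives
  closedness of \<open>Q \<inter> omega_set f\<close> without closedness of
  \<open>omega_set f\<close>.\<close>

lemma closed_between:
  assumes "S \<subseteq> A" "A \<subseteq> Q \<inter> nonwandering f" shows "closed A"
proof -
  have "x \<in> A" if x: "x \<in> closure A" for x
  proof (rule ccontr)
    assume nx: "x \<notin> A"
    have "closed (Q \<inter> nonwandering f)" using Q_closed nonwandering_closed by (rule closed_Int)
    then have "closure A \<subseteq> Q \<inter> nonwandering f" using assms(2) by (rule closure_minimal[rotated])
    then have "x \<in> Q \<inter> nonwandering f - S" using x nx assms(1) by blast
    then have "x isolated_in (Q \<inter> nonwandering f)" by (rule isolated_in_nonwandering)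
    then obtain e where e: "e > 0" "\<forall>y\<in>Q \<inter> nonwandering f. dist x y < e \<longrightarrow> y = x" unfolding isolated_in_dist_Ex_iff by blast
    obtain y where "y \<in> A" "dist y x < e" using x e(1) unfolding closure_approachable by blast
    then have "y = x" using e(2) assms(2) by (auto simp: dist_commute)
    then show False using \<open>y \<in> A\<close> nx by simp
  qed
  then show ?thesis using closure_subset_eq by blast
qed

lemma Q_subset_S:
  assumes "unit_top interior_of Q = {}" shows "Q = S"
proof
  show "Q \<subseteq> S"
  proof
    fix q assume q: "q \<in> Q"
    obtain a b where ab: "C q = {a..b}" "a \<le> b" "0 \<le> a" "b \<le> 1" by (rule cinterval_Icc[OF C_cinterval[OF q]])
    have "a = b"
    proof (rule ccontr)
      assume "a \<noteq> b"
      then have lt: "a < b" using ab(2) by simp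
      have "openin unit_top {a<..<b}" using ab by (intro open_subset) auto
      moreover have "{a<..<b} \<subseteq> Q" using C_subset[of q] ab(1) by auto
      ultimately have "(a + b) / 2 \<in> unit_top interior_of Q" unfolding interior_of_def using lt by auto
      then show False using assms by simp
    qed
    then have "C q = {q}" using ab C_self[OF q] by auto
    then show "q \<in> S" using C_meets_S[OF q] by auto
  qed
qed (rule S_subset_Q)

text \<open>Outside \<open>S\<close>, the point \<open>x\<close> is an endpoint of
  \<open>C x\<close> approached by periodic points \<open>p\<close> from the outer side
  \<open>s\<close>. While \<open>p\<close> returns to itself, \<open>x\<close> is carried to the
  other side, so the segment between them is stretched over itself. A chain of such segments
  shrinking to \<open>x\<close> gives an orbit with limit point \<open>x\<close>.\<close>

lemma closure_Per_in_omega_set: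
  assumes x: "x \<in> Q" "x \<in> closure (Per f)" shows "x \<in> omega_set f"
proof (cases "x \<in> S")
  case True
  then show ?thesis using omega_S[OF x(1)] Q_in x(1) unfolding omega_set_def by blast
next
  case nS: False
  have xO: "x \<in> nonwandering f" using x(2) closure_Per_nonwandering by blast
  have x01: "x \<in> {0..1}" using x(1) Q_in by blast
  obtain a b g where ab: "C x = {a..b}" "a < b" "x = a \<or> x = b" and g: "g > 0" "Q \<inter> ball x g \<subseteq> C x"
    by (rule isolated[OF x(1) xO nS])
  define s :: real where "s = (if x = a then -1 else 1)"
  have s: "\<bar>s\<bar> = 1" by (simp add: s_def)
  have Cs: "s * (z - x) \<le> 0" if "z \<in> C x" for z using that ab unfolding s_def by auto
  have inC: "z \<in> C x" if "s * (z - x) \<le> 0" "\<bar>z - x\<bar> < b - a" for z using that ab unfolding s_def by (auto split: if_splits)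
  have step: "\<exists>p n. p \<in> {0..1} \<and> n \<ge> 1 \<and> \<bar>p - x\<bar> < e \<and> s * (p - x) > 0 \<and> closed_segment p x \<subseteq> (f ^^ n) ` closed_segment p x"
    if e: "e > 0" for e
  proof -
    \<comment> \<open>\<open>U\<close> limits how far the interval of level \<open>j\<close> reaches
      beyond \<open>x\<close> on the outer side: by less than the isolation radius
      \<open>g\<close>.\<close>
    define U where "U = {z. s * (z - x) < g}"
    have "open U" unfolding U_def by (intro open_Collect_less continuous_intros)
    moreover have "C x \<subseteq> U" unfolding U_def using Cs g(1) by fastforce
    ultimately obtain j where j: "K j x \<subseteq> U" using K_small[OF x(1)] by blast
    obtain t h where t: "h > 0" "ball ((f ^^ t) x) h \<subseteq> K j x" by (rule interior_visit[OF x(1)])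
    obtain h1 where h1: "h1 > 0" "\<forall>y\<in>{0..1}. \<bar>y - x\<bar> \<le> h1 \<longrightarrow> \<bar>(f ^^ t) y - (f ^^ t) x\<bar> < h"
      using funpow_near[OF x01 t(1)] by blast
    obtain i where i: "K j x = (f ^^ i) ` I j" using K_obtain[OF x(1), of j] by metis
    have xo: "x \<in> orb f (I j)" using x(1) Q_subset_orb by blast
    obtain i' where i': "periodic_interval f (m j) ((f ^^ i') ` I j)" "orb f ((f ^^ i') ` I j) = orb f (I j)" "x \<in> (f ^^ i') ` I j"
      by (rule periodic_interval_shift[OF per xo]) 
    have Ki: "K j x = (f ^^ i') ` I j" by (rule K_eq[OF i'(3)])
    obtain h2 where h2: "h2 > 0" "ball x h2 \<inter> orb f (I j) \<subseteq> K j x"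
      using component_nbhd[OF periodic_interval_wp[OF i'(1)] i'(3)] unfolding i'(2) Ki by blast
    define d where "d = min (min e h1) (min h2 (b - a))"
    have d: "d > 0" "d \<le> e" "d \<le> h1" "d \<le> h2" "d \<le> b - a" using e h1(1) h2(1) ab(2) by (auto simp: d_def)
    obtain p where p: "p \<in> Per f" "\<bar>p - x\<bar> < d" using x(2) d(1) unfolding closure_approachable dist_real_def by blast
    have p01: "p \<in> {0..1}" using p(1) Per_in by blast
    obtain n where n: "n \<ge> 1" "(f ^^ n) p = p" using p(1) unfolding Per_def by blast
    \<comment> \<open>The orbit of \<open>p\<close> enters a ball inside \<open>K j x\<close>; being
      periodic, \<open>p\<close> then lies in \<open>orb f (I j)\<close> itself.\<close>
    have "\<bar>(f ^^ t) p - (f ^^ t) x\<bar> < h" using h1(2) p(2) d(3) p01 by auto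
    then have "(f ^^ t) p \<in> ball ((f ^^ t) x) h" by (simp add: dist_real_def abs_minus_commute)
    then have "(f ^^ t) p \<in> orb f (I j)" using t(2) K_subset[of j x] by blast
    then have "(f ^^ (n * t - t)) ((f ^^ t) p) \<in> orb f (I j)" by (rule orb_iter)
    moreover have "t \<le> n * t" using n(1) by simp
    ultimately have "(f ^^ (n * t)) p \<in> orb f (I j)" unfolding funpow_add_app[symmetric] by simp
    moreover have "(f ^^ (n * t)) p = p" using funpow_mod_period[OF n(2), of "n * t"] by simp
    ultimately have "p \<in> orb f (I j)" by simp
    moreover have "p \<in> ball x h2" using p(2) d(4) by (simp add: dist_real_def abs_minus_commute)
    ultimately have pK: "p \<in> K j x" using h2(2) by blast
    have pC: "p \<notin> C x" using C_subset Q_not_Per p(1) by blast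
    have ps: "s * (p - x) > 0" using inC[of p] pC p(2) d(5) by force
    have fx: "(f ^^ n) x \<in> Q" by (rule Q_forward[OF x(1)])
    have "p \<in> (f ^^ n) ` K j x" using pK n(2) by (metis imageI)
    then have "p \<in> K j ((f ^^ n) x)" using K_image[OF x(1), where n = n and j = j] by simp
    then have "K j ((f ^^ n) x) = K j x" using K_cong[of p j] pK by metis
    then have fxU: "s * ((f ^^ n) x - x) < g" using K_self[OF fx, of j] j unfolding U_def by blast
    have "C ((f ^^ 0) x) \<inter> C ((f ^^ n) x) = {}" by (rule C_wander[OF x(1)]) (use n(1) in simp)
    then have fxC: "(f ^^ n) x \<notin> C x" using C_self[OF fx] by auto
    \<comment> \<open>A point of \<open>Q\<close> within \<open>g\<close> of \<open>x\<close> would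
      lie in \<open>C x\<close>, but the components along the orbit are disjoint.\<close>
    have neg: "s * ((f ^^ n) x - x) < 0"
    proof (rule ccontr)
      assume "\<not> ?thesis"
      then have "\<bar>(f ^^ n) x - x\<bar> < g" using fxU side_cases[OF s] by auto
      then have "(f ^^ n) x \<in> Q \<inter> ball x g" using fx by (simp add: dist_real_def abs_minus_commute)
      then show False using g(2) fxC by blast
    qed
    have sub01: "closed_segment p x \<subseteq> {0..1}" using p01 x01 by (auto simp: closed_segment_eq_real_ivl)
    have con: "connected ((f ^^ n) ` closed_segment p x)" by (rule connected_image[OF _ sub01]) simp
    have ends: "p \<in> (f ^^ n) ` closed_segment p x" "(f ^^ n) x \<in> (f ^^ n) ` closed_segment p x"
      using n(2) by (metis ends_in_segment(1) imageI, simp)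
    have "closed_segment p x \<subseteq> (f ^^ n) ` closed_segment p x"
    proof
      fix z assume z: "z \<in> closed_segment p x"
      show "z \<in> (f ^^ n) ` closed_segment p x"
        using connectedD_interval[OF con ends, of z] connectedD_interval[OF con ends(2,1), of z] z neg ps side_cases[OF s]
        by (auto simp: closed_segment_eq_real_ivl split: if_splits)
    qed
    then show ?thesis using p01 n(1) p(2) d(2) ps by (intro exI[of _ p] exI[of _ n]) auto
  qed
  define P where "P j p \<longleftrightarrow> p \<in> {0..1} \<and> \<bar>p - x\<bar> < 1 / real (Suc j) \<and> s * (p - x) > 0 \<and>
     (\<exists>n\<ge>1. closed_segment p x \<subseteq> (f ^^ n) ` closed_segment p x)" for j p
  have "\<exists>p. \<forall>j. P j (p j) \<and> \<bar>p (Suc j) - x\<bar> < \<bar>p j - x\<bar>"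
  proof (rule dependent_nat_choice)
    show "\<exists>p. P 0 p" using step[of 1] unfolding P_def by auto
    fix p j assume "P j p"
    then have "\<bar>p - x\<bar> > 0" unfolding P_def by auto
    then have "min (1 / real (Suc (Suc j))) \<bar>p - x\<bar> > 0" by simp
    from step[OF this] show "\<exists>p'. P (Suc j) p' \<and> \<bar>p' - x\<bar> < \<bar>p - x\<bar>" unfolding P_def min_less_iff_conj by blast
  qed
  then obtain p where p: "\<And>j. P j (p j)" "\<And>j. \<bar>p (Suc j) - x\<bar> < \<bar>p j - x\<bar>" by blast
  define V where "V j = closed_segment (p j) x" for j
  have "\<exists>n\<ge>1. V j \<subseteq> (f ^^ n) ` V j" for j using p(1)[of j] unfolding P_def V_def by blast
  then obtain n where n: "\<And>j. n j \<ge> 1" "\<And>j. V j \<subseteq> (f ^^ n j) ` V j" by metis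
  have VS: "V (Suc j) \<subseteq> V j" for j
    using p(1)[of j] p(1)[of "Suc j"] p(2)[of j] side_cases[OF s] unfolding P_def V_def
    by (auto simp: closed_segment_eq_real_ivl split: if_splits)
  have V01: "V j \<subseteq> {0..1}" for j using p(1)[of j] x01 unfolding P_def V_def by (auto simp: closed_segment_eq_real_ivl)
  have V: "compact (V j)" "V j \<noteq> {}" for j unfolding V_def by auto
  obtain y where y: "y \<in> V 0" "\<And>j. (f ^^ (\<Sum>i<j. n i)) y \<in> V j"
    by (rule covering_chain[of V n, OF V(1) V01 V(2) order_trans[OF VS n(2)]]) blast+
  have large: "(\<Sum>i<j. n i) \<ge> j" for j
    using sum_mono[of "{..<j}" "\<lambda>_. 1" n] n(1) by simp
  have "x \<in> omega_limit f y" unfolding omega_limit_iff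
  proof (intro allI impI)
    fix d :: real and N assume "d > 0"
    then obtain N' where N': "1 / real (Suc N') < d" using nat_approx_posE by metis
    define j where "j = max N N'"
    have "\<bar>(f ^^ (\<Sum>i<j. n i)) y - x\<bar> \<le> \<bar>p j - x\<bar>"
      using y(2)[of j] unfolding V_def by (auto simp: closed_segment_eq_real_ivl split: if_splits)
    moreover have "\<bar>p j - x\<bar> < 1 / real (Suc j)" using p(1)[of j] unfolding P_def by blast
    moreover have "1 / real (Suc j) \<le> 1 / real (Suc N')" unfolding j_def by (simp add: frac_le)
    ultimately have "\<bar>(f ^^ (\<Sum>i<j. n i)) y - x\<bar> < d" using N' by linarith
    then show "\<exists>n\<ge>N. \<bar>(f ^^ n) y - x\<bar> < d" using large[of j] unfolding j_def by (intro exI[of _ "\<Sum>i<max N N'. n i"]) simp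
  qed
  then show ?thesis using y(1) V01 unfolding omega_set_def by blast
qed

text \<open>For each level some iterate of \<open>q\<close> is interior to it, and the dense orbit
  of a neighbourhood of that iterate traps \<open>orb f J\<close> in the level. So
  \<open>orb f J\<close> would lie in \<open>Q\<close>; but a periodic interval contains periodic
  points and \<open>Q\<close> does not.\<close>

lemma disjoint_B:
  assumes J: "periodic_interval f k J" and q: "q \<in> Q" shows "q \<notin> B_set f J"
proof
  assume qB: "q \<in> B_set f J"
  have "orb f J \<subseteq> orb f (I j)" for j
  proof -
    obtain t e where t: "e > 0" "ball ((f ^^ t) q) e \<subseteq> K j q" by (rule interior_visit[OF q])
    have "(f ^^ t) q \<in> B_set f J" by (rule B_set_forward[OF J qB])
    then have "orb f J \<subseteq> closure (orb f (ball ((f ^^ t) q) e \<inter> orb f J))" using t(1) B_set_iff[OF J] by blast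
    also have "\<dots> \<subseteq> orb f (I j)" using t(2) K_subset[of j q] by (intro closure_orb_wp[OF wp]) blast
    finally show ?thesis .
  qed
  then have JQ: "orb f J \<subseteq> Q" unfolding Q_def by blast
  have cJ: "cinterval J" by (rule weakly_periodicD(2)[OF periodic_interval_wp[OF J]])
  have "convex J" using cintervalD(2)[OF cJ] by (metis is_interval_connected_1 is_interval_convex_1)
  then obtain p where p: "p \<in> J" "(f ^^ k) p = p"
    using brouwer[OF cintervalD(1)[OF cJ] _ cintervalD(3)[OF cJ] cont_funpow_on[OF cintervalD(4)[OF cJ]], of k]
      periodic_orb_facts(10)[OF J] by auto
  have "p \<in> Per f" using p cintervalD(4)[OF cJ] periodic_orb_facts(11)[OF J] unfolding Per_def by blast
  moreover have "p \<in> Q" using p(1) JQ orb_superset by blast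
  ultimately show False using Q_not_Per by blast
qed

end

section \<open>Separation of different solenoidal sets\<close>

context interval_map begin

lemma generated_set_tower:
  assumes "generated_set f R" obtains m I where "solenoid_tower f m I" "R = solenoid_tower.Q f I"
proof -
  obtain m I where g: "generating_intervals f m I" "R = (\<Inter>j. orb f (I j))"
    using assms unfolding generated_set_def by blast
  have "solenoid_tower f m I" by unfold_locales (rule g(1))
  moreover from this have "R = solenoid_tower.Q f I" using g(2) solenoid_tower.Q_def by blast
  ultimately show thesis by (rule that)
qed

text \<open>The idea of \<open>interior_visit\<close> for two towers: of three intervals of a deep
  level of the second tower that meet \<open>K j x\<close>, the middle one lies between two points
  of \<open>K j x\<close>, hence inside it. So every level of the first tower contains a whole level
  of the second.\<close>

lemma generated_set_subset:
  assumes "solenoid_tower f m I" "solenoid_tower f m' I'" and x: "x \<in> solenoid_tower.Q f I" "x \<in> solenoid_tower.Q f I'"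
  shows "solenoid_tower.Q f I' \<subseteq> solenoid_tower.Q f I"
proof -
  interpret T: solenoid_tower f m I by fact
  interpret T': solenoid_tower f m' I' by fact
  have "T'.Q \<subseteq> orb f (I j)" for j
  proof -
    obtain i where i: "Suc (2 * m j) \<le> m' i" using T'.unbounded by blast
    define p where "p a = (f ^^ (a * m j)) x" for a :: nat
    have pQ: "p a \<in> T.Q" "p a \<in> T'.Q" for a unfolding p_def using T.Q_forward T'.Q_forward x by auto
    have pK: "p a \<in> T.K j x" for a using T.K_period[OF x(1), of j "a * m j"] T.K_self[OF pQ(1), of a j] unfolding p_def by simp
    have dis: "T'.K i (p a) \<inter> T'.K i (p b) = {}" if "a < b" "b \<le> 2" for a b
    proof (rule ccontr)
      assume "T'.K i (p a) \<inter> T'.K i (p b) \<noteq> {}"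
      then obtain z where z: "z \<in> T'.K i (p a)" "z \<in> T'.K i (p b)" by blast
      have "p b = (f ^^ ((b - a) * m j)) (p a)" unfolding p_def funpow_add_app[symmetric] using that(1)
        by (simp add: add_mult_distrib[symmetric])
      then have "m' i dvd (b - a) * m j" using T'.K_return[OF pQ(2) z(1)] z(2) by simp
      moreover have "(b - a) * m j > 0" using that(1) T.m_pos[of j] by simp
      ultimately have "m' i \<le> (b - a) * m j" by (rule dvd_imp_le)
      also have "\<dots> \<le> 2 * m j" using that(2) by (intro mult_right_mono) auto
      finally show False using i by simp
    qed
    have dis': "T'.K i (p a) \<inter> T'.K i (p b) = {}" if "a \<noteq> b" "a \<le> 2" "b \<le> 2" for a b
      using dis[of a b] dis[of b a] that by (cases "a < b") auto
    have pne: "p a \<noteq> p b" if "a < b" "b \<le> 2" for a b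
      using dis[OF that] T'.K_self[OF pQ(2), of a i] T'.K_self[OF pQ(2), of b i] by auto
    have "\<exists>a b c. a \<le> 2 \<and> b \<le> 2 \<and> c \<le> 2 \<and> p a < p b \<and> p b < p c"
    proof -
      have "p 0 \<noteq> p 1" "p 0 \<noteq> p 2" "p 1 \<noteq> p 2" using pne[of 0 1] pne[of 0 2] pne[of 1 2] by auto
      then consider "p 0 < p 1 \<and> p 1 < p 2" | "p 0 < p 2 \<and> p 2 < p 1" | "p 1 < p 0 \<and> p 0 < p 2"
        | "p 1 < p 2 \<and> p 2 < p 0" | "p 2 < p 0 \<and> p 0 < p 1" | "p 2 < p 1 \<and> p 1 < p 0" by linarith
      then show ?thesis by cases (metis order_refl one_le_numeral zero_le)+
    qed
    then obtain a b c where abc: "a \<le> 2" "b \<le> 2" "c \<le> 2" "p a < p b" "p b < p c" by blast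
    have con: "connected (T.K j x)" by (rule cintervalD(2)[OF T.K_cinterval[OF x(1)]])
    have con': "connected (T'.K i (p b))" by (rule cintervalD(2)[OF T'.K_cinterval[OF pQ(2)]])
    have sub: "T'.K i (p b) \<subseteq> T.K j x"
    proof
      fix z assume z: "z \<in> T'.K i (p b)"
      have "p a \<notin> T'.K i (p b)" using dis'[of a b] abc T'.K_self[OF pQ(2), of a i] by auto
      moreover have "p c \<notin> T'.K i (p b)" using dis'[of c b] abc T'.K_self[OF pQ(2), of c i] by auto
      ultimately have "p a \<le> z" "z \<le> p c"
        using connectedD_interval[OF con' z T'.K_self[OF pQ(2), of b i], of "p a"]
          connectedD_interval[OF con' T'.K_self[OF pQ(2), of b i] z, of "p c"] abc(4,5) by (meson less_imp_le linear)+
      then show "z \<in> T.K j x" using connectedD_interval[OF con pK[of a] pK[of c]] by blast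
    qed
    obtain l where l: "T'.K i (p b) = (f ^^ l) ` I' i" using T'.K_obtain[OF pQ(2)[of b], of i] by metis
    have "orb f (I' i) = orb f (T'.K i (p b))"
      unfolding l orb_funpow_image using periodic_orb_facts(6)[OF T'.per] by simp
    also have "\<dots> \<subseteq> orb f (I j)" using sub T.K_subset[of j x] by (intro orb_orb_subset) blast
    finally show ?thesis using T'.Q_subset_orb[of i] by blast
  qed
  then show ?thesis unfolding T.Q_def by blast
qed

lemma generated_set_disjoint:
  assumes "generated_set f R" "generated_set f R'" "x \<in> R" "x \<in> R'" shows "R = R'"
proof -
  obtain m I where 1: "solenoid_tower f m I" "R = solenoid_tower.Q f I" by (rule generated_set_tower[OF assms(1)])
  obtain m' I' where 2: "solenoid_tower f m' I'" "R' = solenoid_tower.Q f I'" by (rule generated_set_tower[OF assms(2)])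
  show ?thesis
    using generated_set_subset[OF 1(1) 2(1)] generated_set_subset[OF 2(1) 1(1)] assms(3,4) unfolding 1(2) 2(2) by blast
qed

section \<open>The decomposition\<close>

text \<open>The intervals are the components of the orbit, so their endpoints do not depend on the
  generating interval. This makes the Omega-basic set a function of the orbit.\<close>

lemma orb_endpoints_cong:
  assumes I: "periodic_interval f k I" and J: "periodic_interval f l J" and eq: "orb f I = orb f J"
  shows "orb_endpoints f I = orb_endpoints f J"
proof -
  have "\<exists>j. (f ^^ i) ` I = (f ^^ j) ` J"
    if I: "periodic_interval f k I" and J: "periodic_interval f l J" and eq: "orb f I = orb f J" for k l I J i
  proof -
    have "(f ^^ i) ` I \<noteq> {}" using cintervalD(3)[OF weakly_periodicD(2)[OF periodic_interval_wp[OF I]]] by simp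
    then obtain x where x: "x \<in> (f ^^ i) ` I" by (rule ex_in_conv[THEN iffD2, THEN exE])
    then have "x \<in> orb f J" using image_subset_orb eq by (metis subsetD)
    then obtain j where j: "x \<in> (f ^^ j) ` J" unfolding orb_def by (elim UN_E)
    show ?thesis
      using periodic_component[OF I x] periodic_component[OF J j] unfolding eq by (intro exI[of _ j]) simp
  qed
  from this[OF I J eq] this[OF J I eq[symmetric]] show ?thesis
    unfolding orb_endpoints_def by (intro Collect_cong) metis
qed

lemma B'_set_cong:
  assumes "periodic_interval f k I" "periodic_interval f l J" "orb f I = orb f J"
  shows "B'_set f I = B'_set f J"
  unfolding B'_set_def A_set_def orb_endpoints_cong[OF assms] orb_f_B_cong[OF assms(3)] assms(3) ..

lemma finite_A_set:
  assumes I: "periodic_interval f k I" shows "finite (A_set f I)"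
proof -
  define E :: "real set \<Rightarrow> real set" where "E X = {x. \<exists>a b. X = {a..b} \<and> a \<le> b \<and> (x = a \<or> x = b)}" for X
  have "finite (E X)" for X
  proof (cases "\<exists>a b. X = {a..b} \<and> a \<le> b")
    case True
    then obtain a b where "X = {a..b}" "a \<le> b" by blast
    then have "E X \<subseteq> {a, b}" unfolding E_def by (auto simp: Icc_eq_Icc)
    then show ?thesis using finite_subset by blast
  next
    case False
    then have "E X = {}" unfolding E_def by blast
    then show ?thesis by simp
  qed
  then have "finite (\<Union>i<k. E ((f ^^ i) ` I))" by blast
  moreover have "A_set f I \<subseteq> (\<Union>i<k. E ((f ^^ i) ` I))"
  proof
    fix x assume "x \<in> A_set f I"
    then obtain i where i: "x \<in> E ((f ^^ i) ` I)" unfolding A_set_def orb_endpoints_def E_def by blast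
    have "i mod k < k" using periodic_orb_facts(11)[OF I] by simp
    then show "x \<in> (\<Union>i<k. E ((f ^^ i) ` I))" using i unfolding periodic_image_mod[OF I, of i] by blast
  qed
  ultimately show ?thesis by (rule finite_subset[rotated])
qed

lemma B'_set_eventually_B:
  assumes I: "periodic_interval f k I" and x: "x \<in> B'_set f I"
  obtains n where "\<And>m. n \<le> m \<Longrightarrow> (f ^^ m) x \<in> B_set f I"
proof -
  obtain n where n: "(f ^^ n) x \<in> B_set f I"
    using x funpow_0[of f x] unfolding B'_set_def A_set_def by (elim UnE CollectE conjE exE) (metis, rule that)
  have "(f ^^ m) x \<in> B_set f I" if "n \<le> m" for m
    using B_set_forward[OF I n, of "m - n"] that unfolding funpow_add_app[symmetric] by simp
  then show thesis by (rule that)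
qed

lemma B_full_germ_orb:
  assumes I: "periodic_interval f k I" "infinite (B_set f I)" and x: "x \<in> B_set f I"
  shows "\<exists>s. full_germ (orb f I) x s"
proof -
  obtain i where i: "periodic_interval f k ((f ^^ i) ` I)" "orb f ((f ^^ i) ` I) = orb f I"
    "B_set f ((f ^^ i) ` I) = B_set f I" "x \<in> (f ^^ i) ` I"
    by (rule periodic_interval_shift[OF I(1) subsetD[OF B_set_subset x]])
  show ?thesis using B_full_germ[OF i(1) _ _ i(4)] I(2) x unfolding i(2,3) .
qed

lemma full_germ_orb_subset:
  assumes "full_germ M x s" "full_germ (orb f J) x s" and J: "periodic_interval f l J"
  shows "M \<subseteq> orb f J"
proof -
  obtain d where d: "d > 0" "germ x s d \<subseteq> ball x 1 \<inter> orb f J" by (rule full_germ_small[OF assms(2) zero_less_one])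
  have "M \<subseteq> closure (orb f (germ x s d))" using assms(1) d(1) unfolding full_germ_def by blast
  also have "\<dots> \<subseteq> orb f J" using d(2) by (intro closure_orb_wp[OF periodic_interval_wp[OF J]]) blast
  finally show ?thesis .
qed

text \<open>A point of three basic sets would carry full germs of two of the orbits on the same side.\<close>

lemma B'_three_disjoint:
  fixes I :: "nat \<Rightarrow> real set"
  assumes I: "\<And>i. i < 3 \<Longrightarrow> periodic_interval f (k i) (I i)" "\<And>i. i < 3 \<Longrightarrow> infinite (B_set f (I i))"
    and x: "\<And>i. i < 3 \<Longrightarrow> x \<in> B'_set f (I i)"
  obtains i j where "i < j" "j < 3" "orb f (I i) = orb f (I j)"
proof -
  have "\<exists>n. \<forall>m\<ge>n. (f ^^ m) x \<in> B_set f (I i)" if "i < 3" for i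
    using B'_set_eventually_B[OF I(1) x, OF that that] by metis
  then have "\<forall>i\<in>{..<3}. \<exists>n. \<forall>m\<ge>n. (f ^^ m) x \<in> B_set f (I i)" by simp
  from bchoice[OF this] obtain n where n: "\<forall>i\<in>{..<3}. \<forall>m\<ge>n i. (f ^^ m) x \<in> B_set f (I i)" ..
  \<comment> \<open>The sum of the three entry times is at least each of them, so \<open>y\<close>
    lies in all three basic sets.\<close>
  define y where "y = (f ^^ (\<Sum>i<3. n i)) x"
  have "y \<in> B_set f (I i)" if "i < 3" for i
    using n that member_le_sum[of i "{..<3}" n] unfolding y_def by simp
  then have "\<exists>s. full_germ (orb f (I i)) y s" if "i < 3" for i using B_full_germ_orb[OF I] that by simp
  then have "\<forall>i\<in>{..<3}. \<exists>s. full_germ (orb f (I i)) y s" by simp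
  from bchoice[OF this] obtain s where s: "\<forall>i\<in>{..<3}. full_germ (orb f (I i)) y (s i)" ..
  have same: "orb f (I i) = orb f (I j)" if ij: "i < 3" "j < 3" "s i = s j" for i j
  proof -
    have g: "full_germ (orb f (I i)) y (s i)" "full_germ (orb f (I j)) y (s i)"
      using bspec[OF s, of i] bspec[OF s, of j] ij(1,2) unfolding ij(3) by simp_all
    show ?thesis using full_germ_orb_subset[OF g I(1)[OF ij(2)]] full_germ_orb_subset[OF g(2,1) I(1)[OF ij(1)]] by (rule subset_antisym)
  qed
  have "s i = 1 \<or> s i = -1" if "i < 3" for i
  proof (rule side_cases)
    show "\<bar>s i\<bar> = 1" using s that unfolding full_germ_def by simp
  qed
  from this[of 0] this[of 1] this[of 2] have "s 0 = s 1 \<or> s 0 = s 2 \<or> s 1 = s 2" by auto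
  then show thesis
    using that[of 0 1] that[of 0 2] that[of 1 2] same[of 0 1] same[of 0 2] same[of 1 2] by auto
qed

text \<open>An infinite intersection contains an interior point of each orbit, and neighbourhoods
  with dense orbits there make each orbit contain the other. The sets \<open>A_set\<close>
  contribute only endpoints.\<close>

lemma B'_intersection_finite:
  assumes I: "periodic_interval f k I" and J: "periodic_interval f l J" and ne: "orb f I \<noteq> orb f J"
  shows "finite (B_set f I \<inter> B_set f J)" "finite (B'_set f I \<inter> B'_set f J)"
proof -
  let ?X = "B_set f I \<inter> B_set f J"
  show fin: "finite ?X"
  proof (rule ccontr)
    assume inf: "infinite ?X"
    have sub: "?X \<subseteq> orb f I" "?X \<subseteq> orb f J" using B_set_subset by blast+
    have *: "orb f I' \<subseteq> orb f J'"
      if J': "periodic_interval f l' J'" and I': "periodic_interval f k' I'"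
        and X: "infinite (B_set f I' \<inter> B_set f J')" for k' l' I' J'
    proof -
      have "B_set f I' \<inter> B_set f J' \<subseteq> orb f J'" using B_set_subset by blast
      then obtain z e where z: "z \<in> B_set f I' \<inter> B_set f J'" "e > 0" "ball z e \<subseteq> orb f J'"
        by (rule finite_complement_interior[OF periodic_interval_wp[OF J'] X])
      have "orb f I' \<subseteq> closure (orb f (ball z e \<inter> orb f I'))" using z(1,2) B_set_iff[OF I', of z] by simp
      also have "\<dots> \<subseteq> orb f J'" using z(3) by (intro closure_orb_wp[OF periodic_interval_wp[OF J']]) blast
      finally show ?thesis .
    qed
    show False using *[OF J I inf] *[OF I J] inf ne by (simp add: Int_commute)
  qed
  have "B'_set f I \<inter> B'_set f J \<subseteq> ?X \<union> (A_set f I \<union> A_set f J)" unfolding B'_set_def by blast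
  then show "finite (B'_set f I \<inter> B'_set f J)"
    by (rule finite_subset) (simp add: fin finite_A_set[OF I] finite_A_set[OF J])
qed

text \<open>Basic sets are enumerated by orbits, because periodic intervals with the same orbit
  define the same basic set, and a repetition would violate the finiteness of intersections.\<close>

definition basic_orbits :: "real set set" where
  "basic_orbits = {M. \<exists>k I. periodic_interval f k I \<and> infinite (B_set f I) \<and> M = orb f I}"

text \<open>Each orbit is recovered from a rational interval around an interior point of its basic
  set, as the closure of the orbit of that interval.\<close>

lemma countable_basic_orbits: "countable basic_orbits"
proof -
  have "basic_orbits \<subseteq> range (\<lambda>r :: rat \<times> rat. closure (orb f {of_rat (fst r)<..<of_rat (snd r)}))"
  proof
    fix M assume "M \<in> basic_orbits"
    then obtain k I where I: "periodic_interval f k I" "infinite (B_set f I)" "M = orb f I" unfolding basic_orbits_def by blast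
    obtain z e where z: "z \<in> B_set f I" "e > 0" "ball z e \<subseteq> orb f I"
      by (rule finite_complement_interior[OF periodic_interval_wp[OF I(1)] I(2) B_set_subset])
    have "z - e < z" "z < z + e" using z(2) by auto
    then obtain p q :: rat
      where p: "z - e < of_rat p" "of_rat p < z" and q: "z < of_rat q" "of_rat q < z + e" by (meson of_rat_dense)
    let ?U = "{of_rat p<..<of_rat q} :: real set"
    have U: "?U \<subseteq> ball z e" using p(1) q(2) by (auto simp: dist_real_def)
    then have UM: "?U \<subseteq> orb f I" using z(3) by (rule order_trans)
    have "closure (orb f ?U) \<subseteq> orb f I" by (rule closure_orb_wp[OF periodic_interval_wp[OF I(1)] UM])
    moreover have "orb f I \<subseteq> closure (orb f ?U)"
    proof -
      have "min (z - of_rat p) (of_rat q - z) > 0" using p(2) q(1) by simp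
      then have "orb f I \<subseteq> closure (orb f (ball z (min (z - of_rat p) (of_rat q - z)) \<inter> orb f I))"
        using z(1) B_set_iff[OF I(1), of z] by simp
      also have "\<dots> \<subseteq> closure (orb f ?U)" by (intro closure_mono orb_mono) (auto simp: dist_real_def)
      finally show ?thesis .
    qed
    ultimately have "M = closure (orb f ?U)" unfolding I(3) by simp
    then show "M \<in> range (\<lambda>r :: rat \<times> rat. closure (orb f {of_rat (fst r)<..<of_rat (snd r)}))"
      by (intro range_eqI[of _ _ "(p, q)"]) simp
  qed
  then show ?thesis by (rule countable_subset) simp
qed

lemma B'_set_genus0_disjoint:
  assumes I: "periodic_interval f k I" "infinite (B_set f I)"
  shows "genus0_union f \<inter> B'_set f I = {}"
proof (rule ccontr)
  assume "\<not> ?thesis"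
  then obtain x where x: "x \<in> genus0_union f" "x \<in> B'_set f I" by blast
  obtain n where n: "\<And>m. n \<le> m \<Longrightarrow> (f ^^ m) x \<in> B_set f I" by (rule B'_set_eventually_B[OF I(1) x(2)]) blast
  have "(f ^^ n) x \<in> B_set f I \<inter> genus0_union f" using n[OF order_refl] genus0_forward[OF x(1)] by (rule IntI)
  then show False using B_genus0_disjoint[OF I] by simp
qed

lemma B'_set_nonwandering:
  assumes I: "periodic_interval f k I" shows "B'_set f I \<subseteq> nonwandering f"
proof -
  have "A_set f I \<subseteq> nonwandering f" by (auto simp: A_set_def)
  moreover have "B_set f I \<subseteq> nonwandering f" by (rule order_trans[OF B_subset_closure_Per[OF I] closure_Per_nonwandering])
  ultimately show ?thesis unfolding B'_set_def by (rule Un_least[rotated])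
qed

text \<open>Before the first entry into \<open>B_set f I\<close> no iterate belongs to it, so by the
  last clause of \<open>nonwandering_end\<close> none is interior.\<close>

lemma nonwandering_end_A_set:
  assumes "x \<in> nonwandering f" "nonwandering_end x"
  obtains k I where "periodic_interval f k I" "infinite (B_set f I)" "x \<in> B'_set f I"
proof -
  obtain k I where I: "periodic_interval f k I" "infinite (B_set f I)" "x \<in> orb_endpoints f I"
    "\<exists>n. (f ^^ n) x \<in> B_set f I"
    "\<forall>i. (f ^^ i) x \<in> unit_top interior_of (orb f I) \<longrightarrow> (f ^^ i) x \<in> B_set f I"
    using assms(2) unfolding nonwandering_end_def by blast
  have "x \<in> A_set f I" unfolding A_set_def using assms(1) I(3-5) not_less_Least by blast
  then show thesis using that[OF I(1,2)] unfolding B'_set_def by blast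
qed

lemma generated_set_nonempty: "generated_set f R \<Longrightarrow> R \<noteq> {}"
  using generated_set_tower[of R] solenoid_tower.Q_nonempty by metis

lemma generated_set_collection:
  assumes R: "generated_set f R" and x: "x \<in> R"
  defines "S \<equiv> omega_limit f x"
  shows "solenoidal_collection f S (R \<inter> closure (Per f)) (R \<inter> omega_set f) (R \<inter> nonwandering f) R"
    and "S \<subseteq> R \<inter> closure (Per f)" "R \<inter> closure (Per f) \<subseteq> R \<inter> omega_set f"
    and "solenoidal f S" "solenoidal f (R \<inter> closure (Per f))" "solenoidal f (R \<inter> omega_set f)"
    and "solenoidal f (R \<inter> nonwandering f)" "solenoidal f R"
    and "countable (R \<inter> nonwandering f - S)"
    and "\<forall>y \<in> R \<inter> nonwandering f - S. y isolated_in (R \<inter> nonwandering f)"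
    and "unit_top interior_of R = {} \<Longrightarrow> S = R"
    and "genus0_union f \<inter> R = {}"
    and "periodic_interval f k J \<Longrightarrow> R \<inter> B'_set f J = {}"
proof -
  obtain m I where T: "solenoid_tower f m I" "R = solenoid_tower.Q f I" by (rule generated_set_tower[OF R])
  interpret T: solenoid_tower f m I by (rule T(1))
  note RQ = T(2)
  have S: "S = T.S" unfolding S_def using x unfolding RQ by (rule T.omega_S)
  show 1: "S \<subseteq> R \<inter> closure (Per f)" unfolding S RQ using T.S_subset_Q T.S_closure_Per by (rule Int_greatest)
  then show "solenoidal_collection f S (R \<inter> closure (Per f)) (R \<inter> omega_set f) (R \<inter> nonwandering f) R"
    using R T.omega_S unfolding solenoidal_collection_def S RQ by simp
  show 2: "R \<inter> closure (Per f) \<subseteq> R \<inter> omega_set f" unfolding RQ using T.closure_Per_in_omega_set by (simp add: subset_iff)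
  have 3: "R \<inter> omega_set f \<subseteq> R \<inter> nonwandering f" by (rule Int_mono[OF order_refl omega_set_nonwandering])
  have sol: "solenoidal f X" if "closed X" "\<And>y. y \<in> X \<Longrightarrow> f y \<in> X" "X \<subseteq> R" for X
    unfolding solenoidal_def using that R by blast
  have fw: "y \<in> R \<Longrightarrow> f y \<in> R" for y using T.Q_forward[of y 1] unfolding RQ by simp
  show "solenoidal f S" using T.S_closed T.S_forward[of _ 1] T.S_subset_Q unfolding S RQ[symmetric] by (intro sol) simp_all
  show "solenoidal f R" using T.Q_closed fw unfolding RQ[symmetric] by (intro sol) simp_all
  have cl: "closed X" if "S \<subseteq> X" "X \<subseteq> R \<inter> nonwandering f" for X using that unfolding S RQ by (rule T.closed_between)
  note 12 = order_trans[OF 1 2]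
  show "solenoidal f (R \<inter> closure (Per f))"
    using closure_Per_forward fw by (intro sol cl[OF 1 order_trans[OF 2 3]]) simp_all
  show "solenoidal f (R \<inter> omega_set f)" using omega_set_forward fw by (intro sol cl[OF 12 3]) simp_all
  show "solenoidal f (R \<inter> nonwandering f)"
    using nonwandering_forward fw by (intro sol cl[OF order_trans[OF 12 3] order_refl]) simp_all
  show "countable (R \<inter> nonwandering f - S)" unfolding S RQ by (rule T.countable_difference)
  show "\<forall>y \<in> R \<inter> nonwandering f - S. y isolated_in (R \<inter> nonwandering f)"
    unfolding S RQ by (intro ballI T.isolated_in_nonwandering)
  show "unit_top interior_of R = {} \<Longrightarrow> S = R" unfolding S RQ by (rule T.Q_subset_S[symmetric])
  show "genus0_union f \<inter> R = {}" unfolding RQ disjoint_iff using genus0_subset_Per T.Q_not_Per by (meson subsetD)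
  show "R \<inter> B'_set f J = {}" if J: "periodic_interval f k J"
  proof (rule ccontr)
    assume "R \<inter> B'_set f J \<noteq> {}"
    then obtain y where y: "y \<in> R" "y \<in> B'_set f J" by blast
    obtain n where n: "\<And>m. n \<le> m \<Longrightarrow> (f ^^ m) y \<in> B_set f J" by (rule B'_set_eventually_B[OF J y(2)]) blast
    have "(f ^^ n) y \<notin> B_set f J" using T.disjoint_B[OF J T.Q_forward] y(1) unfolding RQ .
    then show False using n[OF order_refl] by (rule notE)
  qed
qed

text \<open>A set with interior in the unit interval contains a rational number, and disjoint sets
  contain different ones.\<close>

lemma countable_interior_disjoint:
  assumes "\<And>a b. a \<in> A \<Longrightarrow> b \<in> A \<Longrightarrow> a \<noteq> b \<Longrightarrow> R a \<inter> R b = {}"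
  shows "countable {a \<in> A. unit_top interior_of (R a) \<noteq> {}}"
proof -
  let ?A = "{a \<in> A. unit_top interior_of (R a) \<noteq> {}}"
  have "\<forall>a\<in>?A. \<exists>r :: rat. of_rat r \<in> R a"
  proof
    fix a assume "a \<in> ?A"
    then obtain x where x: "x \<in> unit_top interior_of (R a)" by blast
    have "openin unit_top (unit_top interior_of (R a))" by (rule openin_interior_of)
    then obtain V where V: "open V" "unit_top interior_of (R a) = {0..1} \<inter> V" unfolding openin_open by (elim exE conjE)
    have "x \<in> V" "x \<in> {0..1}" using x unfolding V(2) by simp_all
    from openE[OF V(1) this(1)] obtain e where e: "e > 0" "ball x e \<subseteq> V" .
    have "max 0 (x - e) < min 1 (x + e)" using \<open>x \<in> {0..1}\<close> e(1) by auto
    then obtain r :: rat where r: "max 0 (x - e) < of_rat r" "of_rat r < min 1 (x + e)" by (meson of_rat_dense)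
    have "of_rat r \<in> V" using r by (intro subsetD[OF e(2)]) (simp add: dist_real_def abs_less_iff)
    then have "of_rat r \<in> unit_top interior_of (R a)" unfolding V(2) using r by simp
    from subsetD[OF interior_of_subset this] show "\<exists>r :: rat. of_rat r \<in> R a" by (rule exI)
  qed
  from bchoice[OF this] obtain r :: "_ \<Rightarrow> rat" where r: "\<forall>a\<in>?A. of_rat (r a) \<in> R a" ..
  have "inj_on r ?A"
  proof (rule inj_onI, rule ccontr)
    fix a b assume ab: "a \<in> ?A" "b \<in> ?A" "r a = r b" "a \<noteq> b"
    have "of_rat (r a) \<in> R a \<inter> R b" using bspec[OF r ab(1)] bspec[OF r ab(2)] unfolding ab(3) by (rule IntI)
    also have "\<dots> = {}" using ab by (intro assms) simp_all
    finally show False by simp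
  qed
  then show ?thesis by (rule countable_image_inj_on[OF countableI_type])
qed

end

theorem theorem5p4:
  fixes f :: "real \<Rightarrow> real"
  assumes "continuous_on {0..1} f" and "f ` {0..1} \<subseteq> {0..1}"
  shows "\<exists>(N :: nat set) (B :: nat \<Rightarrow> real set) (B' :: nat \<Rightarrow> real set)
          (A :: real set) (S :: real \<Rightarrow> real set) (Sp :: real \<Rightarrow> real set)
          (Sw :: real \<Rightarrow> real set) (SO :: real \<Rightarrow> real set) (Q :: real \<Rightarrow> real set).
     (\<forall>i\<in>N. basic_pair f (B i) (B' i) \<and> B i \<subseteq> B' i) \<and>
     (\<forall>\<alpha>\<in>A. solenoidal_collection f (S \<alpha>) (Sp \<alpha>) (Sw \<alpha>) (SO \<alpha>) (Q \<alpha>) \<and>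
        S \<alpha> \<subseteq> Sp \<alpha> \<and> Sp \<alpha> \<subseteq> Sw \<alpha> \<and> Sw \<alpha> \<subseteq> SO \<alpha> \<and> SO \<alpha> \<subseteq> Q \<alpha> \<and>
        solenoidal f (S \<alpha>) \<and> solenoidal f (Sp \<alpha>) \<and> solenoidal f (Sw \<alpha>) \<and>
        solenoidal f (SO \<alpha>) \<and> solenoidal f (Q \<alpha>)) \<and>
     nonwandering f = genus0_union f \<union> (\<Union>\<alpha>\<in>A. SO \<alpha>) \<union> (\<Union>i\<in>N. B' i) \<and>
     omega_set f = genus0_union f \<union> (\<Union>\<alpha>\<in>A. Sw \<alpha>) \<union> (\<Union>i\<in>N. B i) \<and>
     closure (Per f) = genus0_union f \<union> (\<Union>\<alpha>\<in>A. Sp \<alpha>) \<union> (\<Union>i\<in>N. B i) \<and>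
     (\<forall>\<alpha>\<in>A. countable (SO \<alpha> - S \<alpha>) \<and> (\<forall>x \<in> SO \<alpha> - S \<alpha>. x isolated_in SO \<alpha>)) \<and>
     countable {\<alpha>\<in>A. unit_top interior_of (Q \<alpha>) \<noteq> {}} \<and>
     (\<forall>\<alpha>\<in>A. unit_top interior_of (Q \<alpha>) = {} \<longrightarrow> S \<alpha> = Q \<alpha>) \<and>
     (\<forall>\<alpha>\<in>A. \<forall>\<beta>\<in>A. \<alpha> \<noteq> \<beta> \<longrightarrow> Q \<alpha> \<inter> Q \<beta> = {}) \<and>
     (\<forall>\<alpha>\<in>A. genus0_union f \<inter> Q \<alpha> = {}) \<and>
     (\<forall>i\<in>N. genus0_union f \<inter> B' i = {}) \<and>
     (\<forall>\<alpha>\<in>A. \<forall>i\<in>N. Q \<alpha> \<inter> B' i = {}) \<and>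
     (\<forall>i\<in>N. \<forall>j\<in>N. \<forall>k\<in>N. i \<noteq> j \<and> i \<noteq> k \<and> j \<noteq> k \<longrightarrow> B' i \<inter> B' j \<inter> B' k = {}) \<and>
     (\<forall>i\<in>N. \<forall>j\<in>N. i \<noteq> j \<longrightarrow> finite (B i \<inter> B j) \<and> finite (B' i \<inter> B' j))"
proof -
  interpret interval_map f by unfold_locales (fact assms)+
  note cou = countable_basic_orbits
  have "\<forall>M\<in>basic_orbits. \<exists>I. (\<exists>k. periodic_interval f k I) \<and> infinite (B_set f I) \<and> M = orb f I"
    unfolding basic_orbits_def by blast
  from bchoice[OF this] obtain Ic where
    Ic: "\<forall>M\<in>basic_orbits. (\<exists>k. periodic_interval f k (Ic M)) \<and> infinite (B_set f (Ic M)) \<and> M = orb f (Ic M)" ..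
  \<comment> \<open>\<open>N\<close> need not be all of the natural numbers: there may be finitely
    many orbits, or none.\<close>
  define N where "N = to_nat_on basic_orbits ` basic_orbits"
  define J where "J i = Ic (from_nat_into basic_orbits i)" for i
  define B where "B i = B_set f (J i)" for i
  define B' where "B' i = B'_set f (J i)" for i
  have J: "\<exists>k. periodic_interval f k (J i)" "infinite (B i)" "orb f (J i) = from_nat_into basic_orbits i" if i: "i \<in> N" for i
  proof -
    obtain M where M: "M \<in> basic_orbits" "i = to_nat_on basic_orbits M" using i unfolding N_def by (elim imageE)
    have "from_nat_into basic_orbits i \<in> basic_orbits" using M from_nat_into_to_nat_on[OF cou M(1)] by simp
    then show "\<exists>k. periodic_interval f k (J i)" "infinite (B i)" "orb f (J i) = from_nat_into basic_orbits i"
      using Ic unfolding J_def B_def by simp_all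
  qed
  have "\<forall>i\<in>N. \<exists>k. periodic_interval f k (J i)" using J(1) by blast
  from bchoice[OF this] obtain kk where "\<forall>i\<in>N. periodic_interval f (kk i) (J i)" ..
  note kk = this[rule_format]
  have orb_ne: "orb f (J i) \<noteq> orb f (J j)" if ij: "i \<in> N" "j \<in> N" "i \<noteq> j" for i j
  proof
    assume "orb f (J i) = orb f (J j)"
    then have "from_nat_into basic_orbits i = from_nat_into basic_orbits j" using J(3) ij(1,2) by simp
    moreover have "to_nat_on basic_orbits (from_nat_into basic_orbits l) = l" if "l \<in> N" for l
      using that cou unfolding N_def by auto
    ultimately show False using ij by metis
  qed
  have index: "\<exists>i\<in>N. B_set f I = B i \<and> B'_set f I = B' i" if I: "periodic_interval f k I" "infinite (B_set f I)" for k I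
  proof -
    have M: "orb f I \<in> basic_orbits" unfolding basic_orbits_def using I by blast
    let ?i = "to_nat_on basic_orbits (orb f I)"
    have i: "?i \<in> N" unfolding N_def using M by (rule imageI)
    have eq: "orb f I = orb f (J ?i)" unfolding J(3)[OF i] from_nat_into_to_nat_on[OF cou M] ..
    show ?thesis using i orb_f_B_cong[OF eq] B'_set_cong[OF I(1) kk[OF i] eq] unfolding B_def B'_def by (intro bexI[of _ ?i] conjI)
  qed
  have basic: "x \<in> (\<Union>i\<in>N. B i)" if b: "in_basic x" for x
  proof -
    obtain k I where I: "periodic_interval f k I" "infinite (B_set f I)" "x \<in> B_set f I" using b unfolding in_basic_def by (elim exE conjE)
    from index[OF I(1,2)] obtain i where "i \<in> N" "B_set f I = B i" by (elim bexE conjE)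
    then show ?thesis using I(3) by (intro UN_I[of i]) simp_all
  qed
  have BB': "B i \<subseteq> B' i" for i unfolding B_def B'_def B'_set_def by simp
  have Binf: "infinite (B_set f (J i))" if "i \<in> N" for i using J(2)[OF that] unfolding B_def .
  have B_Per: "B i \<subseteq> closure (Per f)" if "i \<in> N" for i unfolding B_def by (rule B_subset_closure_Per[OF kk[OF that]])
  have B_om: "B i \<subseteq> omega_set f" if "i \<in> N" for i unfolding B_def by (rule B_subset_omega_set[OF kk[OF that] Binf[OF that]])
  have B'_nw: "B' i \<subseteq> nonwandering f" if "i \<in> N" for i unfolding B'_def by (rule B'_set_nonwandering[OF kk[OF that]])
  define pt where "pt R = (SOME x. x \<in> R)" for R :: "real set"
  \<comment> \<open>The index of a solenoidal set is a point chosen in it, so that real indices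
    suffice; disjointness makes the indexing injective.\<close>
  define A where "A = pt ` {R. generated_set f R}"
  define Q where "Q \<alpha> = (THE R. generated_set f R \<and> \<alpha> \<in> R)" for \<alpha>
  have pt: "pt R \<in> R" if "generated_set f R" for R
    unfolding pt_def using generated_set_nonempty[OF that] by (simp add: some_in_eq)
  have Q_eq: "Q \<alpha> = R" if "generated_set f R" "\<alpha> \<in> R" for R \<alpha>
    unfolding Q_def using that generated_set_disjoint[OF _ that(1) _ that(2)] by (intro the_equality) blast+
  have Q: "generated_set f (Q \<alpha>)" "\<alpha> \<in> Q \<alpha>" "pt (Q \<alpha>) = \<alpha>" if \<alpha>: "\<alpha> \<in> A" for \<alpha>
  proof -
    obtain R where R: "\<alpha> = pt R" "generated_set f R" using \<alpha> unfolding A_def by blast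
    have "Q \<alpha> = R" using Q_eq[OF R(2)] pt[OF R(2)] unfolding R(1) .
    then show "generated_set f (Q \<alpha>)" "\<alpha> \<in> Q \<alpha>" "pt (Q \<alpha>) = \<alpha>" using R pt by simp_all
  qed
  have Q_disj: "Q \<alpha> \<inter> Q \<beta> = {}" if "\<alpha> \<in> A" "\<beta> \<in> A" "\<alpha> \<noteq> \<beta>" for \<alpha> \<beta>
    using generated_set_disjoint[OF Q(1)[OF that(1)] Q(1)[OF that(2)]] Q(3)[OF that(1)] Q(3)[OF that(2)] that(3)
    by (metis disjoint_iff)
  note col = generated_set_collection[OF Q(1,2)]
  have solenoid: "x \<in> (\<Union>\<alpha>\<in>A. Q \<alpha>)" if "in_solenoid x" for x
  proof -
    obtain R where R: "generated_set f R" "x \<in> R" using \<open>in_solenoid x\<close> unfolding in_solenoid_def by blast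
    have "pt R \<in> A" "Q (pt R) = R" using R(1) Q_eq pt unfolding A_def by simp_all
    then show ?thesis using R(2) by (intro UN_I[of "pt R"]) simp_all
  qed
  have genus0: "genus0_union f \<subseteq> closure (Per f)" "genus0_union f \<subseteq> omega_set f" "genus0_union f \<subseteq> nonwandering f"
    by (rule order_trans[OF genus0_subset_Per] closure_subset Per_omega_set Per_nonwandering)+
  \<comment> \<open>The common pattern of the three decompositions: \<open>U\<close> is the set to
    be decomposed and \<open>D\<close> the family of basic or Omega-basic sets.\<close>
  have cover: "U = genus0_union f \<union> (\<Union>\<alpha>\<in>A. Q \<alpha> \<inter> U) \<union> (\<Union>i\<in>N. D i)"
    if sub: "genus0_union f \<subseteq> U" "\<And>i. i \<in> N \<Longrightarrow> D i \<subseteq> U"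
      and dec: "\<And>x. x \<in> U \<Longrightarrow> x \<in> genus0_union f \<or> in_solenoid x \<or> x \<in> (\<Union>i\<in>N. D i)" for U D
  proof (intro subset_antisym Un_least UN_least Int_lower2 sub)
    show "U \<subseteq> genus0_union f \<union> (\<Union>\<alpha>\<in>A. Q \<alpha> \<inter> U) \<union> (\<Union>i\<in>N. D i)"
    proof
      fix x assume x: "x \<in> U"
      from dec[OF x] consider "x \<in> genus0_union f" | "in_solenoid x" | "x \<in> (\<Union>i\<in>N. D i)" by (elim disjE)
      then show "x \<in> genus0_union f \<union> (\<Union>\<alpha>\<in>A. Q \<alpha> \<inter> U) \<union> (\<Union>i\<in>N. D i)"
      proof cases
        case 2
        from solenoid[OF 2] obtain \<alpha> where "\<alpha> \<in> A" "x \<in> Q \<alpha>" by (elim UN_E)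
        then show ?thesis using x by (intro UnI1 UnI2 UN_I[of \<alpha>] IntI)
      qed (rule UnI1[THEN UnI1] UnI2, assumption)+
    qed
  qed
  have om: "omega_set f = genus0_union f \<union> (\<Union>\<alpha>\<in>A. Q \<alpha> \<inter> omega_set f) \<union> (\<Union>i\<in>N. B i)"
    using omega_set_trichotomy basic by (intro cover genus0 B_om) metis+
  have cp: "closure (Per f) = genus0_union f \<union> (\<Union>\<alpha>\<in>A. Q \<alpha> \<inter> closure (Per f)) \<union> (\<Union>i\<in>N. B i)"
    using closure_Per_trichotomy basic by (intro cover genus0 B_Per) metis+
  have basic': "x \<in> (\<Union>i\<in>N. B' i)" if b: "in_basic x" for x
    using basic[OF b] by (rule subsetD[OF UN_mono[OF order_refl BB']])
  have "x \<in> (\<Union>i\<in>N. B' i)" if x: "x \<in> nonwandering f" "nonwandering_end x" for x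
  proof (rule nonwandering_end_A_set[OF x])
    fix k I assume I: "periodic_interval f k I" "infinite (B_set f I)" "x \<in> B'_set f I"
    from index[OF I(1,2)] obtain i where "i \<in> N" "B'_set f I = B' i" by (elim bexE conjE)
    then show ?thesis using I(3) by (intro UN_I[of i]) simp_all
  qed
  then have nw: "nonwandering f = genus0_union f \<union> (\<Union>\<alpha>\<in>A. Q \<alpha> \<inter> nonwandering f) \<union> (\<Union>i\<in>N. B' i)"
    using nonwandering_tetrachotomy basic' by (intro cover genus0 B'_nw) metis+
  have three: "B' i \<inter> B' j \<inter> B' k = {}" if N: "i \<in> N" "j \<in> N" "k \<in> N" and ne: "i \<noteq> j \<and> i \<noteq> k \<and> j \<noteq> k" for i j k
  proof (rule ccontr)
    assume "\<not> ?thesis"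
    then obtain x where x: "x \<in> B' i" "x \<in> B' j" "x \<in> B' k" by blast
    \<comment> \<open>The three indices as a family over \<open>0\<close>, \<open>1\<close>,
      \<open>2\<close>; the value \<open>k\<close> at all further arguments keeps it inside
      \<open>N\<close>.\<close>
    define l where "l n = (if n = 0 then i else if n = 1 then j else k)" for n :: nat
    have l: "l n \<in> N" "x \<in> B'_set f (J (l n))" for n using N x unfolding l_def B'_def by (simp_all split: if_split)
    obtain a b where ab: "a < b" "b < 3" "orb f (J (l a)) = orb f (J (l b))"
      by (rule B'_three_disjoint[OF kk[OF l(1)] Binf[OF l(1)] l(2)])
    have "l a \<noteq> l b" using ab(1,2) ne unfolding l_def by auto
    then show False using orb_ne[OF l(1) l(1)] ab(3) by blast
  qed
  have pair: "basic_pair f (B i) (B' i)" if "i \<in> N" for i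
    unfolding basic_pair_def B_def B'_def using kk[OF that] Binf[OF that] by (intro exI[of _ "kk i"] exI[of _ "J i"] conjI refl)
  have B'_genus0: "genus0_union f \<inter> B' i = {}" if "i \<in> N" for i
    unfolding B'_def by (rule B'_set_genus0_disjoint[OF kk[OF that] Binf[OF that]])
  have Q_B': "Q \<alpha> \<inter> B' i = {}" if "\<alpha> \<in> A" "i \<in> N" for \<alpha> i
    unfolding B'_def by (rule col(13)[OF that(1,1) kk[OF that(2)]])
  have fin: "finite (B i \<inter> B j)" "finite (B' i \<inter> B' j)" if ij: "i \<in> N" "j \<in> N" "i \<noteq> j" for i j
    unfolding B_def B'_def by (rule B'_intersection_finite[OF kk[OF ij(1)] kk[OF ij(2)] orb_ne[OF ij]])+
  have chain: "Q \<alpha> \<inter> omega_set f \<subseteq> Q \<alpha> \<inter> nonwandering f" for \<alpha>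
    by (rule Int_mono[OF order_refl omega_set_nonwandering])
  \<comment> \<open>The limit set of the index itself serves as \<open>S\<close>, since the index is
    a point of \<open>Q\<close>.\<close>
  show ?thesis
    by (rule exI[of _ N], rule exI[of _ B], rule exI[of _ B'], rule exI[of _ A],
        rule exI[of _ "omega_limit f"], rule exI[of _ "\<lambda>\<alpha>. Q \<alpha> \<inter> closure (Per f)"],
        rule exI[of _ "\<lambda>\<alpha>. Q \<alpha> \<inter> omega_set f"], rule exI[of _ "\<lambda>\<alpha>. Q \<alpha> \<inter> nonwandering f"], rule exI[of _ Q],
        intro conjI ballI impI nw om cp pair BB' chain Int_lower1 countable_interior_disjoint)
      (assumption | (rule col(1-9) bspec[OF col(10)] col(11,12) Q_disj B'_genus0 Q_B' three fin; assumption))+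
qed

end
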